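(* Let $L$ and $M$ be algebraically closed fields, both contained in some common larger field, such that neither is contained in the other, and such that $L$ and $M$ are linearly disjoint over their intersection $C:=L\cap M$. Let $N:=LM$ be their compositum. Then the Galois group $G^{\mathrm{ab}}_N$ of the maximal abelian extension of $N$ is the free pro-abelian group of rank $|N|$, that is, $G^{\mathrm{ab}}_N\simeq \widehat{\mathbb Z}^{I}$ for an index set $I$ with $|I|=|N|$.
   Context: Two extensions $L_1/F$ and $L_2/F$ inside a common field are linearly disjoint over $F$ if any elements of $L_2$ that are linearly independent over $F$ remain linearly independent over $L_1$. $\widehat{\mathbb Z}$ denotes the profinite completion of $\mathbb Z$, and $\widehat{\mathbb Z}^{I}$ the product of copies of $\widehat{\mathbb Z}$ indexed by $I$. *)

theory Defs
  imports "HOL-Analysis.Analysis" "HOL-Computational_Algebra.Polynomial"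
begin

definition subfield :: "'a::field set \<Rightarrow> bool" where
  "subfield K \<longleftrightarrow> 0 \<in> K \<and> 1 \<in> K \<and>
     (\<forall>x\<in>K. \<forall>y\<in>K. x + y \<in> K \<and> x - y \<in> K \<and> x * y \<in> K) \<and>
     (\<forall>x\<in>K. inverse x \<in> K)"

definition alg_closed_subfield :: "'a::field set \<Rightarrow> bool" where
  "alg_closed_subfield K \<longleftrightarrow> subfield K \<and>
     (\<forall>p::'a poly. (\<forall>i. coeff p i \<in> K) \<longrightarrow> degree p > 0 \<longrightarrow> (\<exists>x\<in>K. poly p x = 0))"

definition lin_indep_over :: "'a::field set \<Rightarrow> 'a set \<Rightarrow> bool" where
  "lin_indep_over K S \<longleftrightarrow> finite S \<and>
     (\<forall>c. (\<forall>s\<in>S. c s \<in> K) \<longrightarrow> (\<Sum>s\<in>S. c s * s) = 0 \<longrightarrow> (\<forall>s\<in>S. c s = 0))"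

definition linearly_disjoint :: "'a::field set \<Rightarrow> 'a set \<Rightarrow> 'a set \<Rightarrow> bool" where
  "linearly_disjoint F L M \<longleftrightarrow>
     (\<forall>S. S \<subseteq> M \<longrightarrow> lin_indep_over F S \<longrightarrow> lin_indep_over L S)"

definition compositum :: "'a::field set \<Rightarrow> 'a set \<Rightarrow> 'a set" where
  "compositum L M = \<Inter>{F. subfield F \<and> L \<union> M \<subseteq> F}"

definition Aut_over :: "'b::field set \<Rightarrow> 'b set \<Rightarrow> ('b \<Rightarrow> 'b) set" where
  "Aut_over K E = {\<sigma> \<in> extensional E. bij_betw \<sigma> E E \<and>
      (\<forall>x\<in>E. \<forall>y\<in>E. \<sigma> (x + y) = \<sigma> x + \<sigma> y \<and> \<sigma> (x * y) = \<sigma> x * \<sigma> y) \<and>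
      (\<forall>x\<in>K. \<sigma> x = x)}"

definition finite_degree :: "'b::field set \<Rightarrow> 'b set \<Rightarrow> bool" where
  "finite_degree K E \<longleftrightarrow> (\<exists>B. finite B \<and> B \<subseteq> E \<and>
      E = {(\<Sum>b\<in>B. c b * b) | c. \<forall>b\<in>B. c b \<in> K})"

definition finite_galois :: "'b::field set \<Rightarrow> 'b set \<Rightarrow> bool" where
  "finite_galois K E \<longleftrightarrow> subfield K \<and> subfield E \<and> K \<subseteq> E \<and> finite_degree K E \<and>
      {x \<in> E. \<forall>\<sigma>\<in>Aut_over K E. \<sigma> x = x} = K"

definition finite_abelian_galois :: "'b::field set \<Rightarrow> 'b set \<Rightarrow> bool" where
  "finite_abelian_galois K E \<longleftrightarrow> finite_galois K E \<and>
      (\<forall>\<sigma>\<in>Aut_over K E. \<forall>\<tau>\<in>Aut_over K E. \<forall>x\<in>E. \<sigma> (\<tau> x) = \<tau> (\<sigma> x))"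

text \<open>Maximal abelian extension of K inside the ambient field (meant to be an
  algebraic closure of K): union of all finite abelian Galois subextensions.\<close>
definition max_abelian_ext :: "'b::field set \<Rightarrow> 'b set" where
  "max_abelian_ext K = \<Union>{E. finite_abelian_galois K E}"

definition gal_mult :: "'b set \<Rightarrow> ('b \<Rightarrow> 'b) \<Rightarrow> ('b \<Rightarrow> 'b) \<Rightarrow> ('b \<Rightarrow> 'b)" where
  "gal_mult E \<sigma> \<tau> = restrict (\<sigma> \<circ> \<tau>) E"

definition krull_topology :: "'b::field set \<Rightarrow> 'b set \<Rightarrow> ('b \<Rightarrow> 'b) topology" where
  "krull_topology K E =
     subtopology (product_topology (\<lambda>_. discrete_topology E) E) (Aut_over K E)"

text \<open>\<open>\<Zhat>\<close> = inverse limit of Z/nZ over n > 0; an element is a compatible family of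
  residues f n \<in> {0..<n}.\<close>
definition zhat :: "(nat \<Rightarrow> int) set" where
  "zhat = {f \<in> PiE {0<..} (\<lambda>n. {0..<int n}).
      \<forall>m n. 0 < m \<longrightarrow> 0 < n \<longrightarrow> m dvd n \<longrightarrow> f m = f n mod int m}"

definition zhat_add :: "(nat \<Rightarrow> int) \<Rightarrow> (nat \<Rightarrow> int) \<Rightarrow> (nat \<Rightarrow> int)" where
  "zhat_add f g = (\<lambda>n\<in>{0<..}. (f n + g n) mod int n)"

definition zhat_topology :: "(nat \<Rightarrow> int) topology" where
  "zhat_topology = subtopology (product_topology (\<lambda>_. discrete_topology UNIV) {0<..}) zhat"

definition zhat_pow_topology :: "'i set \<Rightarrow> ('i \<Rightarrow> nat \<Rightarrow> int) topology" where
  "zhat_pow_topology I = product_topology (\<lambda>_. zhat_topology) I"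

definition zhat_pow_add :: "'i set \<Rightarrow> ('i \<Rightarrow> nat \<Rightarrow> int) \<Rightarrow> ('i \<Rightarrow> nat \<Rightarrow> int) \<Rightarrow> ('i \<Rightarrow> nat \<Rightarrow> int)" where
  "zhat_pow_add I x y = (\<lambda>i\<in>I. zhat_add (x i) (y i))"

definition gal_iso_zhat_pow :: "'b::field set \<Rightarrow> 'b set \<Rightarrow> 'i set \<Rightarrow> bool" where
  "gal_iso_zhat_pow K E I \<longleftrightarrow> (\<exists>\<phi>. homeomorphic_map (krull_topology K E) (zhat_pow_topology I) \<phi> \<and>
      (\<forall>\<sigma>\<in>Aut_over K E. \<forall>\<tau>\<in>Aut_over K E.
          \<phi> (gal_mult E \<sigma> \<tau>) = zhat_pow_add I (\<phi> \<sigma>) (\<phi> \<tau>)))"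

end

theory Submission
  imports Defs "HOL-Number_Theory.Cong"
begin

text \<open>Since \<open>N\<close> contains all roots of unity, every continuous character of \<open>G\<^sub>N\<close> of prime power order \<open>l\<^sup>k\<close> is
  congruent modulo \<open>l\<^sup>k\<close> to one of order \<open>l\<^bsup>k+1\<^esup>\<close>: by Kummer theory if \<open>l\<close> is not the characteristic, and by the
  additive Hilbert 90 and Artin-Schreier theory otherwise.
  Hence each character of order \<open>l\<close> extends to a compatible tower of characters modulo all \<open>n\<close>, that is, to a
  homomorphism to the profinite integers. If \<open>I\<close> indexes, for every prime \<open>l\<close>, a basis of the characters of order
  \<open>l\<close>, then the towers over these bases define a map from the abelianised group to the product over \<open>I\<close>, which is
  injective because characters separate points and surjective by compactness.

  It remains to see that for each \<open>l\<close> such a basis has cardinality \<open>|N|\<close>. By Kummer and Artin-Schreier theory it has at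
  most \<open>|N|\<close> elements. For the lower bound choose \<open>t \<in> M - L\<close>, assuming \<open>|M| \<le> |L|\<close>. The classes of \<open>t - a\<close>
  for \<open>a \<in> L - M\<close>, respectively of \<open>1 / (t - a)\<close>, are independent: \<open>M\<close>
  is the algebraic closure of \<open>F(t)\<close> for some ring \<open>F\<close> containing \<open>C\<close> over which \<open>t\<close> is transcendental, and by linear
  disjointness the automorphisms of \<open>M\<close> over \<open>F(t)\<close> act on \<open>N = LM\<close> and fix \<open>L\<close>. Applying them to a relation
  in \<open>N\<close> gives one in \<open>LF(t)\<close>, up to a factor (respectively summand) from \<open>F(t)\<close> that has neither zero nor pole at \<open>t = a\<close>,
  and there the order at \<open>t = a\<close> decides.\<close>

section \<open>Subrings and partial homomorphisms\<close>

text \<open>Invariance under the automorphisms of \<open>M\<close> over \<open>F(t)\<close> does not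
  bring an element into \<open>F(t)\<close>, since \<open>M\<close> may be inseparable over it: only
  a power with exponent \<open>N = p^k\<close> gets there. For a prime \<open>l\<close> other than
  \<open>p\<close> this is harmless, \<open>N\<close> being prime to \<open>l\<close>; in the
  Artin-Schreier case \<open>g^N - g\<close> is again a value of \<open>z^p - z\<close> and is
  absorbed. That factors from \<open>F(t)\<close> are invisible at \<open>a\<close> has a precise
  reason: an element \<open>a\<close> of \<open>L\<close> outside \<open>C\<close> is transcendental
  over \<open>M\<close>, because \<open>C\<close> is algebraically closed, so that the powers of
  \<open>a\<close> are independent over \<open>C\<close> and hence over \<open>M\<close>. The bases
  for different primes are unrelated, and a product over a single \<open>I\<close> is possible only
  because all of them have the same size; so the exact count is needed at every prime. Homomorphisms
  are handled as subrings of a product ring: unions of chains and the adjunction of one pair are all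
  it takes to extend them. The Galois group is studied in a second field, an algebraic closure of
  the image of the compositum.\<close>

definition pring :: "('a::comm_ring_1 \<times> 'b::comm_ring_1) set \<Rightarrow> bool" where
  "pring g \<longleftrightarrow> (0,0) \<in> g \<and> (1,1) \<in> g \<and>
     (\<forall>x y x' y'. (x,y) \<in> g \<longrightarrow> (x',y') \<in> g \<longrightarrow>
        (x + x', y + y') \<in> g \<and> (x - x', y - y') \<in> g \<and> (x * x', y * y') \<in> g)"

definition ppol :: "('a::comm_ring_1 \<times> 'b::comm_ring_1) set \<Rightarrow> ('a poly \<times> 'b poly) set" where
  "ppol g = {(p,q). \<forall>i. (coeff p i, coeff q i) \<in> g}"

text \<open>The last conjunct makes the relation single-valued, since the difference of two pairs
  with equal first entry lies in \<open>g\<close>; injectivity then follows from the inverses. So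
  \<open>g\<close> is the graph of an isomorphism between two subfields.\<close>

definition pfield :: "('a::field \<times> 'b::field) set \<Rightarrow> bool" where
  "pfield g \<longleftrightarrow> pring g \<and> (\<forall>x y. (x,y) \<in> g \<longrightarrow> (inverse x, inverse y) \<in> g \<and> (x = 0 \<longrightarrow> y = 0))"

text \<open>A subring is treated as the identity homomorphism on itself, so that closure facts are
  proved once, for relations.\<close>

definition sring :: "'a::comm_ring_1 set \<Rightarrow> bool" where
  "sring A \<longleftrightarrow> pring (Id_on A)"

definition pol :: "'a::comm_ring_1 set \<Rightarrow> 'a poly set" where
  "pol A = {p. \<forall>i. coeff p i \<in> A}"

lemma poly_sum_le: "degree p \<le> n \<Longrightarrow> poly p x = (\<Sum>i\<le>n. coeff p i * x ^ i)" for p :: "'c::comm_semiring_1 poly"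
  unfolding poly_altdef
  by (intro sum.mono_neutral_left) (auto intro: le_degree)

context
  fixes g :: "('a::comm_ring_1 \<times> 'b::comm_ring_1) set"
  assumes g: "pring g"
begin

lemma pring_0: "(0,0) \<in> g" and pring_1: "(1,1) \<in> g"
  using g by (auto simp: pring_def)

lemma pring_add: "(x,y) \<in> g \<Longrightarrow> (x',y') \<in> g \<Longrightarrow> (x + x', y + y') \<in> g"
  and pring_diff: "(x,y) \<in> g \<Longrightarrow> (x',y') \<in> g \<Longrightarrow> (x - x', y - y') \<in> g"
  and pring_mult: "(x,y) \<in> g \<Longrightarrow> (x',y') \<in> g \<Longrightarrow> (x * x', y * y') \<in> g"
  using g unfolding pring_def by blast+

lemma pring_uminus: "(x,y) \<in> g \<Longrightarrow> (-x,-y) \<in> g"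
  using pring_diff[OF pring_0] by fastforce

lemma pring_power: "(x,y) \<in> g \<Longrightarrow> (x^n,y^n) \<in> g"
  by (induction n) (auto intro: pring_1 pring_mult)

lemma pring_sum: "(\<And>i. i \<in> A \<Longrightarrow> (f i, h i) \<in> g) \<Longrightarrow> (sum f A, sum h A) \<in> g"
  by (induction A rule: infinite_finite_induct) (auto intro: pring_0 pring_add)

lemma pring_prod: "(\<And>i. i \<in> A \<Longrightarrow> (f i, h i) \<in> g) \<Longrightarrow> (prod f A, prod h A) \<in> g"
  by (induction A rule: infinite_finite_induct) (auto intro: pring_1 pring_mult)

lemma pring_of_nat: "(of_nat n, of_nat n) \<in> g"
  by (induction n) (auto intro: pring_0 pring_1 pring_add)

lemma ppol_pring: "pring (ppol g)"
  unfolding pring_def ppol_def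
  by (auto simp: coeff_1 coeff_mult intro: pring_0 pring_1 pring_add pring_diff pring_mult pring_sum)

lemma ppol_const: "(a,b) \<in> g \<Longrightarrow> ([:a:],[:b:]) \<in> ppol g"
  by (auto simp: ppol_def coeff_pCons intro: pring_0 split: nat.split)

lemma ppol_pCons: "(a,b) \<in> g \<Longrightarrow> (p,q) \<in> ppol g \<Longrightarrow> (pCons a p, pCons b q) \<in> ppol g"
  by (auto simp: ppol_def coeff_pCons split: nat.split)

lemma ppol_monom: "(a,b) \<in> g \<Longrightarrow> (monom a n, monom b n) \<in> ppol g"
  by (auto simp: ppol_def intro: pring_0)

lemma ppol_linear: "(a,b) \<in> g \<Longrightarrow> ([:-a,1:],[:-b,1:]) \<in> ppol g"
  by (intro ppol_pCons pring_uminus ppol_const pring_1) auto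

lemma ppol_poly: "(p,q) \<in> ppol g \<Longrightarrow> (x,y) \<in> g \<Longrightarrow> (poly p x, poly q y) \<in> g"
  unfolding poly_sum_le[of p "max (degree p) (degree q)", simplified]
            poly_sum_le[of q "max (degree p) (degree q)", simplified]
  by (intro pring_sum pring_mult pring_power) (auto simp: ppol_def)

end

lemma ppol_pderiv:
  fixes g :: "('a::idom \<times> 'b::idom) set"
  shows "pring g \<Longrightarrow> (p,q) \<in> ppol g \<Longrightarrow> (pderiv p, pderiv q) \<in> ppol g"
  by (auto simp: ppol_def coeff_pderiv simp del: of_nat_Suc intro!: pring_mult pring_of_nat)

lemma pring_Id_on: "sring A \<Longrightarrow> pring (Id_on A)"
  by (simp add: sring_def)

lemma ppol_Id_on: "ppol (Id_on A) = Id_on (pol A)"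
  by (auto simp: ppol_def pol_def Id_on_def poly_eq_iff)

lemma polD: "p \<in> pol A \<Longrightarrow> coeff p i \<in> A"
  by (simp add: pol_def)

lemma pol_mono: "A \<subseteq> B \<Longrightarrow> pol A \<subseteq> pol B"
  by (auto simp: pol_def)

lemma pol_UNIV [simp]: "pol UNIV = UNIV"
  by (auto simp: pol_def)

context
  fixes A :: "'a::comm_ring_1 set"
  assumes A: "sring A"
begin

lemma sring_0: "0 \<in> A" and sring_1: "1 \<in> A"
  using pring_0[OF pring_Id_on[OF A]] pring_1[OF pring_Id_on[OF A]] by auto

lemma sring_add: "x \<in> A \<Longrightarrow> y \<in> A \<Longrightarrow> x + y \<in> A"
  and sring_diff: "x \<in> A \<Longrightarrow> y \<in> A \<Longrightarrow> x - y \<in> A"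
  and sring_mult: "x \<in> A \<Longrightarrow> y \<in> A \<Longrightarrow> x * y \<in> A"
  using pring_add[OF pring_Id_on[OF A], of x x y y] pring_diff[OF pring_Id_on[OF A], of x x y y]
        pring_mult[OF pring_Id_on[OF A], of x x y y] by (auto simp: Id_on_iff)

lemma sring_uminus: "x \<in> A \<Longrightarrow> -x \<in> A"
  using sring_diff[OF sring_0] by fastforce

lemma sring_power: "x \<in> A \<Longrightarrow> x^n \<in> A"
  by (induction n) (auto intro: sring_1 sring_mult)

lemma sring_sum: "(\<And>i. i \<in> S \<Longrightarrow> f i \<in> A) \<Longrightarrow> sum f S \<in> A"
  by (induction S rule: infinite_finite_induct) (auto intro: sring_0 sring_add)

lemma sring_prod: "(\<And>i. i \<in> S \<Longrightarrow> f i \<in> A) \<Longrightarrow> prod f S \<in> A"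
  by (induction S rule: infinite_finite_induct) (auto intro: sring_1 sring_mult)

lemma sring_of_nat: "of_nat n \<in> A"
  by (induction n) (auto intro: sring_0 sring_1 sring_add)

lemma sring_of_int: "of_int n \<in> A"
  by (cases n) (auto simp del: of_nat_Suc intro: sring_of_nat sring_uminus)

lemma sring_pol: "sring (pol A)"
  using ppol_pring[OF pring_Id_on[OF A]] by (simp add: sring_def ppol_Id_on)

lemma pol_const: "a \<in> A \<Longrightarrow> [:a:] \<in> pol A"
  by (auto simp: pol_def coeff_pCons intro: sring_0 split: nat.split)

lemma pol_pCons: "a \<in> A \<Longrightarrow> p \<in> pol A \<Longrightarrow> pCons a p \<in> pol A"
  by (auto simp: pol_def coeff_pCons split: nat.split)

lemma pol_monom: "a \<in> A \<Longrightarrow> monom a n \<in> pol A"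
  by (auto simp: pol_def intro: sring_0)

lemma pol_linear: "a \<in> A \<Longrightarrow> [:-a,1:] \<in> pol A"
  by (intro pol_pCons sring_uminus pol_const sring_1) auto

lemma pol_poly: "p \<in> pol A \<Longrightarrow> x \<in> A \<Longrightarrow> poly p x \<in> A"
  unfolding poly_altdef by (intro sring_sum sring_mult sring_power) (auto simp: pol_def)

end

lemma pol_pderiv:
  fixes A :: "'a::idom set"
  shows "sring A \<Longrightarrow> p \<in> pol A \<Longrightarrow> pderiv p \<in> pol A"
  by (auto simp: pol_def coeff_pderiv simp del: of_nat_Suc intro!: sring_mult sring_of_nat)

lemma sringI:
  assumes "0 \<in> A" "1 \<in> A" "\<And>x y. x \<in> A \<Longrightarrow> y \<in> A \<Longrightarrow> x + y \<in> A"
    "\<And>x y. x \<in> A \<Longrightarrow> y \<in> A \<Longrightarrow> x - y \<in> A" "\<And>x y. x \<in> A \<Longrightarrow> y \<in> A \<Longrightarrow> x * y \<in> A"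
  shows "sring A"
  using assms unfolding sring_def pring_def by (auto simp: Id_on_iff)

lemma subfield_sring: "subfield K \<Longrightarrow> sring K"
  by (rule sringI) (auto simp: subfield_def)

lemma subfield_inverse: "subfield K \<Longrightarrow> x \<in> K \<Longrightarrow> inverse x \<in> K"
  by (simp add: subfield_def)

lemma subfield_divide: "subfield K \<Longrightarrow> x \<in> K \<Longrightarrow> y \<in> K \<Longrightarrow> x / y \<in> K"
  unfolding divide_inverse by (simp add: subfield_def)

lemma subfieldI: "sring K \<Longrightarrow> (\<And>x. x \<in> K \<Longrightarrow> inverse x \<in> K) \<Longrightarrow> subfield K"
  unfolding subfield_def by (intro conjI ballI) (auto intro: sring_0 sring_1 sring_add sring_diff sring_mult)

lemma subfield_pfield: "subfield K \<Longrightarrow> pfield (Id_on K)"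
  unfolding pfield_def using subfield_sring[of K] by (auto simp: sring_def subfield_inverse)

lemma subfield_UNIV: "subfield UNIV"
  by (simp add: subfield_def)

lemma pfield_pring: "pfield g \<Longrightarrow> pring g"
  by (simp add: pfield_def)

lemma pfield_zero: "pfield g \<Longrightarrow> (0,y) \<in> g \<Longrightarrow> y = 0"
  by (simp add: pfield_def)

lemma pfield_inverse: "pfield g \<Longrightarrow> (x,y) \<in> g \<Longrightarrow> (inverse x, inverse y) \<in> g"
  by (simp add: pfield_def)

lemma pfield_Domain: "pfield g \<Longrightarrow> subfield (Domain g)"
  unfolding pfield_def pring_def subfield_def Domain_iff by (intro conjI ballI) (elim exE conjE, blast)+

lemma alg_closed_subfieldD: "alg_closed_subfield K \<Longrightarrow> subfield K"
  by (simp add: alg_closed_subfield_def)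

lemma alg_closed_root:
  "alg_closed_subfield K \<Longrightarrow> p \<in> pol K \<Longrightarrow> degree p > 0 \<Longrightarrow> \<exists>x\<in>K. poly p x = 0"
  by (simp add: alg_closed_subfield_def pol_def)

text \<open>Long division by the first components, with the second components carried along. Only
  the degree of \<open>r1\<close> is controlled: this suffices to force \<open>r1 = 0\<close> in
  \<open>padj_pfield\<close>, after which \<open>r2 = 0\<close> follows from
  single-valuedness.\<close>

lemma ppol_div:
  fixes g :: "('a::field \<times> 'b::field) set"
  assumes g: "pfield g" and m: "(m1,m2) \<in> ppol g" "m1 \<noteq> 0" and f: "(f1,f2) \<in> ppol g"
  shows "\<exists>q1 q2 r1 r2. (q1,q2) \<in> ppol g \<and> (r1,r2) \<in> ppol g \<and> f1 = q1 * m1 + r1 \<and>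
           f2 = q2 * m2 + r2 \<and> (r1 = 0 \<or> degree r1 < degree m1)"
  using f
\<comment> \<open>The measure separates the zero polynomial from the nonzero constants, which have
  the same degree; this matters when \<open>m1\<close> is constant.\<close>
proof (induction "if f1 = 0 then 0 else Suc (degree f1)" arbitrary: f1 f2 rule: less_induct)
  case less
  note P = pfield_pring[OF g] and PP = ppol_pring[OF pfield_pring[OF g]]
  show ?case
  proof (cases "f1 = 0 \<or> degree f1 < degree m1")
    case True
    then show ?thesis
      by (intro exI[of _ 0] exI[of _ f1] exI[of _ f2]) (use less.prems pring_0[OF PP] in auto)
  next
    case False
    define d where "d = degree f1 - degree m1"
    define c1 where "c1 = coeff f1 (degree f1) * inverse (coeff m1 (degree m1))"
    define c2 where "c2 = coeff f2 (degree f1) * inverse (coeff m2 (degree m1))"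
    have c: "(c1,c2) \<in> g"
      unfolding c1_def c2_def using less.prems m
      by (intro pring_mult[OF P] pfield_inverse[OF g]) (auto simp: ppol_def)
    have s: "(monom c1 d, monom c2 d) \<in> ppol g"
      by (rule ppol_monom[OF P c])
    define h1 where "h1 = f1 - monom c1 d * m1"
    define h2 where "h2 = f2 - monom c2 d * m2"
    have h: "(h1,h2) \<in> ppol g"
      unfolding h1_def h2_def by (intro pring_diff[OF PP] pring_mult[OF PP] s m less.prems)
    have "degree (monom c1 d) + degree m1 \<le> degree f1"
      using False degree_monom_le[of c1 d] unfolding d_def by linarith
    then have le: "degree h1 \<le> degree f1"
      unfolding h1_def by (intro degree_diff_le order.refl order.trans[OF degree_mult_le])
    have "coeff h1 (degree f1) = 0"
      using False m by (simp add: h1_def coeff_monom_mult d_def c1_def)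
    then have "h1 = 0 \<or> degree h1 < degree f1"
      using le by (metis le_neq_implies_less leading_coeff_0_iff)
    then have "(if h1 = 0 then 0 else Suc (degree h1)) < (if f1 = 0 then 0 else Suc (degree f1))"
      using False by auto
    from less.hyps[OF this h] obtain q1 q2 r1 r2 where q: "(q1,q2) \<in> ppol g" "(r1,r2) \<in> ppol g"
      "h1 = q1 * m1 + r1" "h2 = q2 * m2 + r2" "r1 = 0 \<or> degree r1 < degree m1" by blast
    show ?thesis
      by (intro exI[of _ "q1 + monom c1 d"] exI[of _ "q2 + monom c2 d"] exI[of _ r1] exI[of _ r2])
         (use q s in \<open>auto intro: pring_add[OF PP] simp: h1_def h2_def algebra_simps\<close>)
  qed
qed

lemma pol_div:
  assumes "subfield K" "m \<in> pol K" "m \<noteq> 0" "f \<in> pol K"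
  shows "\<exists>q\<in>pol K. \<exists>r\<in>pol K. f = q * m + r \<and> (r = 0 \<or> degree r < degree m)"
  using ppol_div[OF subfield_pfield[OF assms(1)], of m m f f] assms(2-)
  unfolding ppol_Id_on by (auto simp: Id_on_iff)

section \<open>Fraction fields, minimal polynomials and simple algebraic extensions\<close>

definition frac :: "'a::field set \<Rightarrow> 'a set" where
  "frac R = {u / v | u v. u \<in> R \<and> v \<in> R}"

lemma fracI: "u \<in> R \<Longrightarrow> v \<in> R \<Longrightarrow> u / v \<in> frac R"
  unfolding frac_def by blast

lemma frac_subset: "sring R \<Longrightarrow> R \<subseteq> frac R"
  unfolding frac_def using sring_1[of R] by (fastforce intro: exI[of _ 1])

lemma frac_obtain:
  assumes "x \<in> frac R" "sring R"
  obtains u v where "u \<in> R" "v \<in> R" "v \<noteq> 0" "x = u / v"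
proof -
  obtain u v where uv: "u \<in> R" "v \<in> R" "x = u / v" using assms(1) by (auto simp: frac_def)
  show ?thesis
  proof (cases "v = 0")
    case True
    then show ?thesis using that[of 0 1] uv sring_0[OF assms(2)] sring_1[OF assms(2)] by simp
  next
    case False
    then show ?thesis using that uv by blast
  qed
qed

lemma frac_subfield:
  assumes R: "sring R"
  shows "subfield (frac R)"
proof (rule subfieldI)
  show "sring (frac R)"
  proof (rule sringI)
    show "0 \<in> frac R" "1 \<in> frac R" using frac_subset[OF R] sring_0[OF R] sring_1[OF R] by auto
    fix x y assume "x \<in> frac R" "y \<in> frac R"
    then obtain u v u' v' where h: "u \<in> R" "v \<in> R" "v \<noteq> 0" "x = u / v" "u' \<in> R" "v' \<in> R" "v' \<noteq> 0" "y = u' / v'"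
      by (metis frac_obtain R)
    have "x + y = (u * v' + u' * v) / (v * v')" "x - y = (u * v' - u' * v) / (v * v')" "x * y = (u * u') / (v * v')"
      using h by (auto simp: field_simps)
    then show "x + y \<in> frac R" "x - y \<in> frac R" "x * y \<in> frac R"
      by (simp_all only:) (intro fracI sring_mult[OF R] sring_add[OF R] sring_diff[OF R] h)+
  qed
  fix x assume "x \<in> frac R"
  then obtain u v where "u \<in> R" "v \<in> R" "x = u / v" by (auto simp: frac_def)
  then show "inverse x \<in> frac R" using fracI[of v R u] by simp
qed

definition is_min :: "'a::field set \<Rightarrow> 'a \<Rightarrow> 'a poly \<Rightarrow> bool" where
  "is_min K x m \<longleftrightarrow> m \<in> pol K \<and> m \<noteq> 0 \<and> poly m x = 0 \<and>
     (\<forall>f\<in>pol K. f \<noteq> 0 \<longrightarrow> poly f x = 0 \<longrightarrow> degree m \<le> degree f)"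

definition alg_over :: "'a::field set \<Rightarrow> 'a \<Rightarrow> bool" where
  "alg_over K x \<longleftrightarrow> (\<exists>f\<in>pol K. f \<noteq> 0 \<and> poly f x = 0)"

lemma ex_is_min:
  assumes "alg_over K x"
  obtains m where "is_min K x m"
proof -
  define P where "P f \<longleftrightarrow> f \<in> pol K \<and> f \<noteq> 0 \<and> poly f x = 0" for f
  obtain f where "P f" using assms by (auto simp: alg_over_def P_def)
  from ex_has_least_nat[of P, OF this, of degree] that show ?thesis
    unfolding is_min_def P_def by blast
qed

lemma is_min_dvd:
  assumes "subfield K" "is_min K x m" "f \<in> pol K" "poly f x = 0"
  shows "\<exists>q\<in>pol K. f = q * m"
proof -
  obtain q r where q: "q \<in> pol K" "r \<in> pol K" "f = q * m + r" "r = 0 \<or> degree r < degree m"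
    using pol_div[of K m f] assms by (auto simp: is_min_def)
  have "poly r x = 0" using q assms by (simp add: is_min_def)
  then have "r = 0" using q assms(2) by (meson is_min_def not_le)
  then show ?thesis using q by auto
qed

lemma is_min_degree: "is_min K x m \<Longrightarrow> degree m > 0"
  unfolding is_min_def by (metis degree_eq_zeroE neq0_conv pCons_0_0 poly_pCons poly_0 mult_zero_right add.right_neutral)

lemma is_min_div:
  assumes "subfield K" "is_min K x m" "f \<in> pol K"
  obtains r where "r \<in> pol K" "r = 0 \<or> degree r < degree m" "poly r x = poly f x"
proof -
  obtain q r where q: "q \<in> pol K" "r \<in> pol K" "f = q * m + r" "r = 0 \<or> degree r < degree m"
    using pol_div[of K m f] assms by (auto simp: is_min_def)
  then show ?thesis using that[of r] assms(2) by (simp add: is_min_def)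
qed

definition adj :: "'a::field set \<Rightarrow> 'a \<Rightarrow> 'a set" where
  "adj K x = (\<lambda>f. poly f x) ` pol K"

lemma adj_sring:
  assumes "sring K"
  shows "sring (adj K x)"
proof -
  note P = sring_pol[OF assms]
  show ?thesis
    unfolding adj_def
    by (rule sringI)
       (auto simp: image_iff poly_add[symmetric] poly_diff[symmetric] poly_mult[symmetric]
          simp del: poly_add poly_diff poly_mult
          intro: bexI[of _ 0] bexI[of _ 1] sring_0[OF P] sring_1[OF P] sring_add[OF P] sring_diff[OF P] sring_mult[OF P])
qed

lemma adj_subset: "sring K \<Longrightarrow> K \<subseteq> adj K x"
proof
  fix k assume "sring K" "k \<in> K"
  then have "[:k:] \<in> pol K" by (rule pol_const)
  then show "k \<in> adj K x" unfolding adj_def by force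
qed

lemma adj_self: "sring K \<Longrightarrow> x \<in> adj K x"
proof -
  assume K: "sring K"
  have "[:0,1:] \<in> pol K" by (intro pol_pCons[OF K] pol_const[OF K] sring_0[OF K] sring_1[OF K])
  then show "x \<in> adj K x" unfolding adj_def by force
qed

lemma adj_least: "sring F \<Longrightarrow> K \<subseteq> F \<Longrightarrow> x \<in> F \<Longrightarrow> adj K x \<subseteq> F"
  unfolding adj_def using pol_poly[of F] pol_mono[of K F] by blast

text \<open>The ideal of \<open>pol K\<close> generated by \<open>f\<close> and the minimal
  polynomial \<open>m\<close> has a generator \<open>d\<close> of least degree. As \<open>d\<close>
  does not vanish at \<open>x\<close>, its cofactor in \<open>m\<close> does, so by minimality that
  cofactor has the full degree of \<open>m\<close> and \<open>d\<close> is constant: a Bezout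
  identity, evaluated at \<open>x\<close>.\<close>

lemma adj_inverse:
  assumes K: "subfield K" and x: "alg_over K x" and f: "f \<in> pol K" "poly f x \<noteq> 0"
  shows "\<exists>a\<in>pol K. poly a x * poly f x = 1"
proof -
  note S = sring_pol[OF subfield_sring[OF K]]
  obtain m where m: "is_min K x m" using ex_is_min[OF x] .
  have mp: "m \<in> pol K" "m \<noteq> 0" "poly m x = 0" using m by (auto simp: is_min_def)
  define J where "J = {a * f + b * m | a b. a \<in> pol K \<and> b \<in> pol K}"
  have "m = 0 * f + 1 * m" "f = 1 * f + 0 * m" by auto
  then have mJ: "m \<in> J" and fJ: "f \<in> J"
    unfolding J_def using sring_0[OF S] sring_1[OF S] by blast+
  from ex_has_least_nat[of "\<lambda>h. h \<in> J \<and> h \<noteq> 0" m degree] mJ mp obtain d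
    where d: "d \<in> J" "d \<noteq> 0" "\<And>h. h \<in> J \<Longrightarrow> h \<noteq> 0 \<Longrightarrow> degree d \<le> degree h" by blast
  obtain a b where ab: "a \<in> pol K" "b \<in> pol K" "d = a * f + b * m" using d(1) by (auto simp: J_def)
  have dp: "d \<in> pol K" unfolding ab(3) by (intro sring_add[OF S] sring_mult[OF S] ab f mp)
  have Jdvd: "\<exists>q\<in>pol K. h = q * d" if h: "h \<in> J" for h
  proof -
    obtain a' b' where ab': "a' \<in> pol K" "b' \<in> pol K" "h = a' * f + b' * m" using h by (auto simp: J_def)
    have hp: "h \<in> pol K" unfolding ab'(3) by (intro sring_add[OF S] sring_mult[OF S] ab' f mp)
    obtain q r where q: "q \<in> pol K" "h = q * d + r" "r = 0 \<or> degree r < degree d"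
      using pol_div[OF K dp d(2) hp] by blast
    have "r = (a' - q * a) * f + (b' - q * b) * m"
      using q(2) ab'(3) ab(3) by (simp add: algebra_simps)
    then have "r \<in> J" unfolding J_def using ab ab' q(1) sring_diff[OF S] sring_mult[OF S] by blast
    then show ?thesis using q d(3) by fastforce
  qed
  obtain q where q: "q \<in> pol K" "m = q * d" using Jdvd[OF mJ] by blast
  obtain q' where q': "q' \<in> pol K" "f = q' * d" using Jdvd[OF fJ] by blast
  have "poly d x \<noteq> 0" using q' f by auto
  then have "poly q x = 0" using q mp by auto
  moreover have "q \<noteq> 0" using q mp by auto
  ultimately have "degree m \<le> degree q" using m q(1) by (auto simp: is_min_def)
  then have "degree d = 0" using q(2) \<open>q \<noteq> 0\<close> d(2) by (simp add: degree_mult_eq)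
  then obtain c where c: "d = [:c:]" by (elim degree_eq_zeroE)
  have "c \<noteq> 0" using c d(2) by auto
  have "c \<in> K" using dp c by (metis polD coeff_pCons_0)
  have "poly a x * poly f x = c" using arg_cong[OF ab(3), of "\<lambda>p. poly p x"] mp c by simp
  moreover have "[:inverse c:] * a \<in> pol K"
    by (intro sring_mult[OF S] pol_const[OF subfield_sring[OF K]] subfield_inverse[OF K] \<open>c \<in> K\<close> ab)
  ultimately show ?thesis
    using \<open>c \<noteq> 0\<close> by (intro bexI[of _ "[:inverse c:] * a"]) (simp_all add: mult.assoc)
qed

lemma adj_subfield:
  assumes K: "subfield K" and x: "alg_over K x"
  shows "subfield (adj K x)"
proof (rule subfieldI[OF adj_sring[OF subfield_sring[OF K]]])
  fix y assume "y \<in> adj K x"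
  then obtain f where f: "f \<in> pol K" "y = poly f x" by (auto simp: adj_def)
  show "inverse y \<in> adj K x"
  proof (cases "y = 0")
    case True
    then show ?thesis using sring_0[OF adj_sring[OF subfield_sring[OF K]]] by simp
  next
    case False
    then obtain a where "a \<in> pol K" "poly a x * y = 1" using adj_inverse[OF K x] f by blast
    then show ?thesis using False unfolding adj_def by (auto simp: field_simps image_iff intro!: bexI[of _ a])
  qed
qed

text \<open>A pair in \<open>g\<close> records a value of a partial homomorphism, so extending the homomorphism by
  \<open>x \<mapsto> y\<close> is adjoining the pair \<open>(x, y)\<close> to \<open>g\<close>.\<close>

definition padj :: "('a::field \<times> 'b::field) set \<Rightarrow> 'a \<Rightarrow> 'b \<Rightarrow> ('a \<times> 'b) set" where
  "padj g x y = {(poly p x, poly q y) | p q. (p,q) \<in> ppol g}"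

lemma padj_subset:
  assumes "pring g"
  shows "g \<subseteq> padj g x y"
proof (clarify)
  fix a b assume "(a,b) \<in> g"
  then have "([:a:],[:b:]) \<in> ppol g" by (rule ppol_const[OF assms])
  then show "(a,b) \<in> padj g x y" unfolding padj_def by force
qed

lemma padj_self:
  assumes "pring g"
  shows "(x,y) \<in> padj g x y"
proof -
  have "([:0,1:],[:0,1:]) \<in> ppol g"
    by (intro ppol_pCons[OF assms] ppol_const[OF assms] pring_0[OF assms] pring_1[OF assms])
  then show ?thesis unfolding padj_def by force
qed

lemma ppol_lift:
  assumes "p \<in> pol (Domain g)" "pring g"
  obtains q where "(p,q) \<in> ppol g" "degree q \<le> degree p"
proof -
  \<comment> \<open>Images are chosen only up to the degree; beyond it 0 corresponds to 0, so that
    the choices are the coefficients of a polynomial.\<close>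
  define c where "c i = (if i \<le> degree p then (SOME y. (coeff p i, y) \<in> g) else 0)" for i
  have c: "(coeff p i, c i) \<in> g" for i
  proof (cases "i \<le> degree p")
    case True
    have "\<exists>y. (coeff p i, y) \<in> g" using polD[OF assms(1)] by blast
    then have "(coeff p i, SOME y. (coeff p i, y) \<in> g) \<in> g" by (rule someI_ex)
    then show ?thesis using True by (simp add: c_def)
  next
    case False
    then show ?thesis using pring_0[OF assms(2)] by (simp add: c_def coeff_eq_0)
  qed
  define q where "q = (\<Sum>i\<le>degree p. monom (c i) i)"
  have q: "coeff q i = c i" for i
    unfolding q_def by (auto simp: coeff_sum c_def sum.delta)
  show ?thesis
    by (rule that[of q]) (use q c in \<open>auto simp: ppol_def c_def intro!: degree_le\<close>)
qed

text \<open>Sending \<open>x\<close> to \<open>y\<close> is well defined because a polynomial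
  vanishing at \<open>x\<close> leaves remainder 0 on division by \<open>m1\<close>; its partner is
  then a multiple of \<open>m2\<close> up to a remainder whose coefficients correspond to 0, and
  \<open>y\<close> is a root of \<open>m2\<close>.\<close>

lemma padj_pfield:
  fixes g :: "('a::field \<times> 'b::field) set"
  assumes g: "pfield g" and m: "is_min (Domain g) x m1" "(m1,m2) \<in> ppol g" "poly m2 y = 0"
  shows "pfield (padj g x y)"
proof -
  note P = pfield_pring[OF g] and PP = ppol_pring[OF pfield_pring[OF g]]
  have D: "subfield (Domain g)" by (rule pfield_Domain[OF g])
  have R: "pring (padj g x y)"
    unfolding pring_def
  proof (intro conjI allI impI)
    show "(0,0) \<in> padj g x y" "(1,1) \<in> padj g x y"
      using padj_subset[OF P] pring_0[OF P] pring_1[OF P] by blast+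
    fix a b a' b' assume "(a,b) \<in> padj g x y" "(a',b') \<in> padj g x y"
    then obtain p q p' q' where pq: "(p,q) \<in> ppol g" "a = poly p x" "b = poly q y"
        "(p',q') \<in> ppol g" "a' = poly p' x" "b' = poly q' y" by (auto simp: padj_def)
    have "poly (p + p') x = a + a'" "poly (q + q') y = b + b'" "poly (p - p') x = a - a'"
         "poly (q - q') y = b - b'" "poly (p * p') x = a * a'" "poly (q * q') y = b * b'"
      using pq by auto
    then show "(a + a', b + b') \<in> padj g x y" "(a - a', b - b') \<in> padj g x y" "(a * a', b * b') \<in> padj g x y"
      unfolding padj_def mem_Collect_eq prod.inject
      using pring_add[OF PP pq(1,4)] pring_diff[OF PP pq(1,4)] pring_mult[OF PP pq(1,4)] by metis+
  qed
  have zero: "poly q y = 0" if pq: "(p,q) \<in> ppol g" "poly p x = 0" for p q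
  proof -
    have m1: "m1 \<noteq> 0" "poly m1 x = 0" using m by (auto simp: is_min_def)
    obtain q1 q2 r1 r2 where q: "(q1,q2) \<in> ppol g" "(r1,r2) \<in> ppol g" "p = q1 * m1 + r1"
           "q = q2 * m2 + r2" "r1 = 0 \<or> degree r1 < degree m1"
      using ppol_div[OF g m(2) m1(1) pq(1)] by blast
    have "poly r1 x = 0" using q m1 pq by simp
    moreover have "r1 \<in> pol (Domain g)" using q(2) by (auto simp: ppol_def pol_def)
    ultimately have "r1 = 0" using q(5) m(1) by (auto simp: is_min_def dest: leD)
    then have "(0, coeff r2 i) \<in> g" for i using q(2) by (auto simp: ppol_def)
    then have "r2 = 0" using pfield_zero[OF g] by (auto simp: poly_eq_iff)
    then show ?thesis using q m by simp
  qed
  have alg: "alg_over (Domain g) x" using m(1) by (auto simp: is_min_def alg_over_def)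
  show ?thesis
    unfolding pfield_def
  proof (intro conjI R allI impI)
    fix a b assume "(a,b) \<in> padj g x y"
    then obtain p q where pq: "(p,q) \<in> ppol g" "a = poly p x" "b = poly q y" by (auto simp: padj_def)
    show "b = 0" if "a = 0" using zero[OF pq(1)] pq(2,3) that by simp
    show "(inverse a, inverse b) \<in> padj g x y"
    proof (cases "a = 0")
      case True
      then have "b = 0" using zero[OF pq(1)] pq(2,3) by simp
      then show ?thesis using True pring_0[OF R] by simp
    next
      case False
      have "p \<in> pol (Domain g)" using pq by (auto simp: ppol_def pol_def)
      then obtain c1 where c1: "c1 \<in> pol (Domain g)" "poly c1 x * a = 1"
        using adj_inverse[OF D alg, of p] False pq by auto
      obtain c2 where c2: "(c1,c2) \<in> ppol g" using ppol_lift[OF c1(1) P] by blast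
      have "(c1 * p - 1, c2 * q - 1) \<in> ppol g"
        by (intro pring_diff[OF PP] pring_mult[OF PP] c2 pq pring_1[OF PP])
      from zero[OF this] have "poly c2 y * b = 1" using c1 pq by simp
      then have "inverse a = poly c1 x" "inverse b = poly c2 y"
        using c1 by (metis inverse_unique mult.commute)+
      then show ?thesis using c2 by (auto simp: padj_def)
    qed
  qed
qed

section \<open>Galois theory of algebraic extensions\<close>

text \<open>Elements are the identity off \<open>\<Omega>\<close>, so that they compose by plain
  \<open>\<circ>\<close> and equality of functions is the right equality. The extensional maps of
  \<open>Aut_over\<close> are compared with them only later, by restriction and lifting.\<close>

definition gal :: "'a::field set \<Rightarrow> 'a set \<Rightarrow> ('a \<Rightarrow> 'a) set" where
  "gal K \<Omega> = {\<sigma>. (\<forall>x. x \<notin> \<Omega> \<longrightarrow> \<sigma> x = x) \<and> \<sigma> ` \<Omega> = \<Omega> \<and>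
     (\<forall>x\<in>\<Omega>. \<forall>y\<in>\<Omega>. \<sigma> (x + y) = \<sigma> x + \<sigma> y \<and> \<sigma> (x * y) = \<sigma> x * \<sigma> y) \<and> (\<forall>x\<in>K. \<sigma> x = x)}"

definition graph :: "'a set \<Rightarrow> ('a \<Rightarrow> 'b) \<Rightarrow> ('a \<times> 'b) set" where
  "graph A f = (\<lambda>x. (x, f x)) ` A"

lemma graph_iff [simp]: "(x, y) \<in> graph A f \<longleftrightarrow> x \<in> A \<and> y = f x"
  by (auto simp: graph_def)

lemma pfield_inj: "pfield g \<Longrightarrow> (x,0) \<in> g \<Longrightarrow> x = 0"
proof (rule ccontr)
  assume g: "pfield g" "(x,0) \<in> g" "x \<noteq> 0"
  note P = pfield_pring[OF g(1)]
  have "(1, 0) \<in> g" using pring_mult[OF P g(2) pfield_inverse[OF g(1,2)]] g(3) by simp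
  from pring_diff[OF P this this] pring_diff[OF P pring_1[OF P] this] pfield_zero[OF g(1), of 1]
  show False by simp
qed

lemma pfield_single: "pfield g \<Longrightarrow> (x,y) \<in> g \<Longrightarrow> (x,z) \<in> g \<Longrightarrow> y = z"
  using pring_diff[OF pfield_pring, of g x y x z] pfield_zero[of g "y - z"] by simp

lemma pfield_graph:
  assumes "sring A" "\<And>x y. x \<in> A \<Longrightarrow> y \<in> A \<Longrightarrow> f (x + y) = f x + f y \<and> f (x * y) = f x * f y"
    "f 1 = (1::'b::field)" "\<And>x. x \<in> A \<Longrightarrow> inverse x \<in> A"
  shows "pfield (graph (A :: 'a::field set) f)"
proof -
  note A = sring_0[OF assms(1)] sring_1[OF assms(1)] sring_add[OF assms(1)] sring_diff[OF assms(1)] sring_mult[OF assms(1)]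
  have "f 0 + f 0 = f 0" using assms(2)[of 0 0] A by simp
  then have 0: "f 0 = 0" by (metis add_cancel_right_right)
  have d: "f (x - y) = f x - f y" if "x \<in> A" "y \<in> A" for x y
    using assms(2)[of "x - y" y] A that by (simp add: algebra_simps)
  have i: "f (inverse x) = inverse (f x)" if "x \<in> A" for x
  proof (cases "x = 0")
    case False
    then have "f x * f (inverse x) = 1" using assms(2)[of x "inverse x"] assms(3,4) that by simp
    then show ?thesis by (simp add: inverse_unique)
  qed (simp add: 0)
  show ?thesis unfolding pfield_def pring_def
    using A assms(2-4) by (auto simp: 0 d i)
qed

text \<open>A simple root of some polynomial over \<open>K\<close>, not necessarily the minimal one:
  in this form separability passes to larger fields at once, and \<open>sep_min\<close> recovers the
  usual definition.\<close>

definition sep :: "'a::field set \<Rightarrow> 'a \<Rightarrow> bool" where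
  "sep K x \<longleftrightarrow> (\<exists>f\<in>pol K. poly f x = 0 \<and> poly (pderiv f) x \<noteq> 0)"

lemma sep_mono: "K \<subseteq> F \<Longrightarrow> sep K x \<Longrightarrow> sep F x"
  unfolding sep_def using pol_mono by blast

lemma sep_self: "sring K \<Longrightarrow> x \<in> K \<Longrightarrow> sep K x"
  unfolding sep_def using pol_linear[of K x] by (intro bexI[of _ "[:-x,1:]"]) (auto simp: pderiv_pCons)

lemma sep_min:
  assumes "subfield K" "sep K x" "is_min K x m"
  shows "poly (pderiv m) x \<noteq> 0"
proof -
  obtain f where f: "f \<in> pol K" "poly f x = 0" "poly (pderiv f) x \<noteq> 0" using assms(2) by (auto simp: sep_def)
  obtain q where "f = q * m" using is_min_dvd[OF assms(1,3) f(1,2)] by blast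
  then have "poly (pderiv f) x = poly q x * poly (pderiv m) x"
    using assms(3) by (simp add: pderiv_mult is_min_def)
  then show ?thesis using f by auto
qed

text \<open>Roots are split off one at a time. As \<open>r\<close> is a simple root of
  \<open>m\<close>, it is not a root of the quotient \<open>q\<close>, so \<open>f\<close> divided
  by \<open>X - r\<close> still vanishes at every root of \<open>q\<close> and the induction goes
  on.\<close>

lemma split_dvd:
  assumes O: "alg_closed_subfield \<Omega>" and m: "m \<in> pol \<Omega>" "m \<noteq> 0"
    and "\<And>r. r \<in> \<Omega> \<Longrightarrow> poly m r = 0 \<Longrightarrow> poly (pderiv m) r \<noteq> 0 \<and> poly f r = 0"
  shows "m dvd f"
  using assms(2-4)
proof (induction "degree m" arbitrary: m f)
  case 0
  then obtain c where "m = [:c:]" by (metis degree_eq_zeroE)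
  then show ?case using 0 by (simp add: const_poly_dvd_iff dvd_field_iff)
next
  case (Suc n)
  note S = alg_closed_subfieldD[OF O]
  obtain r where r: "r \<in> \<Omega>" "poly m r = 0" using alg_closed_root[OF O Suc.prems(1)] Suc.hyps by auto
  have l: "[:-r,1:] \<in> pol \<Omega>" by (rule pol_linear[OF subfield_sring[OF S] r(1)])
  obtain q s where q: "q \<in> pol \<Omega>" "m = q * [:-r,1:] + s" "s = 0 \<or> degree s < degree [:-r,1:]"
    using pol_div[OF S l _ Suc.prems(1)] by auto
  have "degree s = 0" using q(3) by auto
  then obtain c where "s = [:c:]" by (elim degree_eq_zeroE)
  then have qm: "m = q * [:-r,1:]" using q(2) r(2) by simp
  obtain f1 where f1: "f = [:-r,1:] * f1" using Suc.prems(3)[OF r] by (auto simp: poly_eq_0_iff_dvd)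
  have "q \<noteq> 0" using qm Suc.prems by auto
  then have "degree m = degree q + degree [:-r,1:]" unfolding qm by (intro degree_mult_eq) auto
  then have "degree q = n" using Suc.hyps by simp
  moreover have "poly (pderiv q) t \<noteq> 0 \<and> poly f1 t = 0" if t: "t \<in> \<Omega>" "poly q t = 0" for t
  proof -
    have "poly m t = 0" using t qm by simp
    note h = Suc.prems(3)[OF t(1) this]
    have "poly (pderiv m) t = poly (pderiv q) t * (t - r)"
      using t unfolding qm pderiv_mult poly_add poly_mult by (simp add: pderiv_pCons del: mult_pCons_right)
    then show ?thesis using h f1 by auto
  qed
  ultimately have "q dvd f1" using Suc.hyps(1)[of q f1] q(1) \<open>q \<noteq> 0\<close> by blast
  then show ?case using qm f1 by (metis mult.commute mult_dvd_mono dvd_refl)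
qed

section \<open>Extensions of finite degree\<close>

lemma sum_image_family:
  fixes g :: "'j \<Rightarrow> 'a::field"
  assumes "finite J"
  shows "(\<Sum>j\<in>J. c j * g j) = (\<Sum>b\<in>g ` J. (\<Sum>j\<in>{j\<in>J. g j = b}. c j) * b)"
  unfolding sum.image_gen[OF assms, of "\<lambda>j. c j * g j" g] sum_distrib_right
  by (intro sum.cong refl) auto

text \<open>\<open>finite_degree\<close> speaks of a spanning set, whereas powers of an element and
  products in a tower come as families with possible repetitions; the coefficients of equal members
  are added up.\<close>

lemma finite_degreeI:
  fixes g :: "'j \<Rightarrow> 'a::field"
  assumes "subfield K" "sring E" "K \<subseteq> E" "finite J" "g ` J \<subseteq> E"
    and "\<And>z. z \<in> E \<Longrightarrow> \<exists>c. (\<forall>j\<in>J. c j \<in> K) \<and> z = (\<Sum>j\<in>J. c j * g j)"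
  shows "finite_degree K E"
  unfolding finite_degree_def
proof (intro exI[of _ "g ` J"] conjI)
  show "finite (g ` J)" "g ` J \<subseteq> E" using assms by auto
  show "E = {(\<Sum>b\<in>g ` J. c b * b) |c. \<forall>b\<in>g ` J. c b \<in> K}"
  proof (intro equalityI subsetI)
    fix z assume "z \<in> E"
    then obtain c where c: "\<forall>j\<in>J. c j \<in> K" "z = (\<Sum>j\<in>J. c j * g j)" using assms(6) by blast
    have "(\<Sum>j\<in>{j\<in>J. g j = b}. c j) \<in> K" for b
      by (rule sring_sum[OF subfield_sring[OF assms(1)]]) (use c in auto)
    then show "z \<in> {(\<Sum>b\<in>g ` J. c b * b) |c. \<forall>b\<in>g ` J. c b \<in> K}"
      unfolding c(2) sum_image_family[OF assms(4)]
      by (intro CollectI exI[of _ "\<lambda>b. \<Sum>j\<in>{j\<in>J. g j = b}. c j"]) simp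
  next
    fix z assume "z \<in> {(\<Sum>b\<in>g ` J. c b * b) |c. \<forall>b\<in>g ` J. c b \<in> K}"
    then obtain c where "\<forall>b\<in>g ` J. c b \<in> K" "z = (\<Sum>b\<in>g ` J. c b * b)" by blast
    then show "z \<in> E" using assms(3,5) by (auto intro!: sring_sum[OF assms(2)] sring_mult[OF assms(2)])
  qed
qed

lemma finite_degree_trans:
  assumes K: "subfield K" and F: "subfield F" and E: "subfield E" "K \<subseteq> F" "F \<subseteq> E"
    and d: "finite_degree K F" "finite_degree F E"
  shows "finite_degree K E"
proof -
  obtain B where B: "finite B" "B \<subseteq> F" "F = {(\<Sum>b\<in>B. c b * b) |c. \<forall>b\<in>B. c b \<in> K}"
    using d(1) by (auto simp: finite_degree_def)
  obtain D where D: "finite D" "D \<subseteq> E" "E = {(\<Sum>b\<in>D. c b * b) |c. \<forall>b\<in>D. c b \<in> F}"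
    using d(2) by (auto simp: finite_degree_def)
  show ?thesis
  proof (rule finite_degreeI[OF K subfield_sring[OF E(1)], of "D \<times> B" "\<lambda>(d,b). d * b"])
    show "K \<subseteq> E" "finite (D \<times> B)" using E B D by auto
    show "(\<lambda>(d,b). d * b) ` (D \<times> B) \<subseteq> E"
      using B(2) D(2) E(3) sring_mult[OF subfield_sring[OF E(1)]] by fast
    fix z assume "z \<in> E"
    then obtain c where c: "\<forall>d\<in>D. c d \<in> F" "z = (\<Sum>d\<in>D. c d * d)" using D(3) by auto
    have "\<exists>e. (\<forall>b\<in>B. e b \<in> K) \<and> c d = (\<Sum>b\<in>B. e b * b)" if "d \<in> D" for d
      using c(1) that B(3) by blast
    then obtain e where e: "\<And>d b. d \<in> D \<Longrightarrow> b \<in> B \<Longrightarrow> e d b \<in> K" "\<And>d. d \<in> D \<Longrightarrow> c d = (\<Sum>b\<in>B. e d b * b)"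
      by metis
    have "z = (\<Sum>d\<in>D. \<Sum>b\<in>B. e d b * (d * b))"
      unfolding c(2) by (intro sum.cong refl) (simp add: e(2) sum_distrib_right sum_distrib_left mult_ac)
    also have "\<dots> = (\<Sum>j\<in>D \<times> B. (case j of (d,b) \<Rightarrow> e d b) * (case j of (d,b) \<Rightarrow> d * b))"
      by (simp add: sum.cartesian_product case_prod_beta)
    finally show "\<exists>c. (\<forall>j\<in>D \<times> B. c j \<in> K) \<and> z = (\<Sum>j\<in>D \<times> B. c j * (case j of (d,b) \<Rightarrow> d * b))"
      using e(1) by (intro exI[of _ "\<lambda>(d,b). e d b"]) auto
  qed
qed

lemma finite_degree_adj:
  assumes K: "subfield K" and x: "alg_over K x"
  shows "finite_degree K (adj K x)"
proof -
  obtain m where m: "is_min K x m" using ex_is_min[OF x] .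
  note R = adj_sring[OF subfield_sring[OF K], of x]
  show ?thesis
  proof (rule finite_degreeI[OF K R adj_subset[OF subfield_sring[OF K]], of "{..<degree m}" "\<lambda>i. x ^ i"])
    show "(\<lambda>i. x ^ i) ` {..<degree m} \<subseteq> adj K x"
      using sring_power[OF R adj_self[OF subfield_sring[OF K]]] by auto
    fix z assume "z \<in> adj K x"
    then obtain f where f: "f \<in> pol K" "z = poly f x" by (auto simp: adj_def)
    obtain r where r: "r \<in> pol K" "r = 0 \<or> degree r < degree m" "poly r x = z"
      using is_min_div[OF K m f(1)] f(2) by blast
    have "degree r \<le> degree m - 1" using r(2) by auto
    from poly_sum_le[OF this, of x] have "z = (\<Sum>i\<le>degree m - 1. coeff r i * x ^ i)" using r(3) by simp
    also have "{..degree m - 1} = {..<degree m}" using is_min_degree[OF m] by auto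
    finally show "\<exists>c. (\<forall>j\<in>{..<degree m}. c j \<in> K) \<and> z = (\<Sum>j\<in>{..<degree m}. c j * x ^ j)"
      using polD[OF r(1)] by (intro exI[of _ "coeff r"]) simp
  qed auto
qed

fun adjl :: "'a::field set \<Rightarrow> 'a list \<Rightarrow> 'a set" where
  "adjl K [] = K"
| "adjl K (x # xs) = adjl (adj K x) xs"

text \<open>Only elements of \<open>F\<close> are tested: for imperfect \<open>K\<close> the whole
  fixed field in \<open>\<Omega>\<close> can be a proper purely inseparable extension of
  \<open>K\<close>.\<close>

definition desc :: "'a::field set \<Rightarrow> 'a set \<Rightarrow> 'a set \<Rightarrow> bool" where
  "desc \<Omega> K F \<longleftrightarrow> (\<forall>z\<in>F. (\<forall>\<sigma>\<in>gal K \<Omega>. \<sigma> z = z) \<longrightarrow> z \<in> K)"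

lemma gal_mono: "K \<subseteq> F \<Longrightarrow> gal F \<Omega> \<subseteq> gal K \<Omega>"
  by (auto simp: gal_def)

lemma desc_trans: "desc \<Omega> K F \<Longrightarrow> desc \<Omega> F F' \<Longrightarrow> K \<subseteq> F \<Longrightarrow> desc \<Omega> K F'"
  unfolding desc_def using gal_mono[of K F \<Omega>] by (meson subsetD)

lemma alg_over_mono: "K \<subseteq> F \<Longrightarrow> alg_over K x \<Longrightarrow> alg_over F x"
  unfolding alg_over_def using pol_mono[of K F] by (meson subsetD)

section \<open>Automorphisms of an algebraically closed algebraic extension\<close>

locale galois =
  fixes K \<Omega> :: "'a::field set"
  assumes K: "subfield K" and O: "alg_closed_subfield \<Omega>" and KO: "K \<subseteq> \<Omega>"
    and alg: "x \<in> \<Omega> \<Longrightarrow> alg_over K x"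
begin

lemmas Ks = subfield_sring[OF K]
lemmas Of = alg_closed_subfieldD[OF O]
lemmas Os = subfield_sring[OF Of]

lemma galois_mono: "subfield F \<Longrightarrow> K \<subseteq> F \<Longrightarrow> F \<subseteq> \<Omega> \<Longrightarrow> galois F \<Omega>"
  using O alg alg_over_mono[of K F] by unfold_locales auto

lemma gal_add: "\<sigma> \<in> gal K \<Omega> \<Longrightarrow> x \<in> \<Omega> \<Longrightarrow> y \<in> \<Omega> \<Longrightarrow> \<sigma> (x + y) = \<sigma> x + \<sigma> y"
  and gal_times: "\<sigma> \<in> gal K \<Omega> \<Longrightarrow> x \<in> \<Omega> \<Longrightarrow> y \<in> \<Omega> \<Longrightarrow> \<sigma> (x * y) = \<sigma> x * \<sigma> y"
  and gal_K: "\<sigma> \<in> gal K \<Omega> \<Longrightarrow> x \<in> K \<Longrightarrow> \<sigma> x = x"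
  and gal_image: "\<sigma> \<in> gal K \<Omega> \<Longrightarrow> \<sigma> ` \<Omega> = \<Omega>"
  by (auto simp: gal_def)

lemma gal_O: "\<sigma> \<in> gal K \<Omega> \<Longrightarrow> x \<in> \<Omega> \<Longrightarrow> \<sigma> x \<in> \<Omega>"
  by (auto simp: gal_def)

lemma gal_pfield: "\<sigma> \<in> gal K \<Omega> \<Longrightarrow> pfield (graph \<Omega> \<sigma>)"
  by (rule pfield_graph[OF Os]) (auto simp: gal_add gal_times gal_K sring_1[OF Ks] subfield_inverse[OF Of])

lemmas gal_pring = pfield_pring[OF gal_pfield]

lemma gal_0: "\<sigma> \<in> gal K \<Omega> \<Longrightarrow> \<sigma> 0 = 0" and gal_1: "\<sigma> \<in> gal K \<Omega> \<Longrightarrow> \<sigma> 1 = 1"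
  using gal_K sring_0[OF Ks] sring_1[OF Ks] by blast+

lemma gal_diff: "\<sigma> \<in> gal K \<Omega> \<Longrightarrow> x \<in> \<Omega> \<Longrightarrow> y \<in> \<Omega> \<Longrightarrow> \<sigma> (x - y) = \<sigma> x - \<sigma> y"
  using pring_diff[OF gal_pring, of \<sigma> x "\<sigma> x" y "\<sigma> y"] by simp

lemma gal_uminus: "\<sigma> \<in> gal K \<Omega> \<Longrightarrow> x \<in> \<Omega> \<Longrightarrow> \<sigma> (- x) = - \<sigma> x"
  using gal_diff[of \<sigma> 0 x] gal_0 sring_0[OF Os] by simp

lemma gal_inverse: "\<sigma> \<in> gal K \<Omega> \<Longrightarrow> x \<in> \<Omega> \<Longrightarrow> \<sigma> (inverse x) = inverse (\<sigma> x)"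
  using pfield_inverse[OF gal_pfield, of \<sigma> x "\<sigma> x"] by simp

lemma gal_divide: "\<sigma> \<in> gal K \<Omega> \<Longrightarrow> x \<in> \<Omega> \<Longrightarrow> y \<in> \<Omega> \<Longrightarrow> \<sigma> (x / y) = \<sigma> x / \<sigma> y"
  unfolding divide_inverse by (simp add: gal_times gal_inverse subfield_inverse[OF Of])

lemma gal_power: "\<sigma> \<in> gal K \<Omega> \<Longrightarrow> x \<in> \<Omega> \<Longrightarrow> \<sigma> (x ^ n) = \<sigma> x ^ n"
  using pring_power[OF gal_pring, of \<sigma> x "\<sigma> x" n] by simp

lemma gal_sum: "\<sigma> \<in> gal K \<Omega> \<Longrightarrow> (\<And>i. i \<in> S \<Longrightarrow> f i \<in> \<Omega>) \<Longrightarrow> \<sigma> (sum f S) = (\<Sum>i\<in>S. \<sigma> (f i))"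
  using pring_sum[OF gal_pring, of \<sigma> S f "\<lambda>i. \<sigma> (f i)"] by simp

lemma gal_eq_0: "\<sigma> \<in> gal K \<Omega> \<Longrightarrow> x \<in> \<Omega> \<Longrightarrow> \<sigma> x = 0 \<longleftrightarrow> x = 0"
  using pfield_inj[OF gal_pfield, of \<sigma> x] gal_0 by auto

lemma gal_inj: "\<sigma> \<in> gal K \<Omega> \<Longrightarrow> inj_on \<sigma> \<Omega>"
proof (rule inj_onI)
  fix x y assume h: "\<sigma> \<in> gal K \<Omega>" "x \<in> \<Omega>" "y \<in> \<Omega>" "\<sigma> x = \<sigma> y"
  then have "\<sigma> (x - y) = 0" by (simp add: gal_diff)
  then show "x = y" using gal_eq_0[of \<sigma> "x - y"] h sring_diff[OF Os] by simp
qed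

lemma gal_poly: "\<sigma> \<in> gal K \<Omega> \<Longrightarrow> f \<in> pol K \<Longrightarrow> x \<in> \<Omega> \<Longrightarrow> \<sigma> (poly f x) = poly f (\<sigma> x)"
proof -
  assume h: "\<sigma> \<in> gal K \<Omega>" "f \<in> pol K" "x \<in> \<Omega>"
  have "(f, f) \<in> ppol (graph \<Omega> \<sigma>)" using h KO by (auto simp: ppol_def pol_def gal_K)
  from ppol_poly[OF gal_pring[OF h(1)] this, of x "\<sigma> x"] show ?thesis using h by simp
qed

lemma gal_id: "id \<in> gal K \<Omega>"
  by (auto simp: gal_def)

lemma gal_comp: "\<sigma> \<in> gal K \<Omega> \<Longrightarrow> \<tau> \<in> gal K \<Omega> \<Longrightarrow> \<sigma> \<circ> \<tau> \<in> gal K \<Omega>"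
  using gal_O[of \<tau>] gal_image[of \<sigma>] gal_image[of \<tau>] image_image[of \<sigma> \<tau> \<Omega>] unfolding gal_def by simp

text \<open>Zorn's lemma on partial isomorphisms inside \<open>\<Omega>\<close>. Maximality gives
  totality: a new \<open>x\<close> can be sent to any root of the image of its minimal polynomial.
  Surjectivity is then automatic, since an injective map over \<open>K\<close> permutes the finitely
  many roots of a polynomial over \<open>K\<close>.\<close>

theorem extend:
  assumes g0: "pfield g0" "g0 \<subseteq> \<Omega> \<times> \<Omega>" "Id_on K \<subseteq> g0"
  shows "\<exists>\<sigma>\<in>gal K \<Omega>. \<forall>(x,y)\<in>g0. \<sigma> x = y"
proof -
  define A where "A = {g. pfield g \<and> g0 \<subseteq> g \<and> g \<subseteq> \<Omega> \<times> \<Omega>}"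
  have "\<exists>g\<in>A. \<forall>X\<in>A. g \<subseteq> X \<longrightarrow> X = g"
  proof (rule subset_Zorn_nonempty)
    show "A \<noteq> {}" using g0 by (auto simp: A_def)
    fix C assume C: "C \<noteq> {}" "subset.chain A C"
    have CA: "C \<subseteq> A" using C(2) by (simp add: subset.chain_def)
    have common: "\<exists>g\<in>C. u \<in> g \<and> v \<in> g" if uv: "u \<in> \<Union>C" "v \<in> \<Union>C" for u v
    proof -
      obtain g h where gh: "g \<in> C" "h \<in> C" "u \<in> g" "v \<in> h" using uv by blast
      then have "g \<subseteq> h \<or> h \<subseteq> g" using C(2) by (auto simp: subset.chain_def)
      then show ?thesis using gh by blast
    qed
    have pf: "pfield g" if "g \<in> C" for g using that CA by (auto simp: A_def)
    have "pring (\<Union>C)" unfolding pring_def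
    proof (intro conjI allI impI)
      obtain g where "g \<in> C" using C by auto
      then show "(0,0) \<in> \<Union>C" "(1,1) \<in> \<Union>C"
        using pring_0[OF pfield_pring[OF pf]] pring_1[OF pfield_pring[OF pf]] by blast+
      fix x y x' y' assume "(x,y) \<in> \<Union>C" "(x',y') \<in> \<Union>C"
      from common[OF this] obtain g where g: "g \<in> C" "(x,y) \<in> g" "(x',y') \<in> g" by blast
      note P = pfield_pring[OF pf[OF g(1)]]
      show "(x + x', y + y') \<in> \<Union>C" "(x - x', y - y') \<in> \<Union>C" "(x * x', y * y') \<in> \<Union>C"
        using g(1) pring_add[OF P g(2,3)] pring_diff[OF P g(2,3)] pring_mult[OF P g(2,3)] by blast+
    qed
    moreover have "(inverse x, inverse y) \<in> \<Union>C \<and> (x = 0 \<longrightarrow> y = 0)" if "(x,y) \<in> \<Union>C" for x y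
    proof -
      obtain g where g: "g \<in> C" "(x,y) \<in> g" using \<open>(x,y) \<in> \<Union>C\<close> by blast
      then show ?thesis using pfield_inverse[OF pf[OF g(1)] g(2)] pfield_zero[OF pf[OF g(1)]] by blast
    qed
    ultimately have "pfield (\<Union>C)" by (simp add: pfield_def)
    moreover have "g0 \<subseteq> \<Union>C" using C(1) CA by (auto simp: A_def)
    moreover have "\<Union>C \<subseteq> \<Omega> \<times> \<Omega>" using CA by (auto simp: A_def)
    ultimately show "\<Union>C \<in> A" by (simp add: A_def)
  qed
  then obtain g where gA: "g \<in> A" and max: "\<And>X. X \<in> A \<Longrightarrow> g \<subseteq> X \<Longrightarrow> X = g" by blast
  have g: "pfield g" "g0 \<subseteq> g" "g \<subseteq> \<Omega> \<times> \<Omega>" using gA by (auto simp: A_def)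
  note P = pfield_pring[OF g(1)]
  have tot: "\<exists>y. (x,y) \<in> g" if x: "x \<in> \<Omega>" for x
  proof -
    have "K \<subseteq> Domain g" using g0 g by fastforce
    then have "alg_over (Domain g) x" using alg[OF x] by (rule alg_over_mono)
    then obtain m1 where m1: "is_min (Domain g) x m1" by (rule ex_is_min)
    then have "m1 \<in> pol (Domain g)" by (simp add: is_min_def)
    then obtain m2 where m2: "(m1,m2) \<in> ppol g" using ppol_lift P by blast
    \<comment> \<open>The leading coefficient stays nonzero by injectivity, so \<open>m2\<close> is
      not constant and has a root.\<close>
    have "(coeff m1 (degree m1), coeff m2 (degree m1)) \<in> g" using m2 by (auto simp: ppol_def)
    then have "coeff m2 (degree m1) \<noteq> 0"
      using pfield_inj[OF g(1)] m1 by (fastforce simp: is_min_def)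
    then have "degree m2 > 0" using is_min_degree[OF m1] le_degree[of m2 "degree m1"] by linarith
    moreover have "m2 \<in> pol \<Omega>" using m2 g(3) by (auto simp: ppol_def pol_def)
    ultimately obtain y where y: "y \<in> \<Omega>" "poly m2 y = 0" using alg_closed_root[OF O] by blast
    have "padj g x y \<in> A" unfolding A_def
    proof (intro CollectI conjI)
      show "pfield (padj g x y)" by (rule padj_pfield[OF g(1) m1 m2 y(2)])
      show "g0 \<subseteq> padj g x y" using padj_subset[OF P] g(2) by blast
      show "padj g x y \<subseteq> \<Omega> \<times> \<Omega>"
      proof (clarify)
        fix a b assume "(a,b) \<in> padj g x y"
        then obtain p q where pq: "(p,q) \<in> ppol g" "a = poly p x" "b = poly q y" by (auto simp: padj_def)
        have "p \<in> pol \<Omega>" "q \<in> pol \<Omega>" using pq(1) g(3) by (auto simp: ppol_def pol_def)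
        then show "a \<in> \<Omega> \<and> b \<in> \<Omega>" using pq x y pol_poly[OF Os] by auto
      qed
    qed
    then have "padj g x y = g" using max padj_subset[OF P] by blast
    then show ?thesis using padj_self[OF P] by blast
  qed
  define \<sigma> where "\<sigma> x = (if x \<in> \<Omega> then (THE y. (x,y) \<in> g) else x)" for x
  have \<sigma>: "(x, \<sigma> x) \<in> g" if "x \<in> \<Omega>" for x
  proof -
    have "\<exists>!y. (x,y) \<in> g" using tot[OF that] pfield_single[OF g(1)] by blast
    from theI'[OF this] show ?thesis using that by (simp add: \<sigma>_def)
  qed
  have \<sigma>_eq: "\<sigma> x = y" if "(x,y) \<in> g" for x y
    using \<sigma>[of x] that g(3) pfield_single[OF g(1)] by blast
  have \<sigma>O: "\<sigma> x \<in> \<Omega>" if "x \<in> \<Omega>" for x using \<sigma>[OF that] g(3) by blast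
  have hom: "\<sigma> (x + y) = \<sigma> x + \<sigma> y \<and> \<sigma> (x * y) = \<sigma> x * \<sigma> y" if "x \<in> \<Omega>" "y \<in> \<Omega>" for x y
    using \<sigma>_eq pring_add[OF P \<sigma>[OF that(1)] \<sigma>[OF that(2)]] pring_mult[OF P \<sigma>[OF that(1)] \<sigma>[OF that(2)]] by blast
  have fix_K: "\<sigma> x = x" if "x \<in> K" for x using \<sigma>_eq g0(3) g(2) that by blast
  have inj: "inj_on \<sigma> \<Omega>"
  proof (rule inj_onI)
    fix x y assume h: "x \<in> \<Omega>" "y \<in> \<Omega>" "\<sigma> x = \<sigma> y"
    have "(x - y, 0) \<in> g" using pring_diff[OF P \<sigma>[OF h(1)] \<sigma>[OF h(2)]] h(3) by simp
    then show "x = y" using pfield_inj[OF g(1)] by fastforce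
  qed
  have surj: "y \<in> \<sigma> ` \<Omega>" if y: "y \<in> \<Omega>" for y
  proof -
    obtain f where f: "f \<in> pol K" "f \<noteq> 0" "poly f y = 0" using alg[OF y] by (auto simp: alg_over_def)
    define R where "R = {z\<in>\<Omega>. poly f z = 0}"
    have "finite R" using poly_roots_finite[OF f(2)] by (simp add: R_def)
    moreover have "\<sigma> ` R \<subseteq> R"
    proof
      fix w assume "w \<in> \<sigma> ` R"
      then obtain z where z: "z \<in> \<Omega>" "poly f z = 0" "w = \<sigma> z" by (auto simp: R_def)
      have "(f,f) \<in> ppol g" using f(1) \<sigma> KO fix_K by (force simp: ppol_def pol_def)
      from ppol_poly[OF P this \<sigma>[OF z(1)]] have "poly f w = 0" using z pfield_zero[OF g(1)] by simp
      then show "w \<in> R" using z \<sigma>O by (simp add: R_def)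
    qed
    moreover have "inj_on \<sigma> R" using inj by (rule inj_on_subset) (auto simp: R_def)
    ultimately have "\<sigma> ` R = R" using endo_inj_surj by blast
    moreover have "y \<in> R" using y f by (simp add: R_def)
    ultimately show ?thesis by (auto simp: R_def)
  qed
  have "\<sigma> \<in> gal K \<Omega>"
    unfolding gal_def using hom fix_K surj \<sigma>O by (auto simp: \<sigma>_def)
  then show ?thesis using \<sigma>_eq g(2) by (intro bexI[of _ \<sigma>]) auto
qed

lemma conjugate:
  assumes "x \<in> \<Omega>" "is_min K x m" "r \<in> \<Omega>" "poly m r = 0"
  shows "\<exists>\<sigma>\<in>gal K \<Omega>. \<sigma> x = r"
proof -
  have m: "(m,m) \<in> ppol (Id_on K)" using assms(2) by (auto simp: ppol_Id_on is_min_def)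
  have P: "pring (Id_on K)" by (rule pfield_pring[OF subfield_pfield[OF K]])
  have "pfield (padj (Id_on K) x r)"
    by (rule padj_pfield[OF subfield_pfield[OF K] _ m assms(4)]) (use assms(2) in simp)
  moreover have "padj (Id_on K) x r \<subseteq> \<Omega> \<times> \<Omega>"
  proof (clarify)
    fix a b assume "(a,b) \<in> padj (Id_on K) x r"
    then obtain p where "p \<in> pol K" "a = poly p x" "b = poly p r" by (auto simp: padj_def ppol_Id_on)
    then show "a \<in> \<Omega> \<and> b \<in> \<Omega>" using assms pol_poly[OF Os] pol_mono[OF KO] by auto
  qed
  ultimately have "\<exists>\<sigma>\<in>gal K \<Omega>. \<forall>(u,v)\<in>padj (Id_on K) x r. \<sigma> u = v"
    using extend padj_subset[OF P] by blast
  then show ?thesis using padj_self[OF P, of x r] by auto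
qed

text \<open>Write a fixed \<open>z\<close> as \<open>q(x)\<close> with \<open>q\<close> of smaller
  degree than the minimal polynomial \<open>m\<close>. Every root of \<open>m\<close> is a conjugate
  of \<open>x\<close>, so \<open>q - z\<close> vanishes at all of them; the roots being simple,
  \<open>m\<close> divides \<open>q - z\<close>, which forces \<open>q = z\<close>.\<close>

lemma desc_adj:
  assumes x: "x \<in> \<Omega>" "sep K x"
  shows "desc \<Omega> K (adj K x)"
  unfolding desc_def
proof (intro ballI impI)
  fix z assume z: "z \<in> adj K x" "\<forall>\<sigma>\<in>gal K \<Omega>. \<sigma> z = z"
  obtain m where m: "is_min K x m" using ex_is_min[OF alg[OF x(1)]] .
  have mp: "m \<in> pol K" "m \<noteq> 0" using m by (auto simp: is_min_def)
  have dm: "poly (pderiv m) x \<noteq> 0" by (rule sep_min[OF K x(2) m])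
  obtain f where f: "f \<in> pol K" "z = poly f x" using z by (auto simp: adj_def)
  obtain q where q: "q \<in> pol K" "q = 0 \<or> degree q < degree m" "poly q x = z"
    using is_min_div[OF K m f(1)] f(2) by blast
  have "m dvd q - [:z:]"
  proof (rule split_dvd[OF O _ mp(2)])
    show "m \<in> pol \<Omega>" using mp pol_mono[OF KO] by blast
    fix r assume r: "r \<in> \<Omega>" "poly m r = 0"
    obtain \<sigma> where \<sigma>: "\<sigma> \<in> gal K \<Omega>" "\<sigma> x = r" using conjugate[OF x(1) m r] by blast
    have "poly (pderiv m) r = \<sigma> (poly (pderiv m) x)"
      using gal_poly[OF \<sigma>(1) pol_pderiv[OF Ks mp(1)] x(1)] \<sigma>(2) by simp
    moreover have "poly (pderiv m) x \<in> \<Omega>"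
      using pol_poly[OF Os] pol_pderiv[OF Ks mp(1)] pol_mono[OF KO] x by blast
    ultimately have "poly (pderiv m) r \<noteq> 0" using gal_eq_0[OF \<sigma>(1)] dm by simp
    moreover have "poly q r = z"
      using gal_poly[OF \<sigma>(1) q(1) x(1)] \<sigma> q(3) z(2) by metis
    ultimately show "poly (pderiv m) r \<noteq> 0 \<and> poly (q - [:z:]) r = 0" by simp
  qed
  moreover have "degree (q - [:z:]) < degree m"
    using q(2) is_min_degree[OF m] by (auto intro!: degree_diff_less)
  ultimately have "q = [:z:]" by (metis dvd_imp_degree_le eq_iff_diff_eq_0 not_le)
  then show "z \<in> K" using q(1) by (metis polD coeff_pCons_0)
qed

lemma galois_adj: "x \<in> \<Omega> \<Longrightarrow> galois (adj K x) \<Omega>"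
  using galois_mono[OF adj_subfield[OF K alg]] adj_subset[OF Ks] adj_least[OF Os KO] by blast

definition stable :: "'a set \<Rightarrow> bool" where
  "stable F \<longleftrightarrow> (\<forall>\<sigma>\<in>gal K \<Omega>. \<sigma> ` F \<subseteq> F)"

lemma stableD: "stable F \<Longrightarrow> \<sigma> \<in> gal K \<Omega> \<Longrightarrow> x \<in> F \<Longrightarrow> \<sigma> x \<in> F"
  by (auto simp: stable_def)

definition orb :: "'a \<Rightarrow> 'a set" where
  "orb x = (\<lambda>\<sigma>. \<sigma> x) ` gal K \<Omega>"

end

text \<open>The properties are proved together because each adjunction changes the base field, over
  which the induction hypothesis is then applied.\<close>

lemma galois_adjl:
  assumes "galois K \<Omega>" "set xs \<subseteq> \<Omega>"
  shows "galois (adjl K xs) \<Omega> \<and> K \<subseteq> adjl K xs \<and> set xs \<subseteq> adjl K xs \<and> finite_degree K (adjl K xs)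
    \<and> (\<forall>F. subfield F \<longrightarrow> K \<subseteq> F \<longrightarrow> set xs \<subseteq> F \<longrightarrow> adjl K xs \<subseteq> F)
    \<and> ((\<forall>x\<in>set xs. sep K x) \<longrightarrow> desc \<Omega> K (adjl K xs))"
  using assms
proof (induction xs arbitrary: K)
  case Nil
  then interpret galois K \<Omega> by simp
  have "finite_degree K K"
    by (rule finite_degreeI[OF K Ks _, of "{()}" "\<lambda>_. 1"]) (use sring_1[OF Ks] in auto)
  then show ?case using Nil by (auto simp: desc_def)
next
  case (Cons x xs)
  interpret galois K \<Omega> by (rule Cons.prems(1))
  have x: "x \<in> \<Omega>" using Cons.prems by auto
  interpret A: galois "adj K x" \<Omega> by (rule galois_adj[OF x])
  note sub = adj_subset[OF Ks, of x] adj_self[OF Ks, of x]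
  have IH: "galois (adjl (adj K x) xs) \<Omega>" "adj K x \<subseteq> adjl (adj K x) xs"
    "set xs \<subseteq> adjl (adj K x) xs" "finite_degree (adj K x) (adjl (adj K x) xs)"
    "\<And>F. subfield F \<Longrightarrow> adj K x \<subseteq> F \<Longrightarrow> set xs \<subseteq> F \<Longrightarrow> adjl (adj K x) xs \<subseteq> F"
    "(\<forall>y\<in>set xs. sep (adj K x) y) \<Longrightarrow> desc \<Omega> (adj K x) (adjl (adj K x) xs)"
    using Cons.IH[OF A.galois_axioms] Cons.prems(2) by auto
  interpret B: galois "adjl (adj K x) xs" \<Omega> by (rule IH(1))
  have "finite_degree K (adjl K (x # xs))"
    using finite_degree_trans[OF K A.K B.K sub(1) IH(2) finite_degree_adj[OF K alg[OF x]] IH(4)] by simp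
  moreover have "desc \<Omega> K (adjl K (x # xs))" if "\<forall>y\<in>set (x # xs). sep K y"
    using desc_trans[OF desc_adj[OF x] IH(6) sub(1)] that sep_mono[OF sub(1)] by simp
  moreover have "adjl K (x # xs) \<subseteq> F" if F: "subfield F" "K \<subseteq> F" "set (x # xs) \<subseteq> F" for F
    using IH(5)[OF F(1) adj_least[OF subfield_sring[OF F(1)] F(2)]] F(3) by simp
  moreover have "K \<subseteq> adjl K (x # xs)" "set (x # xs) \<subseteq> adjl K (x # xs)" using IH(2,3) sub by auto
  ultimately show ?case using IH(1) by simp
qed

section \<open>Galois hulls and the separable closure\<close>

context galois begin

lemma orb_self: "x \<in> orb x"
  unfolding orb_def using gal_id by (metis image_eqI id_apply)

lemma orb_O: "x \<in> \<Omega> \<Longrightarrow> orb x \<subseteq> \<Omega>"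
  unfolding orb_def using gal_O by blast

lemma gal_orb: "\<sigma> \<in> gal K \<Omega> \<Longrightarrow> y \<in> orb x \<Longrightarrow> \<sigma> y \<in> orb x"
proof -
  assume \<sigma>: "\<sigma> \<in> gal K \<Omega>" and "y \<in> orb x"
  then obtain \<tau> where \<tau>: "\<tau> \<in> gal K \<Omega>" "y = \<tau> x" by (auto simp: orb_def)
  then show "\<sigma> y \<in> orb x" unfolding orb_def using gal_comp[OF \<sigma> \<tau>(1)] by (intro image_eqI[of _ _ "\<sigma> \<circ> \<tau>"]) auto
qed

lemma finite_orb:
  assumes "x \<in> \<Omega>"
  shows "finite (orb x)"
proof -
  obtain f where f: "f \<in> pol K" "f \<noteq> 0" "poly f x = 0" using alg[OF assms] by (auto simp: alg_over_def)
  have "orb x \<subseteq> {z. poly f z = 0}"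
    unfolding orb_def using gal_poly[OF _ f(1) assms] gal_0 f(3) by fastforce
  then show ?thesis using poly_roots_finite[OF f(2)] finite_subset by blast
qed

lemma orb_bij:
  assumes "x \<in> \<Omega>" "\<sigma> \<in> gal K \<Omega>"
  shows "bij_betw \<sigma> (orb x) (orb x)"
proof -
  have "inj_on \<sigma> (orb x)" using gal_inj[OF assms(2)] orb_O[OF assms(1)] inj_on_subset by blast
  moreover have "\<sigma> ` orb x \<subseteq> orb x" using gal_orb[OF assms(2)] by blast
  ultimately show ?thesis
    using endo_inj_surj[OF finite_orb[OF assms(1)]] by (simp add: bij_betw_def)
qed

text \<open>The polynomial with the orbit of \<open>z\<close> as its roots has coefficients in
  \<open>F\<close> that are fixed by every automorphism, hence lie in \<open>K\<close>; its roots
  are distinct by construction.\<close>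

lemma sep_of_desc:
  assumes F: "subfield F" "K \<subseteq> F" "F \<subseteq> \<Omega>" "stable F" "desc \<Omega> K F" and z: "z \<in> F"
  shows "sep K z"
proof -
  have zO: "z \<in> \<Omega>" using z F by blast
  have orbF: "orb z \<subseteq> F" using F(4) z by (auto simp: stable_def orb_def)
  define P where "P = (\<Prod>w\<in>orb z. [:-w,1:])"
  have PF: "P \<in> pol F"
    unfolding P_def using orbF
    by (auto intro!: sring_prod[OF sring_pol[OF subfield_sring[OF F(1)]]] pol_linear[OF subfield_sring[OF F(1)]])
  have "coeff P i \<in> K" for i
  proof -
    have "\<sigma> (coeff P i) = coeff P i" if \<sigma>: "\<sigma> \<in> gal K \<Omega>" for \<sigma>
    proof -
      have "(P, \<Prod>w\<in>orb z. [:-\<sigma> w,1:]) \<in> ppol (graph \<Omega> \<sigma>)"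
        unfolding P_def using orb_O[OF zO]
        by (intro pring_prod[OF ppol_pring[OF gal_pring[OF \<sigma>]]] ppol_linear[OF gal_pring[OF \<sigma>]]) auto
      also have "(\<Prod>w\<in>orb z. [:-\<sigma> w,1:]) = P"
        unfolding P_def using prod.reindex_bij_betw[OF orb_bij[OF zO \<sigma>], of "\<lambda>w. [:-w,1:]"] .
      finally show ?thesis by (simp add: ppol_def)
    qed
    then show ?thesis using F(5) polD[OF PF] by (simp add: desc_def)
  qed
  then have "P \<in> pol K" by (simp add: pol_def)
  moreover have split: "P = [:-z,1:] * (\<Prod>w\<in>orb z - {z}. [:-w,1:])"
    unfolding P_def by (rule prod.remove[OF finite_orb[OF zO] orb_self])
  then have "poly P z = 0" by simp
  moreover have "poly (pderiv P) z = (\<Prod>w\<in>orb z - {z}. z - w)"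
    unfolding split pderiv_mult poly_add poly_mult by (simp add: pderiv_pCons poly_prod del: mult_pCons_left)
  then have "poly (pderiv P) z \<noteq> 0" using finite_orb[OF zO] by simp
  ultimately show ?thesis unfolding sep_def by blast
qed

lemma sep_gal:
  assumes "\<sigma> \<in> gal K \<Omega>" "x \<in> \<Omega>" "sep K x"
  shows "sep K (\<sigma> x)"
proof -
  obtain f where f: "f \<in> pol K" "poly f x = 0" "poly (pderiv f) x \<noteq> 0" using assms by (auto simp: sep_def)
  note d = pol_pderiv[OF Ks f(1)]
  have "poly (pderiv f) x \<in> \<Omega>" using pol_poly[OF Os] d pol_mono[OF KO] assms(2) by blast
  then show ?thesis
    unfolding sep_def using f gal_poly[OF assms(1) f(1) assms(2)] gal_poly[OF assms(1) d assms(2)]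
      gal_0[OF assms(1)] gal_eq_0[OF assms(1)] by (intro bexI[of _ f]) auto
qed

lemma subfield_preimage:
  assumes \<sigma>: "\<sigma> \<in> gal K \<Omega>" and F: "subfield F"
  shows "subfield {x\<in>\<Omega>. \<sigma> x \<in> F}"
proof -
  note R = subfield_sring[OF F]
  show ?thesis
    by (intro subfieldI sringI)
      (auto simp: gal_add[OF \<sigma>] gal_diff[OF \<sigma>] gal_times[OF \<sigma>] gal_inverse[OF \<sigma>] gal_0[OF \<sigma>] gal_1[OF \<sigma>]
          sring_0[OF Os] sring_1[OF Os] sring_add[OF Os] sring_diff[OF Os] sring_mult[OF Os] subfield_inverse[OF Of]
          sring_0[OF R] sring_1[OF R] sring_add[OF R] sring_diff[OF R] sring_mult[OF R] subfield_inverse[OF F])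
qed

text \<open>Adjoining full orbits makes the field stable: for an automorphism \<sigma> the elements
  sent into \<open>F\<close> form a field containing the generators. The minimality clause is what
  later keeps the hull of a subset of \<open>E\<close> inside \<open>E\<close>.\<close>

lemma hull:
  assumes "finite X" "X \<subseteq> \<Omega>" "\<And>x. x \<in> X \<Longrightarrow> sep K x"
  obtains F where "subfield F" "K \<subseteq> F" "F \<subseteq> \<Omega>" "X \<subseteq> F" "finite_degree K F" "desc \<Omega> K F" "stable F"
    "\<And>F'. subfield F' \<Longrightarrow> K \<subseteq> F' \<Longrightarrow> stable F' \<Longrightarrow> X \<subseteq> F' \<Longrightarrow> F \<subseteq> F'"
proof -
  have "finite (\<Union>(orb ` X))" using assms finite_orb by auto
  then obtain xs where xs: "set xs = \<Union>(orb ` X)" using finite_list by metis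
  have sub: "set xs \<subseteq> \<Omega>" using xs orb_O assms(2) by auto
  have sp: "sep K x" if "x \<in> set xs" for x
    using that xs sep_gal assms(2,3) by (fastforce simp: orb_def)
  define F where "F = adjl K xs"
  have F: "galois F \<Omega>" "K \<subseteq> F" "set xs \<subseteq> F" "finite_degree K F"
    "\<And>F'. subfield F' \<Longrightarrow> K \<subseteq> F' \<Longrightarrow> set xs \<subseteq> F' \<Longrightarrow> F \<subseteq> F'" "desc \<Omega> K F"
    using galois_adjl[OF galois_axioms sub] sp unfolding F_def by auto
  interpret F: galois F \<Omega> by (rule F(1))
  have "stable F"
    unfolding stable_def
  proof
    fix \<sigma> assume \<sigma>: "\<sigma> \<in> gal K \<Omega>"
    define F' where "F' = {x\<in>\<Omega>. \<sigma> x \<in> F}"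
    have "subfield F'"
      unfolding F'_def by (rule subfield_preimage[OF \<sigma> F.K])
    moreover have "K \<subseteq> F'" using KO F(2) gal_K[OF \<sigma>] by (auto simp: F'_def)
    moreover have "set xs \<subseteq> F'"
      using sub F(3) gal_orb[OF \<sigma>] unfolding F'_def xs by blast
    ultimately show "\<sigma> ` F \<subseteq> F" using F(5) by (auto simp: F'_def)
  qed
  moreover have "X \<subseteq> F" using F(3) xs orb_self by blast
  moreover have "F \<subseteq> F'" if F': "subfield F'" "K \<subseteq> F'" "stable F'" "X \<subseteq> F'" for F'
  proof (rule F(5)[OF F'(1,2)])
    show "set xs \<subseteq> F'" using F'(3,4) unfolding xs stable_def orb_def by blast
  qed
  ultimately show ?thesis using that[of F] F F.K F.KO by blast
qed

text \<open>The separable closure of \<open>K\<close> in \<open>\<Omega>\<close>.\<close>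

definition sepc :: "'a set" where
  "sepc = {x\<in>\<Omega>. sep K x}"

lemma hull_sepc:
  assumes "subfield F" "K \<subseteq> F" "F \<subseteq> \<Omega>" "stable F" "desc \<Omega> K F"
  shows "F \<subseteq> sepc"
  using sep_of_desc[OF assms] assms(3) by (auto simp: sepc_def)

lemma sepc_subfield: "subfield sepc"
proof -
  have ops: "x + y \<in> sepc \<and> x - y \<in> sepc \<and> x * y \<in> sepc \<and> inverse x \<in> sepc" if xy: "x \<in> sepc" "y \<in> sepc" for x y
  proof -
    obtain F where F: "subfield F" "K \<subseteq> F" "F \<subseteq> \<Omega>" "{x,y} \<subseteq> F" "finite_degree K F" "desc \<Omega> K F" "stable F"
      by (rule hull[of "{x,y}"]) (use xy in \<open>auto simp: sepc_def\<close>)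
    note R = subfield_sring[OF F(1)]
    have "x + y \<in> F" "x - y \<in> F" "x * y \<in> F" "inverse x \<in> F"
      using F(4) by (auto intro: sring_add[OF R] sring_diff[OF R] sring_mult[OF R] subfield_inverse[OF F(1)])
    then show ?thesis using hull_sepc[OF F(1-3,7,6)] by blast
  qed
  have "K \<subseteq> sepc" using sep_self[OF Ks] KO by (auto simp: sepc_def)
  then show ?thesis
    by (intro subfieldI sringI) (use ops sring_0[OF Ks] sring_1[OF Ks] in blast)+
qed

lemma K_sepc: "K \<subseteq> sepc"
  using sep_self[OF Ks] KO by (auto simp: sepc_def)

text \<open>Transitivity of separability by way of fixed fields. The coefficients of a polynomial
  for \<open>x\<close> lie in a stable finite \<open>F\<close>; an automorphism moves this
  polynomial to another one over \<open>F\<close>, so all conjugates of \<open>x\<close> are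
  separable over \<open>F\<close>. Adjoining them gives a stable field that descends to
  \<open>K\<close> through \<open>F\<close>, and \<open>sep_of_desc\<close> applies.\<close>

lemma sep_trans:
  assumes x: "x \<in> \<Omega>" "sep sepc x"
  shows "x \<in> sepc"
proof -
  obtain f where f: "f \<in> pol sepc" "poly f x = 0" "poly (pderiv f) x \<noteq> 0" using x by (auto simp: sep_def)
  obtain F where F: "subfield F" "K \<subseteq> F" "F \<subseteq> \<Omega>" "set (coeffs f) \<subseteq> F" "finite_degree K F" "desc \<Omega> K F" "stable F"
  proof (rule hull[of "set (coeffs f)"])
    have "range (coeff f) \<subseteq> sepc" using f(1) by (auto simp: pol_def)
    then have "set (coeffs f) \<subseteq> sepc" by (simp add: range_coeff)
    then show "set (coeffs f) \<subseteq> \<Omega>" "\<And>x. x \<in> set (coeffs f) \<Longrightarrow> sep K x" by (auto simp: sepc_def)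
  qed auto
  interpret F: galois F \<Omega> by (rule galois_mono[OF F(1-3)])
  have fF: "f \<in> pol F"
  proof -
    have "range (coeff f) \<subseteq> F" using F(4) sring_0[OF F.Ks] by (simp add: range_coeff)
    then show ?thesis by (auto simp: pol_def)
  qed
  have sepF: "sep F (\<sigma> x)" if \<sigma>: "\<sigma> \<in> gal K \<Omega>" for \<sigma>
  proof -
    define g where "g = (\<lambda>x. (x, \<sigma> x)) ` F"
    obtain f' where f': "(f,f') \<in> ppol (graph \<Omega> \<sigma>)"
      using ppol_lift[of f "graph \<Omega> \<sigma>"] gal_pring[OF \<sigma>] fF F(3) pol_mono
      by (metis (no_types, lifting) Domain.simps graph_iff subsetD subsetI)
    have "f' \<in> pol F" using f' fF stableD[OF F(7) \<sigma>] by (auto simp: ppol_def pol_def)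
    moreover have "poly f' (\<sigma> x) = \<sigma> (poly f x)"
      using ppol_poly[OF gal_pring[OF \<sigma>] f', of x "\<sigma> x"] x by simp
    moreover have "poly (pderiv f') (\<sigma> x) = \<sigma> (poly (pderiv f) x) \<and> poly (pderiv f) x \<in> \<Omega>"
      using ppol_poly[OF gal_pring[OF \<sigma>] ppol_pderiv[OF gal_pring[OF \<sigma>] f'], of x "\<sigma> x"] x by simp
    ultimately show ?thesis
      using f gal_0[OF \<sigma>] gal_eq_0[OF \<sigma>] unfolding sep_def by (intro bexI[of _ f']) auto
  qed
  obtain xs where xs: "set xs = orb x" using finite_list[OF finite_orb[OF x(1)]] by blast
  have sub: "set xs \<subseteq> \<Omega>" using xs orb_O[OF x(1)] by simp
  define F2 where "F2 = adjl F xs"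
  have F2: "galois F2 \<Omega>" "F \<subseteq> F2" "set xs \<subseteq> F2" "\<And>F'. subfield F' \<Longrightarrow> F \<subseteq> F' \<Longrightarrow> set xs \<subseteq> F' \<Longrightarrow> F2 \<subseteq> F'"
     "desc \<Omega> F F2"
    using galois_adjl[OF F.galois_axioms sub] sepF unfolding F2_def xs orb_def by auto
  interpret F2: galois F2 \<Omega> by (rule F2(1))
  have "stable F2"
    unfolding stable_def
  proof
    fix \<sigma> assume \<sigma>: "\<sigma> \<in> gal K \<Omega>"
    define F' where "F' = {x\<in>\<Omega>. \<sigma> x \<in> F2}"
    have "subfield F'"
      unfolding F'_def by (rule subfield_preimage[OF \<sigma> F2.K])
    moreover have "F \<subseteq> F'" using F(3,7) F2(2) \<sigma> by (auto simp: F'_def stable_def)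
    moreover have "set xs \<subseteq> F'"
      using sub F2(3) gal_orb[OF \<sigma>] unfolding F'_def xs by blast
    ultimately show "\<sigma> ` F2 \<subseteq> F2" using F2(4) by (auto simp: F'_def)
  qed
  moreover have "desc \<Omega> K F2" by (rule desc_trans[OF F(6) F2(5) F(2)])
  moreover have "K \<subseteq> F2" using F(2) F2(2) by simp
  moreover have "x \<in> F2" using F2(3) xs orb_self by blast
  ultimately show ?thesis using hull_sepc[OF F2.K _ F2.KO] by blast
qed

end

text \<open>The characteristic exponent: 1 in characteristic 0, so that statements on purely
  inseparable elements hold in both cases.\<close>

definition pexp :: "'a::field itself \<Rightarrow> nat" where
  "pexp _ = (if CHAR('a) = 0 then 1 else CHAR('a))"

text \<open>Induction on the degree of an annihilating \<open>f\<close>. If \<open>x\<close> is a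
  simple root, \<open>desc_adj\<close> puts it in \<open>K\<close>; if the derivative is nonzero and
  vanishes at \<open>x\<close>, it replaces \<open>f\<close>; if the derivative is zero,
  \<open>f\<close> is a polynomial \<open>h\<close> in \<open>X^p\<close>, and \<open>x^p\<close>
  takes the place of \<open>x\<close>.\<close>

lemma (in galois) fixed_pinsep:
  assumes "x \<in> \<Omega>" "\<forall>\<sigma>\<in>gal K \<Omega>. \<sigma> x = x"
  shows "\<exists>k. x ^ (pexp TYPE('a) ^ k) \<in> K"
proof -
  obtain f where "f \<in> pol K" "f \<noteq> 0" "poly f x = 0" using alg[OF assms(1)] by (auto simp: alg_over_def)
  then show ?thesis using assms
  proof (induction "degree f" arbitrary: f x rule: less_induct)
    case less
    note prems = less.prems
    have deg: "degree f > 0"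
    proof (rule ccontr)
      assume "\<not> degree f > 0"
      then obtain c where "f = [:c:]" using degree_eq_zeroE by blast
      then show False using prems by simp
    qed
    consider "poly (pderiv f) x \<noteq> 0" | "poly (pderiv f) x = 0" "pderiv f \<noteq> 0" | "pderiv f = 0" by blast
    then show ?case
    proof cases
      case 1
      then have "sep K x" using prems by (auto simp: sep_def)
      from desc_adj[OF prems(4) this] have "x \<in> K"
        unfolding desc_def using adj_self[OF Ks] prems(5) by blast
      then show ?thesis by (intro exI[of _ 0]) simp
    next
      case 2
      have "degree (pderiv f) < degree f"
      proof -
        have "degree (pderiv f) \<le> degree f - 1"
          by (rule degree_le) (auto simp: coeff_pderiv intro!: coeff_eq_0)
        then show ?thesis using deg by linarith
      qed
      from less.hyps[OF this pol_pderiv[OF Ks prems(1)] 2(2,1) prems(4,5)] show ?thesis .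
    next
      case 3
      define p where "p = CHAR('a)"
      have cf: "p dvd i" if "coeff f i \<noteq> 0" for i
      proof (cases i)
        case (Suc n)
        have "of_nat (Suc n) * coeff f (Suc n) = 0" using 3 by (metis coeff_0 coeff_pderiv)
        then have "of_nat i = (0::'a)" using that Suc by simp
        then show ?thesis by (simp add: of_nat_eq_0_iff_char_dvd p_def)
      qed simp
      have "p dvd degree f" using cf[of "degree f"] prems(2) by simp
      then have p0: "p \<noteq> 0" using deg by (intro notI) simp
      have p1: "p > 1" using p0 CHAR_not_1[where 'a='a] unfolding p_def by (metis One_nat_def less_one linorder_neqE_nat)
      define h where "h = (\<Sum>i\<le>degree f. monom (coeff f (p * i)) i)"
      have ch: "coeff h i = coeff f (p * i)" for i
      proof -
        have "coeff f (p * i) = 0" if "\<not> i \<le> degree f"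
          using that p1 by (intro coeff_eq_0) (metis mult.commute mult_le_mono1 nat_le_linear not_le less_le_trans nat_mult_1_right mult_le_mono2 less_imp_le)
        then show ?thesis unfolding h_def by (auto simp: coeff_sum)
      qed
      have hp: "h \<in> pol K" using prems(1) by (simp add: pol_def ch)
      obtain d where d: "degree f = p * d" using \<open>p dvd degree f\<close> by blast
      have "coeff h d \<noteq> 0" using ch d prems(2) by (metis leading_coeff_0_iff)
      then have h0: "h \<noteq> 0" by auto
      have hdeg: "degree h < degree f"
      proof -
        have "degree h \<le> d"
          by (rule degree_le) (use ch d p0 in \<open>auto intro!: coeff_eq_0\<close>)
        moreover have "d < degree f" using d p1 deg n_less_m_mult_n[of d p] by (cases "d = 0") auto
        ultimately show ?thesis by simp
      qed
      have "poly h (x ^ p) = (\<Sum>i\<le>degree f. coeff f (p * i) * x ^ (p * i))"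
        using hdeg by (simp add: poly_sum_le[of h "degree f"] ch power_mult)
      also have "\<dots> = (\<Sum>j\<in>(*) p ` {..degree f}. coeff f j * x ^ j)"
        using p0 by (subst sum.reindex) (auto simp: inj_on_def)
      also have "\<dots> = (\<Sum>j\<le>degree f. coeff f j * x ^ j)"
      proof (rule sum.mono_neutral_cong)
        show "coeff f j * x ^ j = 0" if "j \<in> {..degree f} - (*) p ` {..degree f}" for j
        proof -
          have "\<not> p dvd j"
          proof
            assume "p dvd j"
            then obtain i where "j = p * i" by blast
            have "i \<le> j" using \<open>j = p * i\<close> p0 by (cases p) auto
            also have "j \<le> degree f" using that by simp
            finally show False using that \<open>j = p * i\<close> by blast
          qed
          then show ?thesis using cf by auto
        qed
        show "coeff f j * x ^ j = 0" if "j \<in> (*) p ` {..degree f} - {..degree f}" for j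
          using that by (auto intro: coeff_eq_0)
      qed auto
      also have "\<dots> = 0" using prems(3) by (simp add: poly_altdef)
      finally have "poly h (x ^ p) = 0" .
      moreover have "x ^ p \<in> \<Omega>" by (rule sring_power[OF Os prems(4)])
      moreover have "\<forall>\<sigma>\<in>gal K \<Omega>. \<sigma> (x ^ p) = x ^ p" 
      proof
        fix \<sigma> assume \<sigma>: "\<sigma> \<in> gal K \<Omega>"
        show "\<sigma> (x ^ p) = x ^ p" unfolding gal_power[OF \<sigma> prems(4)] bspec[OF prems(5) \<sigma>] ..
      qed
      ultimately obtain k where "(x ^ p) ^ (pexp TYPE('a) ^ k) \<in> K"
        using less.hyps[OF hdeg hp h0] by blast
      moreover have "pexp TYPE('a) = p" using p0 by (simp add: pexp_def p_def)
      ultimately show ?thesis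
        by (intro exI[of _ "Suc k"]) (simp add: power_mult)
    qed
  qed
qed

section \<open>The maximal abelian extension\<close>

lemma Aut_overD:
  assumes "s \<in> Aut_over K F"
  shows "s \<in> extensional F" "s ` F = F" "inj_on s F" "\<And>x y. x \<in> F \<Longrightarrow> y \<in> F \<Longrightarrow> s (x + y) = s x + s y \<and> s (x * y) = s x * s y"
    "\<And>x. x \<in> K \<Longrightarrow> s x = x"
  using assms by (auto simp: Aut_over_def bij_betw_def)

locale absgal = galois K UNIV for K :: "'b::field set"
begin

abbreviation G :: "('b \<Rightarrow> 'b) set" where "G \<equiv> gal K UNIV"

lemmas gal_simps = gal_add[OF _ UNIV_I UNIV_I] gal_diff[OF _ UNIV_I UNIV_I] gal_times[OF _ UNIV_I UNIV_I]
  gal_divide[OF _ UNIV_I UNIV_I] gal_inverse[OF _ UNIV_I] gal_power[OF _ UNIV_I] gal_uminus[OF _ UNIV_I]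
  gal_sum[OF _ UNIV_I] gal_0 gal_1 gal_K gal_eq_0[OF _ UNIV_I]

text \<open>An intrinsic description of the maximal abelian extension: closure under field
  operations and automorphisms is immediate, and \<open>max_abelian_ext_eq\<close> identifies it
  with the union of the finite abelian extensions.\<close>

definition E :: "'b set" where
  "E = {x \<in> sepc. \<forall>\<sigma>\<in>G. \<forall>\<tau>\<in>G. \<sigma> (\<tau> x) = \<tau> (\<sigma> x)}"

lemma E_comm: "x \<in> E \<Longrightarrow> \<sigma> \<in> G \<Longrightarrow> \<tau> \<in> G \<Longrightarrow> \<sigma> (\<tau> x) = \<tau> (\<sigma> x)"
  by (simp add: E_def)

lemma E_sepc: "E \<subseteq> sepc"
  by (auto simp: E_def)

lemma E_subfield: "subfield E"
  by (intro subfieldI sringI)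
     (auto simp: E_def gal_simps sring_0[OF subfield_sring[OF sepc_subfield]] sring_1[OF subfield_sring[OF sepc_subfield]]
       sring_add[OF subfield_sring[OF sepc_subfield]] sring_diff[OF subfield_sring[OF sepc_subfield]]
       sring_mult[OF subfield_sring[OF sepc_subfield]] subfield_inverse[OF sepc_subfield])

lemmas Es = subfield_sring[OF E_subfield]

lemma K_E: "K \<subseteq> E"
  using K_sepc by (auto simp: E_def gal_K)

lemma stable_E: "stable E"
  unfolding stable_def
proof (intro ballI subsetI)
  fix \<rho> y assume \<rho>: "\<rho> \<in> G" and "y \<in> \<rho> ` E"
  then obtain x where x: "x \<in> E" "y = \<rho> x" by auto
  have "sep K y" using sep_gal[OF \<rho> UNIV_I] x by (auto simp: E_def sepc_def)
  moreover have "\<sigma> (\<tau> y) = \<tau> (\<sigma> y)" if "\<sigma> \<in> G" "\<tau> \<in> G" for \<sigma> \<tau>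
    using E_comm[OF x(1) that(1) gal_comp[OF that(2) \<rho>]] E_comm[OF x(1) \<rho> that(1)] x(2) by simp
  ultimately show "y \<in> E" by (simp add: E_def sepc_def)
qed

lemma fixed_K: "x \<in> sepc \<Longrightarrow> (\<And>\<sigma>. \<sigma> \<in> G \<Longrightarrow> \<sigma> x = x) \<Longrightarrow> x \<in> K"
  using desc_adj[of x] adj_self[OF Ks, of x] by (auto simp: desc_def sepc_def)

lemma gal_stable_image:
  assumes "stable F" "\<sigma> \<in> G"
  shows "\<sigma> ` F = F"
proof
  show "\<sigma> ` F \<subseteq> F" using assms by (simp add: stable_def)
  show "F \<subseteq> \<sigma> ` F"
  proof
    fix y assume "y \<in> F"
    then have "orb y \<subseteq> F" using stableD[OF assms(1)] by (auto simp: orb_def)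
    moreover have "y \<in> \<sigma> ` orb y" using orb_bij[OF UNIV_I assms(2), of y] orb_self by (auto simp: bij_betw_def)
    ultimately show "y \<in> \<sigma> ` F" by blast
  qed
qed

lemma restrict_Aut:
  assumes "subfield F" "K \<subseteq> F" "stable F" "\<sigma> \<in> G"
  shows "restrict \<sigma> F \<in> Aut_over K F"
proof -
  note R = subfield_sring[OF assms(1)]
  have "inj_on \<sigma> F" using gal_inj[OF assms(4)] inj_on_subset by blast
  then have "bij_betw (restrict \<sigma> F) F F"
    using gal_stable_image[OF assms(3,4)] by (auto simp: bij_betw_def inj_on_def)
  then show ?thesis
    unfolding Aut_over_def using assms(2)
    by (auto simp: sring_add[OF R] sring_mult[OF R] gal_simps[OF assms(4)])
qed

lemma Aut_lift:
  assumes "subfield F" "K \<subseteq> F" "s \<in> Aut_over K F"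
  shows "\<exists>\<sigma>\<in>G. \<forall>x\<in>F. \<sigma> x = s x"
proof -
  note s = Aut_overD[OF assms(3)]
  have "pfield (graph F s)"
    by (rule pfield_graph[OF subfield_sring[OF assms(1)]])
       (use s sring_1[OF Ks] subfield_inverse[OF assms(1)] in auto)
  moreover have "Id_on K \<subseteq> graph F s" using s assms(2) by auto
  ultimately obtain \<sigma> where "\<sigma> \<in> G" "\<forall>(x,y)\<in>graph F s. \<sigma> x = y" using extend[of "graph F s"] by auto
  then show ?thesis by (intro bexI[of _ \<sigma>]) (auto simp: graph_def)
qed

lemma E_hull:
  assumes "finite X" "X \<subseteq> E"
  obtains F where "subfield F" "K \<subseteq> F" "F \<subseteq> E" "X \<subseteq> F" "finite_degree K F" "desc UNIV K F" "stable F"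
    "finite_abelian_galois K F"
proof -
  obtain F where F: "subfield F" "K \<subseteq> F" "F \<subseteq> UNIV" "X \<subseteq> F" "finite_degree K F" "desc UNIV K F" "stable F"
    "\<And>F'. subfield F' \<Longrightarrow> K \<subseteq> F' \<Longrightarrow> stable F' \<Longrightarrow> X \<subseteq> F' \<Longrightarrow> F \<subseteq> F'"
    by (rule hull[OF assms(1)]) (use assms(2) in \<open>auto simp: E_def sepc_def\<close>)
  have FE: "F \<subseteq> E" by (rule F(8)[OF E_subfield K_E stable_E assms(2)])
  have "{x \<in> F. \<forall>\<sigma>\<in>Aut_over K F. \<sigma> x = x} \<subseteq> K"
  proof clarify
    fix x assume x: "x \<in> F" "\<forall>\<sigma>\<in>Aut_over K F. \<sigma> x = x"
    have "\<sigma> x = x" if "\<sigma> \<in> G" for \<sigma>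
      using bspec[OF x(2) restrict_Aut[OF F(1,2,7) that]] x(1) by simp
    then show "x \<in> K" using F(6) x(1) by (simp add: desc_def)
  qed
  then have fg: "finite_galois K F"
    unfolding finite_galois_def using F K by (auto simp: Aut_over_def)
  have "\<sigma> (\<tau> x) = \<tau> (\<sigma> x)" if h: "\<sigma> \<in> Aut_over K F" "\<tau> \<in> Aut_over K F" "x \<in> F" for \<sigma> \<tau> x
  proof -
    obtain \<sigma>' where \<sigma>': "\<sigma>' \<in> G" "\<forall>x\<in>F. \<sigma>' x = \<sigma> x" using Aut_lift[OF F(1,2) h(1)] by blast
    obtain \<tau>' where \<tau>': "\<tau>' \<in> G" "\<forall>x\<in>F. \<tau>' x = \<tau> x" using Aut_lift[OF F(1,2) h(2)] by blast
    have "\<sigma> x \<in> F" "\<tau> x \<in> F" using Aut_overD(2)[OF h(1)] Aut_overD(2)[OF h(2)] h(3) by blast+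
    then show ?thesis using \<sigma>' \<tau>' h(3) E_comm[of x \<sigma>' \<tau>'] FE by fastforce
  qed
  then have "finite_abelian_galois K F" using fg by (simp add: finite_abelian_galois_def)
  then show ?thesis using that[of F] F FE by blast
qed

text \<open>\<open>finite_abelian_galois\<close> knows only automorphisms of \<open>F\<close>, not
  those of the algebraic closure. The orbit polynomial of \<open>z\<close> under
  \<open>Aut_over K F\<close> has fixed coefficients, hence lies over \<open>K\<close>; so every
  automorphism of the closure sends \<open>z\<close> to one of its roots, all of which are in
  \<open>F\<close>. Thus \<open>F\<close> is stable, and restriction transfers
  commutativity.\<close>

lemma fag_subset_E:
  assumes "finite_abelian_galois K F"
  shows "F \<subseteq> E"
proof
  fix x assume x: "x \<in> F"
  have F: "subfield F" "K \<subseteq> F" and fixK: "{x \<in> F. \<forall>\<sigma>\<in>Aut_over K F. \<sigma> x = x} = K"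
    and ab: "\<And>\<sigma> \<tau> x. \<sigma> \<in> Aut_over K F \<Longrightarrow> \<tau> \<in> Aut_over K F \<Longrightarrow> x \<in> F \<Longrightarrow> \<sigma> (\<tau> x) = \<tau> (\<sigma> x)"
    using assms unfolding finite_abelian_galois_def finite_galois_def by blast+
  note R = subfield_sring[OF F(1)]
  define A where "A = Aut_over K F"
  define ob where "ob z = (\<lambda>s. s z) ` A" for z
  have obF: "ob z \<subseteq> F" if "z \<in> F" for z using Aut_overD(2) that by (fastforce simp: ob_def A_def)
  have obself: "z \<in> ob z" if "z \<in> F" for z
  proof -
    have "restrict id F \<in> A" using F(2) by (auto simp: A_def Aut_over_def bij_betw_def inj_on_def sring_add[OF R] sring_mult[OF R])
    then show ?thesis using that unfolding ob_def by (intro image_eqI[of _ _ "restrict id F"]) auto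
  qed
  have ob_orb: "ob z \<subseteq> orb z" if "z \<in> F" for z
  proof
    fix w assume "w \<in> ob z"
    then obtain s where s: "s \<in> A" "w = s z" by (auto simp: ob_def)
    obtain \<sigma> where "\<sigma> \<in> G" "\<forall>x\<in>F. \<sigma> x = s x" using Aut_lift[OF F, of s] s(1) by (auto simp: A_def)
    then have "w = \<sigma> z" and "\<sigma> \<in> G" using s that by simp_all
    then show "w \<in> orb z" by (auto simp: orb_def)
  qed
  have fin: "finite (ob z)" if "z \<in> F" for z using ob_orb[OF that] finite_orb[OF UNIV_I] finite_subset by blast
  have sob: "s w \<in> ob z" if h: "s \<in> A" "w \<in> ob z" "z \<in> F" for s w z
  proof -
    obtain t where t: "t \<in> A" "w = t z" using h(2) by (auto simp: ob_def)
    note S = Aut_overD[OF h(1)[unfolded A_def]] and T = Aut_overD[OF t(1)[unfolded A_def]]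
    have bs: "bij_betw s F F" and bt: "bij_betw t F F" using S T by (auto simp: bij_betw_def)
    have TF: "t x \<in> F" if "x \<in> F" for x using T(2) that by blast
    have "bij_betw (restrict (s \<circ> t) F) F F"
      using bij_betw_trans[OF bt bs] by (simp add: bij_betw_def inj_on_def)
    then have "restrict (s \<circ> t) F \<in> A"
      unfolding A_def Aut_over_def using S T F(2) TF
      by (auto simp: sring_add[OF R] sring_mult[OF R])
    then show ?thesis using t h(3) unfolding ob_def by (intro image_eqI[of _ _ "restrict (s \<circ> t) F"]) auto
  qed
  define P where "P z = (\<Prod>w\<in>ob z. [:-w,1:])" for z
  have PK: "P z \<in> pol K" if z: "z \<in> F" for z
  proof -
    have PF: "P z \<in> pol F" unfolding P_def using obF[OF z]
      by (auto intro!: sring_prod[OF sring_pol[OF R]] pol_linear[OF R])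
    have "s (coeff (P z) i) = coeff (P z) i" if s: "s \<in> A" for s i
    proof -
      note S = Aut_overD[OF s[unfolded A_def]]
      have pg: "pfield (graph F s)"
        by (rule pfield_graph[OF R]) (use S sring_1[OF Ks] subfield_inverse[OF F(1)] in auto)
      have "(P z, \<Prod>w\<in>ob z. [:-s w,1:]) \<in> ppol (graph F s)"
        unfolding P_def using obF[OF z]
        by (intro pring_prod[OF ppol_pring[OF pfield_pring[OF pg]]] ppol_linear[OF pfield_pring[OF pg]]) auto
      moreover have "bij_betw s (ob z) (ob z)"
      proof -
        have "inj_on s (ob z)" using S(3) obF[OF z] inj_on_subset by blast
        moreover have "s ` ob z \<subseteq> ob z" using sob[OF s _ z] by blast
        ultimately show ?thesis using endo_inj_surj[OF fin[OF z]] by (simp add: bij_betw_def)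
      qed
      from prod.reindex_bij_betw[OF this, of "\<lambda>w. [:-w,1:]"]
      have "(\<Prod>w\<in>ob z. [:-s w,1:]) = P z" by (simp add: P_def)
      ultimately show ?thesis by (simp add: ppol_def)
    qed
    then have "coeff (P z) i \<in> K" for i using fixK polD[OF PF] by (auto simp: A_def)
    then show ?thesis by (simp add: pol_def)
  qed
  have P0: "poly (P z) y = 0 \<longleftrightarrow> y \<in> ob z" if "z \<in> F" for z y
    using fin[OF that] by (auto simp: P_def poly_prod)
  have st: "stable F"
    unfolding stable_def
  proof (intro ballI subsetI)
    fix \<sigma> y assume \<sigma>: "\<sigma> \<in> G" and "y \<in> \<sigma> ` F"
    then obtain z where z: "z \<in> F" "y = \<sigma> z" by auto
    have "poly (P z) y = \<sigma> (poly (P z) z)" using gal_poly[OF \<sigma> PK[OF z(1)]] z by simp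
    moreover have "poly (P z) z = 0" unfolding P0[OF z(1)] by (rule obself[OF z(1)])
    ultimately have "poly (P z) y = 0" using gal_0[OF \<sigma>] by simp
    then show "y \<in> F" unfolding P0[OF z(1)] using obF[OF z(1)] by blast
  qed
  have "desc UNIV K F"
    unfolding desc_def
  proof (intro ballI impI)
    fix z assume z: "z \<in> F" "\<forall>\<sigma>\<in>G. \<sigma> z = z"
    have "s z = z" if "s \<in> Aut_over K F" for s using Aut_lift[OF F that] z by force
    then show "z \<in> K" using fixK z(1) by blast
  qed
  then have "F \<subseteq> sepc" using hull_sepc[OF F subset_UNIV st] by blast
  moreover have "\<sigma> (\<tau> x) = \<tau> (\<sigma> x)" if "\<sigma> \<in> G" "\<tau> \<in> G" for \<sigma> \<tau>
    using ab[OF restrict_Aut[OF F st that(1)] restrict_Aut[OF F st that(2)] x] x stableD[OF st] that by simp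
  ultimately show "x \<in> E" using x by (auto simp: E_def)
qed

lemma max_abelian_ext_eq: "max_abelian_ext K = E"
proof
  show "max_abelian_ext K \<subseteq> E" using fag_subset_E by (auto simp: max_abelian_ext_def)
  show "E \<subseteq> max_abelian_ext K"
  proof
    fix x assume "x \<in> E"
    then have "{x} \<subseteq> E" by simp
    from E_hull[OF _ this] obtain F where "finite_abelian_galois K F" "{x} \<subseteq> F" by (metis finite.emptyI finite_insert)
    then show "x \<in> max_abelian_ext K" by (auto simp: max_abelian_ext_def)
  qed
qed

text \<open>Characters live on \<open>G\<close>, so an automorphism of \<open>E\<close> is evaluated
  on a chosen extension; characters depend on elements of \<open>E\<close> only and do not see the
  choice.\<close>

definition lift :: "('b \<Rightarrow> 'b) \<Rightarrow> 'b \<Rightarrow> 'b" where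
  "lift s = (SOME \<sigma>. \<sigma> \<in> G \<and> (\<forall>x\<in>E. \<sigma> x = s x))"

lemma lift:
  assumes "s \<in> Aut_over K E"
  shows "lift s \<in> G" "x \<in> E \<Longrightarrow> lift s x = s x"
proof -
  have "\<exists>\<sigma>. \<sigma> \<in> G \<and> (\<forall>x\<in>E. \<sigma> x = s x)" using Aut_lift[OF E_subfield K_E assms] by blast
  from someI_ex[OF this] show "lift s \<in> G" "x \<in> E \<Longrightarrow> lift s x = s x" unfolding lift_def by auto
qed

lemma restrict_E: "\<sigma> \<in> G \<Longrightarrow> restrict \<sigma> E \<in> Aut_over K E"
  by (rule restrict_Aut[OF E_subfield K_E stable_E])

lemma gal_mult_Aut:
  assumes "s \<in> Aut_over K E" "t \<in> Aut_over K E"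
  shows "gal_mult E s t = restrict (lift s \<circ> lift t) E" "gal_mult E s t \<in> Aut_over K E"
proof -
  have tE: "t x \<in> E" if "x \<in> E" for x using Aut_overD(2)[OF assms(2)] that by blast
  show "gal_mult E s t = restrict (lift s \<circ> lift t) E"
    unfolding gal_mult_def by (rule restrict_ext) (simp add: lift(2)[OF assms(1)] lift(2)[OF assms(2)] tE)
  then show "gal_mult E s t \<in> Aut_over K E"
    using restrict_E[OF gal_comp[OF lift(1)[OF assms(1)] lift(1)[OF assms(2)]]] by simp
qed

lemma topspace_krull: "topspace (krull_topology K E) = Aut_over K E"
proof -
  have "Aut_over K E \<subseteq> PiE E (\<lambda>_. E)" 
  proof
    fix s assume "s \<in> Aut_over K E"
    from Aut_overD(1,2)[OF this] show "s \<in> PiE E (\<lambda>_. E)" by (auto simp: PiE_def)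
  qed
  then show ?thesis by (auto simp: krull_topology_def)
qed

text \<open>The group is a closed subset of the product of the orbits, which are finite. Additivity
  and multiplicativity are conditions on three coordinates each, and bijectivity comes for free, as
  an injective map sending each finite orbit into itself permutes it.\<close>

lemma compact_krull: "compact_space (krull_topology K E)"
proof -
  define T where "T = product_topology (\<lambda>_::'b. discrete_topology E) E"
  have orbE: "orb x \<subseteq> E" if "x \<in> E" for x using that stableD[OF stable_E] by (auto simp: orb_def)
  have cp: "compactin T (PiE E orb)"
    unfolding T_def compactin_PiE using orbE finite_orb[OF UNIV_I] by (auto simp: compactin_discrete_topology)
  have proj: "continuous_map T (discrete_topology E) (\<lambda>f. f x)" if "x \<in> E" for x
    unfolding T_def using continuous_map_product_projection[OF that, of "\<lambda>_. discrete_topology E"] by simp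
  \<comment> \<open>Any condition on three coordinates cuts out a closed set, because a finite
    product of discrete spaces is discrete.\<close>
  have clo: "closedin T {f \<in> topspace T. Q (f x) (f y) (f z)}" if h: "x \<in> E" "y \<in> E" "z \<in> E" for Q :: "'b \<Rightarrow> 'b \<Rightarrow> 'b \<Rightarrow> bool" and x y z
  proof -
    have "continuous_map T (prod_topology (discrete_topology E) (prod_topology (discrete_topology E) (discrete_topology E)))
            (\<lambda>f. (f x, f y, f z))"
      by (intro continuous_map_pairedI proj h)
    then have c: "continuous_map T (discrete_topology (E \<times> E \<times> E)) (\<lambda>f. (f x, f y, f z))"
      by (simp add: prod_topology_discrete_topology)
    have "closedin T {f \<in> topspace T. (f x, f y, f z) \<in> {(a,b,c). (a,b,c) \<in> E \<times> E \<times> E \<and> Q a b c}}"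
      by (rule closedin_continuous_map_preimage[OF c]) auto
    also have "{f \<in> topspace T. (f x, f y, f z) \<in> {(a,b,c). (a,b,c) \<in> E \<times> E \<times> E \<and> Q a b c}} = {f \<in> topspace T. Q (f x) (f y) (f z)}"
      using h by (auto simp: T_def)
    finally show ?thesis .
  qed
  define B where "B = (\<Inter>p\<in>E \<times> E. {f \<in> topspace T. f (fst p + snd p) = f (fst p) + f (snd p)} \<inter>
      {f \<in> topspace T. f (fst p * snd p) = f (fst p) * f (snd p)})"
  have "closedin T B"
    unfolding B_def
  proof (intro closedin_Inter)
    show "(\<lambda>p. {f \<in> topspace T. f (fst p + snd p) = f (fst p) + f (snd p)} \<inter>
      {f \<in> topspace T. f (fst p * snd p) = f (fst p) * f (snd p)}) ` (E \<times> E) \<noteq> {}"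
      using sring_0[OF Es] by auto
    fix S assume "S \<in> (\<lambda>p. {f \<in> topspace T. f (fst p + snd p) = f (fst p) + f (snd p)} \<inter>
      {f \<in> topspace T. f (fst p * snd p) = f (fst p) * f (snd p)}) ` (E \<times> E)"
    then obtain a b where ab: "a \<in> E" "b \<in> E" "S = {f \<in> topspace T. f (a + b) = f a + f b} \<inter> {f \<in> topspace T. f (a * b) = f a * f b}"
      by auto
    show "closedin T S" unfolding ab(3)
      using clo[of "a + b" a b "\<lambda>u v w. u = v + w"] clo[of "a * b" a b "\<lambda>u v w. u = v * w"] ab(1,2)
        sring_add[OF Es ab(1,2)] sring_mult[OF Es ab(1,2)] by (intro closedin_Int) auto
  qed
  from closed_Int_compactin[OF this cp] have "compactin T (B \<inter> PiE E orb)" .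
  also have "B \<inter> PiE E orb = Aut_over K E"
  proof (intro equalityI subsetI)
    fix f assume f: "f \<in> B \<inter> PiE E orb"
    have hom: "f (x + y) = f x + f y \<and> f (x * y) = f x * f y" if "x \<in> E" "y \<in> E" for x y
      using f that unfolding B_def by fastforce
    have fo: "f x \<in> orb x" if "x \<in> E" for x using f that by auto
    have fK: "f x = x" if x: "x \<in> K" for x
    proof -
      have "f x \<in> orb x" using fo x K_E by blast
      then show ?thesis using gal_K[OF _ x] by (auto simp: orb_def)
    qed
    have pg: "pfield (graph E f)"
      by (rule pfield_graph[OF Es]) (use hom fK sring_1[OF Ks] subfield_inverse[OF E_subfield] in auto)
    have inj: "inj_on f E"
    proof (rule inj_onI)
      fix x y assume h: "x \<in> E" "y \<in> E" "f x = f y"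
      have "(x - y, 0) \<in> graph E f" using pring_diff[OF pfield_pring[OF pg], of x "f x" y "f y"] h by simp
      from pfield_inj[OF pg this] show "x = y" by simp
    qed
    have "f ` E = E"
    proof
      show "f ` E \<subseteq> E" using fo orbE by blast
      show "E \<subseteq> f ` E"
      proof
        fix y assume y: "y \<in> E"
        have "f ` orb y \<subseteq> orb y"
        proof
          fix w assume "w \<in> f ` orb y"
          then obtain z where z: "z \<in> orb y" "w = f z" by auto
          then have "w \<in> orb z" using fo orbE[OF y] by blast
          then show "w \<in> orb y" using gal_orb z by (auto simp: orb_def[of z])
        qed
        moreover have "inj_on f (orb y)" using inj orbE[OF y] inj_on_subset by blast
        ultimately have "f ` orb y = orb y" using endo_inj_surj[OF finite_orb[OF UNIV_I]] by blast
        then show "y \<in> f ` E" using orb_self[of y] orbE[OF y] by blast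
      qed
    qed
    then show "f \<in> Aut_over K E" unfolding Aut_over_def using f hom fK inj by (auto simp: bij_betw_def PiE_def)
  next
    fix s assume s: "s \<in> Aut_over K E"
    have "s x \<in> orb x" if "x \<in> E" for x
      unfolding orb_def using lift[OF s] that by (intro image_eqI[of _ _ "lift s"]) auto
    moreover have "s \<in> topspace T" using s topspace_krull by (auto simp: krull_topology_def T_def)
    ultimately show "s \<in> B \<inter> PiE E orb" using Aut_overD[OF s] by (auto simp: B_def PiE_def)
  qed
  finally show ?thesis
    unfolding krull_topology_def T_def by (rule compact_space_subtopology)
qed

end

section \<open>Kummer and Artin-Schreier theory\<close>

lemma all_roots_in:
  fixes f :: "'a::field poly"
  assumes "f \<noteq> 0" "\<And>x. x \<in> S \<Longrightarrow> poly f x = 0" "card S = degree f" "finite S" "poly f w = 0"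
  shows "w \<in> S"
proof -
  have "S \<subseteq> {x. poly f x = 0}" using assms by auto
  moreover have "card {x. poly f x = 0} \<le> card S" using card_poly_roots_bound[OF assms(1)] assms(3) by simp
  ultimately have "S = {x. poly f x = 0}" using card_seteq[OF poly_roots_finite[OF assms(1)]] by blast
  then show ?thesis using assms by auto
qed

text \<open>Primitivity in terms of integer exponents, because characters take integer values:
  powers of \<open>z\<close> then encode residues modulo \<open>n\<close> faithfully.\<close>

definition prim :: "nat \<Rightarrow> 'a::field \<Rightarrow> bool" where
  "prim n z \<longleftrightarrow> z \<noteq> 0 \<and> (\<forall>k::int. z powi k = 1 \<longleftrightarrow> int n dvd k)"

lemma prim_eq_iff: "prim n z \<Longrightarrow> z powi a = z powi b \<longleftrightarrow> [a = b] (mod int n)"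
proof -
  assume p: "prim n z"
  have "z powi a = z powi b \<longleftrightarrow> z powi (a - b) = 1" using p by (simp add: prim_def power_int_diff)
  also have "\<dots> \<longleftrightarrow> int n dvd a - b" using p unfolding prim_def by blast
  finally show ?thesis by (simp add: cong_iff_dvd_diff)
qed

lemma prim_power: "prim n z \<Longrightarrow> z ^ n = 1"
  unfolding prim_def by (metis dvd_refl power_int_of_nat)

lemma prim_root:
  assumes "prim n z" "n > 0" "w ^ n = 1"
  shows "\<exists>k. w = z powi k"
proof -
  define S where "S = (\<lambda>i. z ^ i) ` {..<n}"
  have "inj_on (\<lambda>i. z ^ i) {..<n}"
  proof (rule inj_onI)
    fix i j assume h: "i \<in> {..<n}" "j \<in> {..<n}" "z ^ i = z ^ j"
    then have "[int i = int j] (mod int n)"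
      using prim_eq_iff[OF assms(1), of "int i" "int j"] by simp
    then show "i = j" using h by (simp add: cong_def)
  qed
  then have cS: "card S = n" by (simp add: S_def card_image)
  define f :: "'a poly" where "f = monom 1 n - 1"
  have df: "degree f = n"
    unfolding f_def using assms(2) degree_add_eq_left[of "-1" "monom (1::'a) n"] by (simp add: degree_monom_eq)
  have "w \<in> S"
  proof (rule all_roots_in[of f])
    show "f \<noteq> 0" using df assms(2) by auto
    show "poly f x = 0" if "x \<in> S" for x
      using that prim_power[OF assms(1)] by (auto simp: S_def f_def poly_monom power_mult[symmetric] mult.commute[of _ n] power_mult)
    show "card S = degree f" "finite S" using cS df by (auto simp: S_def)
    show "poly f w = 0" using assms(3) by (simp add: f_def poly_monom)
  qed
  then show ?thesis unfolding S_def by (metis imageE power_int_of_nat)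
qed

text \<open>The polynomial \<open>X^p - X\<close> already has the \<open>p\<close> elements of the
  prime field as roots, and its degree leaves room for no others.\<close>

lemma frobenius_fixed:
  fixes t :: "'a::field"
  assumes "CHAR('a) > 0" "t ^ CHAR('a) = t"
  shows "\<exists>k::int. t = of_int k"
proof -
  define p where "p = CHAR('a)"
  have pr: "prime p" using prime_CHAR_semidom assms(1) by (simp add: p_def)
  then have p1: "p > 1" by (rule prime_gt_1_nat)
  define S where "S = (of_nat ` {..<p} :: 'a set)"
  have "inj_on (of_nat :: nat \<Rightarrow> 'a) {..<p}"
    by (rule inj_onI) (auto simp: of_nat_eq_iff_cong_CHAR p_def cong_def)
  then have cS: "card S = p" by (simp add: S_def card_image)
  define f :: "'a poly" where "f = monom 1 p - [:0,1:]"
  have "degree ([:0,1:] :: 'a poly) < degree (monom (1::'a) p)" using p1 by (simp add: degree_monom_eq)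
  then have df: "degree f = p"
    unfolding f_def using degree_add_eq_left[of "- [:0,1:]" "monom (1::'a) p"]
    by (simp only: diff_conv_add_uminus degree_minus degree_monom_eq one_neq_zero not_False_eq_True)
  have fr: "(of_nat n :: 'a) ^ p = of_nat n" for n
  proof (induction n)
    case (Suc n)
    then show ?case using freshmans_dream[of p "1::'a" "of_nat n"] pr by (simp add: p_def)
  qed (use p1 in simp)
  have "t \<in> S"
  proof (rule all_roots_in[of f])
    show "f \<noteq> 0" using df p1 by auto
    show "poly f x = 0" if "x \<in> S" for x
      using that by (auto simp: S_def f_def poly_monom fr)
    show "card S = degree f" "finite S" using cS df by (auto simp: S_def)
    show "poly f t = 0" using assms(2) by (simp add: f_def poly_monom p_def)
  qed
  then show ?thesis unfolding S_def by (metis imageE of_int_of_nat_eq)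
qed

lemma frobenius_of_int:
  assumes "CHAR('a::field) > 0"
  shows "(of_int k :: 'a) ^ CHAR('a) = of_int k"
proof -
  have pr: "prime CHAR('a)" by (rule prime_CHAR_semidom[OF assms])
  have fr: "(of_nat n :: 'a) ^ CHAR('a) = of_nat n" for n
  proof (induction n)
    case (Suc n)
    then show ?case using freshmans_dream[of "CHAR('a)" "1::'a" "of_nat n"] pr by simp
  qed (use assms in simp)
  have "[k = int (nat (k mod int CHAR('a)))] (mod int CHAR('a))"
    using assms by (simp add: cong_def)
  then have "(of_int k :: 'a) = of_int (int (nat (k mod int CHAR('a))))"
    by (simp only: of_int_eq_iff_cong_CHAR)
  then show ?thesis using fr by (simp only: of_int_of_nat_eq)
qed

text \<open>Dedekind's elimination: the relation at \<open>x * y\<close> minus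
  \<open>\<delta> y\<close> times the relation at \<open>x\<close> no longer involves \<delta>, and
  a \<open>y\<close> with \<open>\<gamma>0 y \<noteq> \<delta> y\<close> keeps the coefficient of
  \<open>\<gamma>0\<close> visible. The maps are total functions, so their distinctness is required
  on \<open>F\<close> itself.\<close>

lemma dedekind:
  fixes \<Gamma> :: "('a::field \<Rightarrow> 'a) set"
  assumes "finite \<Gamma>" "1 \<in> F" "\<And>x y. x \<in> F \<Longrightarrow> y \<in> F \<Longrightarrow> x * y \<in> F"
    and "\<And>\<gamma>. \<gamma> \<in> \<Gamma> \<Longrightarrow> \<gamma> 1 = 1" "\<And>\<gamma> x y. \<gamma> \<in> \<Gamma> \<Longrightarrow> x \<in> F \<Longrightarrow> y \<in> F \<Longrightarrow> \<gamma> (x * y) = \<gamma> x * \<gamma> y"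
    and "\<And>\<gamma> \<delta>. \<gamma> \<in> \<Gamma> \<Longrightarrow> \<delta> \<in> \<Gamma> \<Longrightarrow> (\<forall>x\<in>F. \<gamma> x = \<delta> x) \<Longrightarrow> \<gamma> = \<delta>"
    and "\<And>x. x \<in> F \<Longrightarrow> (\<Sum>\<gamma>\<in>\<Gamma>. a \<gamma> * \<gamma> x) = 0" "\<gamma> \<in> \<Gamma>"
  shows "a \<gamma> = 0"
  using assms(1,4-8)
proof (induction \<Gamma> arbitrary: a \<gamma> rule: finite_induct)
  case (insert \<delta> \<Gamma>)
  have Z: "a \<gamma>0 = 0" if g0: "\<gamma>0 \<in> \<Gamma>" for \<gamma>0
  proof -
    have "\<gamma>0 \<noteq> \<delta>" using g0 insert.hyps by auto
    then obtain y where y: "y \<in> F" "\<gamma>0 y \<noteq> \<delta> y" using insert.prems(3)[of \<gamma>0 \<delta>] g0 by auto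
    define b where "b \<gamma> = a \<gamma> * (\<gamma> y - \<delta> y)" for \<gamma>
    have "b \<gamma>0 = 0"
    proof (rule insert.IH[OF _ _ _ _ g0])
      fix x assume x: "x \<in> F"
      have e1: "a \<delta> * \<delta> (x * y) + (\<Sum>\<gamma>\<in>\<Gamma>. a \<gamma> * \<gamma> (x * y)) = 0"
        using insert.prems(4)[OF assms(3)[OF x y(1)]] insert.hyps by simp
      have e2: "a \<delta> * \<delta> x + (\<Sum>\<gamma>\<in>\<Gamma>. a \<gamma> * \<gamma> x) = 0"
        using insert.prems(4)[OF x] insert.hyps by simp
      have "(\<Sum>\<gamma>\<in>\<Gamma>. b \<gamma> * \<gamma> x) = (\<Sum>\<gamma>\<in>\<Gamma>. a \<gamma> * \<gamma> (x * y)) - (\<Sum>\<gamma>\<in>\<Gamma>. a \<gamma> * \<gamma> x) * \<delta> y"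
        unfolding sum_distrib_right sum_subtractf[symmetric] b_def
        by (rule sum.cong) (use insert.prems(2) x y in \<open>auto simp: algebra_simps\<close>)
      also have "\<dots> = - (a \<delta> * \<delta> (x * y)) + (a \<delta> * \<delta> x) * \<delta> y"
      proof -
        have "(\<Sum>\<gamma>\<in>\<Gamma>. a \<gamma> * \<gamma> (x * y)) = - (a \<delta> * \<delta> (x * y))" using e1 by (simp add: add_eq_0_iff)
        moreover have "(\<Sum>\<gamma>\<in>\<Gamma>. a \<gamma> * \<gamma> x) = - (a \<delta> * \<delta> x)" using e2 by (simp add: add_eq_0_iff)
        ultimately show ?thesis by simp
      qed
      also have "\<dots> = 0" using insert.prems(2)[of \<delta> x y] x y by simp
      finally show "(\<Sum>\<gamma>\<in>\<Gamma>. b \<gamma> * \<gamma> x) = 0" .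
    qed (use insert.prems in auto)
    then show ?thesis using y by (simp add: b_def)
  qed
  have "a \<delta> * \<delta> 1 + (\<Sum>\<gamma>\<in>\<Gamma>. a \<gamma> * \<gamma> 1) = 0"
    using insert.prems(4)[OF assms(2)] insert.hyps by simp
  then have "a \<delta> = 0" using Z insert.prems(1)[of \<delta>] by simp
  then show ?case using Z insert.prems(5) by auto
qed simp

section \<open>Continuous characters and sums over finite quotients\<close>

context absgal begin

text \<open>A continuous homomorphism to the integers modulo \<open>n\<close>, represented by any
  integer-valued lift: only the residues are constrained. Dependence on finitely many elements of
  \<open>E\<close> expresses continuity and triviality on the automorphisms that fix
  \<open>E\<close>.\<close>

definition chr :: "nat \<Rightarrow> (('b \<Rightarrow> 'b) \<Rightarrow> int) \<Rightarrow> bool" where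
  "chr n \<psi> \<longleftrightarrow> (\<forall>\<sigma>\<in>G. \<forall>\<tau>\<in>G. [\<psi> (\<sigma> \<circ> \<tau>) = \<psi> \<sigma> + \<psi> \<tau>] (mod int n)) \<and>
     (\<exists>X. finite X \<and> X \<subseteq> E \<and> (\<forall>\<sigma>\<in>G. \<forall>\<tau>\<in>G. (\<forall>x\<in>X. \<sigma> x = \<tau> x) \<longrightarrow> [\<psi> \<sigma> = \<psi> \<tau>] (mod int n)))"

lemma chr_hom: "chr n \<psi> \<Longrightarrow> \<sigma> \<in> G \<Longrightarrow> \<tau> \<in> G \<Longrightarrow> [\<psi> (\<sigma> \<circ> \<tau>) = \<psi> \<sigma> + \<psi> \<tau>] (mod int n)"
  by (simp add: chr_def)

text \<open>A transversal: one representative in \<open>G\<close> for every restriction to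
  \<open>F\<close>, with \<open>r\<close> selecting it. Sums over the finite group of
  \<open>F\<close> over \<open>K\<close> thus become sums over elements of \<open>G\<close>.\<close>

definition trv :: "'b set \<Rightarrow> ('b \<Rightarrow> 'b) set \<Rightarrow> (('b \<Rightarrow> 'b) \<Rightarrow> ('b \<Rightarrow> 'b)) \<Rightarrow> bool" where
  "trv F \<Gamma> r \<longleftrightarrow> finite \<Gamma> \<and> \<Gamma> \<subseteq> G \<and> (\<forall>\<sigma>\<in>G. r \<sigma> \<in> \<Gamma> \<and> (\<forall>x\<in>F. r \<sigma> x = \<sigma> x)) \<and>
     (\<forall>\<sigma>\<in>G. \<forall>\<tau>\<in>G. (\<forall>x\<in>F. \<sigma> x = \<tau> x) \<longrightarrow> r \<sigma> = r \<tau>) \<and> (\<forall>\<gamma>\<in>\<Gamma>. r \<gamma> = \<gamma>)"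

lemma finite_determined:
  assumes "finite_degree K F"
  obtains B where "finite B" "B \<subseteq> F" "\<And>\<sigma> \<tau>. \<sigma> \<in> G \<Longrightarrow> \<tau> \<in> G \<Longrightarrow> (\<forall>x\<in>B. \<sigma> x = \<tau> x) \<Longrightarrow> \<forall>x\<in>F. \<sigma> x = \<tau> x"
proof -
  obtain B where B: "finite B" "B \<subseteq> F" "F = {(\<Sum>b\<in>B. c b * b) |c. \<forall>b\<in>B. c b \<in> K}"
    using assms by (auto simp: finite_degree_def)
  have "\<forall>x\<in>F. \<sigma> x = \<tau> x" if h: "\<sigma> \<in> G" "\<tau> \<in> G" "\<forall>x\<in>B. \<sigma> x = \<tau> x" for \<sigma> \<tau>
  proof
    fix x assume "x \<in> F"
    then obtain c where c: "\<forall>b\<in>B. c b \<in> K" "x = (\<Sum>b\<in>B. c b * b)" using B(3) by auto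
    show "\<sigma> x = \<tau> x"
      unfolding c(2) using h c(1) by (auto simp: gal_simps intro!: sum.cong)
  qed
  then show ?thesis using that B by blast
qed

lemma ex_trv:
  assumes "finite_degree K F"
  obtains \<Gamma> r where "trv F \<Gamma> r"
proof -
  obtain B where B: "finite B" "B \<subseteq> F" "\<And>\<sigma> \<tau>. \<sigma> \<in> G \<Longrightarrow> \<tau> \<in> G \<Longrightarrow> (\<forall>x\<in>B. \<sigma> x = \<tau> x) \<Longrightarrow> \<forall>x\<in>F. \<sigma> x = \<tau> x"
    using finite_determined[OF assms] by blast
  define r where "r \<sigma> = (SOME \<tau>. \<tau> \<in> G \<and> (\<forall>x\<in>F. \<tau> x = \<sigma> x))" for \<sigma> :: "'b \<Rightarrow> 'b"
  have r: "r \<sigma> \<in> G" "\<And>x. x \<in> F \<Longrightarrow> r \<sigma> x = \<sigma> x" if "\<sigma> \<in> G" for \<sigma>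
    using someI[of "\<lambda>\<tau>. \<tau> \<in> G \<and> (\<forall>x\<in>F. \<tau> x = \<sigma> x)" \<sigma>] that unfolding r_def by auto
  have req: "r \<sigma> = r \<tau>" if "\<forall>x\<in>F. \<sigma> x = \<tau> x" for \<sigma> \<tau>
  proof -
    have "(\<lambda>\<rho>. \<rho> \<in> G \<and> (\<forall>x\<in>F. \<rho> x = \<sigma> x)) = (\<lambda>\<rho>. \<rho> \<in> G \<and> (\<forall>x\<in>F. \<rho> x = \<tau> x))" using that by auto
    then show ?thesis by (simp add: r_def)
  qed
  have rr: "r \<gamma> = \<gamma>" if "\<gamma> \<in> r ` G" for \<gamma>
  proof -
    obtain \<sigma> where "\<sigma> \<in> G" "\<gamma> = r \<sigma>" using \<open>\<gamma> \<in> r ` G\<close> by auto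
    then show ?thesis using req[of "r \<sigma>" \<sigma>] r(2)[of \<sigma>] by metis
  qed
  have rG: "r ` G \<subseteq> G" using r by auto
  \<comment> \<open>The values on the finite spanning set \<open>B\<close> determine a
    representative, and each value lies in a finite orbit; so there are only finitely many
    representatives.\<close>
  have "inj_on (\<lambda>\<gamma>. restrict \<gamma> B) (r ` G)"
  proof (rule inj_onI)
    fix \<gamma> \<delta> assume h: "\<gamma> \<in> r ` G" "\<delta> \<in> r ` G" "restrict \<gamma> B = restrict \<delta> B"
    have "\<forall>x\<in>B. \<gamma> x = \<delta> x" using h(3) by (metis restrict_apply')
    then have "\<forall>x\<in>F. \<gamma> x = \<delta> x" using B(3) h rG by blast
    from req[OF this] show "\<gamma> = \<delta>" unfolding rr[OF h(1)] rr[OF h(2)] .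
  qed
  moreover have "(\<lambda>\<gamma>. restrict \<gamma> B) ` (r ` G) \<subseteq> PiE B orb"
    using rG by (auto simp: orb_def)
  moreover have "finite (PiE B orb)" using finite_PiE[OF B(1)] finite_orb[OF UNIV_I] by blast
  ultimately have "finite (r ` G)" using finite_imageD finite_subset by blast
  then have "trv F (r ` G) r"
    unfolding trv_def
  proof (intro conjI ballI impI)
    show "r ` G \<subseteq> G" by (rule rG)
    show "r \<sigma> \<in> r ` G" if "\<sigma> \<in> G" for \<sigma> using that by (rule imageI)
    show "r \<sigma> x = \<sigma> x" if "\<sigma> \<in> G" "x \<in> F" for \<sigma> x by (rule r(2)[OF that])
    show "r \<sigma> = r \<tau>" if "\<forall>x\<in>F. \<sigma> x = \<tau> x" for \<sigma> \<tau> by (rule req[OF that])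
    show "r \<gamma> = \<gamma>" if "\<gamma> \<in> r ` G" for \<gamma> by (rule rr[OF that])
  qed
  then show ?thesis using that by blast
qed

text \<open>Left translation by \<rho> permutes the restrictions to \<open>F\<close>, hence, after
  applying \<open>r\<close>, the transversal.\<close>

lemma trv_shift:
  assumes t: "trv F \<Gamma> r" and f: "\<And>\<sigma> \<tau>. \<sigma> \<in> G \<Longrightarrow> \<tau> \<in> G \<Longrightarrow> (\<forall>x\<in>F. \<sigma> x = \<tau> x) \<Longrightarrow> f \<sigma> = f \<tau>" and \<rho>: "\<rho> \<in> G"
  shows "(\<Sum>\<gamma>\<in>\<Gamma>. f (\<rho> \<circ> \<gamma>)) = (\<Sum>\<gamma>\<in>\<Gamma>. f \<gamma>)"
proof -
  have T: "finite \<Gamma>" "\<Gamma> \<subseteq> G" "\<And>\<sigma>. \<sigma> \<in> G \<Longrightarrow> r \<sigma> \<in> \<Gamma>" "\<And>\<sigma> x. \<sigma> \<in> G \<Longrightarrow> x \<in> F \<Longrightarrow> r \<sigma> x = \<sigma> x"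
    "\<And>\<sigma> \<tau>. \<sigma> \<in> G \<Longrightarrow> \<tau> \<in> G \<Longrightarrow> (\<forall>x\<in>F. \<sigma> x = \<tau> x) \<Longrightarrow> r \<sigma> = r \<tau>" "\<And>\<gamma>. \<gamma> \<in> \<Gamma> \<Longrightarrow> r \<gamma> = \<gamma>"
    using t unfolding trv_def by blast+
  have c: "\<rho> \<circ> \<gamma> \<in> G" if "\<gamma> \<in> \<Gamma>" for \<gamma> using gal_comp[OF \<rho>] T(2) that by blast
  have "inj_on (\<lambda>\<gamma>. r (\<rho> \<circ> \<gamma>)) \<Gamma>"
  proof (rule inj_onI)
    fix \<gamma> \<delta> assume h: "\<gamma> \<in> \<Gamma>" "\<delta> \<in> \<Gamma>" "r (\<rho> \<circ> \<gamma>) = r (\<rho> \<circ> \<delta>)"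
    have "\<gamma> x = \<delta> x" if "x \<in> F" for x
    proof -
      have "\<rho> (\<gamma> x) = \<rho> (\<delta> x)" using T(4)[OF c[OF h(1)] that] T(4)[OF c[OF h(2)] that] h(3) by simp
      then show ?thesis using gal_inj[OF \<rho>] by (simp add: inj_on_def)
    qed
    then have "r \<gamma> = r \<delta>" using T(2,5) h by blast
    then show "\<gamma> = \<delta>" using T(6) h by simp
  qed
  moreover have "(\<lambda>\<gamma>. r (\<rho> \<circ> \<gamma>)) ` \<Gamma> \<subseteq> \<Gamma>" using T(3) c by blast
  ultimately have "bij_betw (\<lambda>\<gamma>. r (\<rho> \<circ> \<gamma>)) \<Gamma> \<Gamma>"
    using endo_inj_surj[OF T(1)] by (simp add: bij_betw_def)
  from sum.reindex_bij_betw[OF this, of f] have "(\<Sum>\<gamma>\<in>\<Gamma>. f (r (\<rho> \<circ> \<gamma>))) = (\<Sum>\<gamma>\<in>\<Gamma>. f \<gamma>)" .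
  moreover have "f (r (\<rho> \<circ> \<gamma>)) = f (\<rho> \<circ> \<gamma>)" if "\<gamma> \<in> \<Gamma>" for \<gamma>
    by (rule f) (use T c[OF that] in blast)+
  ultimately show ?thesis by simp
qed

lemma trv_nonzero:
  assumes t: "trv F \<Gamma> r" and F: "subfield F" and a: "\<gamma> \<in> \<Gamma>" "a \<gamma> \<noteq> 0"
  shows "\<exists>\<theta>\<in>F. (\<Sum>\<gamma>\<in>\<Gamma>. a \<gamma> * \<gamma> \<theta>) \<noteq> 0"
proof (rule ccontr)
  assume n: "\<not> ?thesis"
  have T: "finite \<Gamma>" "\<Gamma> \<subseteq> G" "\<And>\<sigma> \<tau>. \<sigma> \<in> G \<Longrightarrow> \<tau> \<in> G \<Longrightarrow> (\<forall>x\<in>F. \<sigma> x = \<tau> x) \<Longrightarrow> r \<sigma> = r \<tau>" "\<And>\<gamma>. \<gamma> \<in> \<Gamma> \<Longrightarrow> r \<gamma> = \<gamma>"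
    using t unfolding trv_def by blast+
  have "a \<gamma> = 0"
  proof (rule dedekind[OF T(1) sring_1[OF subfield_sring[OF F]] _ _ _ _ _ a(1)])
    show "x * y \<in> F" if "x \<in> F" "y \<in> F" for x y using sring_mult[OF subfield_sring[OF F] that] .
    show "\<gamma> 1 = 1" if "\<gamma> \<in> \<Gamma>" for \<gamma> using T(2) that gal_1 by blast
    show "\<gamma> (x * y) = \<gamma> x * \<gamma> y" if "\<gamma> \<in> \<Gamma>" for \<gamma> x y using T(2) that gal_times by blast
    show "\<gamma> = \<delta>" if "\<gamma> \<in> \<Gamma>" "\<delta> \<in> \<Gamma>" "\<forall>x\<in>F. \<gamma> x = \<delta> x" for \<gamma> \<delta>
      using T(3)[OF _ _ that(3)] T(2,4) that(1,2) by fastforce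
    show "(\<Sum>\<gamma>\<in>\<Gamma>. a \<gamma> * \<gamma> x) = 0" if "x \<in> F" for x using n that by blast
  qed
  then show False using a by simp
qed

text \<open>By independence of automorphisms some trace is nonzero; it lies in \<open>K\<close>, so
  one may divide by it. An element of trace 1 is what the additive Hilbert 90 below rests
  on.\<close>

lemma trv_trace_one:
  assumes t: "trv F \<Gamma> r" and F: "subfield F" "K \<subseteq> F" "stable F" "desc UNIV K F"
  shows "\<exists>\<theta>\<in>F. (\<Sum>\<gamma>\<in>\<Gamma>. \<gamma> \<theta>) = 1"
proof -
  have T: "\<Gamma> \<subseteq> G" "r id \<in> \<Gamma>" using t gal_id unfolding trv_def by blast+
  obtain c where c: "c \<in> F" "(\<Sum>\<gamma>\<in>\<Gamma>. \<gamma> c) \<noteq> 0"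
    using trv_nonzero[OF t F(1) T(2), of "\<lambda>_. 1"] by auto
  define s where "s = (\<Sum>\<gamma>\<in>\<Gamma>. \<gamma> c)"
  have "s \<in> F" unfolding s_def
    by (rule sring_sum[OF subfield_sring[OF F(1)]]) (use stableD[OF F(3) _ c(1)] T(1) in blast)
  moreover have "\<sigma> s = s" if \<sigma>: "\<sigma> \<in> G" for \<sigma>
  proof -
    have "\<sigma> s = (\<Sum>\<gamma>\<in>\<Gamma>. (\<sigma> \<circ> \<gamma>) c)" unfolding s_def by (simp add: gal_simps[OF \<sigma>])
    also have "\<dots> = s" unfolding s_def by (rule trv_shift[OF t _ \<sigma>]) (use c(1) in blast)
    finally show ?thesis .
  qed
  ultimately have sK: "s \<in> K" using F(4) by (simp add: desc_def)
  have "(\<Sum>\<gamma>\<in>\<Gamma>. \<gamma> (c / s)) = (\<Sum>\<gamma>\<in>\<Gamma>. \<gamma> c / s)"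
    by (rule sum.cong) (use T(1) sK in \<open>auto simp: gal_simps\<close>)
  also have "\<dots> = 1" using c(2) by (simp add: sum_divide_distrib[symmetric] s_def)
  finally show ?thesis using subfield_divide[OF F(1) c(1)] sK F(2) by blast
qed

lemma chr_setup:
  assumes "chr n \<psi>"
  obtains F \<Gamma> r where "subfield F" "K \<subseteq> F" "F \<subseteq> E" "finite_degree K F" "desc UNIV K F" "stable F" "trv F \<Gamma> r"
    "\<And>\<sigma> \<tau>. \<sigma> \<in> G \<Longrightarrow> \<tau> \<in> G \<Longrightarrow> (\<forall>x\<in>F. \<sigma> x = \<tau> x) \<Longrightarrow> [\<psi> \<sigma> = \<psi> \<tau>] (mod int n)"
proof -
  obtain X where X: "finite X" "X \<subseteq> E" "\<And>\<sigma> \<tau>. \<sigma> \<in> G \<Longrightarrow> \<tau> \<in> G \<Longrightarrow> (\<forall>x\<in>X. \<sigma> x = \<tau> x) \<Longrightarrow> [\<psi> \<sigma> = \<psi> \<tau>] (mod int n)"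
    using assms unfolding chr_def by blast
  obtain F where F: "subfield F" "K \<subseteq> F" "F \<subseteq> E" "X \<subseteq> F" "finite_degree K F" "desc UNIV K F" "stable F"
    using E_hull[OF X(1,2)] by metis
  obtain \<Gamma> r where "trv F \<Gamma> r" using ex_trv[OF F(5)] by blast
  then show ?thesis using that[of F \<Gamma> r] F X(3) by (meson subsetD)
qed

section \<open>Kummer theory\<close>

lemma K_powi: "x \<in> K \<Longrightarrow> x powi k \<in> K"
  unfolding power_int_def by (auto intro: sring_power[OF Ks] subfield_inverse[OF K])

text \<open>Hilbert 90 by the Lagrange resolvent: the weights
  \<open>\<zeta> powi (- \<psi> \<gamma>)\<close> make \<sigma> act on the sum through
  \<open>\<zeta> powi \<psi> \<sigma>\<close>, and independence of automorphisms supplies a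
  \<open>c\<close> for which the sum does not vanish.\<close>

lemma kummer_generator:
  assumes \<psi>: "chr n \<psi>" and z: "prim n \<zeta>" "\<zeta> \<in> K"
  shows "\<exists>y\<in>E. y \<noteq> 0 \<and> (\<forall>\<sigma>\<in>G. \<sigma> y = \<zeta> powi \<psi> \<sigma> * y)"
proof -
  obtain F \<Gamma> r where F: "subfield F" "K \<subseteq> F" "F \<subseteq> E" "finite_degree K F" "desc UNIV K F" "stable F" "trv F \<Gamma> r"
    "\<And>\<sigma> \<tau>. \<sigma> \<in> G \<Longrightarrow> \<tau> \<in> G \<Longrightarrow> (\<forall>x\<in>F. \<sigma> x = \<tau> x) \<Longrightarrow> [\<psi> \<sigma> = \<psi> \<tau>] (mod int n)"
    using chr_setup[OF \<psi>] by metis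
  have T: "\<Gamma> \<subseteq> G" "r id \<in> \<Gamma>" using F(7) gal_id unfolding trv_def by blast+
  have z0: "\<zeta> \<noteq> 0" using z by (simp add: prim_def)
  obtain c where c: "c \<in> F" "(\<Sum>\<gamma>\<in>\<Gamma>. \<zeta> powi (- \<psi> \<gamma>) * \<gamma> c) \<noteq> 0"
    using trv_nonzero[OF F(7,1) T(2), of "\<lambda>\<gamma>. \<zeta> powi (- \<psi> \<gamma>)"] z0 by auto
  define y where "y = (\<Sum>\<gamma>\<in>\<Gamma>. \<zeta> powi (- \<psi> \<gamma>) * \<gamma> c)"
  have "y \<in> F" unfolding y_def
  proof (intro sring_sum[OF subfield_sring[OF F(1)]] sring_mult[OF subfield_sring[OF F(1)]])
    fix \<gamma> assume "\<gamma> \<in> \<Gamma>"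
    then have "\<gamma> \<in> G" using T(1) by blast
    then show "\<gamma> c \<in> F" using stableD[OF F(6) _ c(1)] by simp
    show "\<zeta> powi (- \<psi> \<gamma>) \<in> F" by (rule subsetD[OF F(2) K_powi[OF z(2)]])
  qed
  moreover have "\<sigma> y = \<zeta> powi \<psi> \<sigma> * y" if \<sigma>: "\<sigma> \<in> G" for \<sigma>
  proof -
    have "\<sigma> y = (\<Sum>\<gamma>\<in>\<Gamma>. \<zeta> powi (- \<psi> \<gamma>) * \<sigma> (\<gamma> c))"
      unfolding y_def using gal_K[OF \<sigma> K_powi[OF z(2)]] by (simp add: gal_simps(1-8)[OF \<sigma>])
    also have "\<dots> = (\<Sum>\<gamma>\<in>\<Gamma>. \<zeta> powi \<psi> \<sigma> * (\<zeta> powi (- \<psi> (\<sigma> \<circ> \<gamma>)) * (\<sigma> \<circ> \<gamma>) c))"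
    proof (rule sum.cong[OF refl])
      fix \<gamma> assume "\<gamma> \<in> \<Gamma>"
      then have "[- \<psi> (\<sigma> \<circ> \<gamma>) = - (\<psi> \<sigma> + \<psi> \<gamma>)] (mod int n)"
        using chr_hom[OF \<psi> \<sigma>] T(1) by (simp add: cong_minus_minus_iff del: minus_add_distrib) blast
      then have "\<zeta> powi (- \<psi> (\<sigma> \<circ> \<gamma>)) = \<zeta> powi (- \<psi> \<gamma> - \<psi> \<sigma>)" unfolding prim_eq_iff[OF z(1)] by (simp add: algebra_simps)
      also have "\<dots> = \<zeta> powi (- \<psi> \<gamma>) / \<zeta> powi \<psi> \<sigma>"
        using z0 by (intro power_int_diff) simp
      finally show "\<zeta> powi (- \<psi> \<gamma>) * \<sigma> (\<gamma> c) = \<zeta> powi \<psi> \<sigma> * (\<zeta> powi (- \<psi> (\<sigma> \<circ> \<gamma>)) * (\<sigma> \<circ> \<gamma>) c)"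
        using z0 by simp
    qed
    also have "\<dots> = \<zeta> powi \<psi> \<sigma> * (\<Sum>\<gamma>\<in>\<Gamma>. (\<lambda>\<tau>. \<zeta> powi (- \<psi> \<tau>) * \<tau> c) (\<sigma> \<circ> \<gamma>))"
      by (simp add: sum_distrib_left)
    also have "(\<Sum>\<gamma>\<in>\<Gamma>. (\<lambda>\<tau>. \<zeta> powi (- \<psi> \<tau>) * \<tau> c) (\<sigma> \<circ> \<gamma>)) = y"
      unfolding y_def
    proof (rule trv_shift[OF F(7) _ \<sigma>])
      fix \<sigma> \<tau> assume h: "\<sigma> \<in> G" "\<tau> \<in> G" "\<forall>x\<in>F. \<sigma> x = \<tau> x"
      have "[- \<psi> \<sigma> = - \<psi> \<tau>] (mod int n)" using F(8)[OF h] by (simp add: cong_minus_minus_iff)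
      then show "\<zeta> powi (- \<psi> \<sigma>) * \<sigma> c = \<zeta> powi (- \<psi> \<tau>) * \<tau> c"
        unfolding prim_eq_iff[OF z(1), symmetric] using h(3) c(1) by simp
    qed
    finally show ?thesis .
  qed
  ultimately show ?thesis using F(3) c(2) unfolding y_def by blast
qed

text \<open>Since \<open>m\<close> is invertible, \<open>z\<close> is a simple root of
  \<open>X^m - z^m\<close> over the separable closure; and automorphisms that scale \<open>z\<close>
  by elements of \<open>K\<close> commute on \<open>z\<close>.\<close>

lemma radical_in_E:
  assumes "z \<noteq> 0" "z ^ m \<in> E" "of_nat m \<noteq> (0::'b)" "\<And>\<sigma>. \<sigma> \<in> G \<Longrightarrow> \<exists>w\<in>K. \<sigma> z = w * z"
  shows "z \<in> E"
proof -
  have m0: "m > 0" using assms(3) by (intro gr0I) simp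
  define f where "f = monom 1 m - [:z ^ m:]"
  note S = subfield_sring[OF sepc_subfield]
  have "f \<in> pol sepc" unfolding f_def using assms(2) E_sepc
    by (intro sring_diff[OF sring_pol[OF S]] pol_monom[OF S] pol_const[OF S] sring_1[OF S]) auto
  moreover have "poly f z = 0" by (simp add: f_def poly_monom)
  moreover have "poly (pderiv f) z \<noteq> 0" using assms(1,3) by (simp add: f_def pderiv_diff pderiv_monom poly_monom)
  ultimately have "z \<in> sepc" using sep_trans[OF UNIV_I, of z] by (auto simp: sep_def)
  moreover have "\<sigma> (\<tau> z) = \<tau> (\<sigma> z)" if h: "\<sigma> \<in> G" "\<tau> \<in> G" for \<sigma> \<tau>
  proof -
    obtain v w where vw: "v \<in> K" "\<sigma> z = v * z" "w \<in> K" "\<tau> z = w * z" using assms(4) h by metis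
    then show ?thesis using h by (simp add: gal_simps)
  qed
  ultimately show ?thesis by (simp add: E_def)
qed

lemma kummer_chr:
  assumes z: "z \<in> E" "z \<noteq> 0" and o: "prim N \<omega>" "\<omega> \<in> K" "N > 0" and zN: "z ^ N \<in> K"
  shows "\<exists>\<kappa>. chr N \<kappa> \<and> (\<forall>\<sigma>\<in>G. \<sigma> z = \<omega> powi \<kappa> \<sigma> * z)"
proof -
  have "\<exists>k. \<sigma> z = \<omega> powi k * z" if \<sigma>: "\<sigma> \<in> G" for \<sigma>
  proof -
    have "(\<sigma> z / z) ^ N = 1"
      using gal_K[OF \<sigma> zN] z(2) by (simp add: power_divide gal_power[OF \<sigma>])
    then obtain k where "\<sigma> z / z = \<omega> powi k" using prim_root[OF o(1,3)] by blast
    then show ?thesis using z(2) by (intro exI[of _ k]) (simp add: field_simps)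
  qed
  then obtain \<kappa> where \<kappa>: "\<And>\<sigma>. \<sigma> \<in> G \<Longrightarrow> \<sigma> z = \<omega> powi \<kappa> \<sigma> * z" by metis
  have o0: "\<omega> \<noteq> 0" using o by (simp add: prim_def)
  have "[\<kappa> (\<sigma> \<circ> \<tau>) = \<kappa> \<sigma> + \<kappa> \<tau>] (mod int N)" if h: "\<sigma> \<in> G" "\<tau> \<in> G" for \<sigma> \<tau>
  proof -
    have "\<omega> powi \<kappa> (\<sigma> \<circ> \<tau>) * z = \<sigma> (\<omega> powi \<kappa> \<tau> * z)" using \<kappa>[OF gal_comp[OF h]] \<kappa>[OF h(2)] by simp
    also have "\<dots> = \<omega> powi \<kappa> \<tau> * (\<omega> powi \<kappa> \<sigma> * z)"
      using gal_K[OF h(1) K_powi[OF o(2)]] \<kappa>[OF h(1)] by (simp add: gal_times[OF h(1)])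
    also have "\<dots> = \<omega> powi (\<kappa> \<sigma> + \<kappa> \<tau>) * z" using o0 by (simp add: power_int_add)
    finally show ?thesis unfolding prim_eq_iff[OF o(1), symmetric] using z(2) by simp
  qed
  moreover have "[\<kappa> \<sigma> = \<kappa> \<tau>] (mod int N)" if h: "\<sigma> \<in> G" "\<tau> \<in> G" "\<forall>x\<in>{z}. \<sigma> x = \<tau> x" for \<sigma> \<tau>
    unfolding prim_eq_iff[OF o(1), symmetric] using \<kappa>[OF h(1)] \<kappa>[OF h(2)] h(3) z(2) by simp
  ultimately have "chr N \<kappa>" unfolding chr_def using z(1) by (intro conjI exI[of _ "{z}"]) auto
  then show ?thesis using \<kappa> by blast
qed

section \<open>Artin-Schreier theory\<close>

lemma artin_schreier_in_E:
  assumes p: "CHAR('b) > 0" and x: "x ^ CHAR('b) - x \<in> E" and c: "\<And>\<sigma> \<tau>. \<sigma> \<in> G \<Longrightarrow> \<tau> \<in> G \<Longrightarrow> \<sigma> (\<tau> x) = \<tau> (\<sigma> x)"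
  shows "x \<in> E"
proof -
  define p where "p = CHAR('b)"
  define f where "f = monom 1 p - [:x ^ p - x, 1:]"
  note S = subfield_sring[OF sepc_subfield]
  have "f \<in> pol sepc" unfolding f_def using x E_sepc
    by (intro sring_diff[OF sring_pol[OF S]] pol_monom[OF S] pol_pCons[OF S] pol_const[OF S] sring_1[OF S]) (auto simp: p_def)
  moreover have "poly f x = 0" by (simp add: f_def poly_monom)
  moreover have "poly (pderiv f) x \<noteq> 0" by (simp add: f_def p_def pderiv_diff pderiv_monom poly_monom pderiv_pCons)
  ultimately have "x \<in> sepc" using sep_trans[OF UNIV_I, of x] by (auto simp: sep_def)
  then show ?thesis using c by (simp add: E_def)
qed

text \<open>Two roots of \<open>X^p - X = c\<close> differ by an element fixed by Frobenius, that
  is, by an integer of the prime field; this integer is \<open>\<kappa> \<sigma>\<close>.\<close>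

lemma artin_schreier_chr:
  assumes p: "CHAR('b) > 0" and x: "x ^ CHAR('b) - x \<in> K"
  shows "x \<in> E \<and> (\<exists>\<kappa>. chr CHAR('b) \<kappa> \<and> (\<forall>\<sigma>\<in>G. \<sigma> x = x + of_int (\<kappa> \<sigma>)))"
proof -
  have pr: "prime CHAR('b)" by (rule prime_CHAR_semidom[OF p])
  have "\<exists>k. \<sigma> x = x + of_int k" if \<sigma>: "\<sigma> \<in> G" for \<sigma>
  proof -
    have "(\<sigma> x) ^ CHAR('b) - \<sigma> x = x ^ CHAR('b) - x" using gal_K[OF \<sigma> x] by (simp add: gal_simps[OF \<sigma>])
    then have "(\<sigma> x - x) ^ CHAR('b) = \<sigma> x - x"
      using freshmans_dream[of "CHAR('b)" "\<sigma> x - x" x] pr by (simp add: algebra_simps)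
    from frobenius_fixed[OF p this] show ?thesis by (metis diff_add_cancel add.commute)
  qed
  then obtain \<kappa> where \<kappa>: "\<And>\<sigma>. \<sigma> \<in> G \<Longrightarrow> \<sigma> x = x + of_int (\<kappa> \<sigma>)" by metis
  have fi: "\<sigma> (of_int k) = of_int k" if "\<sigma> \<in> G" for \<sigma> k using gal_K[OF that sring_of_int[OF Ks]] .
  have hom: "\<sigma> (\<tau> x) = x + of_int (\<kappa> \<sigma> + \<kappa> \<tau>)" if h: "\<sigma> \<in> G" "\<tau> \<in> G" for \<sigma> \<tau>
    using \<kappa>[OF h(1)] \<kappa>[OF h(2)] fi[OF h(1)] by (simp add: gal_add[OF h(1)] add.assoc)
  have xE: "x \<in> E"
  proof (rule artin_schreier_in_E[OF p])
    show "x ^ CHAR('b) - x \<in> E" using x K_E by blast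
    show "\<sigma> (\<tau> x) = \<tau> (\<sigma> x)" if "\<sigma> \<in> G" "\<tau> \<in> G" for \<sigma> \<tau>
      unfolding hom[OF that] hom[OF that(2,1)] by (simp add: add.commute)
  qed
  have "[\<kappa> (\<sigma> \<circ> \<tau>) = \<kappa> \<sigma> + \<kappa> \<tau>] (mod int CHAR('b))" if h: "\<sigma> \<in> G" "\<tau> \<in> G" for \<sigma> \<tau>
    unfolding of_int_eq_iff_cong_CHAR[symmetric] using \<kappa>[OF gal_comp[OF h]] hom[OF h] by simp
  moreover have "[\<kappa> \<sigma> = \<kappa> \<tau>] (mod int CHAR('b))" if h: "\<sigma> \<in> G" "\<tau> \<in> G" "\<forall>y\<in>{x}. \<sigma> y = \<tau> y" for \<sigma> \<tau>
    unfolding of_int_eq_iff_cong_CHAR[symmetric] using \<kappa>[OF h(1)] \<kappa>[OF h(2)] h(3) by simp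
  ultimately have "chr CHAR('b) \<kappa>" unfolding chr_def using xE by (intro conjI exI[of _ "{x}"]) auto
  then show ?thesis using \<kappa> xE by blast
qed

text \<open>Additive Hilbert 90. When \<sigma> is applied to the sum, the cocycle rule replaces
  \<open>\<sigma> (B \<gamma>)\<close> by \<open>B (\<sigma> \<circ> \<gamma>) - B \<sigma>\<close>;
  the first part gives the sum back by translation, the second contributes \<open>B \<sigma>\<close>
  times the trace of \<theta>, which is 1.\<close>

lemma additive_cocycle:
  assumes t: "trv F \<Gamma> r" and F: "stable F" and \<theta>: "\<theta> \<in> F" "(\<Sum>\<gamma>\<in>\<Gamma>. \<gamma> \<theta>) = 1"
    and B: "\<And>\<sigma> \<tau>. \<sigma> \<in> G \<Longrightarrow> \<tau> \<in> G \<Longrightarrow> B (\<sigma> \<circ> \<tau>) = B \<sigma> + \<sigma> (B \<tau>)"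
      "\<And>\<sigma> \<tau>. \<sigma> \<in> G \<Longrightarrow> \<tau> \<in> G \<Longrightarrow> (\<forall>x\<in>F. \<sigma> x = \<tau> x) \<Longrightarrow> B \<sigma> = B \<tau>" and \<sigma>: "\<sigma> \<in> G"
  shows "\<sigma> (- (\<Sum>\<gamma>\<in>\<Gamma>. B \<gamma> * \<gamma> \<theta>)) = - (\<Sum>\<gamma>\<in>\<Gamma>. B \<gamma> * \<gamma> \<theta>) + B \<sigma>"
proof -
  have T: "\<Gamma> \<subseteq> G" using t unfolding trv_def by blast
  have "\<sigma> (\<Sum>\<gamma>\<in>\<Gamma>. B \<gamma> * \<gamma> \<theta>) = (\<Sum>\<gamma>\<in>\<Gamma>. \<sigma> (B \<gamma>) * \<sigma> (\<gamma> \<theta>))" by (simp add: gal_simps(1-8)[OF \<sigma>])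
  also have "\<dots> = (\<Sum>\<gamma>\<in>\<Gamma>. B (\<sigma> \<circ> \<gamma>) * (\<sigma> \<circ> \<gamma>) \<theta> - B \<sigma> * \<sigma> (\<gamma> \<theta>))"
    by (rule sum.cong[OF refl]) (use B(1)[OF \<sigma>] T in \<open>auto simp: algebra_simps\<close>)
  also have "\<dots> = (\<Sum>\<gamma>\<in>\<Gamma>. (\<lambda>\<tau>. B \<tau> * \<tau> \<theta>) (\<sigma> \<circ> \<gamma>)) - B \<sigma> * \<sigma> (\<Sum>\<gamma>\<in>\<Gamma>. \<gamma> \<theta>)"
    by (simp add: sum_subtractf sum_distrib_left gal_simps(1-8)[OF \<sigma>])
  also have "(\<Sum>\<gamma>\<in>\<Gamma>. (\<lambda>\<tau>. B \<tau> * \<tau> \<theta>) (\<sigma> \<circ> \<gamma>)) = (\<Sum>\<gamma>\<in>\<Gamma>. B \<gamma> * \<gamma> \<theta>)"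
  proof (rule trv_shift[OF t _ \<sigma>])
    fix \<tau> \<tau>' assume h: "\<tau> \<in> G" "\<tau>' \<in> G" "\<forall>x\<in>F. \<tau> x = \<tau>' x"
    show "B \<tau> * \<tau> \<theta> = B \<tau>' * \<tau>' \<theta>" unfolding B(2)[OF h] bspec[OF h(3) \<theta>(1)] ..
  qed
  finally show ?thesis using \<theta>(2) gal_1[OF \<sigma>] by (simp add: gal_simps(1-8)[OF \<sigma>])
qed

lemma artin_schreier_generator:
  assumes p: "CHAR('b) > 0" and \<psi>: "chr CHAR('b) \<psi>"
  shows "\<exists>x\<in>E. \<forall>\<sigma>\<in>G. \<sigma> x = x + of_int (\<psi> \<sigma>)"
proof -
  obtain F \<Gamma> r where F: "subfield F" "K \<subseteq> F" "F \<subseteq> E" "finite_degree K F" "desc UNIV K F" "stable F" "trv F \<Gamma> r"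
    "\<And>\<sigma> \<tau>. \<sigma> \<in> G \<Longrightarrow> \<tau> \<in> G \<Longrightarrow> (\<forall>x\<in>F. \<sigma> x = \<tau> x) \<Longrightarrow> [\<psi> \<sigma> = \<psi> \<tau>] (mod int CHAR('b))"
    using chr_setup[OF \<psi>] by metis
  note R = subfield_sring[OF F(1)]
  have T: "\<Gamma> \<subseteq> G" using F(7) unfolding trv_def by blast
  obtain \<theta> where \<theta>: "\<theta> \<in> F" "(\<Sum>\<gamma>\<in>\<Gamma>. \<gamma> \<theta>) = 1" using trv_trace_one[OF F(7,1,2,6,5)] by blast
  define B where "B \<sigma> = (of_int (\<psi> \<sigma>) :: 'b)" for \<sigma>
  define x where "x = - (\<Sum>\<gamma>\<in>\<Gamma>. B \<gamma> * \<gamma> \<theta>)"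
  have "x \<in> F" unfolding x_def B_def
    by (intro sring_uminus[OF R] sring_sum[OF R] sring_mult[OF R] sring_of_int[OF R])
       (use stableD[OF F(6) _ \<theta>(1)] T in auto)
  moreover have "\<sigma> x = x + B \<sigma>" if \<sigma>: "\<sigma> \<in> G" for \<sigma>
    unfolding x_def
  proof (rule additive_cocycle[OF F(7,6) \<theta> _ _ \<sigma>])
    show "B (\<sigma> \<circ> \<tau>) = B \<sigma> + \<sigma> (B \<tau>)" if h: "\<sigma> \<in> G" "\<tau> \<in> G" for \<sigma> \<tau>
    proof -
      have "\<sigma> (B \<tau>) = B \<tau>" unfolding B_def by (rule gal_K[OF h(1) sring_of_int[OF Ks]])
      then show ?thesis using chr_hom[OF \<psi> h] unfolding of_int_eq_iff_cong_CHAR[symmetric] by (simp add: B_def)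
    qed
    show "B \<sigma> = B \<tau>" if "\<sigma> \<in> G" "\<tau> \<in> G" "\<forall>x\<in>F. \<sigma> x = \<tau> x" for \<sigma> \<tau>
      using F(8)[OF that] unfolding of_int_eq_iff_cong_CHAR[symmetric] by (simp add: B_def)
  qed
  ultimately show ?thesis using F(3) unfolding B_def by blast
qed

text \<open>The carry cocycle of a character modulo \<open>n\<close> becomes a coboundary \<open>b\<close> with values in a
  finite extension; its image under \<open>x \<mapsto> x ^ p - x\<close> is a one-cocycle \<open>B\<close>, because the carries lie in
  the prime field, so the additive Hilbert 90 and an Artin-Schreier equation give the lift.\<close>

lemma artin_schreier_lift:
  assumes p: "CHAR('b) > 0" and \<psi>0: "chr n \<psi>0" and n: "n > 0"
  shows "\<exists>\<psi>'. chr (n * CHAR('b)) \<psi>' \<and> (\<forall>\<sigma>\<in>G. [\<psi>' \<sigma> = \<psi>0 \<sigma>] (mod int n))"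
proof -
  define p where "p = CHAR('b)"
  have pr: "prime p" using prime_CHAR_semidom assms(1) by (simp add: p_def)
  have p1: "p > 1" using prime_gt_1_nat[OF pr] .
  \<comment> \<open>With reduced representatives \<open>\<psi> \<sigma>\<close> itself, not only its
    residue, depends on the restriction to \<open>F\<close> alone; the carries below are actual
    integers.\<close>
  define \<psi> where "\<psi> \<sigma> = \<psi>0 \<sigma> mod int n" for \<sigma>
  have c0: "[\<psi> \<sigma> = \<psi>0 \<sigma>] (mod int n)" for \<sigma> by (simp add: \<psi>_def)
  have \<psi>: "chr n \<psi>" using \<psi>0 by (simp add: chr_def \<psi>_def cong_def mod_add_eq)
  have range: "\<psi> \<sigma> = \<psi> \<tau>" if "[\<psi> \<sigma> = \<psi> \<tau>] (mod int n)" for \<sigma> \<tau> using that by (simp add: \<psi>_def cong_def)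
  obtain F \<Gamma> r where F: "subfield F" "K \<subseteq> F" "F \<subseteq> E" "finite_degree K F" "desc UNIV K F" "stable F" "trv F \<Gamma> r"
    and \<psi>F': "\<And>\<sigma> \<tau>. \<sigma> \<in> G \<Longrightarrow> \<tau> \<in> G \<Longrightarrow> (\<forall>x\<in>F. \<sigma> x = \<tau> x) \<Longrightarrow> [\<psi> \<sigma> = \<psi> \<tau>] (mod int n)"
    using chr_setup[OF \<psi>] by metis
  have \<psi>F: "\<psi> \<sigma> = \<psi> \<tau>" if "\<sigma> \<in> G" "\<tau> \<in> G" "\<forall>x\<in>F. \<sigma> x = \<tau> x" for \<sigma> \<tau> using range \<psi>F' that by blast
  note R = subfield_sring[OF F(1)]
  have T: "\<Gamma> \<subseteq> G" using F(7) unfolding trv_def by blast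
  obtain \<theta> where \<theta>: "\<theta> \<in> F" "(\<Sum>\<gamma>\<in>\<Gamma>. \<gamma> \<theta>) = 1" using trv_trace_one[OF F(7,1,2,6,5)] by blast
  define k where "k \<sigma> \<tau> = (\<psi> \<sigma> + \<psi> \<tau> - \<psi> (\<sigma> \<circ> \<tau>)) div int n" for \<sigma> \<tau>
  have k: "int n * k \<sigma> \<tau> = \<psi> \<sigma> + \<psi> \<tau> - \<psi> (\<sigma> \<circ> \<tau>)" if "\<sigma> \<in> G" "\<tau> \<in> G" for \<sigma> \<tau>
  proof -
    have "int n dvd \<psi> \<sigma> + \<psi> \<tau> - \<psi> (\<sigma> \<circ> \<tau>)"
      using cong_sym[OF chr_hom[OF \<psi> that]] by (simp add: cong_iff_dvd_diff)
    then show ?thesis by (simp add: k_def)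
  qed
  have kcoc: "k \<sigma> \<tau> + k (\<sigma> \<circ> \<tau>) \<rho> = k \<tau> \<rho> + k \<sigma> (\<tau> \<circ> \<rho>)" if h: "\<sigma> \<in> G" "\<tau> \<in> G" "\<rho> \<in> G" for \<sigma> \<tau> \<rho>
  proof -
    have "int n * (k \<sigma> \<tau> + k (\<sigma> \<circ> \<tau>) \<rho>) = int n * (k \<tau> \<rho> + k \<sigma> (\<tau> \<circ> \<rho>))"
      using k[OF h(1,2)] k[OF gal_comp[OF h(1,2)] h(3)] k[OF h(2,3)] k[OF h(1) gal_comp[OF h(2,3)]]
      by (simp add: algebra_simps comp_assoc)
    then show ?thesis using n by simp
  qed
  have kF: "k \<sigma> \<tau> = k \<sigma>' \<tau>'" if h: "\<sigma> \<in> G" "\<tau> \<in> G" "\<sigma>' \<in> G" "\<tau>' \<in> G" "\<forall>x\<in>F. \<sigma> x = \<sigma>' x" "\<forall>x\<in>F. \<tau> x = \<tau>' x" for \<sigma> \<tau> \<sigma>' \<tau>'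
  proof -
    have "\<forall>x\<in>F. (\<sigma> \<circ> \<tau>) x = (\<sigma>' \<circ> \<tau>') x" using h stableD[OF F(6)] by simp
    from \<psi>F[OF gal_comp[OF h(1,2)] gal_comp[OF h(3,4)] this] show ?thesis
      unfolding k_def \<psi>F[OF h(1,3,5)] \<psi>F[OF h(2,4,6)] by (rule arg_cong)
  qed
  have comm: "\<forall>x\<in>F. (\<sigma> \<circ> \<tau>) x = (\<tau> \<circ> \<sigma>) x" if "\<sigma> \<in> G" "\<tau> \<in> G" for \<sigma> \<tau>
    using E_comm[OF _ that] F(3) by auto
  \<comment> \<open>Symmetry of the carry will make \<open>\<sigma> (\<tau> x)\<close> symmetric in
    \<sigma> and \<tau>, so that the new element \<open>x\<close> still lies in the abelian
    extension.\<close>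
  have ksym: "k \<sigma> \<tau> = k \<tau> \<sigma>" if h: "\<sigma> \<in> G" "\<tau> \<in> G" for \<sigma> \<tau>
    unfolding k_def \<psi>F[OF gal_comp[OF h] gal_comp[OF h(2,1)] comm[OF h]] by (simp only: add.commute)
  \<comment> \<open>Averaging the carry against the conjugates of \<theta>, whose trace is 1, splits
    the cocycle.\<close>
  define b where "b \<sigma> = (\<Sum>\<gamma>\<in>\<Gamma>. of_int (k \<sigma> \<gamma>) * \<sigma> (\<gamma> \<theta>))" for \<sigma>
  have \<gamma>F: "\<gamma> \<theta> \<in> F" if "\<gamma> \<in> \<Gamma>" for \<gamma> using stableD[OF F(6) _ \<theta>(1)] T that by blast
  have bF: "b \<sigma> \<in> F" if \<sigma>: "\<sigma> \<in> G" for \<sigma>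
    unfolding b_def
    by (intro sring_sum[OF R] sring_mult[OF R] sring_of_int[OF R] stableD[OF F(6) \<sigma>] \<gamma>F)
  have bcong: "b \<sigma> = b \<tau>" if h: "\<sigma> \<in> G" "\<tau> \<in> G" "\<forall>x\<in>F. \<sigma> x = \<tau> x" for \<sigma> \<tau>
    unfolding b_def
  proof (rule sum.cong[OF refl])
    fix \<gamma> assume g: "\<gamma> \<in> \<Gamma>"
    then have "k \<sigma> \<gamma> = k \<tau> \<gamma>" using kF[OF h(1) _ h(2) _ h(3)] T by blast
    then show "of_int (k \<sigma> \<gamma>) * \<sigma> (\<gamma> \<theta>) = of_int (k \<tau> \<gamma>) * \<tau> (\<gamma> \<theta>)" using h(3) \<gamma>F[OF g] by simp
  qed
  have fi: "\<sigma> (of_int i) = of_int i" if "\<sigma> \<in> G" for \<sigma> i using gal_K[OF that sring_of_int[OF Ks]] .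
  have bcob: "b \<sigma> + \<sigma> (b \<tau>) = b (\<sigma> \<circ> \<tau>) + of_int (k \<sigma> \<tau>)" if h: "\<sigma> \<in> G" "\<tau> \<in> G" for \<sigma> \<tau>
  proof -
    \<comment> \<open>After translation by \<tau> all terms involve the same conjugates
      \<open>\<sigma> (\<tau> (\<gamma> \<theta>))\<close>, and the cocycle identity applies to each
      of them.\<close>
    have "b \<sigma> = (\<Sum>\<gamma>\<in>\<Gamma>. (\<lambda>\<rho>. of_int (k \<sigma> \<rho>) * \<sigma> (\<rho> \<theta>)) (\<tau> \<circ> \<gamma>))"
      unfolding b_def
    proof (rule trv_shift[OF F(7) _ h(2), symmetric])
      fix \<rho> \<rho>' assume g: "\<rho> \<in> G" "\<rho>' \<in> G" "\<forall>x\<in>F. \<rho> x = \<rho>' x"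
      show "of_int (k \<sigma> \<rho>) * \<sigma> (\<rho> \<theta>) = of_int (k \<sigma> \<rho>') * \<sigma> (\<rho>' \<theta>)"
        using kF[OF h(1) g(1) h(1) g(2) _ g(3)] g(3) \<theta>(1) by simp
    qed
    then have b1: "b \<sigma> = (\<Sum>\<gamma>\<in>\<Gamma>. of_int (k \<sigma> (\<tau> \<circ> \<gamma>)) * \<sigma> (\<tau> (\<gamma> \<theta>)))" by simp
    have b2: "\<sigma> (b \<tau>) = (\<Sum>\<gamma>\<in>\<Gamma>. of_int (k \<tau> \<gamma>) * \<sigma> (\<tau> (\<gamma> \<theta>)))"
      unfolding b_def by (simp add: gal_simps(1-8)[OF h(1)] fi[OF h(1)])
    have b3: "of_int (k \<sigma> \<tau>) = (\<Sum>\<gamma>\<in>\<Gamma>. of_int (k \<sigma> \<tau>) * \<sigma> (\<tau> (\<gamma> \<theta>)))"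
    proof -
      have "(\<Sum>\<gamma>\<in>\<Gamma>. \<sigma> (\<tau> (\<gamma> \<theta>))) = \<sigma> (\<tau> (\<Sum>\<gamma>\<in>\<Gamma>. \<gamma> \<theta>))"
        by (simp add: gal_simps(1-8)[OF h(1)] gal_simps(1-8)[OF h(2)])
      then show ?thesis using \<theta>(2) gal_1[OF h(1)] gal_1[OF h(2)] by (simp add: sum_distrib_left[symmetric])
    qed
    have "b \<sigma> + \<sigma> (b \<tau>) = (\<Sum>\<gamma>\<in>\<Gamma>. of_int (k (\<sigma> \<circ> \<tau>) \<gamma>) * (\<sigma> \<circ> \<tau>) (\<gamma> \<theta>) + of_int (k \<sigma> \<tau>) * \<sigma> (\<tau> (\<gamma> \<theta>)))"
      unfolding b1 b2 sum.distrib[symmetric]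
    proof (rule sum.cong[OF refl])
      fix \<gamma> assume "\<gamma> \<in> \<Gamma>"
      then have "k \<sigma> (\<tau> \<circ> \<gamma>) + k \<tau> \<gamma> = k (\<sigma> \<circ> \<tau>) \<gamma> + k \<sigma> \<tau>" using kcoc[OF h, of \<gamma>] T by auto
      then have "(of_int (k \<sigma> (\<tau> \<circ> \<gamma>)) + of_int (k \<tau> \<gamma>) :: 'b) = of_int (k (\<sigma> \<circ> \<tau>) \<gamma>) + of_int (k \<sigma> \<tau>)"
        by (metis of_int_add)
      then show "of_int (k \<sigma> (\<tau> \<circ> \<gamma>)) * \<sigma> (\<tau> (\<gamma> \<theta>)) + of_int (k \<tau> \<gamma>) * \<sigma> (\<tau> (\<gamma> \<theta>)) =
        of_int (k (\<sigma> \<circ> \<tau>) \<gamma>) * (\<sigma> \<circ> \<tau>) (\<gamma> \<theta>) + of_int (k \<sigma> \<tau>) * \<sigma> (\<tau> (\<gamma> \<theta>))"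
        by (simp add: distrib_right[symmetric])
    qed
    also have "\<dots> = b (\<sigma> \<circ> \<tau>) + of_int (k \<sigma> \<tau>)"
      unfolding sum.distrib b3[symmetric] b_def[of "\<sigma> \<circ> \<tau>"] ..
    finally show ?thesis .
  qed
  have fresh: "(u + v) ^ p = u ^ p + v ^ p" for u v :: 'b
    using freshmans_dream[of p u v] pr by (simp add: p_def)
  have fri: "(of_int i :: 'b) ^ p = of_int i" for i using frobenius_of_int[OF assms(1)] by (simp add: p_def)
  define B where "B \<sigma> = b \<sigma> ^ p - b \<sigma>" for \<sigma>
  have Bcoc: "B (\<sigma> \<circ> \<tau>) = B \<sigma> + \<sigma> (B \<tau>)" if h: "\<sigma> \<in> G" "\<tau> \<in> G" for \<sigma> \<tau>
  proof -
    have "(b \<sigma> + \<sigma> (b \<tau>)) ^ p - (b \<sigma> + \<sigma> (b \<tau>)) = B (\<sigma> \<circ> \<tau>)"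
      unfolding bcob[OF h] fresh B_def fri by simp
    then show ?thesis unfolding fresh B_def by (simp add: gal_simps(1-8)[OF h(1)] algebra_simps)
  qed
  define \<alpha> where "\<alpha> = - (\<Sum>\<gamma>\<in>\<Gamma>. B \<gamma> * \<gamma> \<theta>)"
  have \<alpha>: "\<sigma> \<alpha> = \<alpha> + B \<sigma>" if \<sigma>: "\<sigma> \<in> G" for \<sigma>
    unfolding \<alpha>_def
  proof (rule additive_cocycle[OF F(7,6) \<theta> Bcoc _ \<sigma>])
    fix \<sigma> \<tau> assume "\<sigma> \<in> G" "\<tau> \<in> G" "\<forall>x\<in>F. \<sigma> x = \<tau> x"
    from bcong[OF this] show "B \<sigma> = B \<tau>" by (simp add: B_def)
  qed
  have \<alpha>F: "\<alpha> \<in> F" unfolding \<alpha>_def B_def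
    by (intro sring_uminus[OF R] sring_sum[OF R] sring_mult[OF R] sring_diff[OF R] sring_power[OF R] bF \<gamma>F subsetD[OF T])
  have "degree (monom 1 p - [:\<alpha>,1:]) = p"
    using degree_add_eq_left[of "- [:\<alpha>,1:]" "monom (1::'b) p"] p1
    by (simp only: diff_conv_add_uminus degree_minus degree_monom_eq one_neq_zero not_False_eq_True) simp
  then obtain x where "poly (monom 1 p - [:\<alpha>,1:]) x = 0"
    using alg_closed_root[OF O, of "monom 1 p - [:\<alpha>,1:]"] p1 by auto
  then have x: "x ^ p - x = \<alpha>" by (simp add: poly_monom algebra_simps)
  have "\<exists>j. \<sigma> x = x + b \<sigma> + of_int j" if \<sigma>: "\<sigma> \<in> G" for \<sigma>
  proof -
    have e: "(\<sigma> x) ^ p - \<sigma> x = (x ^ p - x) + (b \<sigma> ^ p - b \<sigma>)"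
      using \<alpha>[OF \<sigma>] unfolding x[symmetric] B_def by (simp add: gal_simps(1-8)[OF \<sigma>])
    \<comment> \<open>Both \<open>\<sigma> x\<close> and \<open>x + b \<sigma>\<close> solve the
      same Artin-Schreier equation, so their difference lies in the prime field.\<close>
    define d where "d = \<sigma> x - (x + b \<sigma>)"
    have "\<sigma> x = d + (x + b \<sigma>)" by (simp add: d_def)
    then have "d ^ p = d" using e by (simp add: fresh algebra_simps)
    then obtain j where "d = of_int j" using frobenius_fixed[OF assms(1), of d] by (auto simp: p_def)
    then show ?thesis by (intro exI[of _ j]) (simp add: d_def algebra_simps)
  qed
  then obtain j where j: "\<And>\<sigma>. \<sigma> \<in> G \<Longrightarrow> \<sigma> x = x + b \<sigma> + of_int (j \<sigma>)" by metis
  have jhom: "\<sigma> (\<tau> x) = x + b (\<sigma> \<circ> \<tau>) + of_int (j \<sigma> + j \<tau> + k \<sigma> \<tau>)" if h: "\<sigma> \<in> G" "\<tau> \<in> G" for \<sigma> \<tau>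
  proof -
    have "\<sigma> (\<tau> x) = x + (b \<sigma> + \<sigma> (b \<tau>)) + of_int (j \<sigma>) + of_int (j \<tau>)"
      using j[OF h(1)] j[OF h(2)] fi[OF h(1)] by (simp add: gal_add[OF h(1)])
    then show ?thesis unfolding bcob[OF h] by simp
  qed
  have xE: "x \<in> E"
  proof (rule artin_schreier_in_E[OF assms(1)])
    show "x ^ CHAR('b) - x \<in> E" using x \<alpha>F F(3) by (auto simp: p_def)
    show "\<sigma> (\<tau> x) = \<tau> (\<sigma> x)" if h: "\<sigma> \<in> G" "\<tau> \<in> G" for \<sigma> \<tau>
      unfolding jhom[OF h] jhom[OF h(2,1)] bcong[OF gal_comp[OF h] gal_comp[OF h(2,1)] comm[OF h]] ksym[OF h]
      by (simp only: add.commute[of "j \<sigma>"])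
  qed
  \<comment> \<open>The new digit \<open>j \<sigma>\<close> fails to be additive modulo
    \<open>p\<close> by exactly the carry, which compensates the failure of
    \<open>\<psi> \<sigma>\<close> to be additive.\<close>
  define \<psi>' where "\<psi>' \<sigma> = \<psi> \<sigma> + int n * j \<sigma>" for \<sigma>
  have jc: "[j (\<sigma> \<circ> \<tau>) = j \<sigma> + j \<tau> + k \<sigma> \<tau>] (mod int p)" if h: "\<sigma> \<in> G" "\<tau> \<in> G" for \<sigma> \<tau>
    unfolding p_def of_int_eq_iff_cong_CHAR[symmetric] using jhom[OF h] j[OF gal_comp[OF h]] by simp
  have hom: "[\<psi>' (\<sigma> \<circ> \<tau>) = \<psi>' \<sigma> + \<psi>' \<tau>] (mod int (n * p))" if h: "\<sigma> \<in> G" "\<tau> \<in> G" for \<sigma> \<tau>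
  proof -
    have "\<psi>' (\<sigma> \<circ> \<tau>) - (\<psi>' \<sigma> + \<psi>' \<tau>) = int n * (j (\<sigma> \<circ> \<tau>) - (j \<sigma> + j \<tau> + k \<sigma> \<tau>))"
      using k[OF h] by (simp add: \<psi>'_def algebra_simps)
    then show ?thesis using jc[OF h] by (simp add: cong_iff_dvd_diff)
  qed
  obtain D where D: "finite D" "D \<subseteq> F" "\<And>\<sigma> \<tau>. \<sigma> \<in> G \<Longrightarrow> \<tau> \<in> G \<Longrightarrow> (\<forall>x\<in>D. \<sigma> x = \<tau> x) \<Longrightarrow> \<forall>x\<in>F. \<sigma> x = \<tau> x"
    using finite_determined[OF F(4)] by blast
  have cont: "[\<psi>' \<sigma> = \<psi>' \<tau>] (mod int (n * p))" if h: "\<sigma> \<in> G" "\<tau> \<in> G" "\<forall>y\<in>insert x D. \<sigma> y = \<tau> y" for \<sigma> \<tau>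
  proof -
    have a: "\<forall>x\<in>F. \<sigma> x = \<tau> x" using D(3) h by blast
    have "(of_int (j \<sigma>) :: 'b) = of_int (j \<tau>)"
      using j[OF h(1)] j[OF h(2)] h(3) bcong[OF h(1,2) a] by simp
    then have "[j \<sigma> = j \<tau>] (mod int p)" unfolding p_def of_int_eq_iff_cong_CHAR .
    moreover have "\<psi>' \<sigma> - \<psi>' \<tau> = int n * (j \<sigma> - j \<tau>)" using \<psi>F[OF h(1,2) a] by (simp add: \<psi>'_def algebra_simps)
    ultimately show ?thesis by (simp add: cong_iff_dvd_diff)
  qed
  have "chr (n * p) \<psi>'"
    unfolding chr_def using hom cont D(1,2) F(3) xE by (intro conjI exI[of _ "insert x D"]) auto
  moreover have "[\<psi>' \<sigma> = \<psi>0 \<sigma>] (mod int n)" for \<sigma>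
    using c0[of \<sigma>] by (simp add: \<psi>'_def cong_def)
  ultimately show ?thesis by (auto simp: p_def)
qed

end

section \<open>Linearly disjoint algebraically closed fields\<close>

lemma indep_basis:
  assumes C: "subfield C" and T: "finite T"
  shows "\<exists>S\<subseteq>T. lin_indep_over C S \<and> (\<forall>t\<in>T. \<exists>c. (\<forall>s\<in>S. c s \<in> C) \<and> t = (\<Sum>s\<in>S. c s * s))"
proof -
  note R = subfield_sring[OF C]
  define P where "P S \<longleftrightarrow> S \<subseteq> T \<and> lin_indep_over C S" for S
  have "P {}" by (simp add: P_def lin_indep_over_def)
  moreover have "card S < Suc (card T)" if "P S" for S using that T card_mono[of T S] by (simp add: P_def)
  ultimately obtain S where S: "P S" "\<And>S'. P S' \<Longrightarrow> card S' \<le> card S"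
    using ex_has_greatest_nat[of P "{}" card "Suc (card T)"] by blast
  have fS: "finite S" "S \<subseteq> T" "lin_indep_over C S" using S(1) T finite_subset by (auto simp: P_def)
  have "\<exists>c. (\<forall>s\<in>S. c s \<in> C) \<and> t = (\<Sum>s\<in>S. c s * s)" if t: "t \<in> T" for t
  proof (cases "t \<in> S")
    case True
    have "(\<Sum>s\<in>S. (if s = t then 1 else 0) * s) = (\<Sum>s\<in>S. if s = t then s else 0)"
      by (rule sum.cong) auto
    then have "t = (\<Sum>s\<in>S. (if s = t then 1 else 0) * s)" using True fS by (simp add: sum.delta)
    then show ?thesis using sring_0[OF R] sring_1[OF R] by (intro exI[of _ "\<lambda>s. if s = t then 1 else 0"]) auto
  next
    case False
    have "\<not> P (insert t S)" using S(2)[of "insert t S"] False fS(1) by auto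
    then obtain c where c: "\<forall>s\<in>insert t S. c s \<in> C" "(\<Sum>s\<in>insert t S. c s * s) = 0" "\<exists>s\<in>insert t S. c s \<noteq> 0"
      using t fS by (auto simp: P_def lin_indep_over_def)
    have sm: "c t * t + (\<Sum>s\<in>S. c s * s) = 0" using c(2) False fS(1) by simp
    have ct: "c t \<noteq> 0"
    proof
      assume "c t = 0"
      then have "(\<Sum>s\<in>S. c s * s) = 0" using sm by simp
      then have "\<forall>s\<in>S. c s = 0" using fS(3) c(1) by (auto simp: lin_indep_over_def)
      then show False using c(3) \<open>c t = 0\<close> by auto
    qed
    have "c t * t = - (\<Sum>s\<in>S. c s * s)" using sm by (simp add: eq_neg_iff_add_eq_0)
    then have "t = - (\<Sum>s\<in>S. c s * s) / c t" using ct by (simp add: field_simps)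
    also have "\<dots> = (\<Sum>s\<in>S. (- c s / c t) * s)"
      by (simp add: sum_divide_distrib sum_negf[symmetric])
    finally show ?thesis using c(1)
      by (intro exI[of _ "\<lambda>s. - c s / c t"]) (auto intro!: subfield_divide[OF C] sring_uminus[OF R])
  qed
  then show ?thesis using fS by blast
qed

text \<open>Expand the coefficients \<open>m s\<close> in a set \<open>B\<close> of elements of
  \<open>M\<close> independent over \<open>C\<close> and exchange the sums: independence of
  \<open>B\<close> over \<open>L\<close> kills the coefficient of each \<open>b\<close>, which is a
  \<open>C\<close>-combination of \<open>S\<close>, and independence of \<open>S\<close> over
  \<open>C\<close> finishes. Both directions are needed because a comparison of cardinalities
  decides which field plays the role of \<open>L\<close>.\<close>

lemma lin_disjoint_sym:
  assumes L: "subfield L" and M: "subfield M" and C: "subfield C" "C \<subseteq> L" and d: "linearly_disjoint C L M"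
  shows "linearly_disjoint C M L"
  unfolding linearly_disjoint_def
proof (intro allI impI)
  fix S assume S: "S \<subseteq> L" "lin_indep_over C S"
  have fS: "finite S" using S by (simp add: lin_indep_over_def)
  show "lin_indep_over M S"
    unfolding lin_indep_over_def
  proof (intro conjI fS allI impI)
    fix m assume m: "\<forall>s\<in>S. m s \<in> M" "(\<Sum>s\<in>S. m s * s) = 0"
    obtain B where B: "B \<subseteq> m ` S" "lin_indep_over C B"
      "\<forall>t\<in>m ` S. \<exists>c. (\<forall>s\<in>B. c s \<in> C) \<and> t = (\<Sum>s\<in>B. c s * s)"
      using indep_basis[OF C(1), of "m ` S"] fS by auto
    have "\<forall>s\<in>S. \<exists>c. (\<forall>b\<in>B. c b \<in> C) \<and> m s = (\<Sum>b\<in>B. c b * b)" using B(3) by blast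
    then obtain c where c: "\<And>s b. s \<in> S \<Longrightarrow> b \<in> B \<Longrightarrow> c s b \<in> C" "\<And>s. s \<in> S \<Longrightarrow> m s = (\<Sum>b\<in>B. c s b * b)"
      by metis
    have "B \<subseteq> M" using B(1) m(1) by blast
    then have BL: "lin_indep_over L B" using d B(2) by (simp add: linearly_disjoint_def)
    have "(\<Sum>b\<in>B. (\<Sum>s\<in>S. c s b * s) * b) = (\<Sum>s\<in>S. \<Sum>b\<in>B. c s b * b * s)"
      unfolding sum_distrib_right by (subst sum.swap) (simp add: mult_ac)
    also have "\<dots> = (\<Sum>s\<in>S. m s * s)" by (rule sum.cong) (simp_all add: c(2) sum_distrib_right)
    finally have "(\<Sum>b\<in>B. (\<Sum>s\<in>S. c s b * s) * b) = 0" using m(2) by simp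
    moreover have "\<forall>b\<in>B. (\<Sum>s\<in>S. c s b * s) \<in> L"
      using c(1) C(2) S(1) by (auto intro!: sring_sum[OF subfield_sring[OF L]] sring_mult[OF subfield_sring[OF L]])
    ultimately have z: "\<forall>b\<in>B. (\<Sum>s\<in>S. c s b * s) = 0"
      using BL unfolding lin_indep_over_def by (elim conjE allE[of _ "\<lambda>b. \<Sum>s\<in>S. c s b * s"]) blast
    have "c s b = 0" if "s \<in> S" "b \<in> B" for s b
    proof -
      have "\<forall>s\<in>S. c s b \<in> C" using c(1) \<open>b \<in> B\<close> by blast
      moreover have "(\<Sum>s\<in>S. c s b * s) = 0" using z \<open>b \<in> B\<close> by blast
      ultimately have "\<forall>s\<in>S. c s b = 0"
        using S(2) unfolding lin_indep_over_def by (elim conjE allE[of _ "\<lambda>s. c s b"]) blast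
      then show ?thesis using \<open>s \<in> S\<close> by blast
    qed
    then show "\<forall>s\<in>S. m s = 0" using c(2) by simp
  qed
qed

lemma alg_closed_roots:
  assumes O: "alg_closed_subfield \<Omega>" and "p \<in> pol \<Omega>" "p \<noteq> 0" "poly p x = 0"
  shows "x \<in> \<Omega>"
  using assms(2-4)
proof (induction "degree p" arbitrary: p)
  case 0
  then obtain c where "p = [:c:]" using degree_eq_zeroE by metis
  then show ?case using 0 by simp
next
  case (Suc n)
  note S = alg_closed_subfieldD[OF O]
  obtain r where r: "r \<in> \<Omega>" "poly p r = 0" using alg_closed_root[OF O Suc.prems(1)] Suc.hyps by auto
  have l: "[:-r,1:] \<in> pol \<Omega>" by (rule pol_linear[OF subfield_sring[OF S] r(1)])
  obtain q s where q: "q \<in> pol \<Omega>" "p = q * [:-r,1:] + s" "s = 0 \<or> degree s < degree [:-r,1:]"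
    using pol_div[OF S l _ Suc.prems(1)] by auto
  have "degree s = 0" using q(3) by auto
  then obtain c where "s = [:c:]" by (elim degree_eq_zeroE)
  then have qp: "p = q * [:-r,1:]" using q(2) r(2) by simp
  have "q \<noteq> 0" using qp Suc.prems by auto
  then have "degree p = degree q + degree [:-r,1:]" unfolding qp by (intro degree_mult_eq) auto
  then have "degree q = n" using Suc.hyps by simp
  moreover have "poly q x = 0 \<or> x = r" using Suc.prems(3) unfolding qp poly_mult by auto
  ultimately show ?case using Suc.hyps(1)[of q] q(1) \<open>q \<noteq> 0\<close> r(1) by blast
qed

text \<open>The list stands for the tensor with terms \<open>l \<otimes> m\<close>;
  \<open>val id\<close> is its value in the compositum, and \<open>val \<sigma>\<close> the value
  after \<sigma> has acted on the second factors. That the latter depends on the former alone is the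
  content of \<open>tens_0_iff\<close>.\<close>

definition val :: "('a::field \<Rightarrow> 'a) \<Rightarrow> ('a \<times> 'a) list \<Rightarrow> 'a" where
  "val \<sigma> xs = (\<Sum>(l,m)\<leftarrow>xs. l * \<sigma> m)"

text \<open>The graph of the \<open>L\<close>-linear extension to \<open>L[A]\<close> of a homomorphism \<open>\<sigma>\<close> on \<open>A\<close>.\<close>

definition tens :: "'a::field set \<Rightarrow> 'a set \<Rightarrow> ('a \<Rightarrow> 'a) \<Rightarrow> ('a \<times> 'a) set" where
  "tens L A \<sigma> = {(val id xs, val \<sigma> xs) | xs. set xs \<subseteq> L \<times> A}"

lemma val_append [simp]: "val \<sigma> (xs @ ys) = val \<sigma> xs + val \<sigma> ys"
  by (simp add: val_def)

lemma val_Nil [simp]: "val \<sigma> [] = 0" and val_Cons [simp]: "val \<sigma> ((l,m) # xs) = l * \<sigma> m + val \<sigma> xs"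
  by (simp_all add: val_def)

lemma tensI: "set xs \<subseteq> L \<times> A \<Longrightarrow> (val id xs, val \<sigma> xs) \<in> tens L A \<sigma>"
  by (auto simp: tens_def)

lemma tens_pring:
  assumes L: "sring L" and A: "sring A" and s: "\<sigma> 1 = 1" "\<And>x y. x \<in> A \<Longrightarrow> y \<in> A \<Longrightarrow> \<sigma> (x * y) = \<sigma> x * \<sigma> y"
  shows "pring (tens L A \<sigma>)"
  unfolding pring_def
proof (intro conjI allI impI)
  show "(0,0) \<in> tens L A \<sigma>" using tensI[of "[]" L A \<sigma>] by simp
  show "(1,1) \<in> tens L A \<sigma>" using tensI[of "[(1,1)]" L A \<sigma>] sring_1[OF L] sring_1[OF A] s by simp
  fix x y x' y' assume "(x,y) \<in> tens L A \<sigma>" "(x',y') \<in> tens L A \<sigma>"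
  then obtain xs ys where h: "set xs \<subseteq> L \<times> A" "x = val id xs" "y = val \<sigma> xs"
    "set ys \<subseteq> L \<times> A" "x' = val id ys" "y' = val \<sigma> ys" by (auto simp: tens_def)
  show "(x + x', y + y') \<in> tens L A \<sigma>" using tensI[of "xs @ ys" L A \<sigma>] h by simp
  define ng where "ng = map (\<lambda>(l,m). (- l :: 'a, m :: 'a))"
  have ng: "val \<rho> (ng zs) = - val \<rho> zs" for \<rho> zs by (induction zs) (auto simp: ng_def)
  have "set (ng ys) \<subseteq> L \<times> A" using h(4) by (auto simp: ng_def intro: sring_uminus[OF L])
  then show "(x - x', y - y') \<in> tens L A \<sigma>" using tensI[of "xs @ ng ys" L A \<sigma>] h by (simp add: ng)
  define sc where "sc u = map (\<lambda>(l,m). (fst u * l, snd u * m :: 'a))" for u :: "'a \<times> 'a"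
  define I :: "'a \<Rightarrow> 'a" where "I = id"
  have I: "I x = x" for x by (simp add: I_def)
  have sc: "val \<sigma> (sc (l,m) zs) = l * \<sigma> m * val \<sigma> zs \<and> val I (sc (l,m) zs) = l * m * val I zs \<and> set (sc (l,m) zs) \<subseteq> L \<times> A"
    if "l \<in> L" "m \<in> A" "set zs \<subseteq> L \<times> A" for l m zs
    using that(3) by (induction zs) (auto simp: sc_def that s I algebra_simps intro: sring_mult[OF L] sring_mult[OF A])
  define pr where "pr = concat (map (\<lambda>u. sc u ys) xs)"
  have "val \<sigma> pr = val \<sigma> xs * val \<sigma> ys \<and> val I pr = val I xs * val I ys \<and> set pr \<subseteq> L \<times> A"
    using h(1) unfolding pr_def
  proof (induction xs)
    case (Cons u xs)
    obtain l m where u: "u = (l,m)" by (cases u)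
    then have "l \<in> L" "m \<in> A" using Cons.prems by auto
    from sc[OF this h(4)] show ?case using Cons unfolding u by (simp add: I[of m] algebra_simps)
  qed simp
  then show "(x * x', y * y') \<in> tens L A \<sigma>" using tensI[of pr L A \<sigma>] h by (simp add: I_def)
qed

lemma tens_L: "sring A \<Longrightarrow> \<sigma> 1 = 1 \<Longrightarrow> l \<in> L \<Longrightarrow> (l, l) \<in> tens L A \<sigma>"
  using tensI[of "[(l,1)]" L A \<sigma>] sring_1[of A] by simp

lemma tens_A: "sring L \<Longrightarrow> m \<in> A \<Longrightarrow> (m, \<sigma> m) \<in> tens L A \<sigma>"
  using tensI[of "[(1,m)]" L A \<sigma>] sring_1[of L] by simp

text \<open>The coefficients \<open>d\<close> come from the list alone and serve all \<sigma> at
  once; this uniformity allows a sum and its twist to be compared coefficient by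
  coefficient.\<close>

lemma val_normal:
  assumes "sring A" "C \<subseteq> A" and c: "\<And>t s. t \<in> T \<Longrightarrow> s \<in> S \<Longrightarrow> c t s \<in> C" "\<And>t. t \<in> T \<Longrightarrow> t = (\<Sum>s\<in>S. c t s * s)"
    and xs: "set xs \<subseteq> T \<times> A"
  shows "\<exists>d. (\<forall>s\<in>S. d s \<in> A) \<and> (\<forall>\<sigma>. \<sigma> 0 = 0 \<longrightarrow> (\<forall>x\<in>A. \<forall>y\<in>A. \<sigma> (x + y) = \<sigma> x + \<sigma> y \<and> \<sigma> (x * y) = \<sigma> x * \<sigma> y) \<longrightarrow>
     (\<forall>x\<in>C. \<sigma> x = x) \<longrightarrow> val \<sigma> xs = (\<Sum>s\<in>S. \<sigma> (d s) * s))"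
  using xs
proof (induction xs)
  case Nil
  then show ?case by (intro exI[of _ "\<lambda>_. 0"]) (auto simp: sring_0[OF assms(1)])
next
  case (Cons u xs)
  obtain t m where u: "u = (t,m)" by (cases u)
  have tm: "t \<in> T" "m \<in> A" using Cons.prems u by auto
  obtain d where d: "\<forall>s\<in>S. d s \<in> A" "\<And>\<sigma>. \<sigma> 0 = 0 \<Longrightarrow> (\<forall>x\<in>A. \<forall>y\<in>A. \<sigma> (x + y) = \<sigma> x + \<sigma> y \<and> \<sigma> (x * y) = \<sigma> x * \<sigma> y) \<Longrightarrow>
     (\<forall>x\<in>C. \<sigma> x = x) \<Longrightarrow> val \<sigma> xs = (\<Sum>s\<in>S. \<sigma> (d s) * s)" using Cons by auto
  have ca: "c t s * m \<in> A" if "s \<in> S" for s using c(1)[OF tm(1) that] assms(2) tm(2) sring_mult[OF assms(1)] by blast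
  show ?case
  proof (intro exI[of _ "\<lambda>s. c t s * m + d s"] conjI allI impI ballI)
    show "c t s * m + d s \<in> A" if "s \<in> S" for s using sring_add[OF assms(1) ca[OF that]] d(1) that by blast
    fix \<sigma> :: "'a \<Rightarrow> 'a" assume s: "\<sigma> 0 = 0" "\<forall>x\<in>A. \<forall>y\<in>A. \<sigma> (x + y) = \<sigma> x + \<sigma> y \<and> \<sigma> (x * y) = \<sigma> x * \<sigma> y" "\<forall>x\<in>C. \<sigma> x = x"
    have e: "\<sigma> (c t s * m + d s) * s = c t s * s * \<sigma> m + \<sigma> (d s) * s" if "s \<in> S" for s
    proof -
      have cs: "c t s \<in> C" "c t s \<in> A" using c(1)[OF tm(1) that] assms(2) by auto
      have "\<sigma> (c t s * m + d s) = \<sigma> (c t s * m) + \<sigma> (d s)" using s(2) ca[OF that] d(1) that by blast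
      also have "\<sigma> (c t s * m) = c t s * \<sigma> m" using s(2,3) cs tm(2) by metis
      finally show ?thesis by (simp add: algebra_simps)
    qed
    have "(\<Sum>s\<in>S. \<sigma> (c t s * m + d s) * s) = (\<Sum>s\<in>S. c t s * s) * \<sigma> m + val \<sigma> xs"
      unfolding d(2)[OF s] sum_distrib_right sum.distrib[symmetric] by (rule sum.cong[OF refl e])
    then show "val \<sigma> (u # xs) = (\<Sum>s\<in>S. \<sigma> (c t s * m + d s) * s)" unfolding u using c(2)[OF tm(1)] by simp
  qed
qed

section \<open>Linear disjointness over an algebraically closed intersection\<close>

locale ld_pair =
  fixes L M :: "'a::field set"
  assumes L: "alg_closed_subfield L" and M: "alg_closed_subfield M"
    and disj: "linearly_disjoint (L \<inter> M) M L"
begin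

abbreviation "C \<equiv> L \<inter> M"

lemmas Lf = alg_closed_subfieldD[OF L] and Mf = alg_closed_subfieldD[OF M]
lemmas Ls = subfield_sring[OF Lf] and Ms = subfield_sring[OF Mf]

lemma Cf: "subfield C"
  using Lf Mf by (auto simp: subfield_def)

lemmas Cs = subfield_sring[OF Cf]

lemma C_roots: "p \<in> pol C \<Longrightarrow> p \<noteq> 0 \<Longrightarrow> poly p x = 0 \<Longrightarrow> x \<in> C"
  using alg_closed_roots[OF L, of p x] alg_closed_roots[OF M, of p x] pol_mono[of C L] pol_mono[of C M] by blast

lemma indep_M:
  assumes "S \<subseteq> L" "lin_indep_over C S" "\<forall>s\<in>S. m s \<in> M" "(\<Sum>s\<in>S. m s * s) = 0" "s \<in> S"
  shows "m s = 0"
proof -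
  have "lin_indep_over M S" using disj assms(1,2) by (simp add: linearly_disjoint_def)
  then show ?thesis using assms(3-5) by (simp add: lin_indep_over_def)
qed

definition chom :: "'a set \<Rightarrow> ('a \<Rightarrow> 'a) \<Rightarrow> bool" where
  "chom A \<sigma> \<longleftrightarrow> \<sigma> 0 = 0 \<and> (\<forall>x\<in>A. \<forall>y\<in>A. \<sigma> (x + y) = \<sigma> x + \<sigma> y \<and> \<sigma> (x * y) = \<sigma> x * \<sigma> y) \<and> (\<forall>x\<in>C. \<sigma> x = x)"

text \<open>\<open>S\<close> is an independent replacement for the left factors \<open>T\<close>:
  every tensor over \<open>T\<close> is rewritten over \<open>S\<close>, with coefficients from the
  same ring \<open>A\<close> and in a way that respects every homomorphism over
  \<open>C\<close>.\<close>

definition nform :: "'a set \<Rightarrow> 'a set \<Rightarrow> bool" where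
  "nform S T \<longleftrightarrow> finite S \<and> S \<subseteq> L \<and> lin_indep_over C S \<and>
     (\<forall>A xs. sring A \<longrightarrow> C \<subseteq> A \<longrightarrow> set xs \<subseteq> T \<times> A \<longrightarrow> (\<exists>d. (\<forall>s\<in>S. d s \<in> A) \<and>
      (\<forall>\<sigma>. chom A \<sigma> \<longrightarrow> val \<sigma> xs = (\<Sum>s\<in>S. \<sigma> (d s) * s))))"

lemma nformD:
  assumes "nform S T" "sring A" "C \<subseteq> A" "set xs \<subseteq> T \<times> A"
  shows "\<exists>d. (\<forall>s\<in>S. d s \<in> A) \<and> (\<forall>\<sigma>. chom A \<sigma> \<longrightarrow> val \<sigma> xs = (\<Sum>s\<in>S. \<sigma> (d s) * s))"
  using assms unfolding nform_def by blast

lemma chom_id: "chom A id"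
  by (simp add: chom_def)

lemma normal_form:
  assumes T: "finite T" "T \<subseteq> L"
  shows "\<exists>S. nform S T"
proof -
  obtain S where S: "S \<subseteq> T" "lin_indep_over C S" "\<forall>t\<in>T. \<exists>c. (\<forall>s\<in>S. c s \<in> C) \<and> t = (\<Sum>s\<in>S. c s * s)"
    using indep_basis[OF Cf T(1)] by blast
  obtain c where c: "\<And>t s. t \<in> T \<Longrightarrow> s \<in> S \<Longrightarrow> c t s \<in> C" "\<And>t. t \<in> T \<Longrightarrow> t = (\<Sum>s\<in>S. c t s * s)"
    using S(3) by metis
  have SL: "finite S" "S \<subseteq> L" using S(1) T finite_subset by auto
  have "nform S T"
    unfolding nform_def
  proof (intro conjI allI impI SL S(2))
    fix A xs assume A: "sring A" "C \<subseteq> A" "set xs \<subseteq> T \<times> A"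
    show "\<exists>d. (\<forall>s\<in>S. d s \<in> A) \<and> (\<forall>\<sigma>. chom A \<sigma> \<longrightarrow> val \<sigma> xs = (\<Sum>s\<in>S. \<sigma> (d s) * s))"
      using val_normal[OF A(1,2) c A(3)] by (simp add: chom_def imp_conjL)
  qed
  then show ?thesis ..
qed

definition trans :: "'a set \<Rightarrow> 'a \<Rightarrow> bool" where
  "trans A t \<longleftrightarrow> (\<forall>p\<in>pol A. poly p t = 0 \<longrightarrow> p = 0)"

text \<open>\<open>F\<close> is maximal among the subrings of \<open>M\<close> that contain
  \<open>C\<close> and over which \<open>t\<close> is transcendental. For \<open>x\<close> in
  \<open>M\<close>, either \<open>F[x]\<close> still has this property and \<open>x\<close> lies in
  \<open>F\<close>, or a relation for \<open>t\<close> over \<open>F[x]\<close> can be read as one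
  for \<open>x\<close> over \<open>F[t]\<close>.\<close>

lemma exists_F:
  assumes t: "t \<in> M" "t \<notin> L"
  obtains F where "sring F" "C \<subseteq> F" "F \<subseteq> M" "trans F t"
    "\<And>x. x \<in> M \<Longrightarrow> alg_over (frac (adj F t)) x"
proof -
  define A where "A = {F. sring F \<and> C \<subseteq> F \<and> F \<subseteq> M \<and> trans F t}"
  have "trans C t" unfolding trans_def using C_roots t(2) by blast
  then have CA: "C \<in> A" using Cs by (auto simp: A_def)
  have "\<exists>F\<in>A. \<forall>X\<in>A. F \<subseteq> X \<longrightarrow> X = F"
  proof (rule subset_Zorn_nonempty)
    show "A \<noteq> {}" using CA by blast
    fix Z assume Z: "Z \<noteq> {}" "subset.chain A Z"
    have ZA: "Z \<subseteq> A" using Z(2) by (simp add: subset.chain_def)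
    obtain F0 where F0: "F0 \<in> Z" using Z by auto
    have common: "\<exists>F\<in>Z. u \<in> F \<and> v \<in> F" if uv: "u \<in> \<Union>Z" "v \<in> \<Union>Z" for u v
    proof -
      obtain g h where gh: "g \<in> Z" "h \<in> Z" "u \<in> g" "v \<in> h" using uv by blast
      then have "g \<subseteq> h \<or> h \<subseteq> g" using Z(2) by (auto simp: subset.chain_def)
      then show ?thesis using gh by blast
    qed
    have common_fin: "\<exists>F\<in>Z. U \<subseteq> F" if "finite U" "U \<subseteq> \<Union>Z" for U
      using that
    proof (induction U rule: finite_induct)
      case empty
      then show ?case using F0 by blast
    next
      case (insert u U)
      then obtain F1 F2 where F: "F1 \<in> Z" "U \<subseteq> F1" "F2 \<in> Z" "u \<in> F2" by auto
      then have "F1 \<subseteq> F2 \<or> F2 \<subseteq> F1" using Z(2) unfolding subset.chain_def by blast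
      then show ?case using F by blast
    qed
    have sr: "sring F" if "F \<in> Z" for F using that ZA by (auto simp: A_def)
    have "sring (\<Union>Z)"
    proof (rule sringI)
      show "0 \<in> \<Union>Z" "1 \<in> \<Union>Z" using F0 sring_0[OF sr[OF F0]] sring_1[OF sr[OF F0]] by blast+
      fix x y assume "x \<in> \<Union>Z" "y \<in> \<Union>Z"
      from common[OF this] obtain F where F: "F \<in> Z" "x \<in> F" "y \<in> F" by blast
      note R = sr[OF F(1)]
      show "x + y \<in> \<Union>Z" "x - y \<in> \<Union>Z" "x * y \<in> \<Union>Z"
        using F(1) sring_add[OF R F(2,3)] sring_diff[OF R F(2,3)] sring_mult[OF R F(2,3)] by blast+
    qed
    moreover have "C \<subseteq> \<Union>Z" using F0 ZA by (auto simp: A_def)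
    moreover have "\<Union>Z \<subseteq> M" using ZA by (auto simp: A_def)
    moreover have "trans (\<Union>Z) t"
      unfolding trans_def
    proof (intro ballI impI)
      fix p assume p: "p \<in> pol (\<Union>Z)" "poly p t = 0"
      have "range (coeff p) \<subseteq> \<Union>Z" using p(1) by (auto simp: pol_def)
      then obtain F where F: "F \<in> Z" "range (coeff p) \<subseteq> F"
        using common_fin[of "range (coeff p)"] range_coeff[of p] by auto
      have "p \<in> pol F" using F(2) by (auto simp: pol_def)
      moreover have "trans F t" using F(1) ZA by (auto simp: A_def)
      ultimately show "p = 0" using p(2) by (simp add: trans_def)
    qed
    ultimately show "\<Union>Z \<in> A" by (simp add: A_def)
  qed
  then obtain F where F: "F \<in> A" and max: "\<And>X. X \<in> A \<Longrightarrow> F \<subseteq> X \<Longrightarrow> X = F" by blast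
  have F1: "sring F" "C \<subseteq> F" "F \<subseteq> M" "trans F t" using F by (auto simp: A_def)
  define K1 where "K1 = frac (adj F t)"
  have tR: "sring (adj F t)" by (rule adj_sring[OF F1(1)])
  have K1: "subfield K1" unfolding K1_def by (rule frac_subfield[OF tR])
  have FtK: "poly q t \<in> K1" if "q \<in> pol F" for q
    unfolding K1_def using frac_subset[OF tR] that by (auto simp: adj_def)
  have "alg_over K1 x" if x: "x \<in> M" for x
  proof (cases "trans (adj F x) t")
    case True
    have "adj F x \<in> A"
      unfolding A_def using True adj_sring[OF F1(1)] adj_subset[OF F1(1), of x] F1(2) adj_least[OF Ms F1(3) x] by auto
    then have "x \<in> F" using max[OF _ adj_subset[OF F1(1)]] adj_self[OF F1(1), of x] by blast
    then have "[:x:] \<in> pol F" by (rule pol_const[OF F1(1)])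
    from FtK[OF this] have "x \<in> K1" by simp
    then show ?thesis
      unfolding alg_over_def using pol_linear[OF subfield_sring[OF K1]] by (intro bexI[of _ "[:-x,1:]"]) auto
  next
    case False
    then obtain f where f: "f \<in> pol (adj F x)" "poly f t = 0" "f \<noteq> 0" by (auto simp: trans_def)
    have "\<forall>j. \<exists>q\<in>pol F. coeff f j = poly q x" using polD[OF f(1)] by (auto simp: adj_def)
    then obtain q where q: "\<And>j. q j \<in> pol F" "\<And>j. coeff f j = poly (q j) x" by metis
    define J where "J = degree f"
    define I where "I = Max ((\<lambda>j. degree (q j)) ` {..J})"
    have I: "degree (q j) \<le> I" if "j \<le> J" for j unfolding I_def using that by (intro Max_ge) auto
    \<comment> \<open>The relation is a polynomial in \<open>x\<close> and \<open>t\<close>; its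
      terms are now sorted by powers of \<open>x\<close> instead of powers of \<open>t\<close>.
      Transcendence of \<open>t\<close> over \<open>F\<close> keeps some coefficient
      nonzero.\<close>
    define P where "P i = (\<Sum>j\<le>J. monom (coeff (q j) i) j)" for i
    have PF: "P i \<in> pol F" for i unfolding P_def
      by (intro sring_sum[OF sring_pol[OF F1(1)]] pol_monom[OF F1(1)] polD[OF q(1)])
    define h where "h = (\<Sum>i\<le>I. monom (poly (P i) t) i)"
    have hp: "h \<in> pol K1" unfolding h_def
      by (intro sring_sum[OF sring_pol[OF subfield_sring[OF K1]]] pol_monom[OF subfield_sring[OF K1]] FtK PF)
    have "poly h x = (\<Sum>i\<le>I. \<Sum>j\<le>J. coeff (q j) i * t ^ j * x ^ i)"
      unfolding h_def P_def by (simp add: poly_sum poly_monom sum_distrib_right)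
    also have "\<dots> = (\<Sum>j\<le>J. (\<Sum>i\<le>I. coeff (q j) i * x ^ i) * t ^ j)"
      unfolding sum_distrib_right by (subst sum.swap) (simp add: mult_ac)
    also have "\<dots> = (\<Sum>j\<le>J. coeff f j * t ^ j)"
      by (rule sum.cong[OF refl]) (use q(2) poly_sum_le[OF I, of _ x] in simp)
    also have "\<dots> = 0" using f(2) by (simp add: poly_altdef J_def)
    finally have hx: "poly h x = 0" .
    have "coeff f J \<noteq> 0" using f(3) by (simp add: J_def)
    then have "q J \<noteq> 0" using q(2)[of J] by auto
    then obtain i where i: "coeff (q J) i \<noteq> 0" by (metis leading_coeff_0_iff)
    have "i \<le> I" using I[of J] le_degree[OF i] by simp
    have "coeff (P i) J \<noteq> 0" using i by (simp add: P_def coeff_sum)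
    then have "P i \<noteq> 0" by auto
    then have "poly (P i) t \<noteq> 0" using F1(4) PF by (auto simp: trans_def)
    moreover have "coeff h i = poly (P i) t" using \<open>i \<le> I\<close> by (simp add: h_def coeff_sum)
    ultimately have "h \<noteq> 0" by auto
    then show ?thesis unfolding alg_over_def using hp hx by blast
  qed
  then show ?thesis using that[OF F1] by (simp add: K1_def)
qed

text \<open>Coefficients in \<open>L[F]\<close> are written over a set \<open>S\<close> in
  \<open>L\<close> independent over \<open>C\<close>. Linear disjointness makes \<open>S\<close>
  independent over \<open>M\<close>, which contains \<open>t\<close>, so a relation for
  \<open>t\<close> over \<open>L[F]\<close> splits into relations over \<open>F\<close>.\<close>

lemma trans_tens:
  assumes F: "sring F" "C \<subseteq> F" "F \<subseteq> M" "trans F t" "t \<in> M"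
  shows "trans (Domain (tens L F id)) t"
  unfolding trans_def
proof (intro ballI impI)
  fix p assume p: "p \<in> pol (Domain (tens L F id))" "poly p t = 0"
  have "\<forall>j. \<exists>xs. set xs \<subseteq> L \<times> F \<and> coeff p j = val id xs" using polD[OF p(1)] by (fastforce simp: tens_def)
  then obtain xs where xs: "\<And>j. set (xs j) \<subseteq> L \<times> F" "\<And>j. coeff p j = val id (xs j)" by metis
  define T where "T = (\<Union>j\<le>degree p. fst ` set (xs j))"
  have T: "finite T" "T \<subseteq> L" using xs(1) by (fastforce simp: T_def)+
  obtain S where ST: "nform S T" using normal_form[OF T] by blast
  then have S: "finite S" "S \<subseteq> L" "lin_indep_over C S" by (simp_all add: nform_def)
  have "\<exists>d. (\<forall>s\<in>S. d s \<in> F) \<and> val id (xs j) = (\<Sum>s\<in>S. d s * s)" if j: "j \<le> degree p" for j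
  proof -
    have "set (xs j) \<subseteq> T \<times> F" using xs(1)[of j] j by (force simp: T_def)
    from nformD[OF ST F(1,2) this] obtain d where d: "\<forall>s\<in>S. d s \<in> F"
        "\<forall>\<sigma>. chom F \<sigma> \<longrightarrow> val \<sigma> (xs j) = (\<Sum>s\<in>S. \<sigma> (d s) * s)" by blast
    from d(1) d(2)[rule_format, OF chom_id] show ?thesis by (intro exI[of _ d]) simp
  qed
  then obtain d where d: "\<And>j s. j \<le> degree p \<Longrightarrow> s \<in> S \<Longrightarrow> d j s \<in> F"
    "\<And>j. j \<le> degree p \<Longrightarrow> val id (xs j) = (\<Sum>s\<in>S. d j s * s)" by metis
  have "0 = (\<Sum>j\<le>degree p. coeff p j * t ^ j)" using p(2) by (simp add: poly_altdef)
  also have "\<dots> = (\<Sum>j\<le>degree p. \<Sum>s\<in>S. d j s * s * t ^ j)"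
    by (rule sum.cong[OF refl]) (simp add: xs(2) d(2) sum_distrib_right)
  also have "\<dots> = (\<Sum>s\<in>S. (\<Sum>j\<le>degree p. d j s * t ^ j) * s)"
    unfolding sum_distrib_right by (subst sum.swap) (simp add: mult_ac)
  finally have z: "(\<Sum>s\<in>S. (\<Sum>j\<le>degree p. d j s * t ^ j) * s) = 0" by simp
  have cM: "\<forall>s\<in>S. (\<Sum>j\<le>degree p. d j s * t ^ j) \<in> M"
    using d(1) F(3,5) by (auto intro!: sring_sum[OF Ms] sring_mult[OF Ms] sring_power[OF Ms])
  have dz: "d j s = 0" if js: "j \<le> degree p" "s \<in> S" for j s
  proof -
    have "(\<Sum>j\<le>degree p. d j s * t ^ j) = 0" by (rule indep_M[OF S(2,3) cM z js(2)])
    then have "poly (\<Sum>j\<le>degree p. monom (d j s) j) t = 0" by (simp add: poly_sum poly_monom)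
    moreover have "(\<Sum>j\<le>degree p. monom (d j s) j) \<in> pol F"
      using d(1) js(2) by (intro sring_sum[OF sring_pol[OF F(1)]] pol_monom[OF F(1)]) auto
    ultimately have "(\<Sum>j\<le>degree p. monom (d j s) j) = 0" using F(4) by (simp add: trans_def)
    then have "coeff (\<Sum>j\<le>degree p. monom (d j s) j) j = 0" by simp
    then show ?thesis using js(1) by (simp add: coeff_sum)
  qed
  have "coeff p j = 0" for j
  proof (cases "j \<le> degree p")
    case True
    then show ?thesis using xs(2)[of j] d(2) dz by simp
  qed (simp add: coeff_eq_0)
  then show "p = 0" by (simp add: poly_eq_iff)
qed

text \<open>\<open>C\<close> contains the roots of its polynomials, so the powers of
  \<open>a\<close> are independent over \<open>C\<close> and, by linear disjointness, over
  \<open>M\<close>. This is why nonzero polynomials over \<open>F\<close> have order 0 at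
  \<open>a\<close>.\<close>

lemma no_root_L:
  assumes a: "a \<in> L" "a \<notin> C" and h: "h \<in> pol M" "poly h a = 0"
  shows "h = 0"
proof -
  define n where "n = degree h"
  \<comment> \<open>Independence is a property of sets, so the powers must first be pairwise
    distinct.\<close>
  have inj: "inj_on (\<lambda>i. a ^ i) {..n}"
  proof (rule inj_onI, rule ccontr)
    fix i j assume ij: "a ^ i = a ^ j" "i \<noteq> j"
    define p where "p = (monom 1 i - monom 1 j :: 'a poly)"
    have "p \<in> pol C" unfolding p_def by (intro sring_diff[OF sring_pol[OF Cs]] pol_monom[OF Cs] sring_1[OF Cs])
    moreover have "p \<noteq> 0" using ij by (simp add: p_def monom_eq_iff')
    moreover have "poly p a = 0" using ij by (simp add: p_def poly_monom)
    ultimately show False using C_roots a by blast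
  qed
  define S where "S = (\<lambda>i. a ^ i) ` {..n}"
  have SL: "S \<subseteq> L" using sring_power[OF Ls a(1)] by (auto simp: S_def)
  have "lin_indep_over C S"
    unfolding lin_indep_over_def
  proof (intro conjI allI impI)
    show "finite S" by (simp add: S_def)
    fix c assume c: "\<forall>s\<in>S. c s \<in> C" "(\<Sum>s\<in>S. c s * s) = 0"
    define p where "p = (\<Sum>i\<le>n. monom (c (a ^ i)) i)"
    have "p \<in> pol C" unfolding p_def using c(1)
      by (intro sring_sum[OF sring_pol[OF Cs]] pol_monom[OF Cs]) (auto simp: S_def)
    moreover have "poly p a = 0"
      using c(2) sum.reindex[OF inj, of "\<lambda>s. c s * s"] by (simp add: p_def poly_sum poly_monom S_def)
    ultimately have "p = 0" using C_roots a by blast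
    have "c (a ^ i) = 0" if "i \<le> n" for i
    proof -
      have "coeff p i = c (a ^ i)" using that by (simp add: p_def coeff_sum)
      then show ?thesis using \<open>p = 0\<close> by simp
    qed
    then show "\<forall>s\<in>S. c s = 0" by (auto simp: S_def)
  qed
  define m where "m s = coeff h (inv_into {..n} (\<lambda>i. a ^ i) s)" for s
  have m: "m (a ^ i) = coeff h i" if "i \<le> n" for i using inv_into_f_f[OF inj] that by (simp add: m_def)
  have "(\<Sum>s\<in>S. m s * s) = (\<Sum>i\<le>n. coeff h i * a ^ i)"
    unfolding S_def sum.reindex[OF inj] by (simp add: m)
  also have "\<dots> = 0" using h(2) by (simp add: poly_altdef n_def)
  finally have z: "(\<Sum>s\<in>S. m s * s) = 0" .
  have mM: "\<forall>s\<in>S. m s \<in> M" using polD[OF h(1)] by (simp add: m_def)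
  have "coeff h i = 0" for i
  proof (cases "i \<le> n")
    case True
    then have "a ^ i \<in> S" by (auto simp: S_def)
    from indep_M[OF SL \<open>lin_indep_over C S\<close> mM z this] show ?thesis using m[OF True] by simp
  qed (simp add: coeff_eq_0 n_def)
  then show ?thesis by (simp add: poly_eq_iff)
qed

end

section \<open>The action of the automorphisms of \<open>M\<close> over \<open>F(t)\<close> on the
  compositum\<close>

locale ld_trans = ld_pair L M for L M :: "'a::field set" +
  fixes t :: 'a and F :: "'a set"
  assumes t: "t \<in> M" "t \<notin> L" and F: "sring F" "C \<subseteq> F" "F \<subseteq> M" "trans F t"
    and alg_M: "x \<in> M \<Longrightarrow> alg_over (frac (adj F t)) x"
begin

text \<open>The field \<open>F(t)\<close>, over which \<open>M\<close> is algebraic.\<close>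

definition K1 :: "'a set" where "K1 = frac (adj F t)"

text \<open>The ring \<open>L[M]\<close>, whose fraction field contains the compositum.\<close>

definition R :: "'a set" where "R = Domain (tens L M id)"

definition R0 :: "'a set" where "R0 = Domain (tens L F id)"

text \<open>The rational functions in \<open>t\<close> over \<open>L[F]\<close>. As \<open>t\<close>
  is transcendental over \<open>R0\<close>, identities in \<open>Q\<close> become polynomial
  identities, in which orders at points of \<open>L\<close> make sense.\<close>

definition Q :: "'a set" where "Q = frac (adj R0 t)"

lemma K1_M: "K1 \<subseteq> M"
  using adj_least[OF Ms F(3) t(1)] subfield_divide[OF Mf] by (auto simp: K1_def frac_def)

sublocale G: galois K1 M
  using frac_subfield[OF adj_sring[OF F(1)]] M K1_M alg_M by unfold_locales (auto simp: K1_def)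

lemma F_K1: "F \<subseteq> K1" and t_K1: "t \<in> K1"
  using adj_subset[OF F(1), of t] adj_self[OF F(1), of t] frac_subset[OF adj_sring[OF F(1)], of t]
  by (auto simp: K1_def)

lemma chom_gal: "\<sigma> \<in> gal K1 M \<Longrightarrow> chom M \<sigma>"
  using F_K1 F(2) by (auto simp: chom_def G.gal_0 G.gal_add G.gal_times intro: G.gal_K)

lemma tens_gal: "\<sigma> \<in> gal K1 M \<Longrightarrow> pring (tens L M \<sigma>)"
  by (rule tens_pring[OF Ls Ms]) (auto simp: G.gal_1 G.gal_times)

text \<open>In normal form the two values have coefficients \<open>d s\<close> and
  \<open>\<sigma> (d s)\<close> on the same \<open>M\<close>-independent set, so they vanish
  together. Hence the relation is the graph of an injective homomorphism: \<sigma> acts on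
  \<open>L[M]\<close> and fixes \<open>L\<close>.\<close>

lemma tens_0_iff:
  assumes s: "\<sigma> \<in> gal K1 M" and u: "(u,u') \<in> tens L M \<sigma>"
  shows "u = 0 \<longleftrightarrow> u' = 0"
proof -
  obtain xs where xs: "set xs \<subseteq> L \<times> M" "u = val id xs" "u' = val \<sigma> xs" using u by (auto simp: tens_def)
  define T where "T = fst ` set xs"
  have T: "finite T" "T \<subseteq> L" "set xs \<subseteq> T \<times> M" using xs(1) by (force simp: T_def)+
  obtain S where ST: "nform S T" using normal_form[OF T(1,2)] by blast
  then have S: "finite S" "S \<subseteq> L" "lin_indep_over C S" by (simp_all add: nform_def)
  obtain d where d: "\<forall>s\<in>S. d s \<in> M" "\<forall>\<sigma>. chom M \<sigma> \<longrightarrow> val \<sigma> xs = (\<Sum>s\<in>S. \<sigma> (d s) * s)"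
    using nformD[OF ST Ms _ T(3)] by auto
  have u1: "u = (\<Sum>s\<in>S. d s * s)" using d(2)[rule_format, OF chom_id] xs(2) by simp
  have u2: "u' = (\<Sum>s\<in>S. \<sigma> (d s) * s)" using d(2)[rule_format, OF chom_gal[OF s]] xs(3) by simp
  have sd: "\<forall>s\<in>S. \<sigma> (d s) \<in> M" using d(1) G.gal_O[OF s] by blast
  show ?thesis
  proof
    assume "u = 0"
    then have "d r = 0" if "r \<in> S" for r using indep_M[OF S(2,3) d(1) _ that] u1 by simp
    then show "u' = 0" using u2 G.gal_0[OF s] by simp
  next
    assume "u' = 0"
    then have "\<sigma> (d r) = 0" if "r \<in> S" for r using indep_M[OF S(2,3) sd _ that] u2 by simp
    then have "d r = 0" if "r \<in> S" for r using G.gal_eq_0[OF s] d(1) that by blast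
    then show "u = 0" using u1 by simp
  qed
qed

lemma tens_total: "u \<in> R \<Longrightarrow> \<exists>u'. (u,u') \<in> tens L M \<sigma>"
  by (auto simp: R_def tens_def)

lemma Domain_sring: "pring (tens L A id) \<Longrightarrow> sring (Domain (tens L A id))"
proof -
  assume "pring (tens L A id)"
  moreover have "tens L A id = Id_on (Domain (tens L A id))" by (auto simp: tens_def)
  ultimately show ?thesis by (simp add: sring_def)
qed

lemma R_sring: "sring R"
  unfolding R_def by (intro Domain_sring tens_pring[OF Ls Ms]) auto

lemma R0_sring: "sring R0"
  unfolding R0_def by (intro Domain_sring tens_pring[OF Ls F(1)]) auto

lemma compositum_subset: "compositum L M \<subseteq> frac R"
proof -
  have "L \<subseteq> R" using tens_L[OF Ms, of id _ L] by (auto simp: R_def)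
  moreover have "M \<subseteq> R" using tens_A[OF Ls, of _ M id] by (auto simp: R_def)
  ultimately show ?thesis
    unfolding compositum_def using frac_subfield[OF R_sring] frac_subset[OF R_sring] by blast
qed

text \<open>The action passes to fractions. It is recorded through the value \<open>y'\<close> and
  its compatibility with all representations of \<open>y\<close>, so that no map on the whole
  fraction field has to be set up.\<close>

lemma twist:
  assumes y: "y \<in> frac R" and s: "\<sigma> \<in> gal K1 M"
  shows "\<exists>y'. \<forall>u u' v v'. (u,u') \<in> tens L M \<sigma> \<longrightarrow> (v,v') \<in> tens L M \<sigma> \<longrightarrow> u = y * v \<longrightarrow> u' = y' * v'"
proof -
  note P = tens_gal[OF s]
  obtain u0 v0 where uv: "u0 \<in> R" "v0 \<in> R" "v0 \<noteq> 0" "y = u0 / v0" using frac_obtain[OF y R_sring] by blast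
  obtain u0' where u0: "(u0,u0') \<in> tens L M \<sigma>" using tens_total[OF uv(1)] by blast
  obtain v0' where v0: "(v0,v0') \<in> tens L M \<sigma>" using tens_total[OF uv(2)] by blast
  have v0': "v0' \<noteq> 0" using tens_0_iff[OF s v0] uv(3) by simp
  show ?thesis
  proof (intro exI[of _ "u0' / v0'"] allI impI)
    fix u u' v v' assume h: "(u,u') \<in> tens L M \<sigma>" "(v,v') \<in> tens L M \<sigma>" "u = y * v"
    have "(u * v0 - u0 * v, u' * v0' - u0' * v') \<in> tens L M \<sigma>"
      by (intro pring_diff[OF P] pring_mult[OF P] h u0 v0)
    from tens_0_iff[OF s this] have "u' * v0' - u0' * v' = 0" using h(3) uv(3,4) by simp
    then show "u' = u0' / v0' * v'" using v0' by (simp add: field_simps)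
  qed
qed

definition smS :: "'a set \<Rightarrow> ('a \<Rightarrow> 'a) \<Rightarrow> 'a" where
  "smS S m = (\<Sum>s\<in>S. m s * s)"

text \<open>A representation \<open>y = smS S n / smS S m\<close> with \<open>m\<close> of minimal support and a coefficient \<open>1\<close>
  must be fixed by every \<open>\<sigma>\<close>, since the difference with its twist has smaller support.\<close>

lemma minimal_support:
  assumes y: "y \<in> frac R" and \<alpha>: "\<And>\<sigma>. \<sigma> \<in> gal K1 M \<Longrightarrow> \<alpha> \<sigma> \<in> C \<and> \<alpha> \<sigma> \<noteq> 0 \<and> \<beta> \<sigma> \<in> C"
    and tw: "\<And>\<sigma> u u' v v'. \<sigma> \<in> gal K1 M \<Longrightarrow> (u,u') \<in> tens L M \<sigma> \<Longrightarrow> (v,v') \<in> tens L M \<sigma> \<Longrightarrow> u = y * v \<Longrightarrow>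
        u' = (\<alpha> \<sigma> * y + \<beta> \<sigma>) * v'"
  obtains S m n s1 where "finite S" "S \<subseteq> L" "s1 \<in> S" "m s1 = 1" "\<And>s. s \<in> S \<Longrightarrow> m s \<in> M \<and> n s \<in> M"
    "smS S m \<noteq> 0" "y * smS S m = smS S n"
    "\<And>\<sigma> s. \<sigma> \<in> gal K1 M \<Longrightarrow> s \<in> S \<Longrightarrow> \<sigma> (m s) = m s \<and> \<sigma> (n s) = \<alpha> \<sigma> * n s + \<beta> \<sigma> * m s"
proof -
  obtain u0 v0 where uv: "u0 \<in> R" "v0 \<in> R" "v0 \<noteq> 0" "y = u0 / v0" using frac_obtain[OF y R_sring] by blast
  obtain xs where xs: "set xs \<subseteq> L \<times> M" "u0 = val id xs" using uv(1) by (auto simp: R_def tens_def)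
  obtain ys where ys: "set ys \<subseteq> L \<times> M" "v0 = val id ys" using uv(2) by (auto simp: R_def tens_def)
  define T where "T = fst ` set xs \<union> fst ` set ys"
  have T: "finite T" "T \<subseteq> L" "set xs \<subseteq> T \<times> M" "set ys \<subseteq> T \<times> M" using xs(1) ys(1) by (force simp: T_def)+
  obtain S where ST: "nform S T" using normal_form[OF T(1,2)] by blast
  then have S: "finite S" "S \<subseteq> L" "lin_indep_over C S" by (simp_all add: nform_def)
  obtain n0 where n0: "\<forall>s\<in>S. n0 s \<in> M" "\<forall>\<sigma>. chom M \<sigma> \<longrightarrow> val \<sigma> xs = (\<Sum>s\<in>S. \<sigma> (n0 s) * s)"
    using nformD[OF ST Ms _ T(3)] by auto
  obtain m0 where m0: "\<forall>s\<in>S. m0 s \<in> M" "\<forall>\<sigma>. chom M \<sigma> \<longrightarrow> val \<sigma> ys = (\<Sum>s\<in>S. \<sigma> (m0 s) * s)"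
    using nformD[OF ST Ms _ T(4)] by auto
  define P where "P p \<longleftrightarrow> (\<forall>s\<in>S. fst p s \<in> M \<and> snd p s \<in> M) \<and> (\<exists>s\<in>S. fst p s \<noteq> 0) \<and> y * smS S (fst p) = smS S (snd p)" for p
  have "u0 = smS S n0" "v0 = smS S m0"
    using n0(2)[rule_format, OF chom_id] m0(2)[rule_format, OF chom_id] xs(2) ys(2) by (simp_all add: smS_def)
  moreover have "\<exists>s\<in>S. m0 s \<noteq> 0" using uv(3) \<open>v0 = smS S m0\<close> by (auto simp: smS_def intro: ccontr)
  ultimately have "P (m0,n0)" using uv(3,4) n0(1) m0(1) by (simp add: P_def)
  from ex_has_least_nat[of P, OF this, of "\<lambda>p. card {s\<in>S. fst p s \<noteq> 0}"]
  obtain p where p: "P p" "\<And>p'. P p' \<Longrightarrow> card {s\<in>S. fst p s \<noteq> 0} \<le> card {s\<in>S. fst p' s \<noteq> 0}" by blast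
  obtain s1 where s1: "s1 \<in> S" "fst p s1 \<noteq> 0" using p(1) by (auto simp: P_def)
  define m where "m s = fst p s / fst p s1" for s
  define n where "n s = snd p s / fst p s1" for s
  have mn: "m s \<in> M \<and> n s \<in> M" if "s \<in> S" for s
    using p(1) that s1(1) by (auto simp: P_def m_def n_def intro: subfield_divide[OF Mf])
  have "smS S m = smS S (fst p) / fst p s1" "smS S n = smS S (snd p) / fst p s1"
    by (simp_all add: smS_def m_def n_def sum_divide_distrib)
  then have yeq: "y * smS S m = smS S n" using p(1) by (simp add: P_def)
  have m1: "m s1 = 1" using s1 by (simp add: m_def)
  have mM: "\<forall>s\<in>S. m s \<in> M" using mn by blast
  have m_nz: "smS S m \<noteq> 0" using indep_M[OF S(2,3) mM _ s1(1)] m1 by (auto simp: smS_def)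
  have smR: "(smS S f, smS S (\<lambda>s. \<sigma> (f s))) \<in> tens L M \<sigma>"
    if "\<sigma> \<in> gal K1 M" "\<forall>s\<in>S. f s \<in> M" for \<sigma> f
    unfolding smS_def
    by (intro pring_sum[OF tens_gal[OF that(1)]] pring_mult[OF tens_gal[OF that(1)]] tens_A[OF Ls] tens_L[OF Ms])
       (use that S(2) G.gal_1 in auto)
  have "\<sigma> (m s) = m s \<and> \<sigma> (n s) = \<alpha> \<sigma> * n s + \<beta> \<sigma> * m s" if \<sigma>: "\<sigma> \<in> gal K1 M" and s: "s \<in> S" for \<sigma> s
  proof -
    note a = \<alpha>[OF \<sigma>]
    have aM: "\<alpha> \<sigma> \<in> M" "\<beta> \<sigma> \<in> M" using a by auto
    have nM: "\<forall>s\<in>S. n s \<in> M" using mn by blast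
    have t1: "smS S (\<lambda>s. \<sigma> (n s)) = (\<alpha> \<sigma> * y + \<beta> \<sigma>) * smS S (\<lambda>s. \<sigma> (m s))"
      by (rule tw[OF \<sigma> smR[OF \<sigma> nM] smR[OF \<sigma> mM]]) (simp add: yeq)
    \<comment> \<open>The twisted identity is solved for \<open>y\<close> times the twisted
      denominator, and \<open>y * smS S m = smS S n\<close> is subtracted; at \<open>s1\<close> the
      new denominator has coefficient 0 because \<open>m s1 = 1\<close>.\<close>
    define m' where "m' s = \<sigma> (m s) - m s" for s
    define n' where "n' s = (\<sigma> (n s) - \<beta> \<sigma> * \<sigma> (m s) - \<alpha> \<sigma> * n s) / \<alpha> \<sigma>" for s
    have e: "\<alpha> \<sigma> * smS S n' = smS S (\<lambda>s. \<sigma> (n s)) - \<beta> \<sigma> * smS S (\<lambda>s. \<sigma> (m s)) - \<alpha> \<sigma> * smS S n"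
      unfolding smS_def sum_distrib_left sum_subtractf[symmetric]
    proof (rule sum.cong[OF refl])
      fix s
      have "\<alpha> \<sigma> * n' s = \<sigma> (n s) - \<beta> \<sigma> * \<sigma> (m s) - \<alpha> \<sigma> * n s" using a by (simp add: n'_def)
      then have "\<alpha> \<sigma> * n' s * s = (\<sigma> (n s) - \<beta> \<sigma> * \<sigma> (m s) - \<alpha> \<sigma> * n s) * s" by simp
      then show "\<alpha> \<sigma> * (n' s * s) = \<sigma> (n s) * s - \<beta> \<sigma> * (\<sigma> (m s) * s) - \<alpha> \<sigma> * (n s * s)"
        by (simp add: algebra_simps)
    qed
    have sm: "smS S m' = smS S (\<lambda>s. \<sigma> (m s)) - smS S m"
      by (simp add: smS_def m'_def left_diff_distrib sum_subtractf)
    have "\<alpha> \<sigma> * (y * smS S m') = \<alpha> \<sigma> * smS S n'"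
      unfolding e t1 yeq[symmetric] sm by (simp add: algebra_simps)
    then have ye: "y * smS S m' = smS S n'" using a by simp
    have M': "\<forall>s\<in>S. m' s \<in> M \<and> n' s \<in> M"
      using mn aM G.gal_O[OF \<sigma>]
      by (auto simp: m'_def n'_def intro!: sring_diff[OF Ms] sring_mult[OF Ms] subfield_divide[OF Mf])
    have m0: "m' r = 0" if r: "r \<in> S" for r
    proof (rule ccontr)
      assume "m' r \<noteq> 0"
      then have "P (m',n')" using M' r ye by (auto simp: P_def)
      then have le: "card {s\<in>S. fst p s \<noteq> 0} \<le> card {s\<in>S. m' s \<noteq> 0}" using p(2)[of "(m',n')"] by simp
      have "{s\<in>S. m' s \<noteq> 0} \<subseteq> {s\<in>S. fst p s \<noteq> 0}" using G.gal_0[OF \<sigma>] by (auto simp: m'_def m_def)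
      moreover have "s1 \<notin> {s\<in>S. m' s \<noteq> 0}" using m1 G.gal_1[OF \<sigma>] by (simp add: m'_def)
      ultimately have "{s\<in>S. m' s \<noteq> 0} \<subset> {s\<in>S. fst p s \<noteq> 0}" using s1 by blast
      from psubset_card_mono[OF _ this] show False using le S(1) by simp
    qed
    then have "smS S n' = 0" using ye by (simp add: smS_def)
    then have "n' s = 0" using indep_M[OF S(2,3), of n' s] M' s by (auto simp: smS_def)
    then have "\<sigma> (n s) = \<alpha> \<sigma> * n s + \<beta> \<sigma> * \<sigma> (m s)" using a by (simp add: n'_def algebra_simps)
    then show ?thesis using m0[OF s] by (simp add: m'_def)
  qed
  then show ?thesis using that[OF S(1,2) s1(1) m1 mn m_nz yeq] by blast
qed

lemma frob_sum: "(\<Sum>s\<in>S. f s :: 'a) ^ (pexp TYPE('a) ^ k) = (\<Sum>s\<in>S. f s ^ (pexp TYPE('a) ^ k))"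
proof (cases "CHAR('a) = 0")
  case False
  then have "prime CHAR('a)" using prime_CHAR_semidom by blast
  then show ?thesis using False freshmans_dream_sum'[of "pexp TYPE('a) ^ k" k f S] by (simp add: pexp_def)
qed (simp add: pexp_def)

text \<open>Elements fixed by the automorphisms are purely inseparable over \<open>K1\<close>; for
  finitely many of them the largest exponent serves all.\<close>

lemma common_exponent:
  assumes "finite X" "\<And>x. x \<in> X \<Longrightarrow> x \<in> M \<and> (\<forall>\<sigma>\<in>gal K1 M. \<sigma> x = x)"
  shows "\<exists>k. \<forall>x\<in>X. x ^ (pexp TYPE('a) ^ k) \<in> K1"
proof -
  have "\<forall>x\<in>X. \<exists>k. x ^ (pexp TYPE('a) ^ k) \<in> K1" using G.fixed_pinsep assms(2) by blast
  then obtain k where k: "\<And>x. x \<in> X \<Longrightarrow> x ^ (pexp TYPE('a) ^ k x) \<in> K1" by metis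
  define k0 where "k0 = Max (insert 0 (k ` X))"
  have "x ^ (pexp TYPE('a) ^ k0) \<in> K1" if "x \<in> X" for x
  proof -
    have "k x \<le> k0" unfolding k0_def using that assms(1) by (intro Max_ge) auto
    then have "x ^ (pexp TYPE('a) ^ k0) = (x ^ (pexp TYPE('a) ^ k x)) ^ (pexp TYPE('a) ^ (k0 - k x))"
      by (simp add: power_mult[symmetric] power_add[symmetric])
    then show ?thesis using sring_power[OF G.Ks k[OF that]] by simp
  qed
  then show ?thesis by blast
qed

lemma Q_subfield: "subfield Q"
  unfolding Q_def by (rule frac_subfield[OF adj_sring[OF R0_sring]])

lemma F_R0: "F \<subseteq> R0" and L_R0: "L \<subseteq> R0"
  using tens_A[OF Ls, of _ F id] tens_L[OF F(1), of id _ L] by (auto simp: R0_def)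

lemma K1_Q: "K1 \<subseteq> Q"
proof -
  have "adj F t \<subseteq> adj R0 t" using pol_mono[OF F_R0] by (auto simp: adj_def)
  then show ?thesis by (auto simp: K1_def Q_def frac_def)
qed

lemma L_Q: "L \<subseteq> Q"
  using L_R0 adj_subset[OF R0_sring, of t] frac_subset[OF adj_sring[OF R0_sring], of t] by (auto simp: Q_def)

lemma trans_R0: "trans R0 t"
  unfolding R0_def by (rule trans_tens[OF F t(1)])

lemma Q_poly:
  assumes "x \<in> Q"
  obtains a b where "a \<in> pol R0" "b \<in> pol R0" "b \<noteq> 0" "poly b t \<noteq> 0" "x = poly a t / poly b t"
proof -
  obtain u v where "u \<in> adj R0 t" "v \<in> adj R0 t" "v \<noteq> 0" "x = u / v"
    using frac_obtain[OF _ adj_sring[OF R0_sring]] assms unfolding Q_def by blast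
  then obtain a b where ab: "a \<in> pol R0" "b \<in> pol R0" "poly b t \<noteq> 0" "x = poly a t / poly b t" by (auto simp: adj_def)
  then have "b \<noteq> 0" by auto
  then show ?thesis using that[OF ab(1,2) _ ab(3,4)] by blast
qed

lemma K1_poly:
  assumes "x \<in> K1"
  obtains a b where "a \<in> pol F" "b \<in> pol F" "b \<noteq> 0" "poly b t \<noteq> 0" "x = poly a t / poly b t"
proof -
  obtain u v where "u \<in> adj F t" "v \<in> adj F t" "v \<noteq> 0" "x = u / v"
    using frac_obtain[OF _ adj_sring[OF F(1)]] assms unfolding K1_def by blast
  then obtain a b where ab: "a \<in> pol F" "b \<in> pol F" "poly b t \<noteq> 0" "x = poly a t / poly b t" by (auto simp: adj_def)
  then have "b \<noteq> 0" by auto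
  then show ?thesis using that[OF ab(1,2) _ ab(3,4)] by blast
qed

lemma poly_eqI_R0: "a \<in> pol R0 \<Longrightarrow> b \<in> pol R0 \<Longrightarrow> poly a t = poly b t \<Longrightarrow> a = b"
  using trans_R0 sring_diff[OF sring_pol[OF R0_sring], of a b] unfolding trans_def by (metis eq_iff_diff_eq_0 poly_diff)

lemma order_F: "a \<in> L \<Longrightarrow> a \<notin> C \<Longrightarrow> h \<in> pol F \<Longrightarrow> h \<noteq> 0 \<Longrightarrow> order a h = 0"
  using no_root_L[of a h] pol_mono[OF F(3)] by (auto simp: order_root)

lemma quotient_Q:
  assumes S: "finite S" "S \<subseteq> L" and k: "\<And>s. s \<in> S \<Longrightarrow> f s ^ (pexp TYPE('a) ^ k) \<in> K1" "\<And>s. s \<in> S \<Longrightarrow> m s ^ (pexp TYPE('a) ^ k) \<in> K1"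
  shows "(smS S f / smS S m) ^ (pexp TYPE('a) ^ k) \<in> Q"
proof -
  have "smS S f ^ (pexp TYPE('a) ^ k) \<in> Q" if "\<And>s. s \<in> S \<Longrightarrow> f s ^ (pexp TYPE('a) ^ k) \<in> K1" for f
    unfolding smS_def frob_sum power_mult_distrib
  proof (intro sring_sum[OF subfield_sring[OF Q_subfield]] sring_mult[OF subfield_sring[OF Q_subfield]])
    fix s assume s: "s \<in> S"
    show "f s ^ (pexp TYPE('a) ^ k) \<in> Q" using that[OF s] K1_Q by blast
    show "s ^ (pexp TYPE('a) ^ k) \<in> Q"
      by (rule sring_power[OF subfield_sring[OF Q_subfield]]) (use s S(2) L_Q in blast)
  qed
  then show ?thesis using k by (simp add: power_divide subfield_divide[OF Q_subfield])
qed

section \<open>Independence of the classes of \<open>t - a\<close> and of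
  \<open>1 / (t - a)\<close>\<close>

lemma t_a_tens: "\<sigma> \<in> gal K1 M \<Longrightarrow> a \<in> L \<Longrightarrow> (t - a, t - a) \<in> tens L M \<sigma>"
proof -
  assume s: "\<sigma> \<in> gal K1 M" and a: "a \<in> L"
  have "(t, t) \<in> tens L M \<sigma>" using tens_A[OF Ls t(1), of \<sigma>] G.gal_K[OF s t_K1] by simp
  then show ?thesis using pring_diff[OF tens_gal[OF s] _ tens_L[where \<sigma> = \<sigma>, OF Ms G.gal_1[OF s] a]] by blast
qed

text \<open>The right-hand side is fixed by the twists, so \<open>y\<close> is only multiplied by
  roots of unity in \<open>C\<close>. This splits \<open>y\<close> as \<open>h * w\<close> with
  \<open>h\<close> in \<open>M\<close>, where \<open>h^l\<close> is fixed and \<open>w\<close> is a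
  quotient of sums with fixed coefficients. A power \<open>N\<close> of the characteristic exponent
  brings \<open>h^l\<close> into \<open>F(t)\<close> and \<open>w\<close> into \<open>Q\<close>; at
  \<open>a\<close> the former has order 0, so \<open>N * e a\<close> is a multiple of
  \<open>l\<close>.\<close>

theorem kummer_independent:
  assumes A: "finite A" "A \<subseteq> L - C" and l: "prime l" "l \<noteq> CHAR('a)" and y: "y \<in> compositum L M"
    and eq: "y ^ l = (\<Prod>a\<in>A. (t - a) ^ e a)" and a: "a \<in> A"
  shows "l dvd e a"
proof -
  define g where "g = (\<Prod>a\<in>A. (t - a) ^ e a)"
  have l0: "l > 0" using prime_gt_0_nat[OF l(1)] .
  have "g \<noteq> 0" unfolding g_def using A t(2) by auto
  then have y0: "y \<noteq> 0" using eq l0 by (auto simp: g_def zero_power)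
  have yR: "y \<in> frac R" using y compositum_subset by blast
  have gR: "(g,g) \<in> tens L M \<sigma>" if "\<sigma> \<in> gal K1 M" for \<sigma>
    unfolding g_def using A(2) t_a_tens[OF that] by (intro pring_prod[OF tens_gal[OF that]] pring_power[OF tens_gal[OF that]]) auto
  have "\<exists>\<alpha>. \<alpha> \<in> C \<and> \<alpha> \<noteq> 0 \<and> \<alpha> ^ l = 1 \<and> (\<forall>u u' v v'. (u,u') \<in> tens L M \<sigma> \<longrightarrow> (v,v') \<in> tens L M \<sigma> \<longrightarrow> u = y * v \<longrightarrow> u' = \<alpha> * y * v')"
    if \<sigma>: "\<sigma> \<in> gal K1 M" for \<sigma>
  proof -
    note P = tens_gal[OF \<sigma>]
    obtain y' where y': "\<And>u u' v v'. (u,u') \<in> tens L M \<sigma> \<Longrightarrow> (v,v') \<in> tens L M \<sigma> \<Longrightarrow> u = y * v \<Longrightarrow> u' = y' * v'"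
      using twist[OF yR \<sigma>] by blast
    obtain u v where uv: "u \<in> R" "v \<in> R" "v \<noteq> 0" "y = u / v" using frac_obtain[OF yR R_sring] by blast
    obtain u' where u: "(u,u') \<in> tens L M \<sigma>" using tens_total[OF uv(1)] by blast
    obtain v' where v: "(v,v') \<in> tens L M \<sigma>" using tens_total[OF uv(2)] by blast
    have v'0: "v' \<noteq> 0" using tens_0_iff[OF \<sigma> v] uv(3) by simp
    have "(u ^ l - g * v ^ l, u' ^ l - g * v' ^ l) \<in> tens L M \<sigma>"
      by (intro pring_diff[OF P] pring_mult[OF P] pring_power[OF P] u v gR \<sigma>)
    from tens_0_iff[OF \<sigma> this] have "u' ^ l = g * v' ^ l"
      using eq uv(3,4) by (simp add: g_def power_divide field_simps)
    moreover have "u' = y' * v'" by (rule y'[OF u v]) (use uv in simp)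
    ultimately have "y' ^ l = g" using v'0 by (simp add: power_mult_distrib)
    then have e: "(y' / y) ^ l = 1" using eq \<open>g \<noteq> 0\<close> by (simp add: power_divide g_def)
    have "y' / y \<in> C"
    proof (rule C_roots)
      show "monom 1 l - 1 \<in> pol C"
        by (intro sring_diff[OF sring_pol[OF Cs]] pol_monom[OF Cs] sring_1[OF Cs] sring_1[OF sring_pol[OF Cs]])
      have "coeff (monom 1 l - 1 :: 'a poly) l \<noteq> 0" using l0 by (simp add: coeff_1)
      then show "monom 1 l - 1 \<noteq> (0 :: 'a poly)" by (metis coeff_0)
      show "poly (monom 1 l - 1) (y' / y) = 0" using e by (simp add: poly_monom)
    qed
    moreover have "y' / y \<noteq> 0" using e l0 by (auto simp: zero_power)
    ultimately show ?thesis using e y' y0 by (intro exI[of _ "y' / y"]) auto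
  qed
  then obtain \<alpha> where \<alpha>: "\<And>\<sigma>. \<sigma> \<in> gal K1 M \<Longrightarrow> \<alpha> \<sigma> \<in> C \<and> \<alpha> \<sigma> \<noteq> 0 \<and> \<alpha> \<sigma> ^ l = 1"
    "\<And>\<sigma> u u' v v'. \<sigma> \<in> gal K1 M \<Longrightarrow> (u,u') \<in> tens L M \<sigma> \<Longrightarrow> (v,v') \<in> tens L M \<sigma> \<Longrightarrow> u = y * v \<Longrightarrow> u' = \<alpha> \<sigma> * y * v'"
    by metis
  obtain S m n s1 where S: "finite S" "S \<subseteq> L" "s1 \<in> S" "m s1 = 1" "\<And>s. s \<in> S \<Longrightarrow> m s \<in> M \<and> n s \<in> M"
    "smS S m \<noteq> 0" "y * smS S m = smS S n"
    "\<And>\<sigma> s. \<sigma> \<in> gal K1 M \<Longrightarrow> s \<in> S \<Longrightarrow> \<sigma> (m s) = m s \<and> \<sigma> (n s) = \<alpha> \<sigma> * n s + 0 * m s"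
    by (rule minimal_support[OF yR, of \<alpha> "\<lambda>_. 0"]) (use \<alpha> sring_0[OF Cs] in auto)
  have "smS S n \<noteq> 0" using S(6,7) y0 by (metis mult_eq_0_iff)
  then have "\<exists>s\<in>S. n s \<noteq> 0" unfolding smS_def by (metis (no_types, lifting) mult_zero_left sum.neutral)
  then obtain s0 where s0: "s0 \<in> S" "n s0 \<noteq> 0" by blast
  \<comment> \<open>All \<open>n s\<close> are scaled by the same \<open>\<alpha> \<sigma>\<close>,
    so dividing by one nonzero \<open>n s0\<close> leaves fixed elements.\<close>
  define h where "h = n s0"
  have hM: "h \<in> M" using S(5) s0 by (simp add: h_def)
  have fx: "\<sigma> (n s / h) = n s / h" if "\<sigma> \<in> gal K1 M" "s \<in> S" for \<sigma> s
    using S(8)[OF that] S(8)[OF that(1) s0(1)] S(5)[OF that(2)] hM \<alpha>(1)[OF that(1)]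
    by (simp add: G.gal_divide[OF that(1)] h_def)
  have fh: "\<sigma> (h ^ l) = h ^ l" if "\<sigma> \<in> gal K1 M" for \<sigma>
    using S(8)[OF that s0(1)] \<alpha>(1)[OF that] hM by (simp add: G.gal_power[OF that] h_def power_mult_distrib)
  define X where "X = m ` S \<union> (\<lambda>s. n s / h) ` S \<union> {h ^ l}"
  have "\<exists>k. \<forall>x\<in>X. x ^ (pexp TYPE('a) ^ k) \<in> K1"
  proof (rule common_exponent)
    show "finite X" using S(1) by (simp add: X_def)
    fix x assume "x \<in> X"
    then show "x \<in> M \<and> (\<forall>\<sigma>\<in>gal K1 M. \<sigma> x = x)"
      using S(5,8) fx fh hM by (auto simp: X_def intro: subfield_divide[OF Mf] sring_power[OF Ms])
  qed
  then obtain k where k: "\<And>x. x \<in> X \<Longrightarrow> x ^ (pexp TYPE('a) ^ k) \<in> K1" by blast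
  define N where "N = pexp TYPE('a) ^ k"
  define w where "w = smS S (\<lambda>s. n s / h) / smS S m"
  have "w ^ N \<in> Q" unfolding w_def N_def by (rule quotient_Q[OF S(1,2)]) (use k in \<open>auto simp: X_def\<close>)
  then obtain w1 w2 where w: "w1 \<in> pol R0" "w2 \<in> pol R0" "w2 \<noteq> 0" "poly w2 t \<noteq> 0" "w ^ N = poly w1 t / poly w2 t"
    by (rule Q_poly)
  have "(h ^ l) ^ N \<in> K1" using k by (simp add: X_def N_def)
  then obtain h1 h2 where h: "h1 \<in> pol F" "h2 \<in> pol F" "h2 \<noteq> 0" "poly h2 t \<noteq> 0" "(h ^ l) ^ N = poly h1 t / poly h2 t"
    by (rule K1_poly)
  have hR: "h1 \<in> pol R0" "h2 \<in> pol R0" using h pol_mono[OF F_R0] by auto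
  have yw: "y = h * w"
  proof -
    have "smS S (\<lambda>s. n s / h) = smS S n / h" by (simp add: smS_def sum_divide_distrib)
    then show ?thesis using S(6,7) s0 by (simp add: w_def h_def field_simps)
  qed
  define Gp where "Gp = (\<Prod>a\<in>A. [:-a,1:] ^ e a)"
  have Gt: "poly Gp t = g" by (simp add: Gp_def g_def poly_prod)
  have GR: "Gp \<in> pol R0" unfolding Gp_def using A(2) L_R0
    by (intro sring_prod[OF sring_pol[OF R0_sring]] sring_power[OF sring_pol[OF R0_sring]] pol_linear[OF R0_sring]) auto
  have "g ^ N = (h ^ l) ^ N * (w ^ N) ^ l"
    using eq unfolding yw g_def[symmetric] by (metis power_mult_distrib power_mult mult.commute)
  then have "poly (Gp ^ N * h2 * w2 ^ l) t = poly (h1 * w1 ^ l) t"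
    using w(4) h(4) unfolding w(5) h(5) by (simp add: Gt power_divide field_simps)
  then have pe: "Gp ^ N * h2 * w2 ^ l = h1 * w1 ^ l"
    by (intro poly_eqI_R0 sring_mult[OF sring_pol[OF R0_sring]] sring_power[OF sring_pol[OF R0_sring]] GR w hR)
  have G0: "Gp \<noteq> 0" using A(1) by (simp add: Gp_def)
  have "Gp ^ N * h2 * w2 ^ l \<noteq> 0" using G0 h w by simp
  then have nz: "h1 \<noteq> 0" "w1 \<noteq> 0" using pe l0 by (auto simp: zero_power)
  have aL: "a \<in> L" "a \<notin> C" using a A(2) by auto
  have oG: "order a Gp = e a"
  proof -
    have G': "Gp = [:-a,1:] ^ e a * (\<Prod>b\<in>A - {a}. [:-b,1:] ^ e b)" (is "_ = _ * ?r")
      unfolding Gp_def by (rule prod.remove[OF A(1) a])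
    have "poly ?r a \<noteq> 0" using A(1) by (auto simp: poly_prod)
    then have "order a ?r = 0" by (simp add: order_root)
    then show ?thesis unfolding G' by (subst order_mult) (use G0 G' in \<open>auto simp: order_power_n_n\<close>)
  qed
  have op: "order a (p ^ i) = i * order a p" if "p \<noteq> 0" for p :: "'a poly" and i
    using that by (induction i) (auto simp: order_mult order_0I)
  have "order a (Gp ^ N * h2 * w2 ^ l) = N * e a + order a h2 + l * order a w2"
    using G0 h w by (simp add: order_mult op oG)
  moreover have "order a (h1 * w1 ^ l) = order a h1 + l * order a w1"
    using nz by (simp add: order_mult op)
  ultimately have "N * e a + l * order a w2 = l * order a w1"
    using pe order_F[OF aL h(1) nz(1)] order_F[OF aL h(2,3)] by simp
  then have "l dvd N * e a" by (metis dvd_add_left_iff dvd_triv_left)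
  \<comment> \<open>\<open>N\<close> is 1 or a power of the characteristic, which differs from
    \<open>l\<close>.\<close>
  moreover have "\<not> l dvd N"
  proof
    assume "l dvd N"
    then have "l dvd pexp TYPE('a)" unfolding N_def using prime_dvd_power[OF l(1)] by blast
    moreover have "pexp TYPE('a) = 1 \<or> prime (pexp TYPE('a))" using prime_CHAR_semidom[where 'a='a] by (auto simp: pexp_def)
    ultimately have "l = pexp TYPE('a) \<and> prime (pexp TYPE('a))" using l(1) by (metis One_nat_def nat_dvd_1_iff_1 not_prime_1 primes_dvd_imp_eq)
    then show False using l by (auto simp: pexp_def split: if_splits)
  qed
  ultimately show ?thesis using l(1) by (simp add: prime_dvd_mult_iff)
qed

text \<open>Here the twists change \<open>y\<close> by adding elements \<beta> of \<open>C\<close>,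
  so \<open>y\<close> splits as \<open>h + w\<close>. Taking \<open>N\<close>-th powers changes
  \<open>g\<close>, but \<open>g^N - g\<close> has again the form \<open>z^p - z\<close>, so a
  relation for \<open>g\<close> itself survives. In it \<open>W^p - W\<close> has either no pole at
  \<open>a\<close> or one of order at least \<open>p\<close>, whereas that of \<open>g\<close> is
  simple.\<close>

theorem artin_schreier_independent:
  assumes A: "finite A" "A \<subseteq> L - C" and p: "CHAR('a) > 0" and y: "y \<in> compositum L M"
    and eq: "y ^ CHAR('a) - y = (\<Sum>a\<in>A. of_nat (c a) / (t - a))" and a: "a \<in> A"
  shows "CHAR('a) dvd c a"
proof (rule ccontr)
  assume nd: "\<not> CHAR('a) dvd c a"
  define p where "p = CHAR('a)"
  have pr: "prime p" using prime_CHAR_semidom assms(3) by (simp add: p_def)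
  have p2: "p \<ge> 2" using prime_ge_2_nat[OF pr] .
  have qp: "pexp TYPE('a) = p" using assms(3) by (simp add: pexp_def p_def)
  have fresh: "(u + v) ^ p = u ^ p + v ^ p" for u v :: 'a
    using freshmans_dream[of p u v] pr by (simp add: p_def)
  have fresh': "(u - v) ^ p = u ^ p - v ^ p" for u v :: 'a
    using fresh[of "u - v" v] by simp
  have freshN: "(u + v) ^ (p ^ k) = u ^ (p ^ k) + v ^ (p ^ k)" for u v :: 'a and k
    using freshmans_dream'[of "p ^ k" k u v] pr by (simp add: p_def)
  define g where "g = (\<Sum>a\<in>A. of_nat (c a) / (t - a))"
  \<comment> \<open>\<open>g\<close> is only a fraction over \<open>R\<close>; with its denominator
    cleared, the equation becomes one between elements to which the twist applies directly.\<close>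
  define D where "D = (\<Prod>a\<in>A. t - a)"
  define gD where "gD = (\<Sum>a\<in>A. of_nat (c a) * (\<Prod>b\<in>A - {a}. t - b))"
  have tA: "t - b \<noteq> 0" if "b \<in> A" for b using that A(2) t(2) by auto
  have D0: "D \<noteq> 0" unfolding D_def using A(1) tA by auto
  have gD: "g * D = gD"
    unfolding g_def gD_def sum_distrib_right
  proof (rule sum.cong[OF refl])
    fix b assume b: "b \<in> A"
    have "D = (t - b) * (\<Prod>a\<in>A - {b}. t - a)" unfolding D_def by (rule prod.remove[OF A(1) b])
    then show "of_nat (c b) / (t - b) * D = of_nat (c b) * (\<Prod>a\<in>A - {b}. t - a)" using tA[OF b] by simp
  qed
  have yR: "y \<in> frac R" using y compositum_subset by blast
  have DR: "(D,D) \<in> tens L M \<sigma>" if "\<sigma> \<in> gal K1 M" for \<sigma>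
    unfolding D_def using A(2) t_a_tens[OF that] by (intro pring_prod[OF tens_gal[OF that]]) auto
  have gDR: "(gD,gD) \<in> tens L M \<sigma>" if "\<sigma> \<in> gal K1 M" for \<sigma>
    unfolding gD_def using A(2) t_a_tens[OF that]
    by (intro pring_sum[OF tens_gal[OF that]] pring_mult[OF tens_gal[OF that]] pring_prod[OF tens_gal[OF that]]
      pring_of_nat[OF tens_gal[OF that]]) auto
  have "\<exists>\<beta>. \<beta> \<in> C \<and> \<beta> ^ p = \<beta> \<and> (\<forall>u u' v v'. (u,u') \<in> tens L M \<sigma> \<longrightarrow> (v,v') \<in> tens L M \<sigma> \<longrightarrow> u = y * v \<longrightarrow> u' = (y + \<beta>) * v')"
    if \<sigma>: "\<sigma> \<in> gal K1 M" for \<sigma>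
  proof -
    note P = tens_gal[OF \<sigma>]
    obtain y' where y': "\<And>u u' v v'. (u,u') \<in> tens L M \<sigma> \<Longrightarrow> (v,v') \<in> tens L M \<sigma> \<Longrightarrow> u = y * v \<Longrightarrow> u' = y' * v'"
      using twist[OF yR \<sigma>] by blast
    obtain u v where uv: "u \<in> R" "v \<in> R" "v \<noteq> 0" "y = u / v" using frac_obtain[OF yR R_sring] by blast
    obtain u' where u: "(u,u') \<in> tens L M \<sigma>" using tens_total[OF uv(1)] by blast
    obtain v' where v: "(v,v') \<in> tens L M \<sigma>" using tens_total[OF uv(2)] by blast
    have v'0: "v' \<noteq> 0" using tens_0_iff[OF \<sigma> v] uv(3) by simp
    have "(D * (u ^ p - u * v ^ (p - 1)) - gD * v ^ p, D * (u' ^ p - u' * v' ^ (p - 1)) - gD * v' ^ p) \<in> tens L M \<sigma>"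
      by (intro pring_diff[OF P] pring_mult[OF P] pring_power[OF P] u v DR gDR \<sigma>)
    note z = tens_0_iff[OF \<sigma> this]
    have key: "D * (Y ^ p * V ^ p - Y * V * V ^ (p - 1)) - gD * V ^ p = D * V ^ p * (Y ^ p - Y - g)" for Y V
    proof -
      have "V * V ^ (p - 1) = V ^ p" using p2 by (metis power_eq_if not_numeral_le_zero)
      then have e: "Y * V * V ^ (p - 1) = Y * V ^ p" by (simp add: mult.assoc)
      show ?thesis unfolding e gD[symmetric] by (simp add: algebra_simps)
    qed
    have uy: "u = y * v" using uv by simp
    have "D * (u ^ p - u * v ^ (p - 1)) - gD * v ^ p = 0"
      using key[of y v] eq unfolding uy power_mult_distrib by (simp add: g_def p_def)
    then have "D * (u' ^ p - u' * v' ^ (p - 1)) - gD * v' ^ p = 0" using z by simp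
    moreover have "u' = y' * v'" by (rule y'[OF u v uy])
    ultimately have "D * v' ^ p * (y' ^ p - y' - g) = 0" using key[of y' v'] by (simp add: power_mult_distrib)
    then have "y' ^ p - y' = g" using D0 v'0 by simp
    then have e: "(y' - y) ^ p = y' - y" using eq unfolding fresh' by (simp add: g_def p_def algebra_simps)
    have "y' - y \<in> C"
    proof (rule C_roots)
      show "monom 1 p - [:0,1:] \<in> pol C"
        by (intro sring_diff[OF sring_pol[OF Cs]] pol_monom[OF Cs] pol_pCons[OF Cs] pol_const[OF Cs] sring_0[OF Cs] sring_1[OF Cs])
      have "coeff (monom 1 p - [:0,1:] :: 'a poly) 1 \<noteq> 0" using p2 by simp
      then show "monom 1 p - [:0,1:] \<noteq> (0 :: 'a poly)" by (metis coeff_0)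
      show "poly (monom 1 p - [:0,1:]) (y' - y) = 0" using e by (simp add: poly_monom)
    qed
    then show ?thesis using e y' by (intro exI[of _ "y' - y"]) auto
  qed
  then obtain \<beta> where \<beta>: "\<And>\<sigma>. \<sigma> \<in> gal K1 M \<Longrightarrow> \<beta> \<sigma> \<in> C \<and> \<beta> \<sigma> ^ p = \<beta> \<sigma>"
    "\<And>\<sigma> u u' v v'. \<sigma> \<in> gal K1 M \<Longrightarrow> (u,u') \<in> tens L M \<sigma> \<Longrightarrow> (v,v') \<in> tens L M \<sigma> \<Longrightarrow> u = y * v \<Longrightarrow> u' = (y + \<beta> \<sigma>) * v'"
    by metis
  obtain S m n s1 where S: "finite S" "S \<subseteq> L" "s1 \<in> S" "m s1 = 1" "\<And>s. s \<in> S \<Longrightarrow> m s \<in> M \<and> n s \<in> M"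
    "smS S m \<noteq> 0" "y * smS S m = smS S n"
    "\<And>\<sigma> s. \<sigma> \<in> gal K1 M \<Longrightarrow> s \<in> S \<Longrightarrow> \<sigma> (m s) = m s \<and> \<sigma> (n s) = 1 * n s + \<beta> \<sigma> * m s"
    by (rule minimal_support[OF yR, of "\<lambda>_. 1" \<beta>]) (use \<beta> sring_1[OF Cs] in auto)
  \<comment> \<open>Since \<open>m s1 = 1\<close>, this coefficient transforms exactly like
    \<open>y\<close>; subtracting \<open>h * m s\<close> from \<open>n s\<close> removes the
    translation by \<beta>.\<close>
  define h where "h = n s1"
  have hM: "h \<in> M" using S(5)[OF S(3)] by (simp add: h_def)
  have hs: "\<sigma> h = h + \<beta> \<sigma>" if "\<sigma> \<in> gal K1 M" for \<sigma> using S(8)[OF that S(3)] S(4) by (simp add: h_def)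
  have fx: "\<sigma> (n s - h * m s) = n s - h * m s" if "\<sigma> \<in> gal K1 M" "s \<in> S" for \<sigma> s
  proof -
    have "m s \<in> M" "n s \<in> M" "h * m s \<in> M" using S(5)[OF that(2)] sring_mult[OF Ms hM] by auto
    then have "\<sigma> (n s - h * m s) = \<sigma> (n s) - \<sigma> h * \<sigma> (m s)"
      using hM by (simp add: G.gal_diff[OF that(1)] G.gal_times[OF that(1)])
    then show ?thesis using S(8)[OF that] hs[OF that(1)] by (simp add: algebra_simps)
  qed
  have fh: "\<sigma> (h ^ p - h) = h ^ p - h" if "\<sigma> \<in> gal K1 M" for \<sigma>
    using hs[OF that] \<beta>(1)[OF that] hM sring_power[OF Ms hM]
    by (simp add: G.gal_diff[OF that] G.gal_power[OF that] fresh)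
  define X where "X = m ` S \<union> (\<lambda>s. n s - h * m s) ` S \<union> {h ^ p - h}"
  have "\<exists>k. \<forall>x\<in>X. x ^ (pexp TYPE('a) ^ k) \<in> K1"
  proof (rule common_exponent)
    show "finite X" using S(1) by (simp add: X_def)
    fix x assume "x \<in> X"
    then show "x \<in> M \<and> (\<forall>\<sigma>\<in>gal K1 M. \<sigma> x = x)"
      using S(5,8) fx fh hM by (auto simp: X_def intro: sring_diff[OF Ms] sring_mult[OF Ms] sring_power[OF Ms])
  qed
  then obtain k where k: "\<And>x. x \<in> X \<Longrightarrow> x ^ (pexp TYPE('a) ^ k) \<in> K1" by blast
  define N where "N = p ^ k"
  define w where "w = smS S (\<lambda>s. n s - h * m s) / smS S m"
  have wQ: "w ^ N \<in> Q" unfolding w_def N_def qp[symmetric] by (rule quotient_Q[OF S(1,2)]) (use k in \<open>auto simp: X_def\<close>)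
  have "(h ^ p - h) ^ N \<in> K1" using k by (simp add: X_def N_def qp)
  then obtain h1 h2 where h: "h1 \<in> pol F" "h2 \<in> pol F" "h2 \<noteq> 0" "poly h2 t \<noteq> 0" "(h ^ p - h) ^ N = poly h1 t / poly h2 t"
    by (rule K1_poly)
  have yw: "y = h + w"
  proof -
    have "smS S (\<lambda>s. n s - h * m s) = smS S n - h * smS S m"
      by (simp add: smS_def sum_subtractf sum_distrib_left left_diff_distrib mult.assoc)
    then show ?thesis using S(6,7) by (simp add: w_def field_simps)
  qed
  note QR = subfield_sring[OF Q_subfield]
  \<comment> \<open>Chosen so that \<open>z^p - z\<close> telescopes to \<open>g^N - g\<close>,
    which undoes the passage to \<open>N\<close>-th powers.\<close>
  define z where "z = (\<Sum>i<k. g ^ (p ^ i))"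
  have zp: "z ^ p - z = g ^ N - g"
  proof -
    have "(\<Sum>i<j. g ^ (p ^ i)) ^ p - (\<Sum>i<j. g ^ (p ^ i)) = g ^ (p ^ j) - g" for j
    proof (induction j)
      case 0
      then show ?case using p2 by simp
    next
      case (Suc j)
      have "(g ^ (p ^ j)) ^ p = g ^ (p ^ Suc j)" by (simp add: power_mult[symmetric] mult.commute)
      then show ?case using Suc.IH by (simp add: fresh algebra_simps)
    qed
    then show ?thesis by (simp add: z_def N_def)
  qed
  define W where "W = w ^ N - z"
  have tQ: "t \<in> Q" using t_K1 K1_Q by blast
  have gQ: "g \<in> Q" unfolding g_def
  proof (intro sring_sum[OF QR] subfield_divide[OF Q_subfield] sring_of_nat[OF QR] sring_diff[OF QR] tQ)
    fix b assume "b \<in> A"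
    then show "b \<in> Q" using A(2) L_Q by blast
  qed
  have "W \<in> Q" unfolding W_def z_def by (intro sring_diff[OF QR] wQ sring_sum[OF QR] sring_power[OF QR] gQ)
  then obtain w1 w2 where w: "w1 \<in> pol R0" "w2 \<in> pol R0" "w2 \<noteq> 0" "poly w2 t \<noteq> 0" "W = poly w1 t / poly w2 t"
    by (rule Q_poly)
  have gsum: "g = (h ^ p - h) ^ N + W ^ p - W"
  proof -
    have "g = (h ^ p - h) + (w ^ p - w)" using eq unfolding yw p_def[symmetric] g_def[symmetric] fresh by (simp add: algebra_simps)
    then have "g ^ N = (h ^ p - h) ^ N + (w ^ p + (- w)) ^ N" unfolding N_def by (simp add: freshN)
    also have "(w ^ p + (- w)) ^ N = (w ^ p) ^ N - w ^ N"
      using freshN[of "w ^ p - w" w k] by (simp add: N_def)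
    also have "(w ^ p) ^ N = (w ^ N) ^ p" by (simp add: power_mult[symmetric] mult.commute)
    finally have gN: "g ^ N = (h ^ p - h) ^ N + ((w ^ N) ^ p - w ^ N)" .
    have "(h ^ p - h) ^ N + W ^ p - W = (h ^ p - h) ^ N + ((w ^ N) ^ p - w ^ N) - (z ^ p - z)"
      unfolding W_def fresh' by simp
    also have "\<dots> = g" unfolding gN[symmetric] zp by simp
    finally show ?thesis ..
  qed
  define Dp where "Dp = (\<Prod>a\<in>A. [:-a,1:])"
  define Gn where "Gn = (\<Sum>a\<in>A. [:of_nat (c a):] * (\<Prod>b\<in>A - {a}. [:-b,1:]))"
  have Dt: "poly Dp t = D" by (simp add: Dp_def D_def poly_prod)
  have Gt: "poly Gn t = gD" by (simp add: Gn_def gD_def poly_prod poly_sum)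
  have AR: "b \<in> R0" if "b \<in> A" for b using that A(2) L_R0 by blast
  note PR = sring_pol[OF R0_sring]
  have DpR: "Dp \<in> pol R0" unfolding Dp_def by (intro sring_prod[OF PR] pol_linear[OF R0_sring] AR)
  have GnR: "Gn \<in> pol R0" unfolding Gn_def
    by (intro sring_sum[OF PR] sring_mult[OF PR] sring_prod[OF PR] pol_linear[OF R0_sring] pol_const[OF R0_sring] sring_of_nat[OF R0_sring] AR) auto
  have hR: "h1 \<in> pol R0" "h2 \<in> pol R0" using h pol_mono[OF F_R0] by auto
  have "poly (Gn * h2 * w2 ^ p) t = poly (Dp * (h1 * w2 ^ p + h2 * (w1 ^ p - w1 * w2 ^ (p - 1)))) t"
  proof -
    have e: "poly w2 t ^ p = poly w2 t * poly w2 t ^ (p - 1)" using p2 by (metis power_eq_if not_numeral_le_zero)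
    have "g * poly h2 t * poly w2 t ^ p = poly h1 t * poly w2 t ^ p + poly h2 t * (poly w1 t ^ p - poly w1 t * poly w2 t ^ (p - 1))"
      unfolding gsum h(5) w(5) power_divide e using h(4) w(4) by (simp add: field_simps)
    then have "D * (g * poly h2 t * poly w2 t ^ p) = D * (poly h1 t * poly w2 t ^ p + poly h2 t * (poly w1 t ^ p - poly w1 t * poly w2 t ^ (p - 1)))" by simp
    then show ?thesis by (simp add: Gt Dt gD[symmetric] mult_ac)
  qed
  then have pe: "Gn * h2 * w2 ^ p = Dp * (h1 * w2 ^ p + h2 * (w1 ^ p - w1 * w2 ^ (p - 1)))"
    by (intro poly_eqI_R0 sring_mult[OF PR] sring_power[OF PR] sring_add[OF PR] sring_diff[OF PR] GnR DpR w hR)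
  define X1 where "X1 = [:-a,1:]"
  define D' where "D' = (\<Prod>b\<in>A - {a}. [:-b,1:])"
  have DpX: "Dp = X1 * D'" unfolding Dp_def D'_def X1_def by (rule prod.remove[OF A(1) a])
  have D'a: "poly D' a \<noteq> 0" using A(1) by (auto simp: D'_def poly_prod)
  have aL: "a \<in> L" "a \<notin> C" using a A(2) by auto
  have h2a: "poly h2 a \<noteq> 0" using no_root_L[OF aL, of h2] h(2,3) pol_mono[OF F(3)] by blast
  have Gna: "poly Gn a \<noteq> 0"
  proof -
    have "(\<Prod>b'\<in>A - {b}. a - b') = 0" if "b \<in> A - {a}" for b
      using that a A(1) by (intro prod_zero) auto
    then have "poly Gn a = of_nat (c a) * poly D' a"
      by (simp add: Gn_def D'_def poly_sum poly_prod sum.remove[OF A(1) a])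
    moreover have "(of_nat (c a) :: 'a) \<noteq> 0" using nd by (simp add: of_nat_eq_0_iff_char_dvd)
    ultimately show ?thesis using D'a by simp
  qed
  have X1a: "poly X1 a = 0" "X1 \<noteq> 0" by (simp_all add: X1_def)
  define r where "r = order a w2"
  obtain v2 where v2: "w2 = X1 ^ r * v2" "\<not> X1 dvd v2"
    using order_decomp[OF w(3), of a] by (auto simp: X1_def r_def)
  have v2a: "poly v2 a \<noteq> 0" using v2(2) by (simp add: X1_def poly_eq_0_iff_dvd)
  have ppow: "x ^ p = x * x ^ (p - 1)" for x :: "'a poly" using p2 by (metis power_eq_if not_numeral_le_zero)
  \<comment> \<open>Either \<open>W\<close> has no pole at \<open>a\<close>, and after cancelling
    powers of \<open>X1\<close> the right side vanishes at \<open>a\<close> while the left does not;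
    or it has one, and after one more division by \<open>X1\<close> the left side vanishes at
    \<open>a\<close> while the term from \<open>w1 ^ p\<close> does not.\<close>
  show False
  proof (cases "X1 ^ r dvd w1")
    case True
    then obtain v1 where v1: "w1 = X1 ^ r * v1" by blast
    have e1: "w1 * w2 ^ (p - 1) = (X1 ^ r) ^ p * (v1 * v2 ^ (p - 1))"
      unfolding v1 v2(1) power_mult_distrib ppow[of "X1 ^ r"] by (simp add: mult_ac)
    have e2: "w2 ^ p = (X1 ^ r) ^ p * v2 ^ p" "w1 ^ p = (X1 ^ r) ^ p * v1 ^ p"
      unfolding v1 v2(1) by (simp_all only: power_mult_distrib)
    have "(X1 ^ r) ^ p * (Gn * h2 * v2 ^ p) = Gn * h2 * w2 ^ p" unfolding e2 by (simp only: mult_ac)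
    also note pe
    also have "Dp * (h1 * w2 ^ p + h2 * (w1 ^ p - w1 * w2 ^ (p - 1))) = (X1 ^ r) ^ p * (Dp * (h1 * v2 ^ p + h2 * (v1 ^ p - v1 * v2 ^ (p - 1))))"
      unfolding e1 e2 by (simp add: algebra_simps)
    finally have "Gn * h2 * v2 ^ p = Dp * (h1 * v2 ^ p + h2 * (v1 ^ p - v1 * v2 ^ (p - 1)))"
      using X1a(2) by simp
    from arg_cong[OF this, of "\<lambda>f. poly f a"] show False
      using X1a(1) Gna h2a v2a by (simp add: DpX)
  next
    case False
    then have w10: "w1 \<noteq> 0" by auto
    define s where "s = order a w1"
    obtain v1 where v1: "w1 = X1 ^ s * v1" "\<not> X1 dvd v1"
      using order_decomp[OF w10, of a] by (auto simp: X1_def s_def)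
    have v1a: "poly v1 a \<noteq> 0" using v1(2) by (simp add: X1_def poly_eq_0_iff_dvd)
    have "s < r"
    proof (rule ccontr)
      assume "\<not> s < r"
      then have "X1 ^ r dvd X1 ^ s" by (simp add: le_imp_power_dvd)
      then show False using False v1(1) by (metis dvd_mult2)
    qed
    \<comment> \<open>One factor \<open>X1\<close> of the surplus \<open>r - s\<close> is kept
      apart, to cancel against the one in \<open>Dp\<close>.\<close>
    define v where "v = X1 ^ (r - Suc s) * v2"
    have w2: "w2 = X1 ^ s * (X1 * v)"
    proof -
      have "X1 ^ r = X1 ^ s * (X1 * X1 ^ (r - Suc s))"
        using \<open>s < r\<close> by (metis Suc_diff_Suc power_Suc power_add add_diff_inverse_nat less_imp_le not_less)
      then show ?thesis unfolding v2(1) v_def by (simp add: mult_ac)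
    qed
    have e1: "w1 * w2 ^ (p - 1) = (X1 ^ s) ^ p * (v1 * (X1 * v) ^ (p - 1))"
      unfolding v1(1) w2 power_mult_distrib[of "X1 ^ s"] ppow[of "X1 ^ s"] by (simp add: mult_ac)
    have e2: "w2 ^ p = (X1 ^ s) ^ p * (X1 * v) ^ p" "w1 ^ p = (X1 ^ s) ^ p * v1 ^ p"
      unfolding v1(1) w2 by (simp_all only: power_mult_distrib[of "X1 ^ s"])
    have "(X1 ^ s) ^ p * (Gn * h2 * (X1 * v) ^ p) = Gn * h2 * w2 ^ p" unfolding e2 by (simp only: mult_ac)
    also note pe
    also have "Dp * (h1 * w2 ^ p + h2 * (w1 ^ p - w1 * w2 ^ (p - 1))) = (X1 ^ s) ^ p * (Dp * (h1 * (X1 * v) ^ p + h2 * (v1 ^ p - v1 * (X1 * v) ^ (p - 1))))"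
      unfolding e1 e2 by (simp add: algebra_simps)
    finally have "Gn * h2 * (X1 * v) ^ p = Dp * (h1 * (X1 * v) ^ p + h2 * (v1 ^ p - v1 * (X1 * v) ^ (p - 1)))"
      using X1a(2) by simp
    then have "X1 * (Gn * h2 * (v * (X1 * v) ^ (p - 1))) = X1 * (D' * (h1 * (X1 * v) ^ p + h2 * (v1 ^ p - v1 * (X1 * v) ^ (p - 1))))"
      unfolding DpX by (simp add: ppow[of "X1 * v"] mult_ac)
    then have "Gn * h2 * (v * (X1 * v) ^ (p - 1)) = D' * (h1 * (X1 * v) ^ p + h2 * (v1 ^ p - v1 * (X1 * v) ^ (p - 1)))"
      using X1a(2) by simp
    then have "poly (Gn * h2 * (v * (X1 * v) ^ (p - 1))) a = poly (D' * (h1 * (X1 * v) ^ p + h2 * (v1 ^ p - v1 * (X1 * v) ^ (p - 1)))) a"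
      by (rule arg_cong)
    moreover have "p = Suc (Suc (p - 2))" using p2 by simp
    then obtain j where "p = Suc (Suc j)" by blast
    ultimately show False using X1a(1) D'a h2a v1a by simp
  qed
qed

end

section \<open>Characters separate points\<close>

text \<open>Characters of a finite commutative cancellative monoid separate points: a character of a
  submonoid \<open>H\<close> with values modulo \<open>N\<close> extends to \<open>H\<close> and one further element \<open>g\<close>, where the value
  at \<open>g\<close> may be any solution of the congruence imposed by the first power of \<open>g\<close> lying in \<open>H\<close>.\<close>

locale fin_monoid =
  fixes A :: "'g set" and m :: "'g \<Rightarrow> 'g \<Rightarrow> 'g" and e :: 'g
  assumes fin: "finite A" and e: "e \<in> A" and cl: "x \<in> A \<Longrightarrow> y \<in> A \<Longrightarrow> m x y \<in> A"
    and assoc: "x \<in> A \<Longrightarrow> y \<in> A \<Longrightarrow> z \<in> A \<Longrightarrow> m (m x y) z = m x (m y z)"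
    and comm: "x \<in> A \<Longrightarrow> y \<in> A \<Longrightarrow> m x y = m y x"
    and unit: "x \<in> A \<Longrightarrow> m e x = x"
    and cancel: "x \<in> A \<Longrightarrow> y \<in> A \<Longrightarrow> z \<in> A \<Longrightarrow> m x y = m x z \<Longrightarrow> y = z"
begin

primrec pw :: "'g \<Rightarrow> nat \<Rightarrow> 'g" where
  "pw x 0 = e"
| "pw x (Suc k) = m x (pw x k)"

lemma unit': "x \<in> A \<Longrightarrow> m x e = x"
  using comm unit e by metis

lemma pw_A: "x \<in> A \<Longrightarrow> pw x k \<in> A"
  by (induction k) (auto intro: e cl)

lemma pw_add: "x \<in> A \<Longrightarrow> pw x (i + j) = m (pw x i) (pw x j)"
  by (induction i) (auto simp: unit pw_A assoc)

lemma pw_mult: "x \<in> A \<Longrightarrow> pw x (i * j) = pw (pw x i) j"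
  by (induction j) (auto simp: pw_add)

lemma pw_e: "pw e k = e"
  by (induction k) (auto simp: unit e)

text \<open>A common exponent of all elements: by the pigeonhole principle each order is at most
  \<open>card A\<close> and so divides the factorial.\<close>

definition N :: nat where "N = fact (card A)"

lemma N_pos: "N > 0"
  by (simp add: N_def)

lemma pw_N: "x \<in> A \<Longrightarrow> pw x N = e"
proof -
  assume x: "x \<in> A"
  have "\<not> inj_on (pw x) {..card A}"
  proof
    assume "inj_on (pw x) {..card A}"
    then have "card {..card A} \<le> card A" by (rule card_inj_on_le) (use pw_A[OF x] fin in auto)
    then show False by simp
  qed
  then obtain i j where ij: "i < j" "j \<le> card A" "pw x i = pw x j"
    unfolding inj_on_def by (metis atMost_iff linorder_neqE_nat)
  have "m (pw x i) (pw x (j - i)) = m (pw x i) e"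
    using pw_add[OF x, of i "j - i"] ij unit' pw_A[OF x] by simp
  then have z: "pw x (j - i) = e" using cancel pw_A[OF x] e by blast
  have "j - i dvd N" unfolding N_def by (rule dvd_fact) (use ij in auto)
  then obtain k where "N = (j - i) * k" by blast
  then show ?thesis using pw_mult[OF x] z pw_e by simp
qed

definition sub :: "'g set \<Rightarrow> ('g \<Rightarrow> int) \<Rightarrow> bool" where
  "sub H f \<longleftrightarrow> H \<subseteq> A \<and> e \<in> H \<and> (\<forall>x\<in>H. \<forall>y\<in>H. m x y \<in> H \<and> [f (m x y) = f x + f y] (mod int N))"

lemma sub_e: "sub H f \<Longrightarrow> [f e = 0] (mod int N)"
proof -
  assume "sub H f"
  then have "[f (m e e) = f e + f e] (mod int N)" unfolding sub_def by blast
  then show ?thesis unfolding unit[OF e] cong_iff_dvd_diff by simp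
qed

lemma sub_pw: "sub H f \<Longrightarrow> x \<in> H \<Longrightarrow> pw x k \<in> H \<and> [f (pw x k) = int k * f x] (mod int N)"
proof (induction k)
  case 0
  then show ?case using sub_e by (simp add: sub_def)
next
  case (Suc k)
  then have IH: "pw x k \<in> H" "[f (pw x k) = int k * f x] (mod int N)" by auto
  have "[f (m x (pw x k)) = f x + f (pw x k)] (mod int N)" using Suc.prems IH by (simp add: sub_def)
  also have "[f x + f (pw x k) = f x + int k * f x] (mod int N)" using IH(2) by (rule cong_add[OF cong_refl])
  finally show ?case using Suc.prems IH by (simp add: sub_def algebra_simps)
qed

text \<open>Every admissible value \<open>c\<close> at \<open>g\<close> is offered, not just one:
  separating a point needs a particular nonzero value, while the later extensions only need that
  some value exists.\<close>

lemma extend: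
  assumes H: "sub H f" and g: "g \<in> A"
  defines "k0 \<equiv> LEAST k. k > 0 \<and> pw g k \<in> H"
  shows "k0 > 0 \<and> pw g k0 \<in> H \<and> k0 dvd N \<and> (\<exists>c. [int k0 * c = f (pw g k0)] (mod int N)) \<and>
    (\<forall>c. [int k0 * c = f (pw g k0)] (mod int N) \<longrightarrow>
      (\<exists>H' f'. sub H' f' \<and> H \<subseteq> H' \<and> g \<in> H' \<and> [f' g = c] (mod int N) \<and> (\<forall>h\<in>H. [f' h = f h] (mod int N))))"
proof -
  have HA: "H \<subseteq> A" "e \<in> H" using H by (auto simp: sub_def)
  have Hm: "m x y \<in> H" "[f (m x y) = f x + f y] (mod int N)" if "x \<in> H" "y \<in> H" for x y
    using H that by (auto simp: sub_def)
  have "N > 0 \<and> pw g N \<in> H" using N_pos pw_N[OF g] HA by simp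
  from LeastI[of "\<lambda>k. k > 0 \<and> pw g k \<in> H", OF this] have k0: "k0 > 0" "pw g k0 \<in> H" by (auto simp: k0_def)
  have least: "k0 \<le> k" if "k > 0" "pw g k \<in> H" for k unfolding k0_def using that by (intro Least_le) auto
  \<comment> \<open>The power of \<open>g\<close> with the remainder \<open>r\<close> as exponent is
    reached inside \<open>H\<close> by multiplying \<open>pw g j\<close> with \<open>N - 1\<close>
    copies of \<open>pw g i\<close>, which act as the inverse of \<open>pw g i\<close>.\<close>
  have dv: "k0 dvd j" if j: "pw g j \<in> H" for j
  proof -
    define r where "r = j mod k0"
    define i where "i = k0 * (j div k0)"
    have ji: "j = i + r" by (simp add: r_def i_def)
    have "pw g (k0 * ((j div k0) * (N - 1))) \<in> H" unfolding pw_mult[OF g, of k0] using sub_pw[OF H k0(2)] by blast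
    then have "pw g (j + i * (N - 1)) \<in> H" unfolding pw_add[OF g] using Hm(1)[OF j] by (simp add: i_def mult.assoc)
    also have "j + i * (N - 1) = r + i * N" unfolding ji using N_pos by (cases N) simp_all
    also have "pw g (r + i * N) = pw g r"
      unfolding pw_add[OF g] pw_mult[OF g] using pw_N[OF pw_A[OF g]] unit'[OF pw_A[OF g]] by simp
    finally have rH: "pw g r \<in> H" .
    have "r < k0" using k0(1) by (simp add: r_def)
    then have "\<not> r > 0" using least[OF _ rH] by auto
    then show ?thesis by (simp add: r_def dvd_eq_mod_eq_0)
  qed
  have kN: "k0 dvd N" by (rule dv) (simp add: pw_N[OF g] HA)
  then obtain d where d: "N = k0 * d" by blast
  have d0: "d > 0" using d N_pos by (intro gr0I) simp
  \<comment> \<open>The \<open>d\<close>-th power of \<open>pw g k0\<close> is \<open>e\<close>, so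
    \<open>d * f (pw g k0)\<close> vanishes modulo \<open>k0 * d\<close>, and \<open>k0\<close>
    divides \<open>f (pw g k0)\<close>.\<close>
  have ex_c: "\<exists>c. [int k0 * c = f (pw g k0)] (mod int N)"
  proof -
    have "[f (pw (pw g k0) d) = int d * f (pw g k0)] (mod int N)" using sub_pw[OF H k0(2)] by blast
    moreover have "pw (pw g k0) d = e" using pw_mult[OF g, of k0 d] d pw_N[OF g] by simp
    ultimately have "[0 = int d * f (pw g k0)] (mod int N)" using sub_e[OF H] cong_sym cong_trans by metis
    then have "int N dvd int d * f (pw g k0)" using cong_dvd_iff[of 0 "int d * f (pw g k0)" "int N"] by simp
    then have "int d * int k0 dvd int d * f (pw g k0)" by (simp add: d mult.commute)
    then have "int k0 dvd f (pw g k0)" using d0 by simp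
    then obtain c where "f (pw g k0) = int k0 * c" by blast
    then show ?thesis by (intro exI[of _ c]) simp
  qed
  have "\<exists>H' f'. sub H' f' \<and> H \<subseteq> H' \<and> g \<in> H' \<and> [f' g = c] (mod int N) \<and> (\<forall>h\<in>H. [f' h = f h] (mod int N))"
    if c: "[int k0 * c = f (pw g k0)] (mod int N)" for c
  proof -
    define H' where "H' = {m h (pw g k) | h k. h \<in> H}"
    define P where "P x p \<longleftrightarrow> fst p \<in> H \<and> x = m (fst p) (pw g (snd p))" for x p
    define f' where "f' x = (let p = SOME p. P x p in f (fst p) + int (snd p) * c)" for x
    have wd: "[f h + int k * c = f h' + int k' * c] (mod int N)"
      if h: "h \<in> H" "h' \<in> H" "m h (pw g k) = m h' (pw g k')" for h h' k k'
    proof -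
      \<comment> \<open>This power is the inverse of \<open>h\<close>, found inside
        \<open>H\<close>.\<close>
      define hi where "hi = pw h (N - 1)"
      have hA: "h \<in> A" "h' \<in> A" "hi \<in> A" using h HA pw_A by (auto simp: hi_def)
      have hiH: "hi \<in> H" "[f hi = int (N - 1) * f h] (mod int N)" using sub_pw[OF H h(1)] by (auto simp: hi_def)
      have "m h hi = pw h N" using N_pos by (cases N) (auto simp: hi_def)
      then have hh: "m hi h = e" using pw_N[OF hA(1)] comm hA by simp
      define j where "j = k + k' * (N - 1)"
      have gA: "pw g i \<in> A" for i by (rule pw_A[OF g])
      have e1: "m (pw g k') (pw g (k' * (N - 1))) = e"
      proof -
        have "k' + k' * (N - 1) = k' * N" using N_pos by (cases N) auto
        then show ?thesis unfolding pw_add[OF g, symmetric] by (simp add: pw_mult[OF g] pw_N[OF gA])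
      qed
      have "pw g j = m (m hi h) (m (pw g k) (pw g (k' * (N - 1))))"
        unfolding hh j_def pw_add[OF g] using unit cl gA by simp
      also have "\<dots> = m hi (m (m h (pw g k)) (pw g (k' * (N - 1))))" using assoc cl gA hA by simp
      also have "\<dots> = m hi (m h' (m (pw g k') (pw g (k' * (N - 1)))))" using h(3) assoc cl gA hA by simp
      also have "\<dots> = m hi h'" using e1 unit'[OF hA(2)] by simp
      finally have pj: "pw g j = m hi h'" .
      then have "pw g j \<in> H" using Hm(1)[OF hiH(1) h(2)] by simp
      then obtain i where i: "j = k0 * i" using dv by blast
      have "[f (pw g j) = int i * f (pw g k0)] (mod int N)"
        unfolding i pw_mult[OF g] using sub_pw[OF H k0(2)] by blast
      moreover have "[int i * f (pw g k0) = int i * (int k0 * c)] (mod int N)"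
        by (rule cong_mult[OF cong_refl cong_sym[OF c]])
      ultimately have a: "[f (pw g j) = int j * c] (mod int N)" using cong_trans by (fastforce simp: i mult_ac)
      have "[f (pw g j) = f hi + f h'] (mod int N)" unfolding pj by (rule Hm(2)[OF hiH(1) h(2)])
      moreover have "[f hi + f h' = int (N - 1) * f h + f h'] (mod int N)" by (rule cong_add[OF hiH(2) cong_refl])
      ultimately have "[int j * c = int (N - 1) * f h + f h'] (mod int N)" using a cong_sym cong_trans by meson
      then have "int N dvd int j * c - (int (N - 1) * f h + f h')" by (simp add: cong_iff_dvd_diff)
      moreover have "int j * c - (int (N - 1) * f h + f h') =
          (f h + int k * c) - (f h' + int k' * c) + int N * (int k' * c - f h)"
      proof -
        have N1: "int (N - 1) = int N - 1" using N_pos by simp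
        have j: "int j = int k + int k' * (int N - 1)" unfolding j_def of_nat_add of_nat_mult N1 ..
        show ?thesis unfolding j N1 by (simp add: algebra_simps)
      qed
      ultimately show ?thesis unfolding cong_iff_dvd_diff by (metis dvd_add_times_triv_right_iff mult.commute dvd_add_left_iff dvd_triv_left)
    qed
    have f': "[f' (m h (pw g k)) = f h + int k * c] (mod int N)" if h: "h \<in> H" for h k
    proof -
      define p where "p = (SOME p. P (m h (pw g k)) p)"
      have "P (m h (pw g k)) (h, k)" using h by (simp add: P_def)
      then have "P (m h (pw g k)) p" unfolding p_def by (rule someI)
      then have "[f (fst p) + int (snd p) * c = f h + int k * c] (mod int N)"
        by (intro wd) (use h in \<open>auto simp: P_def\<close>)
      then show ?thesis by (simp add: f'_def p_def[symmetric] Let_def)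
    qed
    have hg: "m h (pw g 0) = h" if "h \<in> H" for h using unit' that HA by auto
    have fh: "[f' h = f h] (mod int N)" if "h \<in> H" for h using f'[OF that, of 0] hg[OF that] by simp
    have HH': "H \<subseteq> H'"
    proof
      fix h assume h: "h \<in> H"
      then show "h \<in> H'" unfolding H'_def using hg[OF h, symmetric] by blast
    qed
    have g1: "m e (pw g 1) = g" using unit unit' g by simp
    have gH': "g \<in> H'" unfolding H'_def using g1[symmetric] HA(2) by blast
    have "[f' g = f e + c] (mod int N)" using f'[OF HA(2), of 1] g1 by simp
    moreover have "[f e + c = 0 + c] (mod int N)" by (rule cong_add[OF sub_e[OF H] cong_refl])
    ultimately have fg: "[f' g = c] (mod int N)" using cong_trans by fastforce
    have "m x y \<in> H' \<and> [f' (m x y) = f' x + f' y] (mod int N)" if xy: "x \<in> H'" "y \<in> H'" for x y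
    proof -
      obtain h k h' k' where hk: "h \<in> H" "x = m h (pw g k)" "h' \<in> H" "y = m h' (pw g k')" using xy by (auto simp: H'_def)
      have hA: "h \<in> A" "h' \<in> A" "pw g k \<in> A" "pw g k' \<in> A" using hk HA pw_A[OF g] by auto
      have "m (m h (pw g k)) (m h' (pw g k')) = m h (m (m (pw g k) h') (pw g k'))" using assoc cl hA by simp
      also have "\<dots> = m h (m (m h' (pw g k)) (pw g k'))" using comm hA by simp
      also have "\<dots> = m (m h h') (pw g (k + k'))" unfolding pw_add[OF g] using assoc cl hA by simp
      finally have e: "m x y = m (m h h') (pw g (k + k'))" using hk by simp
      have "[f' (m x y) = f (m h h') + int (k + k') * c] (mod int N)" unfolding e by (rule f'[OF Hm(1)[OF hk(1,3)]])
      moreover have "[f (m h h') + int (k + k') * c = f h + f h' + int (k + k') * c] (mod int N)"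
        by (rule cong_add[OF Hm(2)[OF hk(1,3)] cong_refl])
      moreover have "[f' x + f' y = (f h + int k * c) + (f h' + int k' * c)] (mod int N)"
        unfolding hk by (rule cong_add[OF f'[OF hk(1)] f'[OF hk(3)]])
      moreover have "f h + f h' + int (k + k') * c = (f h + int k * c) + (f h' + int k' * c)" by (simp add: algebra_simps)
      ultimately have "[f' (m x y) = f' x + f' y] (mod int N)" by (metis cong_sym cong_trans)
      moreover have "m x y \<in> H'" unfolding e H'_def using Hm(1)[OF hk(1,3)] by blast
      ultimately show ?thesis by blast
    qed
    moreover have "H' \<subseteq> A" unfolding H'_def using HA cl pw_A[OF g] by blast
    ultimately have "sub H' f'" using HH' HA(2) by (auto simp: sub_def)
    then show ?thesis using HH' gH' fg fh by blast
  qed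
  then show ?thesis using k0 kN ex_c by blast
qed

text \<open>A character is started on the powers of \<open>s\<close> by giving \<open>s\<close> the
  value \<open>N / k0\<close>, where \<open>k0\<close> is the order of \<open>s\<close>; as
  \<open>k0 \<ge> 2\<close>, this is not 0 modulo \<open>N\<close>. An extension with largest domain
  is defined on all of \<open>A\<close>.\<close>

lemma character_separates:
  assumes s: "s \<in> A" "s \<noteq> e"
  shows "\<exists>f. (\<forall>x\<in>A. \<forall>y\<in>A. [f (m x y) = f x + f y] (mod int N)) \<and> \<not> [f s = 0] (mod int N)"
proof -
  define k0 where "k0 = (LEAST k. k > 0 \<and> pw s k \<in> {e})"
  have triv: "sub {e} (\<lambda>_. 0)" using e unit by (auto simp: sub_def)
  note E = extend[OF triv s(1), folded k0_def]
  have k0: "k0 > 0" "pw s k0 = e" "k0 dvd N" using E by auto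
  have "k0 \<noteq> 1" using k0(2) s unit' by auto
  then have k2: "k0 \<ge> 2" using k0(1) by linarith
  obtain d where d: "N = k0 * d" using k0(3) by blast
  have d0: "d > 0" using d N_pos by (intro gr0I) simp
  have "[int k0 * int d = 0] (mod int N)" by (simp add: d cong_def)
  then obtain H1 f1 where H1: "sub H1 f1" "s \<in> H1" "[f1 s = int d] (mod int N)" using E by blast
  have "d < N" using d d0 k2 by simp
  have "\<not> [int d = 0] (mod int N)" using d0 \<open>d < N\<close> by (simp add: cong_def)
  then have nz: "\<not> [f1 s = 0] (mod int N)" using H1(3) cong_sym cong_trans by blast
  define P where "P p \<longleftrightarrow> sub (fst p) (snd p) \<and> s \<in> fst p \<and> \<not> [snd p s = 0] (mod int N)" for p
  have "P (H1, f1)" using H1 nz by (simp add: P_def)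
  moreover have "card (fst p) < Suc (card A)" if "P p" for p
    using that card_mono[OF fin, of "fst p"] by (auto simp: P_def sub_def)
  ultimately obtain p where p: "P p" "\<And>p'. P p' \<Longrightarrow> card (fst p') \<le> card (fst p)"
    using ex_has_greatest_nat[of P "(H1,f1)" "\<lambda>p. card (fst p)" "Suc (card A)"] by blast
  obtain H f where Hf: "p = (H,f)" by (cases p)
  have H: "sub H f" "s \<in> H" "\<not> [f s = 0] (mod int N)" using p(1) by (auto simp: P_def Hf)
  have HA: "H \<subseteq> A" using H(1) by (simp add: sub_def)
  have "A \<subseteq> H"
  proof (rule ccontr)
    assume "\<not> A \<subseteq> H"
    then obtain g where g: "g \<in> A" "g \<notin> H" by blast
    from extend[OF H(1) g(1)] obtain H' f' where H': "sub H' f'" "H \<subseteq> H'" "g \<in> H'" "\<forall>h\<in>H. [f' h = f h] (mod int N)"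
      by blast
    have "[f' s = f s] (mod int N)" using H'(4) H(2) by blast
    then have "\<not> [f' s = 0] (mod int N)" using H(3) cong_sym cong_trans by blast
    then have "P (H',f')" using H' H by (auto simp: P_def)
    then have "card H' \<le> card H" using p(2)[of "(H',f')"] by (simp add: Hf)
    moreover have "finite H'" using H'(1) fin finite_subset by (auto simp: sub_def)
    then have "card H < card H'" using H'(2,3) g(2) by (intro psubset_card_mono) auto
    ultimately show False by simp
  qed
  then have "H = A" using HA by simp
  then show ?thesis using H by (auto simp: sub_def)
qed

end

section \<open>Separation of points of the abelianised Galois group\<close>

context absgal begin

lemma gal_inv: "\<sigma> \<in> G \<Longrightarrow> inv \<sigma> \<in> G \<and> \<sigma> \<circ> inv \<sigma> = id"
proof -
  assume s: "\<sigma> \<in> G"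
  have surj: "surj \<sigma>" and inj: "inj \<sigma>" using gal_image[OF s] gal_inj[OF s] by auto
  have i: "\<sigma> (inv \<sigma> x) = x" for x by (rule surj_f_inv_f[OF surj])
  have eqI: "inv \<sigma> x = y" if "x = \<sigma> y" for x y using inj that by simp
  have "inv \<sigma> (x + y) = inv \<sigma> x + inv \<sigma> y" for x y by (rule eqI) (simp add: gal_simps[OF s] i)
  moreover have "inv \<sigma> (x * y) = inv \<sigma> x * inv \<sigma> y" for x y by (rule eqI) (simp add: gal_simps[OF s] i)
  moreover have "inv \<sigma> x = x" if "x \<in> K" for x by (rule eqI) (simp add: gal_K[OF s that])
  moreover have "range (inv \<sigma>) = UNIV" using inj by (simp add: inj_imp_surj_inv)
  ultimately show ?thesis by (auto simp: gal_def i)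
qed

text \<open>A finite abelian quotient in which \<sigma> is visible is realised on a transversal,
  with product \<open>r (\<alpha> \<circ> \<beta>)\<close>; commutativity is that of the
  automorphisms on \<open>E\<close>.\<close>

lemma chr_separates:
  assumes s: "\<sigma> \<in> G" and x: "x \<in> E" "\<sigma> x \<noteq> x"
  shows "\<exists>n>0. \<exists>\<psi>. chr n \<psi> \<and> \<not> [\<psi> \<sigma> = 0] (mod int n)"
proof -
  obtain F where F: "subfield F" "K \<subseteq> F" "F \<subseteq> E" "{x} \<subseteq> F" "finite_degree K F" "desc UNIV K F" "stable F"
    using E_hull[of "{x}"] x(1) by (metis empty_subsetI finite.emptyI finite_insert insert_subset)
  obtain \<Gamma> r where trv: "trv F \<Gamma> r" using ex_trv[OF F(5)] by blast
  have T: "finite \<Gamma>" "\<Gamma> \<subseteq> G" "\<And>\<sigma>. \<sigma> \<in> G \<Longrightarrow> r \<sigma> \<in> \<Gamma>" "\<And>\<sigma> x. \<sigma> \<in> G \<Longrightarrow> x \<in> F \<Longrightarrow> r \<sigma> x = \<sigma> x"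
    "\<And>\<sigma> \<tau>. \<sigma> \<in> G \<Longrightarrow> \<tau> \<in> G \<Longrightarrow> (\<And>x. x \<in> F \<Longrightarrow> \<sigma> x = \<tau> x) \<Longrightarrow> r \<sigma> = r \<tau>" "\<And>\<gamma>. \<gamma> \<in> \<Gamma> \<Longrightarrow> r \<gamma> = \<gamma>"
    using trv unfolding trv_def by blast+
  have GG: "\<gamma> \<in> G" if "\<gamma> \<in> \<Gamma>" for \<gamma> using that T(2) by blast
  have rG: "r \<gamma> \<in> G" if "\<gamma> \<in> G" for \<gamma> using T(2,3) that by blast
  have rc: "r (r \<alpha> \<circ> r \<beta>) = r (\<alpha> \<circ> \<beta>)" if h: "\<alpha> \<in> G" "\<beta> \<in> G" for \<alpha> \<beta>
  proof (rule T(5)[OF gal_comp[OF rG[OF h(1)] rG[OF h(2)]] gal_comp[OF h]])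
    fix y assume y: "y \<in> F"
    show "(r \<alpha> \<circ> r \<beta>) y = (\<alpha> \<circ> \<beta>) y" using T(4) h y stableD[OF F(7)] rG by simp
  qed
  define m where "m \<alpha> \<beta> = r (\<alpha> \<circ> \<beta>)" for \<alpha> \<beta> :: "'b \<Rightarrow> 'b"
  interpret fm: fin_monoid \<Gamma> m "r id"
  proof
    show "finite \<Gamma>" "r id \<in> \<Gamma>" using T(1,3) gal_id by auto
    fix \<alpha> \<beta> \<gamma> assume h: "\<alpha> \<in> \<Gamma>" "\<beta> \<in> \<Gamma>"
    note g = GG[OF h(1)] GG[OF h(2)]
    show "m \<alpha> \<beta> \<in> \<Gamma>" unfolding m_def by (rule T(3)[OF gal_comp[OF g]])
    show "m \<alpha> \<beta> = m \<beta> \<alpha>" unfolding m_def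
      by (rule T(5)[OF gal_comp[OF g] gal_comp[OF g(2,1)]]) (use E_comm[OF _ g] F(3) in auto)
    show "m (r id) \<alpha> = \<alpha>" unfolding m_def using rc[OF gal_id g(1)] T(6)[OF h(1)] by simp
    assume h3: "\<gamma> \<in> \<Gamma>"
    note g3 = GG[OF h3]
    show "m (m \<alpha> \<beta>) \<gamma> = m \<alpha> (m \<beta> \<gamma>)"
      unfolding m_def using rc[OF gal_comp[OF g] g3] rc[OF g(1) gal_comp[OF g(2) g3]] T(6)[OF h(1)] T(6)[OF h3]
      by (simp add: comp_assoc)
    assume e: "m \<alpha> \<beta> = m \<alpha> \<gamma>"
    have "r \<beta> = r \<gamma>"
    proof (rule T(5)[OF g(2) g3])
      fix y assume y: "y \<in> F"
      have "\<alpha> (\<beta> y) = \<alpha> (\<gamma> y)"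
        using T(4)[OF gal_comp[OF g] y] T(4)[OF gal_comp[OF g(1) g3] y] e by (simp add: m_def)
      then show "\<beta> y = \<gamma> y" using gal_inj[OF g(1)] by (simp add: inj_on_def)
    qed
    then show "\<beta> = \<gamma>" using T(6) h(2) h3 by simp
  qed
  have "r \<sigma> \<noteq> r id" using T(4)[OF s, of x] T(4)[OF gal_id, of x] x(2) F(4) by auto
  then obtain f where f: "\<And>\<alpha> \<beta>. \<alpha> \<in> \<Gamma> \<Longrightarrow> \<beta> \<in> \<Gamma> \<Longrightarrow> [f (m \<alpha> \<beta>) = f \<alpha> + f \<beta>] (mod int fm.N)" "\<not> [f (r \<sigma>) = 0] (mod int fm.N)"
    using fm.character_separates[OF T(3)[OF s]] by blast
  obtain D where D: "finite D" "D \<subseteq> F" "\<And>\<sigma> \<tau>. \<sigma> \<in> G \<Longrightarrow> \<tau> \<in> G \<Longrightarrow> (\<forall>x\<in>D. \<sigma> x = \<tau> x) \<Longrightarrow> \<forall>x\<in>F. \<sigma> x = \<tau> x"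
    using finite_determined[OF F(5)] by blast
  have "chr fm.N (\<lambda>\<sigma>. f (r \<sigma>))"
    unfolding chr_def
  proof (intro conjI exI[of _ D] ballI impI)
    show "finite D" "D \<subseteq> E" using D F(3) by auto
    show "[f (r (\<alpha> \<circ> \<beta>)) = f (r \<alpha>) + f (r \<beta>)] (mod int fm.N)" if h: "\<alpha> \<in> G" "\<beta> \<in> G" for \<alpha> \<beta>
      using f(1)[OF T(3)[OF h(1)] T(3)[OF h(2)]] rc[OF h] by (simp add: m_def)
    show "[f (r \<alpha>) = f (r \<beta>)] (mod int fm.N)" if h: "\<alpha> \<in> G" "\<beta> \<in> G" "\<forall>x\<in>D. \<alpha> x = \<beta> x" for \<alpha> \<beta>
      using T(5)[OF h(1,2)] D(3)[OF h] by simp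
  qed
  then show ?thesis using fm.N_pos f(2) by blast
qed

end

section \<open>Characters of prime power order\<close>

lemma (in absgal) chr_mono: "chr n \<psi> \<Longrightarrow> d dvd n \<Longrightarrow> chr d \<psi>"
  unfolding chr_def by (meson cong_dvd_modulus int_dvd_int_iff)

lemma (in absgal) chr_id: "chr n \<psi> \<Longrightarrow> [\<psi> id = 0] (mod int n)"
  using chr_hom[OF _ gal_id gal_id, of n \<psi>] by (simp add: cong_iff_dvd_diff)

lemma (in absgal) gal_funpow: "\<sigma> \<in> G \<Longrightarrow> \<sigma> ^^ k \<in> G"
  by (induction k) (auto intro: gal_id[unfolded id_def] gal_id gal_comp)

lemma (in absgal) chr_funpow: "chr n \<psi> \<Longrightarrow> \<sigma> \<in> G \<Longrightarrow> [\<psi> (\<sigma> ^^ k) = int k * \<psi> \<sigma>] (mod int n)"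
proof (induction k)
  case 0
  then show ?case using chr_id by (simp only: funpow.simps(1) of_nat_0 mult_zero_left)
next
  case (Suc k)
  have "[\<psi> (\<sigma> \<circ> \<sigma> ^^ k) = \<psi> \<sigma> + \<psi> (\<sigma> ^^ k)] (mod int n)"
    by (rule chr_hom[OF Suc.prems gal_funpow[OF Suc.prems(2)]])
  also have "[\<psi> \<sigma> + \<psi> (\<sigma> ^^ k) = \<psi> \<sigma> + int k * \<psi> \<sigma>] (mod int n)"
    by (rule cong_add[OF cong_refl Suc.IH[OF Suc.prems]])
  finally show ?case by (simp only: funpow.simps(2) of_nat_Suc distrib_right mult_1_left)
qed

lemma (in absgal) chr_diff_mult:
  assumes "chr n \<psi>" "chr n \<kappa>"
  shows "chr n (\<lambda>\<sigma>. \<psi> \<sigma> - c * \<kappa> \<sigma>)"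
proof -
  obtain X where X: "finite X" "X \<subseteq> E" "\<And>\<sigma> \<tau>. \<sigma> \<in> G \<Longrightarrow> \<tau> \<in> G \<Longrightarrow> (\<forall>x\<in>X. \<sigma> x = \<tau> x) \<Longrightarrow> [\<psi> \<sigma> = \<psi> \<tau>] (mod int n)"
    using assms(1) unfolding chr_def by blast
  obtain Y where Y: "finite Y" "Y \<subseteq> E" "\<And>\<sigma> \<tau>. \<sigma> \<in> G \<Longrightarrow> \<tau> \<in> G \<Longrightarrow> (\<forall>x\<in>Y. \<sigma> x = \<tau> x) \<Longrightarrow> [\<kappa> \<sigma> = \<kappa> \<tau>] (mod int n)"
    using assms(2) unfolding chr_def by blast
  show ?thesis
    unfolding chr_def
  proof (intro conjI exI[of _ "X \<union> Y"] ballI impI)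
    show "finite (X \<union> Y)" "X \<union> Y \<subseteq> E" using X Y by auto
    fix \<sigma> \<tau> assume h: "\<sigma> \<in> G" "\<tau> \<in> G"
    have "[\<psi> (\<sigma> \<circ> \<tau>) - c * \<kappa> (\<sigma> \<circ> \<tau>) = (\<psi> \<sigma> + \<psi> \<tau>) - c * (\<kappa> \<sigma> + \<kappa> \<tau>)] (mod int n)"
      by (intro cong_diff cong_mult[OF cong_refl] chr_hom[OF assms(1) h] chr_hom[OF assms(2) h])
    then show "[\<psi> (\<sigma> \<circ> \<tau>) - c * \<kappa> (\<sigma> \<circ> \<tau>) = \<psi> \<sigma> - c * \<kappa> \<sigma> + (\<psi> \<tau> - c * \<kappa> \<tau>)] (mod int n)"
      by (simp add: algebra_simps)
    assume a: "\<forall>x\<in>X \<union> Y. \<sigma> x = \<tau> x"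
    show "[\<psi> \<sigma> - c * \<kappa> \<sigma> = \<psi> \<tau> - c * \<kappa> \<tau>] (mod int n)"
      by (intro cong_diff cong_mult[OF cong_refl] X(3)[OF h] Y(3)[OF h]) (use a in auto)
  qed
qed

lemma (in absgal) chr_diff_sum:
  assumes "chr n \<psi>" "\<And>i. i \<in> A \<Longrightarrow> chr n (\<kappa> i)"
  shows "chr n (\<lambda>\<sigma>. \<psi> \<sigma> - (\<Sum>i\<in>A. c i * \<kappa> i \<sigma>))"
  using assms(2)
proof (induction A rule: infinite_finite_induct)
  case (insert i A)
  have "chr n (\<lambda>\<sigma>. (\<psi> \<sigma> - (\<Sum>i\<in>A. c i * \<kappa> i \<sigma>)) - c i * \<kappa> i \<sigma>)"
    by (rule chr_diff_mult) (use insert in auto)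
  then show ?case using insert.hyps by (simp add: algebra_simps)
qed (use assms(1) in auto)

lemma (in absgal) chr_divide:
  assumes "chr (l * n) (\<lambda>\<sigma>. int l * \<psi> \<sigma>)" "l > 0"
  shows "chr n \<psi>"
proof -
  have e: "[int l * a = int l * b] (mod int (l * n)) \<longleftrightarrow> [a = b] (mod int n)" for a b
    using assms(2) unfolding cong_iff_dvd_diff right_diff_distrib[symmetric] by simp
  have "[int l * \<psi> (\<sigma> \<circ> \<tau>) = int l * (\<psi> \<sigma> + \<psi> \<tau>)] (mod int (l * n))" if "\<sigma> \<in> G" "\<tau> \<in> G" for \<sigma> \<tau>
    using chr_hom[OF assms(1) that] by (simp add: distrib_left)
  then show ?thesis using assms(1) unfolding chr_def e by blast
qed

locale kum = absgal K for K :: "'b::field set" +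
  assumes roots: "n > 0 \<Longrightarrow> w ^ n = 1 \<Longrightarrow> w \<in> K"
begin

lemma nth_root: "n > 0 \<Longrightarrow> \<exists>z. z ^ n = (x::'b)"
proof -
  assume n: "n > 0"
  have "degree (monom 1 n + [:-x:]) = n"
    using degree_add_eq_left[of "[:-x:]" "monom (1::'b) n"] n by (simp add: degree_monom_eq)
  then obtain z where "poly (monom 1 n + [:-x:]) z = 0"
    using alg_closed_root[OF O, of "monom 1 n + [:-x:]"] n by auto
  then show ?thesis by (auto simp: poly_monom)
qed

text \<open>A root \<eta> of \<open>1 + X + ... + X^(l-1)\<close> is an \<open>l\<close>-th root of
  unity other than 1, since \<open>l\<close> is not the characteristic; an \<open>l^(k-1)\<close>-th
  root \<omega> of it has order dividing \<open>l^k\<close> but not \<open>l^(k-1)\<close>.\<close>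

lemma ex_prim:
  assumes l: "prime l" "l \<noteq> CHAR('b)"
  shows "\<exists>\<omega>::'b. prim (l ^ k) \<omega>"
proof (cases k)
  case 0
  then show ?thesis by (intro exI[of _ 1]) (simp add: prim_def)
next
  case (Suc j)
  have l2: "l \<ge> 2" using prime_ge_2_nat[OF l(1)] .
  define f where "f = (\<Sum>i<l. monom (1::'b) i)"
  have "coeff f (l - 1) = 1" using l2 by (simp add: f_def coeff_sum)
  then have "degree f \<ge> l - 1" by (intro le_degree) simp
  then have "degree f > 0" using l2 by linarith
  then obtain \<eta> where \<eta>: "poly f \<eta> = 0" using alg_closed_root[OF O, of f] by auto
  then have s: "(\<Sum>i<l. \<eta> ^ i) = 0" by (simp add: f_def poly_sum poly_monom)
  have \<eta>l: "\<eta> ^ l = 1" using power_diff_1_eq[of \<eta> l] s by simp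
  have "\<eta> \<noteq> 1"
  proof
    assume "\<eta> = 1"
    then have "of_nat l = (0::'b)" using s by simp
    then have "CHAR('b) dvd l" by (simp add: of_nat_eq_0_iff_char_dvd)
    then have "CHAR('b) = 1 \<or> CHAR('b) = l" using l(1) by (auto simp: prime_nat_iff)
    then show False using l(2) by simp
  qed
  obtain \<omega> where \<omega>: "\<omega> ^ (l ^ j) = \<eta>" using nth_root[of "l ^ j" \<eta>] l2 by auto
  have \<omega>k: "\<omega> ^ (l ^ k) = 1" using \<omega> \<eta>l Suc by (simp add: power_mult power_Suc2 del: power_Suc)
  have \<omega>0: "\<omega> \<noteq> 0" using \<omega>k l2 by (auto simp: zero_power)
  have "\<omega> powi i = 1 \<longleftrightarrow> int (l ^ k) dvd i" for i
  proof
    assume i: "\<omega> powi i = 1"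
    \<comment> \<open>By a Bezout identity the exponent \<open>i\<close> may be replaced by its gcd
      with \<open>l^k\<close>, which is a power of \<open>l\<close>.\<close>
    define g where "g = gcd i (int (l ^ k))"
    obtain u v where uv: "u * i + v * int (l ^ k) = g" using bezout_int[of i "int (l ^ k)"] by (auto simp: g_def)
    have "\<omega> powi g = (\<omega> powi i) powi u * (\<omega> powi int (l ^ k)) powi v"
      using \<omega>0 by (simp add: uv[symmetric] power_int_add power_int_mult[symmetric] mult.commute)
    then have g1: "\<omega> powi g = 1" using i \<omega>k by (simp del: of_nat_power)
    have "nat g dvd l ^ k" by (simp add: g_def nat_dvd_iff del: of_nat_power)
    then obtain r where r: "r \<le> k" "nat g = l ^ r" using divides_primepow_nat[OF l(1)] by blast
    have "\<omega> ^ (l ^ r) = 1" using g1 r(2) by (metis g_def gcd_ge_0_int nat_0_le power_int_of_nat)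
    have "r = k"
    proof (rule ccontr)
      assume "r \<noteq> k"
      then have "l ^ r dvd l ^ j" using r(1) Suc by (intro le_imp_power_dvd) simp
      then obtain d where "l ^ j = l ^ r * d" by blast
      then have "\<omega> ^ (l ^ j) = 1" using \<open>\<omega> ^ (l ^ r) = 1\<close> by (simp add: power_mult)
      then show False using \<omega> \<open>\<eta> \<noteq> 1\<close> by simp
    qed
    then have "g = int (l ^ k)" using r(2) by (metis g_def gcd_ge_0_int nat_0_le)
    then show "int (l ^ k) dvd i" unfolding g_def by (metis gcd_dvd1)
  next
    assume "int (l ^ k) dvd i"
    then obtain d where "i = int (l ^ k) * d" by blast
    then show "\<omega> powi i = 1" using \<omega>k by (simp add: power_int_mult del: of_nat_power)
  qed
  then show ?thesis using \<omega>0 by (intro exI[of _ \<omega>]) (simp add: prim_def)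
qed

text \<open>Away from the characteristic, let \<open>y\<close> be a Kummer generator of \<psi> for
  \<open>\<zeta> = \<omega>^l\<close>. An \<open>l\<close>-th root \<open>z\<close> of
  \<open>y\<close> is scaled by powers of \<omega>, whose exponents form the lift: the
  \<open>l\<close>-th power of the scaling of \<open>z\<close> is that of \<open>y\<close>.\<close>

lemma lift_chr:
  assumes l: "prime l" and \<psi>: "chr (l ^ k) \<psi>"
  shows "\<exists>\<psi>'. chr (l ^ Suc k) \<psi>' \<and> (\<forall>\<sigma>\<in>G. [\<psi>' \<sigma> = \<psi> \<sigma>] (mod int (l ^ k)))"
proof (cases "l = CHAR('b)")
  case True
  then have "CHAR('b) > 0" using prime_gt_0_nat[OF l] by simp
  from artin_schreier_lift[OF this \<psi>] show ?thesis using True prime_gt_0_nat[OF l] by (simp add: mult.commute)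
next
  case False
  have l0: "l > 0" using prime_gt_0_nat[OF l] .
  define n where "n = l ^ k"
  have n0: "n > 0" using l0 by (simp add: n_def)
  obtain \<omega> where \<omega>: "prim (l ^ Suc k) (\<omega>::'b)" using ex_prim[OF l False] by blast
  have \<omega>K: "\<omega> \<in> K" using roots[OF _ prim_power[OF \<omega>]] l0 by simp
  define \<zeta> where "\<zeta> = \<omega> ^ l"
  have \<zeta>: "prim n \<zeta>" unfolding prim_def
  proof (intro conjI allI)
    show "\<zeta> \<noteq> 0" using \<omega> by (simp add: \<zeta>_def prim_def)
    fix j :: int
    have "\<zeta> powi j = \<omega> powi (int l * j)" by (simp add: \<zeta>_def power_int_mult)
    also have "\<dots> = 1 \<longleftrightarrow> int (l ^ Suc k) dvd int l * j" using \<omega> unfolding prim_def by blast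
    also have "int (l ^ Suc k) dvd int l * j \<longleftrightarrow> int n dvd j" using l0 by (simp add: n_def)
    finally show "\<zeta> powi j = 1 \<longleftrightarrow> int n dvd j" .
  qed
  have \<zeta>K: "\<zeta> \<in> K" unfolding \<zeta>_def by (rule sring_power[OF Ks \<omega>K])
  obtain y where y: "y \<in> E" "y \<noteq> 0" "\<And>\<sigma>. \<sigma> \<in> G \<Longrightarrow> \<sigma> y = \<zeta> powi \<psi> \<sigma> * y"
    using kummer_generator[OF \<psi>[folded n_def] \<zeta> \<zeta>K] by blast
  obtain z where z: "z ^ l = y" using nth_root[OF l0] by blast
  have z0: "z \<noteq> 0" using z y(2) l0 by (auto simp: zero_power)
  have ynK: "y ^ n \<in> K"
  proof (rule fixed_K)
    show "y ^ n \<in> sepc" using sring_power[OF Es y(1)] E_sepc by blast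
    fix \<sigma> assume s: "\<sigma> \<in> G"
    have "(\<zeta> powi \<psi> \<sigma>) ^ n = (\<zeta> ^ n) powi \<psi> \<sigma>" by (simp add: power_int_power power_int_power' mult.commute flip: power_int_mult power_int_of_nat)
    then show "\<sigma> (y ^ n) = y ^ n" using y(3)[OF s] prim_power[OF \<zeta>] by (simp add: gal_power[OF s] power_mult_distrib)
  qed
  have zN: "z ^ (l ^ Suc k) = y ^ n" by (simp add: power_mult z n_def)
  have zE: "z \<in> E"
  proof (rule radical_in_E[OF z0, of l])
    show "z ^ l \<in> E" using z y by simp
    show "of_nat l \<noteq> (0::'b)"
    proof
      assume "of_nat l = (0::'b)"
      then have "CHAR('b) dvd l" by (simp add: of_nat_eq_0_iff_char_dvd)
      then have "CHAR('b) = 1 \<or> CHAR('b) = l" using l by (auto simp: prime_nat_iff)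
      then show False using False by simp
    qed
    fix \<sigma> assume s: "\<sigma> \<in> G"
    have "(\<sigma> z / z) ^ (l ^ Suc k) = 1"
      using gal_K[OF s ynK] y(2) zN z0 by (simp add: power_divide gal_power[OF s, symmetric] del: power_Suc)
    from roots[OF _ this] show "\<exists>w\<in>K. \<sigma> z = w * z" using l0 z0 by (intro bexI[of _ "\<sigma> z / z"]) auto
  qed
  obtain \<psi>' where \<psi>': "chr (l ^ Suc k) \<psi>'" "\<And>\<sigma>. \<sigma> \<in> G \<Longrightarrow> \<sigma> z = \<omega> powi \<psi>' \<sigma> * z"
    using kummer_chr[OF zE z0 \<omega> \<omega>K] zN ynK l0 by auto
  have "[\<psi>' \<sigma> = \<psi> \<sigma>] (mod int n)" if s: "\<sigma> \<in> G" for \<sigma>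
  proof -
    have "\<zeta> powi \<psi>' \<sigma> = \<omega> powi (int l * \<psi>' \<sigma>)" by (simp add: \<zeta>_def power_int_mult)
    also have "\<dots> = (\<omega> powi \<psi>' \<sigma>) ^ l" by (metis mult.commute power_int_mult power_int_of_nat)
    finally have "\<zeta> powi \<psi>' \<sigma> * y = (\<omega> powi \<psi>' \<sigma> * z) ^ l"
      by (simp only: power_mult_distrib z)
    also have "\<dots> = \<zeta> powi \<psi> \<sigma> * y" using \<psi>'(2)[OF s] gal_power[OF s UNIV_I, of z l] y(3)[OF s] z by simp
    finally show ?thesis unfolding prim_eq_iff[OF \<zeta>, symmetric] using y(2) by simp
  qed
  then show ?thesis using \<psi>'(1) by (auto simp: n_def)
qed

text \<open>Linear independence over the field with \<open>l\<close> elements, in terms of integer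
  representatives. Indexed families make it possible to use one index set for all primes.\<close>

definition ind :: "'i set \<Rightarrow> nat \<Rightarrow> ('i \<Rightarrow> ('b \<Rightarrow> 'b) \<Rightarrow> int) \<Rightarrow> bool" where
  "ind I l b \<longleftrightarrow> (\<forall>F c. finite F \<longrightarrow> F \<subseteq> I \<longrightarrow> (\<forall>\<sigma>\<in>G. [(\<Sum>i\<in>F. c i * b i \<sigma>) = 0] (mod int l)) \<longrightarrow> (\<forall>i\<in>F. int l dvd c i))"

definition spn :: "'i set \<Rightarrow> nat \<Rightarrow> ('i \<Rightarrow> ('b \<Rightarrow> 'b) \<Rightarrow> int) \<Rightarrow> bool" where
  "spn I l b \<longleftrightarrow> (\<forall>\<psi>. chr l \<psi> \<longrightarrow> (\<exists>F c. finite F \<and> F \<subseteq> I \<and> (\<forall>\<sigma>\<in>G. [\<psi> \<sigma> = (\<Sum>i\<in>F. c i * b i \<sigma>)] (mod int l))))"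

lemma inverse_mod:
  assumes "prime l" "\<not> [a = 0] (mod int l)"
  shows "\<exists>u::nat. [int u * a = 1] (mod int l)"
proof -
  have "coprime (int l) a" using assms by (intro prime_imp_coprime) (auto simp: cong_0_iff)
  then have "coprime a (int l)" by (simp add: coprime_commute)
  then obtain u where u: "[a * u = 1] (mod int l)" using cong_solve_coprime_int by blast
  have "[int (nat (u mod int l)) * a = u * a] (mod int l)"
    using prime_gt_0_nat[OF assms(1)] by (simp add: cong_def mod_mult_left_eq)
  then show ?thesis using u by (metis cong_trans mult.commute)
qed

text \<open>Suppose some \<open>\<tau>0\<close> is killed by all \<open>b j\<close> with
  \<open>j\<close> in \<open>F\<close> but not by \<open>b i\<close>. A multiple of
  \<open>b i\<close> is subtracted so that \<psi> vanishes at \<open>\<tau>0\<close>; an element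
  killed by all of \<open>F\<close> is then moved by a power of \<open>\<tau>0\<close> into the
  kernel of \<open>b i\<close> as well. If there is no such \<open>\<tau>0\<close>, then
  \<open>b i\<close> imposes no further condition and \<open>F\<close> suffices.\<close>

lemma chr_combination:
  assumes l: "prime l" and fin: "finite F" and b: "\<And>i. i \<in> F \<Longrightarrow> chr l (b i)" and \<psi>: "chr l \<psi>"
    and van: "\<And>\<tau>. \<tau> \<in> G \<Longrightarrow> (\<forall>i\<in>F. [b i \<tau> = 0] (mod int l)) \<Longrightarrow> [\<psi> \<tau> = 0] (mod int l)"
  shows "\<exists>c. \<forall>\<sigma>\<in>G. [\<psi> \<sigma> = (\<Sum>i\<in>F. c i * b i \<sigma>)] (mod int l)"
  using fin b \<psi> van
proof (induction F arbitrary: \<psi> rule: finite_induct)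
  case empty
  then show ?case by auto
next
  case (insert i F)
  have bi: "chr l (b i)" using insert.prems(1) by simp
  show ?case
  proof (cases "\<exists>\<tau>\<in>G. (\<forall>j\<in>F. [b j \<tau> = 0] (mod int l)) \<and> \<not> [b i \<tau> = 0] (mod int l)")
    case True
    then obtain \<tau>0 where t0: "\<tau>0 \<in> G" "\<forall>j\<in>F. [b j \<tau>0 = 0] (mod int l)" "\<not> [b i \<tau>0 = 0] (mod int l)" by blast
    obtain u :: nat where u: "[int u * b i \<tau>0 = 1] (mod int l)" using inverse_mod[OF l t0(3)] by blast
    \<comment> \<open>As \<open>u\<close> inverts \<open>b i \<tau>0\<close> modulo
      \<open>l\<close>, this makes \<open>\<psi> - ci * b i\<close> vanish at
      \<open>\<tau>0\<close>.\<close>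
    define ci where "ci = int u * \<psi> \<tau>0"
    have "\<exists>c. \<forall>\<sigma>\<in>G. [\<psi> \<sigma> - ci * b i \<sigma> = (\<Sum>j\<in>F. c j * b j \<sigma>)] (mod int l)"
    proof (rule insert.IH)
      show "chr l (b j)" if "j \<in> F" for j using insert.prems(1) that by simp
      show "chr l (\<lambda>\<sigma>. \<psi> \<sigma> - ci * b i \<sigma>)" by (rule chr_diff_mult[OF insert.prems(2) bi])
      fix \<tau> assume t: "\<tau> \<in> G" "\<forall>j\<in>F. [b j \<tau> = 0] (mod int l)"
      define k where "k = nat ((- int u * b i \<tau>) mod int l)"
      have k: "[int k = - int u * b i \<tau>] (mod int l)" using prime_gt_0_nat[OF l] by (simp add: k_def cong_def)
      define \<rho> where "\<rho> = \<tau> \<circ> \<tau>0 ^^ k"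
      have \<rho>: "\<rho> \<in> G" unfolding \<rho>_def by (rule gal_comp[OF t(1) gal_funpow[OF t0(1)]])
      have val: "[\<kappa> \<rho> = \<kappa> \<tau> - int u * b i \<tau> * \<kappa> \<tau>0] (mod int l)" if \<kappa>: "chr l \<kappa>" for \<kappa>
      proof -
        have "[\<kappa> \<rho> = \<kappa> \<tau> + \<kappa> (\<tau>0 ^^ k)] (mod int l)" unfolding \<rho>_def by (rule chr_hom[OF \<kappa> t(1) gal_funpow[OF t0(1)]])
        also have "[\<kappa> \<tau> + \<kappa> (\<tau>0 ^^ k) = \<kappa> \<tau> + int k * \<kappa> \<tau>0] (mod int l)"
          by (rule cong_add[OF cong_refl chr_funpow[OF \<kappa> t0(1)]])
        also have "[\<kappa> \<tau> + int k * \<kappa> \<tau>0 = \<kappa> \<tau> + (- int u * b i \<tau>) * \<kappa> \<tau>0] (mod int l)"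
          by (intro cong_add cong_mult cong_refl k)
        finally show ?thesis by simp
      qed
      have "[b j \<rho> = 0] (mod int l)" if "j \<in> insert i F" for j
      proof (cases "j = i")
        case True
        have "[int u * b i \<tau> * b i \<tau>0 = b i \<tau>] (mod int l)"
          using cong_mult[OF u cong_refl[of "b i \<tau>"]] by (simp add: mult_ac)
        then have "[b i \<tau> - int u * b i \<tau> * b i \<tau>0 = b i \<tau> - b i \<tau>] (mod int l)" by (intro cong_diff cong_refl)
        then show ?thesis using val[OF bi] True cong_trans by fastforce
      next
        case False
        then have j: "j \<in> F" using that by simp
        have "[b j \<tau> - int u * b i \<tau> * b j \<tau>0 = 0 - int u * b i \<tau> * 0] (mod int l)"
          by (intro cong_diff cong_mult cong_refl) (use t t0 j in auto)
        then show ?thesis using val[of "b j"] insert.prems(1) j cong_trans by fastforce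
      qed
      then have "[\<psi> \<rho> = 0] (mod int l)" using insert.prems(3)[OF \<rho>] by blast
      then have "[\<psi> \<tau> - int u * b i \<tau> * \<psi> \<tau>0 = 0] (mod int l)" using val[OF insert.prems(2)] cong_sym cong_trans by blast
      then show "[\<psi> \<tau> - ci * b i \<tau> = 0] (mod int l)" by (simp add: ci_def mult_ac)
    qed
    then obtain c where c: "\<And>\<sigma>. \<sigma> \<in> G \<Longrightarrow> [\<psi> \<sigma> - ci * b i \<sigma> = (\<Sum>j\<in>F. c j * b j \<sigma>)] (mod int l)" by blast
    have "[\<psi> \<sigma> = (\<Sum>j\<in>insert i F. (c(i := ci)) j * b j \<sigma>)] (mod int l)" if s: "\<sigma> \<in> G" for \<sigma>
    proof -
      have "(\<Sum>j\<in>insert i F. (c(i := ci)) j * b j \<sigma>) = ci * b i \<sigma> + (\<Sum>j\<in>F. (c(i := ci)) j * b j \<sigma>)"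
        using insert.hyps by simp
      also have "(\<Sum>j\<in>F. (c(i := ci)) j * b j \<sigma>) = (\<Sum>j\<in>F. c j * b j \<sigma>)"
        by (rule sum.cong) (use insert.hyps in auto)
      finally show ?thesis using cong_add[OF c[OF s] cong_refl[of "ci * b i \<sigma>"]] by (simp add: add.commute)
    qed
    then show ?thesis by blast
  next
    case False
    have "\<exists>c. \<forall>\<sigma>\<in>G. [\<psi> \<sigma> = (\<Sum>j\<in>F. c j * b j \<sigma>)] (mod int l)"
      by (rule insert.IH) (use insert.prems False in auto)
    then obtain c where c: "\<And>\<sigma>. \<sigma> \<in> G \<Longrightarrow> [\<psi> \<sigma> = (\<Sum>j\<in>F. c j * b j \<sigma>)] (mod int l)" by blast
    have "(\<Sum>j\<in>insert i F. (c(i := 0)) j * b j \<sigma>) = (\<Sum>j\<in>F. c j * b j \<sigma>)" for \<sigma>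
      using insert.hyps by (auto intro!: sum.cong)
    then have "\<forall>\<sigma>\<in>G. [\<psi> \<sigma> = (\<Sum>j\<in>insert i F. (c(i := 0)) j * b j \<sigma>)] (mod int l)" using c by simp
    then show ?thesis by blast
  qed
qed

text \<open>For each \<open>j\<close> some automorphism is killed by the other members of the family
  but not by \<open>b j\<close>; otherwise \<open>chr_combination\<close> would express
  \<open>b j\<close> by the others. Powers and products of these dual elements realise any
  values.\<close>

lemma surj_mod_prime:
  assumes l: "prime l" and b: "\<And>i. i \<in> I \<Longrightarrow> chr l (b i)" and ind: "ind I l b" and F: "finite F" "F \<subseteq> I"
  shows "\<exists>\<sigma>\<in>G. \<forall>i\<in>F. [b i \<sigma> = r i] (mod int l)"
proof -
  have dual: "\<exists>\<tau>\<in>G. (\<forall>i\<in>F - {j}. [b i \<tau> = 0] (mod int l)) \<and> \<not> [b j \<tau> = 0] (mod int l)" if j: "j \<in> F" for j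
  proof (rule ccontr)
    assume n: "\<not> ?thesis"
    have "\<exists>c. \<forall>\<sigma>\<in>G. [b j \<sigma> = (\<Sum>i\<in>F - {j}. c i * b i \<sigma>)] (mod int l)"
      by (rule chr_combination[OF l]) (use F b j n in auto)
    then obtain c where c: "\<And>\<sigma>. \<sigma> \<in> G \<Longrightarrow> [b j \<sigma> = (\<Sum>i\<in>F - {j}. c i * b i \<sigma>)] (mod int l)" by blast
    define c' where "c' = c(j := - 1)"
    have "[(\<Sum>i\<in>F. c' i * b i \<sigma>) = 0] (mod int l)" if s: "\<sigma> \<in> G" for \<sigma>
    proof -
      have "(\<Sum>i\<in>F. c' i * b i \<sigma>) = - b j \<sigma> + (\<Sum>i\<in>F - {j}. c' i * b i \<sigma>)"
        using sum.remove[OF F(1) j, of "\<lambda>i. c' i * b i \<sigma>"] by (simp add: c'_def)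
      also have "(\<Sum>i\<in>F - {j}. c' i * b i \<sigma>) = (\<Sum>i\<in>F - {j}. c i * b i \<sigma>)"
        by (rule sum.cong) (auto simp: c'_def)
      finally show ?thesis using c[OF s] by (simp add: cong_iff_dvd_diff) (metis dvd_minus_iff minus_diff_eq)
    qed
    then have "int l dvd c' j" using ind F j unfolding ind_def by blast
    then show False using prime_gt_1_nat[OF l] by (simp add: c'_def)
  qed
  have dual1: "\<exists>\<tau>\<in>G. \<forall>i\<in>F. [b i \<tau> = (if i = j then r j else 0)] (mod int l)" if j: "j \<in> F" for j
  proof -
    obtain \<tau> where t: "\<tau> \<in> G" "\<forall>i\<in>F - {j}. [b i \<tau> = 0] (mod int l)" "\<not> [b j \<tau> = 0] (mod int l)" using dual[OF j] by blast
    obtain u :: nat where u: "[int u * b j \<tau> = 1] (mod int l)" using inverse_mod[OF l t(3)] by blast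
    define k where "k = nat ((int u * r j) mod int l)"
    have k: "[int k = int u * r j] (mod int l)" using prime_gt_0_nat[OF l] by (simp add: k_def cong_def)
    have "[b i (\<tau> ^^ k) = (if i = j then r j else 0)] (mod int l)" if i: "i \<in> F" for i
    proof -
      have a: "[b i (\<tau> ^^ k) = int k * b i \<tau>] (mod int l)" using chr_funpow[OF b t(1)] i F by blast
      show ?thesis
      proof (cases "i = j")
        case True
        have "[int k * b j \<tau> = int u * r j * b j \<tau>] (mod int l)" by (rule cong_mult[OF k cong_refl])
        moreover have "[int u * b j \<tau> * r j = 1 * r j] (mod int l)" by (rule cong_mult[OF u cong_refl])
        ultimately have "[int k * b j \<tau> = r j] (mod int l)" by (simp add: mult_ac cong_def)
        then show ?thesis using cong_trans[OF a] True by simp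
      next
        case False
        then have "[int k * b i \<tau> = int k * 0] (mod int l)" using t(2) i by (intro cong_mult cong_refl) auto
        then show ?thesis using a False cong_trans by fastforce
      qed
    qed
    then show ?thesis using gal_funpow[OF t(1)] by blast
  qed
  have "\<exists>\<sigma>\<in>G. \<forall>i\<in>F. [b i \<sigma> = (if i \<in> F' then r i else 0)] (mod int l)" if "finite F'" "F' \<subseteq> F" for F'
    using that
  proof (induction F' rule: finite_induct)
    case empty
    have "[b i id = 0] (mod int l)" if "i \<in> F" for i using chr_id[OF b] that F by blast
    then show ?case by (intro bexI[OF _ gal_id]) (simp only: empty_iff if_False, blast)
  next
    case (insert j F')
    obtain \<sigma> where s: "\<sigma> \<in> G" "\<forall>i\<in>F. [b i \<sigma> = (if i \<in> F' then r i else 0)] (mod int l)" using insert by auto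
    obtain \<tau> where t: "\<tau> \<in> G" "\<forall>i\<in>F. [b i \<tau> = (if i = j then r j else 0)] (mod int l)" using dual1[of j] insert.prems by auto
    have "[b i (\<sigma> \<circ> \<tau>) = (if i \<in> insert j F' then r i else 0)] (mod int l)" if i: "i \<in> F" for i
    proof -
      have "[b i (\<sigma> \<circ> \<tau>) = b i \<sigma> + b i \<tau>] (mod int l)" using chr_hom[OF b s(1) t(1)] i F by blast
      moreover have "[b i \<sigma> + b i \<tau> = (if i \<in> F' then r i else 0) + (if i = j then r j else 0)] (mod int l)"
        using s(2) t(2) i by (intro cong_add) blast+
      moreover have "(if i \<in> F' then r i else 0) + (if i = j then r j else 0) = (if i \<in> insert j F' then r i else 0)"
        using insert.hyps by auto
      ultimately show ?thesis using cong_trans by (simp only:) blast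
    qed
    then show ?case using gal_comp[OF s(1) t(1)] by blast
  qed
  from this[OF F(1) order_refl] show ?thesis by auto
qed

lemma cong_prime_powers:
  assumes n: "n > 0" and h: "\<And>l. l \<in> prime_factors n \<Longrightarrow> [a = b] (mod int (l ^ multiplicity l n))"
  shows "[a = b] (mod int n)"
proof (cases "a = b")
  case False
  define y where "y = nat \<bar>a - b\<bar>"
  have "n dvd y"
  proof (rule multiplicity_le_imp_dvd)
    show "n \<noteq> 0" using n by simp
    fix p :: nat assume p: "prime p"
    show "multiplicity p n \<le> multiplicity p y"
    proof (cases "p \<in> prime_factors n")
      case True
      have "int (p ^ multiplicity p n) dvd a - b" using h[OF True] by (simp add: cong_iff_dvd_diff)
      then have "p ^ multiplicity p n dvd y" unfolding y_def by (metis int_dvd_int_iff nat_0_le abs_ge_zero dvd_abs_iff)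
      then show ?thesis using False p by (intro multiplicity_geI) (auto simp: y_def)
    next
      case False
      then have "multiplicity p n = 0" using p n by (metis prime_factorsI not_dvd_imp_multiplicity_0 less_irrefl)
      then show ?thesis by simp
    qed
  qed
  then have "int n dvd \<bar>a - b\<bar>" unfolding y_def by (metis int_dvd_int_iff nat_0_le abs_ge_zero)
  then show ?thesis by (simp add: cong_iff_dvd_diff)
qed simp

text \<open>Repeated lifting gives a compatible sequence modulo the powers of each prime. For
  general \<open>n\<close> the prime power components are glued by the Chinese remainder theorem,
  separately for every \<sigma>; additivity and continuity are then checked on the
  components.\<close>

lemma tower:
  assumes b: "\<And>l. prime l \<Longrightarrow> chr l (b l)"
  shows "\<exists>\<Theta>. (\<forall>n>0. chr n (\<Theta> n)) \<and> (\<forall>m n. 0 < m \<longrightarrow> 0 < n \<longrightarrow> m dvd n \<longrightarrow> (\<forall>\<sigma>\<in>G. [\<Theta> n \<sigma> = \<Theta> m \<sigma>] (mod int m))) \<and>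
    (\<forall>l. prime l \<longrightarrow> (\<forall>\<sigma>\<in>G. [\<Theta> l \<sigma> = b l \<sigma>] (mod int l)))"
proof -
  have "\<forall>l. \<exists>\<Psi>. prime l \<longrightarrow> \<Psi> 0 = b l \<and> (\<forall>k. chr (l ^ Suc k) (\<Psi> k) \<and> (\<forall>\<sigma>\<in>G. [\<Psi> (Suc k) \<sigma> = \<Psi> k \<sigma>] (mod int (l ^ Suc k))))"
  proof
    fix l
    show "\<exists>\<Psi>. prime l \<longrightarrow> \<Psi> 0 = b l \<and> (\<forall>k. chr (l ^ Suc k) (\<Psi> k) \<and> (\<forall>\<sigma>\<in>G. [\<Psi> (Suc k) \<sigma> = \<Psi> k \<sigma>] (mod int (l ^ Suc k))))"
    proof (cases "prime l")
      case True
      have "\<exists>f. \<forall>k. (chr (l ^ Suc k) (f k) \<and> (k = 0 \<longrightarrow> f k = b l)) \<and> (\<forall>\<sigma>\<in>G. [f (Suc k) \<sigma> = f k \<sigma>] (mod int (l ^ Suc k)))"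
      proof (rule dependent_nat_choice)
        show "\<exists>x. chr (l ^ Suc 0) x \<and> (0 = (0::nat) \<longrightarrow> x = b l)" using b[OF True] by simp
        fix x k assume "chr (l ^ Suc k) x \<and> (k = 0 \<longrightarrow> x = b l)"
        then show "\<exists>y. (chr (l ^ Suc (Suc k)) y \<and> (Suc k = 0 \<longrightarrow> y = b l)) \<and> (\<forall>\<sigma>\<in>G. [y \<sigma> = x \<sigma>] (mod int (l ^ Suc k)))"
          using lift_chr[OF True, of "Suc k" x] by (auto simp del: power_Suc)
      qed
      then show ?thesis by metis
    qed simp
  qed
  then obtain \<Psi> where \<Psi>: "\<And>l. prime l \<Longrightarrow> \<Psi> l 0 = b l" "\<And>l k. prime l \<Longrightarrow> chr (l ^ Suc k) (\<Psi> l k)"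
    "\<And>l k \<sigma>. prime l \<Longrightarrow> \<sigma> \<in> G \<Longrightarrow> [\<Psi> l (Suc k) \<sigma> = \<Psi> l k \<sigma>] (mod int (l ^ Suc k))" by metis
  \<comment> \<open>A shift of index: \<open>\<Psi> l k\<close> is a character modulo
    \<open>l^(k+1)\<close>, while \<open>\<psi> l k\<close> is one modulo \<open>l^k\<close>,
    trivial for \<open>k = 0\<close>.\<close>
  define \<psi> where "\<psi> l k = (if k = 0 then (\<lambda>_. 0) else \<Psi> l (k - 1))" for l k
  have \<psi>c: "chr (l ^ k) (\<psi> l k)" if "prime l" for l k
  proof (cases k)
    case 0
    then show ?thesis by (auto simp: \<psi>_def chr_def)
  next
    case (Suc j)
    then show ?thesis using \<Psi>(2)[OF that, of j] by (simp add: \<psi>_def del: power_Suc)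
  qed
  have \<psi>s: "[\<psi> l (Suc k) \<sigma> = \<psi> l k \<sigma>] (mod int (l ^ k))" if "prime l" "\<sigma> \<in> G" for l k \<sigma>
    using \<Psi>(3)[OF that, of "k - 1"] by (cases k) (auto simp: \<psi>_def simp del: power_Suc)
  have \<psi>m: "[\<psi> l (k + d) \<sigma> = \<psi> l k \<sigma>] (mod int (l ^ k))" if "prime l" "\<sigma> \<in> G" for l k d \<sigma>
  proof (induction d)
    case (Suc d)
    have "int (l ^ k) dvd int (l ^ (k + d))" by (simp add: power_add)
    then have "[\<psi> l (Suc (k + d)) \<sigma> = \<psi> l (k + d) \<sigma>] (mod int (l ^ k))"
      using \<psi>s[OF that, of "k + d"] cong_dvd_modulus by blast
    then show ?case using Suc cong_trans by simp
  qed simp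
  define M where "M l n = l ^ multiplicity l n" for l n :: nat
  have "\<exists>x. \<forall>l\<in>prime_factors n. [x = \<psi> l (multiplicity l n) \<sigma>] (mod int (M l n))" for n \<sigma>
  proof -
    have "\<exists>x. \<forall>l\<in>prime_factors n. [x = nat (\<psi> l (multiplicity l n) \<sigma> mod int (M l n))] (mod M l n)"
    proof (rule chinese_remainder_nat, simp, intro ballI impI)
      fix l j assume h: "l \<in> prime_factors n" "j \<in> prime_factors n" "l \<noteq> j"
      then have "coprime l j" by (intro primes_coprime) auto
      then show "coprime (M l n) (M j n)" by (simp add: M_def)
    qed
    then obtain x where x: "\<And>l. l \<in> prime_factors n \<Longrightarrow> [x = nat (\<psi> l (multiplicity l n) \<sigma> mod int (M l n))] (mod M l n)" by blast
    have "[int x = \<psi> l (multiplicity l n) \<sigma>] (mod int (M l n))" if l: "l \<in> prime_factors n" for l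
    proof -
      have "M l n > 0" using prime_gt_0_nat[of l] l by (auto simp: M_def)
      then have "int (nat (\<psi> l (multiplicity l n) \<sigma> mod int (M l n))) = \<psi> l (multiplicity l n) \<sigma> mod int (M l n)" by simp
      moreover have "[int x = int (nat (\<psi> l (multiplicity l n) \<sigma> mod int (M l n)))] (mod int (M l n))"
        using x[OF l] by (simp only: cong_int_iff)
      ultimately show ?thesis by (simp add: cong_def)
    qed
    then show ?thesis by blast
  qed
  then obtain \<Theta> where \<Theta>: "\<And>n \<sigma> l. l \<in> prime_factors n \<Longrightarrow> [\<Theta> n \<sigma> = \<psi> l (multiplicity l n) \<sigma>] (mod int (M l n))" by metis
  have pf: "prime l" if "l \<in> prime_factors n" for l n :: nat using that by auto
  have "chr n (\<Theta> n)" if n: "n > 0" for n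
  proof -
    have "\<forall>l\<in>prime_factors n. \<exists>X. finite X \<and> X \<subseteq> E \<and> (\<forall>\<sigma>\<in>G. \<forall>\<tau>\<in>G. (\<forall>x\<in>X. \<sigma> x = \<tau> x) \<longrightarrow>
        [\<psi> l (multiplicity l n) \<sigma> = \<psi> l (multiplicity l n) \<tau>] (mod int (M l n)))"
      using \<psi>c pf unfolding chr_def M_def by blast
    then obtain X where X: "\<And>l. l \<in> prime_factors n \<Longrightarrow> finite (X l) \<and> X l \<subseteq> E \<and> (\<forall>\<sigma>\<in>G. \<forall>\<tau>\<in>G. (\<forall>x\<in>X l. \<sigma> x = \<tau> x) \<longrightarrow>
        [\<psi> l (multiplicity l n) \<sigma> = \<psi> l (multiplicity l n) \<tau>] (mod int (M l n)))" by metis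
    define Y where "Y = (\<Union>l\<in>prime_factors n. X l)"
    show ?thesis
      unfolding chr_def
    proof (intro conjI exI[of _ Y] ballI impI)
      show "finite Y" "Y \<subseteq> E" using X by (auto simp: Y_def)
      fix \<sigma> \<tau> assume h: "\<sigma> \<in> G" "\<tau> \<in> G"
      show "[\<Theta> n (\<sigma> \<circ> \<tau>) = \<Theta> n \<sigma> + \<Theta> n \<tau>] (mod int n)"
      proof (rule cong_prime_powers[OF n, folded M_def])
        fix l assume l: "l \<in> prime_factors n"
        have "[\<psi> l (multiplicity l n) (\<sigma> \<circ> \<tau>) = \<psi> l (multiplicity l n) \<sigma> + \<psi> l (multiplicity l n) \<tau>] (mod int (M l n))"
          using chr_hom[OF \<psi>c[OF pf[OF l]] h] by (simp add: M_def)
        then show "[\<Theta> n (\<sigma> \<circ> \<tau>) = \<Theta> n \<sigma> + \<Theta> n \<tau>] (mod int (M l n))"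
          using \<Theta>[OF l, of "\<sigma> \<circ> \<tau>"] cong_add[OF \<Theta>[OF l, of \<sigma>] \<Theta>[OF l, of \<tau>]] cong_sym cong_trans by meson
      qed
      assume a: "\<forall>x\<in>Y. \<sigma> x = \<tau> x"
      show "[\<Theta> n \<sigma> = \<Theta> n \<tau>] (mod int n)"
      proof (rule cong_prime_powers[OF n, folded M_def])
        fix l assume l: "l \<in> prime_factors n"
        have "[\<psi> l (multiplicity l n) \<sigma> = \<psi> l (multiplicity l n) \<tau>] (mod int (M l n))"
          using X[OF l] h a l by (auto simp: Y_def)
        then show "[\<Theta> n \<sigma> = \<Theta> n \<tau>] (mod int (M l n))"
          using \<Theta>[OF l, of \<sigma>] \<Theta>[OF l, of \<tau>] cong_sym cong_trans by meson
      qed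
    qed
  qed
  moreover have "[\<Theta> n \<sigma> = \<Theta> m \<sigma>] (mod int m)" if mn: "0 < m" "0 < n" "m dvd n" and s: "\<sigma> \<in> G" for m n \<sigma>
  proof (rule cong_prime_powers[OF mn(1), folded M_def])
    fix l assume l: "l \<in> prime_factors m"
    then have ln: "l \<in> prime_factors n" using mn dvd_prime_factors[of n m] by auto
    have "multiplicity l m \<le> multiplicity l n" using mn by (intro dvd_imp_multiplicity_le) auto
    then obtain d where d: "multiplicity l n = multiplicity l m + d" using le_Suc_ex by blast
    have "[\<psi> l (multiplicity l n) \<sigma> = \<psi> l (multiplicity l m) \<sigma>] (mod int (M l m))"
      unfolding d M_def by (rule \<psi>m[OF pf[OF l] s])
    moreover have "[\<Theta> n \<sigma> = \<psi> l (multiplicity l n) \<sigma>] (mod int (M l m))"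
      by (rule cong_dvd_modulus[OF \<Theta>[OF ln]]) (simp add: M_def d power_add)
    ultimately show "[\<Theta> n \<sigma> = \<Theta> m \<sigma>] (mod int (M l m))" using \<Theta>[OF l, of \<sigma>] cong_sym cong_trans by meson
  qed
  moreover have "[\<Theta> l \<sigma> = b l \<sigma>] (mod int l)" if l: "prime l" and s: "\<sigma> \<in> G" for l \<sigma>
  proof -
    have "l \<in> prime_factors l" using l by (simp add: prime_factors_dvd prime_gt_0_nat)
    moreover have "multiplicity l l = 1" using l by simp
    ultimately show ?thesis using \<Theta>[of l l \<sigma>] \<Psi>(1)[OF l] by (simp add: M_def \<psi>_def)
  qed
  ultimately show ?thesis by blast
qed

end

section \<open>Abelian Galois groups as powers of the profinite integers\<close>

lemma topspace_zhat: "topspace zhat_topology = zhat"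
  unfolding zhat_topology_def by (auto simp: zhat_def PiE_def)

lemma Hausdorff_zhat_pow: "Hausdorff_space (zhat_pow_topology I)"
  unfolding zhat_pow_topology_def zhat_topology_def
  by (simp add: Hausdorff_space_product_topology Hausdorff_space_subtopology Hausdorff_space_discrete_topology)

context kum begin

text \<open>Modulo \<open>l\<close> the character is a combination of the towers; subtracting the
  same combination modulo \<open>l^(k+1)\<close> leaves a character divisible by \<open>l\<close>,
  and the quotient is one modulo \<open>l^k\<close>. As all towers vanish at \<sigma>, the induction
  hypothesis for the quotient suffices.\<close>

lemma combination_power:
  assumes l: "prime l" and th: "\<And>i n. i \<in> I \<Longrightarrow> n > 0 \<Longrightarrow> chr n (\<Theta> i n)"
    and comp: "\<And>i m n \<sigma>. i \<in> I \<Longrightarrow> 0 < m \<Longrightarrow> 0 < n \<Longrightarrow> m dvd n \<Longrightarrow> \<sigma> \<in> G \<Longrightarrow> [\<Theta> i n \<sigma> = \<Theta> i m \<sigma>] (mod int m)"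
    and sp: "spn I l (\<lambda>i. \<Theta> i l)" and \<sigma>: "\<sigma> \<in> G" "\<And>i n. i \<in> I \<Longrightarrow> n > 0 \<Longrightarrow> [\<Theta> i n \<sigma> = 0] (mod int n)"
  shows "chr (l ^ k) \<psi> \<Longrightarrow> [\<psi> \<sigma> = 0] (mod int (l ^ k))"
proof (induction k arbitrary: \<psi>)
  case (Suc k)
  have l0: "l > 0" using prime_gt_0_nat[OF l] .
  have N0: "l ^ Suc k > 0" using l0 by simp
  have "chr l \<psi>" by (rule chr_mono[OF Suc.prems]) simp
  then obtain F c where F: "finite F" "F \<subseteq> I" "\<And>\<tau>. \<tau> \<in> G \<Longrightarrow> [\<psi> \<tau> = (\<Sum>i\<in>F. c i * \<Theta> i l \<tau>)] (mod int l)"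
    using sp[unfolded spn_def, rule_format, OF \<open>chr l \<psi>\<close>] by metis
  define \<kappa> where "\<kappa> \<tau> = \<psi> \<tau> - (\<Sum>i\<in>F. c i * \<Theta> i (l ^ Suc k) \<tau>)" for \<tau>
  have \<kappa>: "chr (l ^ Suc k) \<kappa>" unfolding \<kappa>_def
    by (rule chr_diff_sum[OF Suc.prems]) (use th N0 F in blast)
  have dv: "int l dvd \<kappa> \<tau>" if t: "\<tau> \<in> G" for \<tau>
  proof -
    have "[(\<Sum>i\<in>F. c i * \<Theta> i (l ^ Suc k) \<tau>) = (\<Sum>i\<in>F. c i * \<Theta> i l \<tau>)] (mod int l)"
    proof (rule cong_sum)
      fix i assume "i \<in> F"
      then show "[c i * \<Theta> i (l ^ Suc k) \<tau> = c i * \<Theta> i l \<tau>] (mod int l)"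
        using comp[of i l "l ^ Suc k" \<tau>] F(2) l0 N0 t by (intro cong_mult cong_refl) auto
    qed
    then have "[\<kappa> \<tau> = 0] (mod int l)"
      unfolding \<kappa>_def using F(3)[OF t] cong_diff[of "\<psi> \<tau>" "\<Sum>i\<in>F. c i * \<Theta> i l \<tau>" "int l"] by fastforce
    then show ?thesis by (simp add: cong_0_iff)
  qed
  define \<psi>2 where "\<psi>2 \<tau> = \<kappa> \<tau> div int l" for \<tau>
  have e: "int l * \<psi>2 \<tau> = \<kappa> \<tau>" if "\<tau> \<in> G" for \<tau> using dv[OF that] by (simp add: \<psi>2_def)
  have "chr (l * l ^ k) (\<lambda>\<tau>. int l * \<psi>2 \<tau>)"
    using \<kappa> unfolding chr_def by (simp add: e gal_comp)
  then have "chr (l ^ k) \<psi>2" by (rule chr_divide[OF _ l0])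
  from Suc.IH[OF this] have "int (l ^ k) dvd \<psi>2 \<sigma>" by (simp only: cong_0_iff)
  then have "int l * int (l ^ k) dvd int l * \<psi>2 \<sigma>" by (rule mult_dvd_mono[OF dvd_refl])
  then have k0: "[\<kappa> \<sigma> = 0] (mod int (l ^ Suc k))" using e[OF \<sigma>(1)] by (simp add: cong_0_iff)
  have "[(\<Sum>i\<in>F. c i * \<Theta> i (l ^ Suc k) \<sigma>) = (\<Sum>i\<in>F. c i * 0)] (mod int (l ^ Suc k))"
    by (intro cong_sum cong_mult cong_refl \<sigma>(2)) (use F N0 in auto)
  then have "[\<kappa> \<sigma> + (\<Sum>i\<in>F. c i * \<Theta> i (l ^ Suc k) \<sigma>) = 0 + (\<Sum>i\<in>F. c i * 0)] (mod int (l ^ Suc k))"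
    by (rule cong_add[OF k0])
  then show ?case by (simp add: \<kappa>_def)
qed simp

text \<open>The basis may depend on \<open>l\<close>, but its index set may not: for each
  \<open>i\<close> the members \<open>b l i\<close> for all primes \<open>l\<close> are glued into a
  single tower, which becomes one coordinate of the isomorphism.\<close>

theorem gal_iso:
  fixes I :: "'i set"
  assumes bas: "\<And>l. prime l \<Longrightarrow> \<exists>b. (\<forall>i\<in>I. chr l (b i)) \<and> ind I l b \<and> spn I l b"
  shows "gal_iso_zhat_pow K E I"
proof -
  have "\<forall>l. \<exists>b. prime l \<longrightarrow> (\<forall>i\<in>I. chr l (b i)) \<and> ind I l b \<and> spn I l b" using bas by blast
  then obtain b where b: "\<And>l i. prime l \<Longrightarrow> i \<in> I \<Longrightarrow> chr l (b l i)" "\<And>l. prime l \<Longrightarrow> ind I l (b l)" "\<And>l. prime l \<Longrightarrow> spn I l (b l)"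
    by metis
  have "\<forall>i\<in>I. \<exists>\<Theta>. (\<forall>n>0. chr n (\<Theta> n)) \<and> (\<forall>m n. 0 < m \<longrightarrow> 0 < n \<longrightarrow> m dvd n \<longrightarrow> (\<forall>\<sigma>\<in>G. [\<Theta> n \<sigma> = \<Theta> m \<sigma>] (mod int m))) \<and>
    (\<forall>l. prime l \<longrightarrow> (\<forall>\<sigma>\<in>G. [\<Theta> l \<sigma> = b l i \<sigma>] (mod int l)))"
    using tower[OF b(1)] by (intro ballI)
  then obtain \<Theta> where T: "\<forall>i\<in>I. (\<forall>n>0. chr n (\<Theta> i n)) \<and> (\<forall>m n. 0 < m \<longrightarrow> 0 < n \<longrightarrow> m dvd n \<longrightarrow> (\<forall>\<sigma>\<in>G. [\<Theta> i n \<sigma> = \<Theta> i m \<sigma>] (mod int m))) \<and>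
    (\<forall>l. prime l \<longrightarrow> (\<forall>\<sigma>\<in>G. [\<Theta> i l \<sigma> = b l i \<sigma>] (mod int l)))"
    by (rule bchoice[THEN exE])
  have th: "chr n (\<Theta> i n)" if "i \<in> I" "n > 0" for i n using T that by blast
  have comp: "[\<Theta> i n \<sigma> = \<Theta> i m \<sigma>] (mod int m)" if "i \<in> I" "0 < m" "0 < n" "m dvd n" "\<sigma> \<in> G" for i m n \<sigma>
    using T that by blast
  have base: "[\<Theta> i l \<sigma> = b l i \<sigma>] (mod int l)" if "i \<in> I" "prime l" "\<sigma> \<in> G" for i l \<sigma>
    using T that by blast
  have sumc: "[(\<Sum>i\<in>F. c i * \<Theta> i l \<sigma>) = (\<Sum>i\<in>F. c i * b l i \<sigma>)] (mod int l)"
    if "F \<subseteq> I" "prime l" "\<sigma> \<in> G" for F c l \<sigma>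
    by (intro cong_sum cong_mult cong_refl base) (use that in auto)
  have sp: "spn I l (\<lambda>i. \<Theta> i l)" if l: "prime l" for l
    unfolding spn_def
  proof (intro allI impI)
    fix \<psi> assume "chr l \<psi>"
    then obtain F c where F: "finite F" "F \<subseteq> I" "\<forall>\<sigma>\<in>G. [\<psi> \<sigma> = (\<Sum>i\<in>F. c i * b l i \<sigma>)] (mod int l)"
      using b(3)[OF l, unfolded spn_def, rule_format, OF \<open>chr l \<psi>\<close>] by metis
    then have "\<forall>\<sigma>\<in>G. [\<psi> \<sigma> = (\<Sum>i\<in>F. c i * \<Theta> i l \<sigma>)] (mod int l)" using sumc[OF F(2) l] cong_sym cong_trans by meson
    then show "\<exists>F c. finite F \<and> F \<subseteq> I \<and> (\<forall>\<sigma>\<in>G. [\<psi> \<sigma> = (\<Sum>i\<in>F. c i * \<Theta> i l \<sigma>)] (mod int l))" using F by (intro exI[of _ F] exI[of _ c]) simp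
  qed
  have idp: "ind I l (\<lambda>i. \<Theta> i l)" if l: "prime l" for l
    unfolding ind_def
  proof (intro allI impI)
    fix F :: "'i set" and c assume F: "finite F" "F \<subseteq> I" "\<forall>\<sigma>\<in>G. [(\<Sum>i\<in>F. c i * \<Theta> i l \<sigma>) = 0] (mod int l)"
    then have "\<forall>\<sigma>\<in>G. [(\<Sum>i\<in>F. c i * b l i \<sigma>) = 0] (mod int l)" using sumc[OF F(2) l] cong_sym cong_trans by meson
    then show "\<forall>i\<in>F. int l dvd c i" using b(2)[OF l] F unfolding ind_def by blast
  qed
  \<comment> \<open>An automorphism killed by all towers is killed by every character, one prime
    power at a time.\<close>
  have sep: "\<sigma> x = x" if \<sigma>: "\<sigma> \<in> G" "\<And>i n. i \<in> I \<Longrightarrow> n > 0 \<Longrightarrow> [\<Theta> i n \<sigma> = 0] (mod int n)" and x: "x \<in> E" for \<sigma> x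
  proof (rule ccontr)
    assume "\<sigma> x \<noteq> x"
    then obtain n \<psi> where n: "n > 0" "chr n \<psi>" "\<not> [\<psi> \<sigma> = 0] (mod int n)" using chr_separates[OF \<sigma>(1) x] by blast
    have "[\<psi> \<sigma> = 0] (mod int n)"
    proof (rule cong_prime_powers[OF n(1)])
      fix l assume "l \<in> prime_factors n"
      then have l: "prime l" by auto
      show "[\<psi> \<sigma> = 0] (mod int (l ^ multiplicity l n))"
        by (rule combination_power[OF l th comp sp[OF l] \<sigma>]) (auto intro: chr_mono[OF n(2)] multiplicity_dvd)
    qed
    then show False using n(3) by simp
  qed
  \<comment> \<open>Prime factors are added one at a time: if the values are right modulo
    \<open>d\<close>, independence supplies a \<tau> with prescribed values modulo \<open>l\<close>,
    and its \<open>d\<close>-th power corrects them modulo \<open>l * d\<close>.\<close>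
  have surj: "\<exists>\<sigma>\<in>G. \<forall>i\<in>F. [\<Theta> i n \<sigma> = r i] (mod int n)" if F: "finite F" "F \<subseteq> I" and n: "n > 0" for F n r
  proof -
    have "\<forall>r. \<exists>\<sigma>\<in>G. \<forall>i\<in>F. [\<Theta> i n \<sigma> = r i] (mod int d)" if "d dvd n" for d
      using that
    proof (induction d rule: prime_divisors_induct)
      case zero
      then show ?case using n by simp
    next
      case (unit d)
      then show ?case using gal_id by auto
    next
      case (factor l d)
      show ?case
      proof
        fix r
        have dn: "d dvd n" "l dvd n" using factor.prems by (auto dest: dvd_mult_left dvd_mult_right)
        obtain \<sigma> where s: "\<sigma> \<in> G" "\<forall>i\<in>F. [\<Theta> i n \<sigma> = r i] (mod int d)" using factor.IH[OF dn(1)] by blast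
        have "\<forall>i\<in>F. \<exists>z. r i - \<Theta> i n \<sigma> = int d * z" 
        proof
          fix i assume "i \<in> F"
          with s(2) have "[r i = \<Theta> i n \<sigma>] (mod int d)" using cong_sym by metis
          then show "\<exists>z. r i - \<Theta> i n \<sigma> = int d * z" by (simp only: cong_iff_dvd_diff dvd_def)
        qed
        then obtain z where z: "\<And>i. i \<in> F \<Longrightarrow> r i - \<Theta> i n \<sigma> = int d * z i" by metis
        obtain \<tau> where t: "\<tau> \<in> G" "\<forall>i\<in>F. [\<Theta> i l \<tau> = z i] (mod int l)"
          using surj_mod_prime[OF factor.hyps th idp[OF factor.hyps] F, of z] prime_gt_0_nat[OF factor.hyps] by blast
        have "[\<Theta> i n (\<sigma> \<circ> \<tau> ^^ d) = r i] (mod int (l * d))" if i: "i \<in> F" for i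
        proof -
          have iI: "i \<in> I" using i F by blast
          have "[\<Theta> i n (\<sigma> \<circ> \<tau> ^^ d) = \<Theta> i n \<sigma> + \<Theta> i n (\<tau> ^^ d)] (mod int n)"
            by (rule chr_hom[OF th[OF iI n] s(1) gal_funpow[OF t(1)]])
          also have "[\<Theta> i n \<sigma> + \<Theta> i n (\<tau> ^^ d) = \<Theta> i n \<sigma> + int d * \<Theta> i n \<tau>] (mod int n)"
            by (rule cong_add[OF cong_refl chr_funpow[OF th[OF iI n] t(1)]])
          finally have a: "[\<Theta> i n (\<sigma> \<circ> \<tau> ^^ d) = \<Theta> i n \<sigma> + int d * \<Theta> i n \<tau>] (mod int (l * d))"
            by (rule cong_dvd_modulus) (use factor.prems in \<open>simp only: int_dvd_int_iff\<close>)
          have "[\<Theta> i n \<tau> = z i] (mod int l)"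
            using comp[OF iI _ n dn(2) t(1)] t(2) i prime_gt_0_nat[OF factor.hyps] cong_trans by blast
          then have "int l dvd \<Theta> i n \<tau> - z i" by (simp add: cong_iff_dvd_diff)
          then have "int l * int d dvd (\<Theta> i n \<tau> - z i) * int d" by (rule mult_dvd_mono[OF _ dvd_refl])
          moreover have "\<Theta> i n \<sigma> + int d * \<Theta> i n \<tau> - r i = (\<Theta> i n \<tau> - z i) * int d"
            using z[OF i] by (simp add: algebra_simps)
          ultimately have "[\<Theta> i n \<sigma> + int d * \<Theta> i n \<tau> = r i] (mod int (l * d))" by (simp add: cong_iff_dvd_diff)
          then show ?thesis using a cong_trans by blast
        qed
        then show "\<exists>\<sigma>\<in>G. \<forall>i\<in>F. [\<Theta> i n \<sigma> = r i] (mod int (l * d))" using gal_comp[OF s(1) gal_funpow[OF t(1)]] by blast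
      qed
    qed
    from this[OF dvd_refl] show ?thesis by (rule spec)
  qed
  define \<phi> where "\<phi> s = (\<lambda>i\<in>I. \<lambda>n\<in>{0<..}. \<Theta> i n (lift s) mod int n)" for s
  have \<phi>v: "\<phi> s i n = \<Theta> i n (lift s) mod int n" if "i \<in> I" "n > 0" for s i n using that by (simp add: \<phi>_def)
  let ?A = "Aut_over K E"
  have cont: "\<exists>X. finite X \<and> X \<subseteq> E \<and> (\<forall>\<sigma>\<in>G. \<forall>\<tau>\<in>G. (\<forall>x\<in>X. \<sigma> x = \<tau> x) \<longrightarrow> [\<Theta> i n \<sigma> = \<Theta> i n \<tau>] (mod int n))" if "i \<in> I" "n > 0" for i n
    using th[OF that] unfolding chr_def by blast
  have agree: "[\<Theta> i n \<sigma> = \<Theta> i n \<tau>] (mod int n)" if "i \<in> I" "n > 0" "\<sigma> \<in> G" "\<tau> \<in> G" "\<forall>x\<in>E. \<sigma> x = \<tau> x" for i n \<sigma> \<tau>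
    using cont[OF that(1,2)] that(3-5) by blast
  have zh: "\<phi> s i \<in> zhat" if s: "s \<in> ?A" and i: "i \<in> I" for s i
    unfolding zhat_def
  proof (intro CollectI conjI allI impI)
    show "\<phi> s i \<in> PiE {0<..} (\<lambda>n. {0..<int n})" using i by (auto simp: \<phi>_def)
    fix m n :: nat assume mn: "0 < m" "0 < n" "m dvd n"
    have "[\<Theta> i n (lift s) = \<Theta> i m (lift s)] (mod int m)" by (rule comp[OF i mn lift(1)[OF s]])
    moreover have "\<Theta> i n (lift s) mod int n mod int m = \<Theta> i n (lift s) mod int m"
      using mn(3) by (simp add: mod_mod_cancel)
    ultimately show "\<phi> s i m = \<phi> s i n mod int m" using \<phi>v[OF i] mn by (simp add: cong_def)
  qed
  have img: "\<phi> ` ?A \<subseteq> PiE I (\<lambda>_. zhat)"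
    using zh by (auto simp: \<phi>_def[of _ ] PiE_def extensional_def)
  have open_fix: "openin (krull_topology K E) {s \<in> ?A. \<forall>x\<in>X. s x = s0 x}" if X: "finite X" "X \<subseteq> E" and s0: "s0 \<in> ?A" for X s0
  proof -
    define U where "U = PiE E (\<lambda>x. if x \<in> X then {s0 x} else E)"
    have s0E: "s0 x \<in> E" if "x \<in> E" for x using Aut_overD(2)[OF s0] that by blast
    have "openin (product_topology (\<lambda>_. discrete_topology E) E) U"
      unfolding U_def by (rule product_topology_basis) (use X s0E finite_subset[OF _ X(1)] in \<open>auto intro: finite_subset[of _ X] split: if_splits\<close>)
    moreover have "?A \<inter> U = {s \<in> ?A. \<forall>x\<in>X. s x = s0 x}"
    proof -
      have "s \<in> U \<longleftrightarrow> (\<forall>x\<in>X. s x = s0 x)" if s: "s \<in> ?A" for s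
        using Aut_overD(1,2)[OF s] X(2) by (auto simp: U_def PiE_def Pi_def split: if_splits)
      then show ?thesis by blast
    qed
    ultimately show ?thesis unfolding krull_topology_def by (metis openin_subtopology_Int2)
  qed
  \<comment> \<open>The predicate \<open>Q\<close> is arbitrary, so that level sets and their
    complements are both covered.\<close>
  have level_open: "openin (krull_topology K E) {s \<in> ?A. Q (\<phi> s i n)}" if i: "i \<in> I" "n > 0" for Q i n
  proof (subst openin_subopen, intro ballI)
    fix s0 assume s0: "s0 \<in> {s \<in> ?A. Q (\<phi> s i n)}"
    obtain X where X: "finite X" "X \<subseteq> E" "\<And>\<sigma> \<tau>. \<sigma> \<in> G \<Longrightarrow> \<tau> \<in> G \<Longrightarrow> (\<forall>x\<in>X. \<sigma> x = \<tau> x) \<Longrightarrow> [\<Theta> i n \<sigma> = \<Theta> i n \<tau>] (mod int n)"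
      using cont[OF i] by blast
    define W where "W = {s \<in> ?A. \<forall>x\<in>X. s x = s0 x}"
    have eq: "\<phi> s i n = \<phi> s0 i n" if s: "s \<in> W" for s
    proof -
      have sA: "s \<in> ?A" "s0 \<in> ?A" using s s0 by (auto simp: W_def)
      have "\<forall>x\<in>X. lift s x = lift s0 x" using s X(2) lift(2)[OF sA(1)] lift(2)[OF sA(2)] by (auto simp: W_def)
      from X(3)[OF lift(1)[OF sA(1)] lift(1)[OF sA(2)] this] show ?thesis using \<phi>v[OF i] by (simp add: cong_def)
    qed
    have "W \<subseteq> {s \<in> ?A. Q (\<phi> s i n)}"
    proof
      fix s assume s: "s \<in> W"
      show "s \<in> {s \<in> ?A. Q (\<phi> s i n)}" using s s0 unfolding mem_Collect_eq eq[OF s] by (simp add: W_def)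
    qed
    moreover have "openin (krull_topology K E) W" unfolding W_def by (rule open_fix) (use X s0 in auto)
    moreover have "s0 \<in> W" using s0 by (simp add: W_def)
    ultimately show "\<exists>T. openin (krull_topology K E) T \<and> s0 \<in> T \<and> T \<subseteq> {s \<in> ?A. Q (\<phi> s i n)}" by blast
  qed
  have c1: "continuous_map (krull_topology K E) zhat_topology (\<lambda>s. \<phi> s i)" if i: "i \<in> I" for i
    unfolding zhat_topology_def continuous_map_in_subtopology continuous_map_componentwise topspace_krull
  proof (intro conjI ballI)
    show "(\<lambda>s. \<phi> s i) ` ?A \<subseteq> extensional {0<..}" using i by (auto simp: \<phi>_def)
    show "(\<lambda>s. \<phi> s i) \<in> ?A \<rightarrow> zhat" using zh[OF _ i] by auto
    fix n :: nat assume "n \<in> {0<..}"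
    then have n: "n > 0" by simp
    show "continuous_map (krull_topology K E) (discrete_topology UNIV) (\<lambda>s. \<phi> s i n)"
      unfolding continuous_map_def topspace_krull using level_open[OF i n] by auto
  qed
  have cphi: "continuous_map (krull_topology K E) (zhat_pow_topology I) \<phi>"
    unfolding zhat_pow_topology_def continuous_map_componentwise topspace_krull
    using c1 by (auto simp: \<phi>_def)
  have inj: "inj_on \<phi> ?A"
  proof (rule inj_onI)
    fix s u assume h: "s \<in> ?A" "u \<in> ?A" "\<phi> s = \<phi> u"
    define \<rho> where "\<rho> = lift s \<circ> inv (lift u)"
    note iu = gal_inv[OF lift(1)[OF h(2)]]
    have \<rho>: "\<rho> \<in> G" unfolding \<rho>_def using gal_comp lift(1)[OF h(1)] iu by blast
    have "[\<Theta> i n \<rho> = 0] (mod int n)" if i: "i \<in> I" "n > 0" for i n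
    proof -
      have "[\<Theta> i n (lift s) = \<Theta> i n (lift u)] (mod int n)"
        using arg_cong[OF h(3), of "\<lambda>f. f i n"] \<phi>v[OF i] by (simp add: cong_def)
      moreover have "[\<Theta> i n \<rho> = \<Theta> i n (lift s) + \<Theta> i n (inv (lift u))] (mod int n)"
        unfolding \<rho>_def by (rule chr_hom[OF th[OF i] lift(1)[OF h(1)]]) (use iu in blast)
      moreover have "[\<Theta> i n id = \<Theta> i n (lift u) + \<Theta> i n (inv (lift u))] (mod int n)"
        using chr_hom[OF th[OF i] lift(1)[OF h(2)], of "inv (lift u)"] iu by metis
      moreover have "[\<Theta> i n id = 0] (mod int n)" by (rule chr_id[OF th[OF i]])
      ultimately show ?thesis using cong_add[of "\<Theta> i n (lift s)" "\<Theta> i n (lift u)" "int n" "\<Theta> i n (inv (lift u))" "\<Theta> i n (inv (lift u))"]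
        by (metis cong_refl cong_sym cong_trans)
    qed
    then have \<rho>x: "\<rho> x = x" if "x \<in> E" for x using sep[OF \<rho>] that by blast
    have "s x = u x" if x: "x \<in> E" for x
    proof -
      have "inj (lift u)" using gal_inj[OF lift(1)[OF h(2)]] .
      then have "\<rho> (lift u x) = lift s x" by (simp add: \<rho>_def)
      moreover have "lift u x \<in> E" using stableD[OF stable_E lift(1)[OF h(2)] x] .
      ultimately show ?thesis using \<rho>x lift(2)[OF h(1) x] lift(2)[OF h(2) x] by metis
    qed
    then show "s = u" using Aut_overD(1)[OF h(1)] Aut_overD(1)[OF h(2)] by (intro extensionalityI[of s E u]) auto
  qed
  have surj': "\<exists>s\<in>?A. \<phi> s = z" if z: "z \<in> PiE I (\<lambda>_. zhat)" for z
  proof -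
    \<comment> \<open>One closed condition for each coordinate and level. Including the whole group
      keeps the intersection inside it, also when \<open>I\<close> is empty.\<close>
    define \<C> where "\<C> = (\<lambda>(i,n). {s \<in> ?A. \<phi> s i n = z i n}) ` (I \<times> {0<..}) \<union> {?A}"
    have zi: "z i \<in> zhat" if "i \<in> I" for i using z that by auto
    have zc: "z i m = z i n mod int m" if "i \<in> I" "0 < m" "0 < n" "m dvd n" for i m n using zi[OF that(1)] that unfolding zhat_def by blast
    have "closedin (krull_topology K E) C" if C: "C \<in> \<C>" for C
    proof (cases "C = ?A")
      case True
      then show ?thesis by (metis closedin_topspace topspace_krull)
    next
      case False
      then obtain i n where i: "i \<in> I" "n > 0" "C = {s \<in> ?A. \<phi> s i n = z i n}" using C by (auto simp: \<C>_def)
      have "topspace (krull_topology K E) - C = {s \<in> ?A. \<phi> s i n \<noteq> z i n}" using i by (auto simp: topspace_krull)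
      then show ?thesis unfolding closedin_def using level_open[OF i(1,2), of "\<lambda>v. v \<noteq> z i n"] i by (auto simp: topspace_krull)
    qed
    moreover have "\<Inter>\<F> \<noteq> {}" if \<F>: "finite \<F>" "\<F> \<subseteq> \<C>" for \<F>
    proof -
      have "finite (\<F> - {?A})" "\<F> - {?A} \<subseteq> (\<lambda>(i,n). {s \<in> ?A. \<phi> s i n = z i n}) ` (I \<times> {0<..})"
        using \<F> unfolding \<C>_def by blast+
      from finite_subset_image[OF this] obtain P where P0: "P \<subseteq> I \<times> {0<..}" "finite P"
        "\<F> - {?A} = (\<lambda>(i,n). {s \<in> ?A. \<phi> s i n = z i n}) ` P" by (elim exE conjE)
      note P = P0(2,1) eq_refl[OF P0(3)]
      \<comment> \<open>Finitely many levels are dominated by a single modulus, at which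
        \<open>surj\<close> applies.\<close>
      define N where "N = (\<Prod>p\<in>P. snd p)"
      have N0: "N > 0" unfolding N_def using P(2) by (intro prod_pos) auto
      obtain \<sigma> where s: "\<sigma> \<in> G" "\<forall>i\<in>fst ` P. [\<Theta> i N \<sigma> = z i N] (mod int N)"
        using surj[of "fst ` P" N "\<lambda>i. z i N"] P N0 by force
      define s0 where "s0 = restrict \<sigma> E"
      have sA: "s0 \<in> ?A" unfolding s0_def by (rule restrict_E[OF s(1)])
      have "\<phi> s0 i n = z i n" if p: "(i,n) \<in> P" for i n
      proof -
        have i: "i \<in> I" "n > 0" using p P(2) by auto
        have nN: "n dvd N" unfolding N_def using dvd_prodI[OF P(1) p, of snd] by simp
        have "[\<Theta> i n (lift s0) = \<Theta> i n \<sigma>] (mod int n)"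
          by (rule agree[OF i lift(1)[OF sA] s(1)]) (use lift(2)[OF sA] in \<open>auto simp: s0_def\<close>)
        moreover have "[\<Theta> i n \<sigma> = \<Theta> i N \<sigma>] (mod int n)" using comp[OF i N0 nN s(1)] cong_sym by blast
        moreover have "[\<Theta> i N \<sigma> = z i N] (mod int n)"
          by (rule cong_dvd_modulus[of _ _ "int N"]) (use s(2) p nN in force)+
        ultimately have "[\<Theta> i n (lift s0) = z i N] (mod int n)" using cong_trans by blast
        then show ?thesis using \<phi>v[OF i] zc[OF i(1,2) N0 nN] by (simp add: cong_def)
      qed
      then have "s0 \<in> C" if "C \<in> \<F>" for C
        using P(3) that sA by (cases "C = ?A") auto
      then show ?thesis by blast
    qed
    ultimately have "\<Inter>\<C> \<noteq> {}" 
      using compact_krull[unfolded compact_space_fip, rule_format, of \<C>] by presburger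
    then obtain s where s: "s \<in> \<Inter>\<C>" by blast
    have sA: "s \<in> ?A" using s by (auto simp: \<C>_def)
    have "\<phi> s i n = z i n" if "i \<in> I" "n > 0" for i n 
    proof -
      have "{s \<in> ?A. \<phi> s i n = z i n} \<in> \<C>" unfolding \<C>_def using that by force
      then show ?thesis using s by blast
    qed
    note pt = this
    have ii: "\<phi> s i = z i" if "i \<in> I" for i
    proof (rule extensionalityI[of _ "{0<..}"])
      show "\<phi> s i \<in> extensional {0<..}" "z i \<in> extensional {0<..}"
        using zh[OF sA that] zi[OF that] unfolding zhat_def PiE_def by blast+
    qed (use that pt in simp)
    have "\<phi> s = z"
      by (rule extensionalityI[of _ I]) (use ii z in \<open>auto simp: \<phi>_def PiE_def\<close>)
    then show ?thesis using sA by blast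
  qed
  have tz: "topspace (zhat_pow_topology I) = PiE I (\<lambda>_. zhat)"
    by (simp add: zhat_pow_topology_def topspace_zhat)
  have onto: "\<phi> ` ?A = PiE I (\<lambda>_. zhat)" using img surj' by (intro equalityI subsetI) (blast, metis imageI)
  have "homeomorphic_map (krull_topology K E) (zhat_pow_topology I) \<phi>"
    by (rule continuous_imp_homeomorphic_map[OF cphi compact_krull Hausdorff_zhat_pow])
       (simp_all only: topspace_krull tz onto inj)
  moreover have "\<phi> (gal_mult E s u) = zhat_pow_add I (\<phi> s) (\<phi> u)" if h: "s \<in> ?A" "u \<in> ?A" for s u
  proof -
    note m = gal_mult_Aut[OF h]
    have "\<phi> (gal_mult E s u) i n = zhat_pow_add I (\<phi> s) (\<phi> u) i n" if i: "i \<in> I" "n > 0" for i n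
    proof -
      have "[\<Theta> i n (lift (gal_mult E s u)) = \<Theta> i n (lift s \<circ> lift u)] (mod int n)"
        by (rule agree[OF i lift(1)[OF m(2)] gal_comp[OF lift(1)[OF h(1)] lift(1)[OF h(2)]]])
           (use lift(2)[OF m(2)] m(1) in auto)
      moreover have "[\<Theta> i n (lift s \<circ> lift u) = \<Theta> i n (lift s) + \<Theta> i n (lift u)] (mod int n)"
        by (rule chr_hom[OF th[OF i] lift(1)[OF h(1)] lift(1)[OF h(2)]])
      ultimately have "[\<Theta> i n (lift (gal_mult E s u)) = \<Theta> i n (lift s) + \<Theta> i n (lift u)] (mod int n)"
        using cong_trans by blast
      then show ?thesis using i \<phi>v[OF i] by (simp add: zhat_pow_add_def zhat_add_def cong_def mod_add_eq)
    qed
    then have "\<phi> (gal_mult E s u) i = zhat_pow_add I (\<phi> s) (\<phi> u) i" if "i \<in> I" for i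
      using that by (intro extensionalityI[of _ "{0<..}"]) (auto simp: \<phi>_def zhat_pow_add_def zhat_add_def)
    then show ?thesis by (intro extensionalityI[of _ I]) (auto simp: \<phi>_def zhat_pow_add_def)
  qed
  ultimately show ?thesis unfolding gal_iso_zhat_pow_def by blast
qed

end

section \<open>Bases of the character groups\<close>

lemma lepoll_iff_card_of: "A \<lesssim> B \<longleftrightarrow> (card_of A, card_of B) \<in> ordLeq"
  unfolding lepoll_def using card_of_ordLeq by blast

lemma UN_lepoll:
  assumes "infinite B" "I \<lesssim> B" "\<And>i. i \<in> I \<Longrightarrow> A i \<lesssim> B"
  shows "(\<Union>i\<in>I. A i) \<lesssim> B"
  using card_of_UNION_ordLeq_infinite[of B I A] assms unfolding lepoll_iff_card_of by blast

lemma Un_lepoll: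
  assumes "infinite B" "A \<lesssim> B" "A' \<lesssim> B"
  shows "A \<union> A' \<lesssim> B"
proof -
  have "(\<Union>b\<in>UNIV. if b then A else A') \<lesssim> B"
    by (rule UN_lepoll[OF assms(1)]) (use assms finite_lepoll_infinite[of B "UNIV :: bool set"] in auto)
  then show ?thesis by (simp add: UNIV_bool Un_commute)
qed

lemma Times_lepoll:
  assumes "infinite B" "A \<lesssim> B" "A' \<lesssim> B"
  shows "A \<times> A' \<lesssim> B"
proof -
  have "(card_of (B \<times> B), card_of B) \<in> ordLeq"
    using card_of_Times_same_infinite[OF assms(1)] ordIso_iff_ordLeq by blast
  then show ?thesis using times_lepoll_mono[OF assms(2,3)] lepoll_trans unfolding lepoll_iff_card_of by blast
qed

lemma compositum_subfield: "subfield (compositum L M)" and compositum_subset: "L \<union> M \<subseteq> compositum L M"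
  unfolding compositum_def subfield_def by auto

lemma compositum_commute: "compositum L M = compositum M L"
  unfolding compositum_def by (simp add: Un_commute)

text \<open>For finite \<open>L\<close> the polynomial with all elements of \<open>L\<close> as
  roots, increased by 1, would have no root in \<open>L\<close>.\<close>

lemma alg_closed_infinite:
  assumes L: "alg_closed_subfield L"
  shows "infinite L"
proof
  assume fin: "finite L"
  note S = subfield_sring[OF alg_closed_subfieldD[OF L]]
  have L1: "1 \<in> L" using sring_1[OF S] .
  define q where "q = (\<Prod>a\<in>L. [:-a,1:])"
  have q: "q \<in> pol L" unfolding q_def by (intro sring_prod[OF sring_pol[OF S]] pol_linear[OF S])
  have dq: "degree q = card L" unfolding q_def by (subst degree_prod_eq_sum_degree) auto
  have c0: "card L > 0" using fin L1 by (auto simp: card_gt_0_iff)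
  have "degree (q + 1) = degree q" by (rule degree_add_eq_left) (use c0 dq in simp)
  then obtain x where x: "x \<in> L" "poly (q + 1) x = 0"
    using alg_closed_root[OF L sring_add[OF sring_pol[OF S] q sring_1[OF sring_pol[OF S]]]] c0 dq by auto
  have "poly q x = 0" unfolding q_def poly_prod using fin x(1) by (intro prod_zero) auto
  then show False using x(2) by simp
qed

text \<open>The compositum is exhausted by countably many stages, each obtained from the previous
  one by single field operations, so its size does not exceed an infinite bound for \<open>L\<close>
  and \<open>M\<close>.\<close>

lemma compositum_lepoll:
  assumes L: "subfield L" and B: "infinite B" "L \<lesssim> B" "M \<lesssim> B"
  shows "compositum L M \<lesssim> B"
proof -
  \<comment> \<open>The operations are coded by numbers so that one stage is a single image; every
    code from 4 on returns \<open>x\<close>, which makes the stages increase.\<close>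
  define opr where "opr i x y = (if i = 0 then x + y else if i = 1 then x - y else if i = 2 then x * y else if i = 3 then inverse x else x)" for i :: nat and x y :: 'a
  define T where "T = rec_nat (L \<union> M) (\<lambda>_ X. (\<lambda>(i,x,y). opr i x y) ` (UNIV \<times> X \<times> X))"
  have T0: "T 0 = L \<union> M" and TS: "T (Suc n) = (\<lambda>(i,x,y). opr i x y) ` (UNIV \<times> T n \<times> T n)" for n
    by (simp_all add: T_def)
  have step: "opr i x y \<in> T (Suc n)" if "x \<in> T n" "y \<in> T n" for i x y n unfolding TS using that by force
  have mono1: "T n \<subseteq> T (Suc n)" for n
  proof
    fix x assume "x \<in> T n"
    from step[OF this this, of 4] show "x \<in> T (Suc n)" by (simp add: opr_def)
  qed
  have mono: "T m \<subseteq> T n" if "m \<le> n" for m n using lift_Suc_mono_le[of T m n] mono1 that by blast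
  have clos: "opr i x y \<in> (\<Union>n. T n)" if "x \<in> (\<Union>n. T n)" "y \<in> (\<Union>n. T n)" for i x y
  proof -
    from that obtain m n where mn: "x \<in> T m" "y \<in> T n" by blast
    have "x \<in> T (max m n)" "y \<in> T (max m n)" using mn mono[of m "max m n"] mono[of n "max m n"] by auto
    from step[OF this] show ?thesis by blast
  qed
  have "{0,1} \<subseteq> T 0" using L by (auto simp: T0 subfield_def)
  then have "subfield (\<Union>n. T n)"
    unfolding subfield_def using clos[of _ _ 0] clos[of _ _ 1] clos[of _ _ 2] clos[of _ _ 3] by (auto simp: opr_def)
  then have "compositum L M \<subseteq> (\<Union>n. T n)" unfolding compositum_def using T0 by blast
  moreover have "T n \<lesssim> B" for n
  proof (induction n)
    case 0
    then show ?case unfolding T0 using Un_lepoll[OF B] .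
  next
    case (Suc n)
    have "(UNIV :: nat set) \<lesssim> B" using B(1) infinite_le_lepoll by blast
    then have "(UNIV :: nat set) \<times> T n \<times> T n \<lesssim> B" by (intro Times_lepoll[OF B(1)] Suc.IH)
    then show ?case unfolding TS using image_lepoll lepoll_trans by blast
  qed
  then have "(\<Union>n. T n) \<lesssim> B" using UN_lepoll[OF B(1), of UNIV T] B(1) infinite_le_lepoll by blast
  ultimately show ?thesis using subset_imp_lepoll lepoll_trans by blast
qed

text \<open>Translation by an element outside \<open>C\<close> embeds \<open>C\<close> into its
  complement, which therefore has the size of the union.\<close>

lemma lepoll_Diff_subfield:
  assumes L: "subfield L" "infinite L" and C: "subfield C" "C \<subseteq> L" "C \<noteq> L"
  shows "L \<lesssim> L - C"
proof -
  obtain x where x: "x \<in> L" "x \<notin> C" using C by blast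
  note S = subfield_sring[OF L(1)] and SC = subfield_sring[OF C(1)]
  have "(+) x ` C \<subseteq> L - C"
    using sring_add[OF S x(1)] sring_diff[OF SC, of "x + _"] x(2) C(2) by fastforce
  then have c: "C \<lesssim> L - C" unfolding lepoll_def by (intro exI[of _ "(+) x"]) simp
  have "infinite (L - C)"
  proof
    assume "finite (L - C)"
    then have "finite C" using c finite_surj unfolding lepoll_iff by blast
    then show False using L(2) \<open>finite (L - C)\<close> finite_Diff2 by blast
  qed
  from Un_lepoll[OF this lepoll_refl c] show ?thesis using C(2) by (simp add: Un_absorb2)
qed

section \<open>Character groups modulo a prime and their dimension\<close>

context kum begin

text \<open>A normal form: characters congruent modulo \<open>l\<close> on \<open>G\<close> become
  the same function, so that \<open>chars l\<close> can be counted.\<close>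

definition nrm :: "nat \<Rightarrow> (('b \<Rightarrow> 'b) \<Rightarrow> int) \<Rightarrow> ('b \<Rightarrow> 'b) \<Rightarrow> int" where
  "nrm l \<psi> = (\<lambda>\<sigma>\<in>G. \<psi> \<sigma> mod int l)"

definition chars :: "nat \<Rightarrow> (('b \<Rightarrow> 'b) \<Rightarrow> int) set" where
  "chars l = nrm l ` {\<psi>. chr l \<psi>}"

lemma nrm_cong: "\<sigma> \<in> G \<Longrightarrow> [nrm l \<psi> \<sigma> = \<psi> \<sigma>] (mod int l)"
  by (simp add: nrm_def cong_def)

lemma chr_nrm: "chr l \<psi> \<Longrightarrow> chr l (nrm l \<psi>)"
  unfolding chr_def by (simp add: nrm_def gal_comp cong_def mod_add_eq)

lemma chars_chr: "f \<in> chars l \<Longrightarrow> chr l f"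
  unfolding chars_def using chr_nrm by blast

lemma chars_eqI:
  assumes "f \<in> chars l" "g \<in> chars l" "\<And>\<sigma>. \<sigma> \<in> G \<Longrightarrow> [f \<sigma> = g \<sigma>] (mod int l)"
  shows "f = g"
proof
  fix \<sigma>
  obtain \<psi> \<kappa> where "f = nrm l \<psi>" "g = nrm l \<kappa>" using assms(1,2) by (auto simp: chars_def)
  then show "f \<sigma> = g \<sigma>" using assms(3)[of \<sigma>] by (auto simp: nrm_def cong_def)
qed

text \<open>Zorn's lemma gives a maximal independent set above the given family, and maximality
  makes it spanning. Starting from the given family secures the lower bound
  \<open>J \<lesssim> B\<close>.\<close>

lemma ex_basis:
  assumes l: "prime l" and \<kappa>: "\<And>j. j \<in> J \<Longrightarrow> chr l (\<kappa> j)" and ind: "ind J l \<kappa>"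
  shows "\<exists>B. B \<subseteq> chars l \<and> J \<lesssim> B \<and> ind B l (\<lambda>f. f) \<and> spn B l (\<lambda>f. f)"
proof -
  define B0 where "B0 = (\<lambda>j. nrm l (\<kappa> j)) ` J"
  have l1: "\<not> int l dvd 1" using prime_gt_1_nat[OF l] by simp
  have inj: "inj_on (\<lambda>j. nrm l (\<kappa> j)) J"
  proof (rule inj_onI, rule ccontr)
    fix i j assume h: "i \<in> J" "j \<in> J" "nrm l (\<kappa> i) = nrm l (\<kappa> j)" "i \<noteq> j"
    have "[(\<Sum>k\<in>{i,j}. (if k = i then 1 else -1) * \<kappa> k \<sigma>) = 0] (mod int l)" if s: "\<sigma> \<in> G" for \<sigma>
    proof -
      have "[\<kappa> i \<sigma> = \<kappa> j \<sigma>] (mod int l)" using fun_cong[OF h(3), of \<sigma>] s by (simp add: nrm_def cong_def)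
      then show ?thesis using h(4) by (simp add: cong_iff_dvd_diff)
    qed
    then have "int l dvd (if i = i then 1 else -1)"
      using ind[unfolded ind_def, rule_format, of "{i,j}" "\<lambda>k. if k = i then 1 else -1" i] h(1,2) by simp
    then show False using l1 by simp
  qed
  have ind0: "ind B0 l (\<lambda>f. f)"
    unfolding ind_def
  proof (intro allI impI)
    fix F c assume F: "finite F" "F \<subseteq> B0" "\<forall>\<sigma>\<in>G. [(\<Sum>f\<in>F. c f * f \<sigma>) = 0] (mod int l)"
    obtain F' where F': "F' \<subseteq> J" "finite F'" "F = (\<lambda>j. nrm l (\<kappa> j)) ` F'"
      using finite_subset_image[OF F(1) F(2)[unfolded B0_def]] by blast
    have i': "inj_on (\<lambda>j. nrm l (\<kappa> j)) F'" using inj_on_subset[OF inj F'(1)] .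
    have "[(\<Sum>j\<in>F'. c (nrm l (\<kappa> j)) * \<kappa> j \<sigma>) = 0] (mod int l)" if s: "\<sigma> \<in> G" for \<sigma>
    proof -
      have "[(\<Sum>j\<in>F'. c (nrm l (\<kappa> j)) * \<kappa> j \<sigma>) = (\<Sum>j\<in>F'. c (nrm l (\<kappa> j)) * nrm l (\<kappa> j) \<sigma>)] (mod int l)"
        by (intro cong_sum cong_mult cong_refl cong_sym[OF nrm_cong[OF s]])
      also have "(\<Sum>j\<in>F'. c (nrm l (\<kappa> j)) * nrm l (\<kappa> j) \<sigma>) = (\<Sum>f\<in>F. c f * f \<sigma>)"
        unfolding F'(3) by (simp add: sum.reindex[OF i'])
      also have "[(\<Sum>f\<in>F. c f * f \<sigma>) = 0] (mod int l)" using F(3) s by blast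
      finally show ?thesis .
    qed
    then have "\<forall>j\<in>F'. int l dvd c (nrm l (\<kappa> j))"
      using ind[unfolded ind_def, rule_format, of F' "\<lambda>j. c (nrm l (\<kappa> j))"] F'(1,2) by blast
    then show "\<forall>f\<in>F. int l dvd c f" unfolding F'(3) by blast
  qed
  define \<A> where "\<A> = {B. B0 \<subseteq> B \<and> B \<subseteq> chars l \<and> ind B l (\<lambda>f. f)}"
  have "B0 \<in> \<A>" unfolding \<A>_def using ind0 \<kappa> by (auto simp: B0_def chars_def)
  have "\<exists>M\<in>\<A>. \<forall>X\<in>\<A>. M \<subseteq> X \<longrightarrow> X = M"
  proof (rule subset_Zorn_nonempty)
    show "\<A> \<noteq> {}" using \<open>B0 \<in> \<A>\<close> by blast
    fix \<C> assume C: "\<C> \<noteq> {}" "subset.chain \<A> \<C>"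
    then have CA: "\<C> \<subseteq> \<A>" by (simp add: subset_chain_def)
    have "ind (\<Union>\<C>) l (\<lambda>f. f)"
      unfolding ind_def
    proof (intro allI impI)
      fix F c assume F: "finite F" "F \<subseteq> \<Union>\<C>" "\<forall>\<sigma>\<in>G. [(\<Sum>f\<in>F. c f * f \<sigma>) = 0] (mod int l)"
      obtain B where B: "B \<in> \<C>" "F \<subseteq> B" using finite_subset_Union_chain[OF F(1,2) C] .
      then have "ind B l (\<lambda>f. f)" using CA by (auto simp: \<A>_def)
      from this[unfolded ind_def, rule_format, OF F(1) B(2)] F(3) show "\<forall>f\<in>F. int l dvd c f" by blast
    qed
    then show "\<Union>\<C> \<in> \<A>" using CA C(1) by (auto simp: \<A>_def)
  qed
  then obtain M where M: "M \<in> \<A>" "\<And>X. X \<in> \<A> \<Longrightarrow> M \<subseteq> X \<Longrightarrow> X = M" by blast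
  have M': "B0 \<subseteq> M" "M \<subseteq> chars l" "ind M l (\<lambda>f. f)" using M(1) by (auto simp: \<A>_def)
  have "spn M l (\<lambda>f. f)"
    unfolding spn_def
  proof (intro allI impI)
    fix \<psi> assume \<psi>: "chr l \<psi>"
    define g where "g = nrm l \<psi>"
    have g\<psi>: "[\<psi> \<sigma> = g \<sigma>] (mod int l)" if "\<sigma> \<in> G" for \<sigma> unfolding g_def using nrm_cong[OF that] cong_sym by metis
    have gV: "g \<in> chars l" using \<psi> by (auto simp: g_def chars_def)
    show "\<exists>F c. finite F \<and> F \<subseteq> M \<and> (\<forall>\<sigma>\<in>G. [\<psi> \<sigma> = (\<Sum>f\<in>F. c f * f \<sigma>)] (mod int l))"
    proof (cases "g \<in> M")
      case True
      then show ?thesis using g\<psi> by (intro exI[of _ "{g}"] exI[of _ "\<lambda>_. 1"]) simp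
    next
      case False
      then have "\<not> ind (insert g M) l (\<lambda>f. f)" using M(2)[of "insert g M"] M' gV by (auto simp: \<A>_def)
      then obtain F c where F: "finite F" "F \<subseteq> insert g M" "\<forall>\<sigma>\<in>G. [(\<Sum>f\<in>F. c f * f \<sigma>) = 0] (mod int l)" "\<not> (\<forall>f\<in>F. int l dvd c f)"
        unfolding ind_def not_all not_imp by blast
      have Fg: "finite (F - {g})" "F - {g} \<subseteq> M" using F by auto
      have gF: "g \<in> F"
      proof (rule ccontr)
        assume "g \<notin> F"
        then have "F \<subseteq> M" using F(2) by blast
        from M'(3)[unfolded ind_def, rule_format, OF F(1) this] F(3,4) show False by blast
      qed
      have split: "(\<Sum>f\<in>F. c f * f \<sigma>) = c g * g \<sigma> + (\<Sum>f\<in>F - {g}. c f * f \<sigma>)" for \<sigma>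
        by (rule sum.remove[OF F(1) gF])
      have cg: "\<not> [c g = 0] (mod int l)"
      proof
        assume "[c g = 0] (mod int l)"
        then have d: "int l dvd c g" by (simp add: cong_0_iff)
        have "[(\<Sum>f\<in>F - {g}. c f * f \<sigma>) = 0] (mod int l)" if "\<sigma> \<in> G" for \<sigma>
        proof -
          have "int l dvd (\<Sum>f\<in>F. c f * f \<sigma>)" using F(3) that by (simp add: cong_0_iff)
          moreover have "int l dvd c g * g \<sigma>" using d by simp
          ultimately show ?thesis unfolding split cong_0_iff by (simp add: dvd_add_right_iff)
        qed
        then have "\<forall>f\<in>F - {g}. int l dvd c f"
          using M'(3)[unfolded ind_def, rule_format, OF Fg, of c] by blast
        then show False using F(4) d by blast
      qed
      \<comment> \<open>The coefficient of \<open>g\<close> in the relation is prime to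
        \<open>l\<close>; with its inverse \<open>u\<close> the relation is solved for
        \<open>g\<close>.\<close>
      obtain u :: nat where u: "[int u * c g = 1] (mod int l)" using inverse_mod[OF l cg] by blast
      have "[\<psi> \<sigma> = (\<Sum>f\<in>F - {g}. (- int u * c f) * f \<sigma>)] (mod int l)" if s: "\<sigma> \<in> G" for \<sigma>
      proof -
        have "int l dvd c g * g \<sigma> + (\<Sum>f\<in>F - {g}. c f * f \<sigma>)" using F(3) s unfolding split by (simp add: cong_0_iff)
        then have a: "int l dvd int u * (c g * g \<sigma> + (\<Sum>f\<in>F - {g}. c f * f \<sigma>))" by (rule dvd_mult)
        have "int l dvd int u * c g - 1" using u by (simp add: cong_iff_dvd_diff)
        then have b: "int l dvd (int u * c g - 1) * g \<sigma>" by (rule dvd_mult2)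
        have "g \<sigma> - (\<Sum>f\<in>F - {g}. (- int u * c f) * f \<sigma>) =
          int u * (c g * g \<sigma> + (\<Sum>f\<in>F - {g}. c f * f \<sigma>)) - (int u * c g - 1) * g \<sigma>"
          by (simp add: algebra_simps sum_distrib_left sum_negf)
        then have "[g \<sigma> = (\<Sum>f\<in>F - {g}. (- int u * c f) * f \<sigma>)] (mod int l)"
          unfolding cong_iff_dvd_diff using dvd_diff[OF a b] by (simp only:)
        then show ?thesis using cong_trans[OF g\<psi>[OF s]] by blast
      qed
      then show ?thesis using Fg by (intro exI[of _ "F - {g}"] exI[of _ "\<lambda>f. - int u * c f"]) simp
    qed
  qed
  moreover have "J \<lesssim> M" using inj M'(1) unfolding lepoll_def B0_def by blast
  ultimately show ?thesis using M' by blast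
qed

text \<open>A character is determined by the element \<open>y^l\<close>, respectively
  \<open>x^p - x\<close>, of \<open>K\<close> that belongs to a generator: two generators with the
  same element differ by a root of unity, respectively by an element of the prime field, and these
  are fixed by all automorphisms.\<close>

lemma chars_lepoll:
  assumes l: "prime l"
  shows "chars l \<lesssim> K"
proof (cases "l = CHAR('b)")
  case False
  obtain \<omega> :: 'b where o: "prim (l ^ 1) \<omega>" using ex_prim[OF l False] by blast
  then have o: "prim l \<omega>" by simp
  have l0: "l > 0" using prime_gt_0_nat[OF l] .
  have oK: "\<omega> \<in> K" by (rule roots[OF l0 prim_power[OF o]])
  have "\<forall>f\<in>chars l. \<exists>y\<in>E. y \<noteq> 0 \<and> (\<forall>\<sigma>\<in>G. \<sigma> y = \<omega> powi f \<sigma> * y)"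
    using kummer_generator[OF chars_chr o oK] by blast
  then obtain y where y: "\<And>f. f \<in> chars l \<Longrightarrow> y f \<in> E \<and> y f \<noteq> 0 \<and> (\<forall>\<sigma>\<in>G. \<sigma> (y f) = \<omega> powi f \<sigma> * y f)" by metis
  have ol: "(\<omega> powi k) ^ l = 1" for k
  proof -
    have "(\<omega> powi k) ^ l = (\<omega> ^ l) powi k" by (metis power_int_mult power_int_of_nat mult.commute)
    then show ?thesis using prim_power[OF o] by simp
  qed
  have yK: "y f ^ l \<in> K" if f: "f \<in> chars l" for f
  proof (rule fixed_K)
    show "y f ^ l \<in> sepc" using sring_power[OF Es] y[OF f] E_sepc by blast
    fix \<sigma> assume s: "\<sigma> \<in> G"
    then have e: "\<sigma> (y f) = \<omega> powi f \<sigma> * y f" using y[OF f] by blast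
    show "\<sigma> (y f ^ l) = y f ^ l" unfolding gal_power[OF s UNIV_I] e power_mult_distrib ol by simp
  qed
  have "inj_on (\<lambda>f. y f ^ l) (chars l)"
  proof (rule inj_onI)
    fix f g assume h: "f \<in> chars l" "g \<in> chars l" "y f ^ l = y g ^ l"
    define w where "w = y f / y g"
    have "w ^ l = 1" using h(3) y[OF h(2)] by (simp add: w_def power_divide)
    then have wK: "w \<in> K" by (rule roots[OF l0])
    have yw: "y f = w * y g" using y[OF h(2)] by (simp add: w_def)
    show "f = g"
    proof (rule chars_eqI[OF h(1,2)])
      fix \<sigma> assume s: "\<sigma> \<in> G"
      have a: "\<sigma> (y f) = \<omega> powi f \<sigma> * y f" using y[OF h(1)] s by blast
      have "\<sigma> (y f) = w * \<sigma> (y g)" unfolding yw gal_times[OF s UNIV_I UNIV_I] gal_K[OF s wK] ..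
      also have "\<sigma> (y g) = \<omega> powi g \<sigma> * y g" using y[OF h(2)] s by blast
      finally have "\<omega> powi f \<sigma> * y f = \<omega> powi g \<sigma> * y f" unfolding a by (simp add: yw mult_ac)
      then have "\<omega> powi f \<sigma> = \<omega> powi g \<sigma>" using y[OF h(1)] by simp
      then show "[f \<sigma> = g \<sigma>] (mod int l)" using prim_eq_iff[OF o] by blast
    qed
  qed
  then show ?thesis using yK unfolding lepoll_def by blast
next
  case True
  have p: "CHAR('b) > 0" using prime_gt_0_nat[OF l] True by simp
  have pr: "prime CHAR('b)" using l True by simp
  have "\<forall>f\<in>chars l. \<exists>x\<in>E. \<forall>\<sigma>\<in>G. \<sigma> x = x + of_int (f \<sigma>)"
    using artin_schreier_generator[OF p] chars_chr True by blast
  then obtain x where x: "\<And>f. f \<in> chars l \<Longrightarrow> x f \<in> E \<and> (\<forall>\<sigma>\<in>G. \<sigma> (x f) = x f + of_int (f \<sigma>))" by metis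
  define g where "g f = x f ^ CHAR('b) - x f" for f
  have gK: "g f \<in> K" if f: "f \<in> chars l" for f
  proof (rule fixed_K)
    show "g f \<in> sepc" unfolding g_def using sring_diff[OF Es sring_power[OF Es]] x[OF f] E_sepc by blast
    fix \<sigma> assume s: "\<sigma> \<in> G"
    have e: "\<sigma> (x f) = x f + of_int (f \<sigma>)" using x[OF f] s by blast
    show "\<sigma> (g f) = g f"
      unfolding g_def gal_diff[OF s UNIV_I UNIV_I] gal_power[OF s UNIV_I] e freshmans_dream[OF pr refl] frobenius_of_int[OF p] by simp
  qed
  have "inj_on g (chars l)"
  proof (rule inj_onI)
    fix f f' assume h: "f \<in> chars l" "f' \<in> chars l" "g f = g f'"
    define d where "d = x f - x f'"
    have "x f ^ CHAR('b) = d ^ CHAR('b) + x f' ^ CHAR('b)"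
      using freshmans_dream[OF pr refl, of d "x f'"] by (simp add: d_def)
    then have "d ^ CHAR('b) = d" using h(3) by (simp add: g_def d_def algebra_simps)
    then obtain k :: int where k: "d = of_int k" using frobenius_fixed[OF p] by blast
    have dK: "d \<in> K" unfolding k by (rule sring_of_int[OF Ks])
    show "f = f'"
    proof (rule chars_eqI[OF h(1,2)])
      fix \<sigma> assume s: "\<sigma> \<in> G"
      have "\<sigma> d = d + (of_int (f \<sigma>) - of_int (f' \<sigma>))"
        unfolding d_def gal_diff[OF s UNIV_I UNIV_I] using bspec[OF conjunct2[OF x[OF h(1)]] s] bspec[OF conjunct2[OF x[OF h(2)]] s] by simp
      then have "(of_int (f \<sigma>) :: 'b) = of_int (f' \<sigma>)" using gal_K[OF s dK] by simp
      then show "[f \<sigma> = f' \<sigma>] (mod int l)" unfolding True of_int_eq_iff_cong_CHAR .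
    qed
  qed
  then show ?thesis using gK unfolding lepoll_def by blast
qed

lemma nat_mod_cong: "l > 0 \<Longrightarrow> [int (nat (c mod int l)) = c] (mod int l)"
  by (simp add: cong_def)

text \<open>A relation between the characters of the \<open>l\<close>-th roots \<open>z i\<close>
  says that a product of powers of the \<open>z i\<close> is fixed, hence lies in \<open>K\<close>;
  its \<open>l\<close>-th power is a product of powers of the \<open>a i\<close>, to which
  \<open>indep\<close> applies.\<close>

lemma kummer_family:
  assumes l: "prime l" "l \<noteq> CHAR('b)" and a: "\<And>j. j \<in> J \<Longrightarrow> a j \<in> K \<and> a j \<noteq> 0"
    and indep: "\<And>F e y j. finite F \<Longrightarrow> F \<subseteq> J \<Longrightarrow> y \<in> K \<Longrightarrow> y ^ l = (\<Prod>j\<in>F. a j ^ e j) \<Longrightarrow> j \<in> F \<Longrightarrow> l dvd e j"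
  shows "\<exists>\<kappa>. (\<forall>j\<in>J. chr l (\<kappa> j)) \<and> ind J l \<kappa>"
proof -
  obtain \<omega> :: 'b where "prim (l ^ 1) \<omega>" using ex_prim[OF l] by blast
  then have o: "prim l \<omega>" by simp
  have l0: "l > 0" using prime_gt_0_nat[OF l(1)] .
  have oK: "\<omega> \<in> K" by (rule roots[OF l0 prim_power[OF o]])
  have o0: "\<omega> \<noteq> 0" using o by (simp add: prim_def)
  have "\<forall>j. \<exists>z. z ^ l = a j" using nth_root[OF l0] by (intro allI)
  then obtain z where z: "\<And>j. z j ^ l = a j" by metis
  have z0: "z j \<noteq> 0" if "j \<in> J" for j using a[OF that] z[of j] l0 by (auto simp: zero_power)
  have ln: "of_nat l \<noteq> (0::'b)"
  proof
    assume "of_nat l = (0::'b)"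
    then have "CHAR('b) dvd l" by (simp add: of_nat_eq_0_iff_char_dvd)
    then show False using l by (auto simp: prime_nat_iff)
  qed
  have zE: "z j \<in> E" if j: "j \<in> J" for j
  proof (rule radical_in_E[OF z0[OF j] _ ln])
    show "z j ^ l \<in> E" using a[OF j] K_E by (auto simp: z)
    fix \<sigma> assume s: "\<sigma> \<in> G"
    have "(\<sigma> (z j) / z j) ^ l = 1"
      unfolding power_divide gal_power[OF s UNIV_I, symmetric] z using gal_K[OF s] a[OF j] by simp
    then have "\<sigma> (z j) / z j \<in> K" by (rule roots[OF l0])
    then show "\<exists>w\<in>K. \<sigma> (z j) = w * z j" using z0[OF j] by (intro bexI[of _ "\<sigma> (z j) / z j"]) auto
  qed
  have "\<forall>j\<in>J. \<exists>\<kappa>. chr l \<kappa> \<and> (\<forall>\<sigma>\<in>G. \<sigma> (z j) = \<omega> powi \<kappa> \<sigma> * z j)"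
    using kummer_chr[OF zE z0 o oK l0] a z by metis
  then obtain \<kappa> where \<kappa>: "\<And>j. j \<in> J \<Longrightarrow> chr l (\<kappa> j)" "\<And>j \<sigma>. j \<in> J \<Longrightarrow> \<sigma> \<in> G \<Longrightarrow> \<sigma> (z j) = \<omega> powi \<kappa> j \<sigma> * z j" by metis
  have "ind J l \<kappa>"
    unfolding ind_def
  proof (intro allI impI ballI)
    fix F c j assume F: "finite F" "F \<subseteq> J" "\<forall>\<sigma>\<in>G. [(\<Sum>i\<in>F. c i * \<kappa> i \<sigma>) = 0] (mod int l)" and j: "j \<in> F"
    \<comment> \<open>\<open>indep\<close> speaks of natural exponents, so the integer coefficients
      are replaced by their residues.\<close>
    define e where "e i = nat (c i mod int l)" for i
    define y where "y = (\<Prod>i\<in>F. z i ^ e i)"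
    have "y \<in> K"
    proof (rule fixed_K)
      have "y \<in> E" unfolding y_def by (intro sring_prod[OF Es] sring_power[OF Es] zE) (use F in auto)
      then show "y \<in> sepc" using E_sepc by blast
      fix \<sigma> assume s: "\<sigma> \<in> G"
      have "\<sigma> y = (\<Prod>i\<in>F. \<sigma> (z i ^ e i))"
        unfolding y_def using F(1) by (induction F rule: finite_induct) (simp_all add: gal_1[OF s] gal_times[OF s UNIV_I UNIV_I])
      also have "\<dots> = (\<Prod>i\<in>F. \<omega> powi (int (e i) * \<kappa> i \<sigma>) * z i ^ e i)"
      proof (rule prod.cong[OF refl])
        fix i assume "i \<in> F"
        then have "\<sigma> (z i) = \<omega> powi \<kappa> i \<sigma> * z i" using \<kappa>(2) F(2) s by blast
        then show "\<sigma> (z i ^ e i) = \<omega> powi (int (e i) * \<kappa> i \<sigma>) * z i ^ e i"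
          unfolding gal_power[OF s UNIV_I] by (simp add: power_mult_distrib power_int_mult mult.commute[of "int (e i)"])
      qed
      also have "\<dots> = (\<Prod>i\<in>F. \<omega> powi (int (e i) * \<kappa> i \<sigma>)) * y" unfolding y_def by (rule prod.distrib)
      also have "(\<Prod>i\<in>F. \<omega> powi (int (e i) * \<kappa> i \<sigma>)) = \<omega> powi (\<Sum>i\<in>F. int (e i) * \<kappa> i \<sigma>)"
        using F(1) by (induction F rule: finite_induct) (simp_all add: power_int_add o0)
      also have "\<dots> = \<omega> powi 0"
      proof (subst prim_eq_iff[OF o])
        have "[(\<Sum>i\<in>F. int (e i) * \<kappa> i \<sigma>) = (\<Sum>i\<in>F. c i * \<kappa> i \<sigma>)] (mod int l)"
          unfolding e_def by (intro cong_sum cong_mult cong_refl nat_mod_cong[OF l0])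
        then show "[(\<Sum>i\<in>F. int (e i) * \<kappa> i \<sigma>) = 0] (mod int l)" using F(3) s cong_trans by blast
      qed
      finally show "\<sigma> y = y" by simp
    qed
    moreover have "y ^ l = (\<Prod>i\<in>F. a i ^ e i)"
      unfolding y_def prod_power_distrib z[symmetric] power_mult[symmetric] by (simp only: mult.commute)
    ultimately have "l dvd e j" using indep[OF F(1,2)] j by blast
    then have "int l dvd int (e j)" by simp
    then show "int l dvd c j" unfolding e_def using l0 by (simp add: dvd_mod_iff)
  qed
  then show ?thesis using \<kappa>(1) by blast
qed

text \<open>The additive counterpart: a relation puts a combination \<open>y\<close> of the roots
  \<open>x i\<close> into \<open>K\<close>, and its natural coefficients pass through Frobenius
  unchanged.\<close>

lemma artin_schreier_family:
  assumes p: "CHAR('b) > 0" and a: "\<And>j. j \<in> J \<Longrightarrow> a j \<in> K"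
    and indep: "\<And>F e y j. finite F \<Longrightarrow> F \<subseteq> J \<Longrightarrow> y \<in> K \<Longrightarrow> y ^ CHAR('b) - y = (\<Sum>j\<in>F. of_nat (e j) * a j) \<Longrightarrow> j \<in> F \<Longrightarrow> CHAR('b) dvd e j"
  shows "\<exists>\<kappa>. (\<forall>j\<in>J. chr CHAR('b) (\<kappa> j)) \<and> ind J CHAR('b) \<kappa>"
proof -
  have pr: "prime CHAR('b)" using p by (rule prime_CHAR_semidom)
  have root: "\<exists>x. x ^ CHAR('b) - x = c" for c :: 'b
  proof -
    define f where "f = monom 1 CHAR('b) + [:-c,-1:]"
    have "degree f = CHAR('b)"
      unfolding f_def using degree_add_eq_left[of "[:-c,-1:]" "monom (1::'b) CHAR('b)"] prime_gt_1_nat[OF pr] by (simp add: degree_monom_eq)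
    then obtain x where "poly f x = 0" using alg_closed_root[OF O, of f] p by auto
    then show ?thesis by (intro exI[of _ x]) (simp add: f_def poly_monom algebra_simps)
  qed
  have "\<forall>j. \<exists>x. x ^ CHAR('b) - x = a j" using root by (intro allI)
  then obtain x where x: "\<And>j. x j ^ CHAR('b) - x j = a j" by metis
  have "\<forall>j\<in>J. x j \<in> E \<and> (\<exists>\<kappa>. chr CHAR('b) \<kappa> \<and> (\<forall>\<sigma>\<in>G. \<sigma> (x j) = x j + of_int (\<kappa> \<sigma>)))"
    using artin_schreier_chr[OF p] a x by metis
  then obtain \<kappa> where \<kappa>: "\<And>j. j \<in> J \<Longrightarrow> x j \<in> E" "\<And>j. j \<in> J \<Longrightarrow> chr CHAR('b) (\<kappa> j)"
    "\<And>j \<sigma>. j \<in> J \<Longrightarrow> \<sigma> \<in> G \<Longrightarrow> \<sigma> (x j) = x j + of_int (\<kappa> j \<sigma>)" by metis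
  have "ind J CHAR('b) \<kappa>"
    unfolding ind_def
  proof (intro allI impI ballI)
    fix F c j assume F: "finite F" "F \<subseteq> J" "\<forall>\<sigma>\<in>G. [(\<Sum>i\<in>F. c i * \<kappa> i \<sigma>) = 0] (mod int CHAR('b))" and j: "j \<in> F"
    define e where "e i = nat (c i mod int CHAR('b))" for i
    define y where "y = (\<Sum>i\<in>F. of_nat (e i) * x i)"
    have "y \<in> K"
    proof (rule fixed_K)
      have "y \<in> E" unfolding y_def by (intro sring_sum[OF Es] sring_mult[OF Es] sring_of_nat[OF Es] \<kappa>(1)) (use F in auto)
      then show "y \<in> sepc" using E_sepc by blast
      fix \<sigma> assume s: "\<sigma> \<in> G"
      have "\<sigma> y = (\<Sum>i\<in>F. \<sigma> (of_nat (e i) * x i))" unfolding y_def by (rule gal_sum[OF s UNIV_I])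
      also have "\<dots> = (\<Sum>i\<in>F. of_nat (e i) * x i + of_int (int (e i) * \<kappa> i \<sigma>))"
      proof (rule sum.cong[OF refl])
        fix i assume "i \<in> F"
        then have "\<sigma> (x i) = x i + of_int (\<kappa> i \<sigma>)" using \<kappa>(3) F(2) s by blast
        then show "\<sigma> (of_nat (e i) * x i) = of_nat (e i) * x i + of_int (int (e i) * \<kappa> i \<sigma>)"
          unfolding gal_times[OF s UNIV_I UNIV_I] gal_K[OF s sring_of_nat[OF Ks]] by (simp add: distrib_left)
      qed
      also have "\<dots> = y + of_int (\<Sum>i\<in>F. int (e i) * \<kappa> i \<sigma>)" by (simp add: y_def sum.distrib)
      also have "(of_int (\<Sum>i\<in>F. int (e i) * \<kappa> i \<sigma>) :: 'b) = of_int 0"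
        unfolding of_int_eq_iff_cong_CHAR
      proof -
        have "[(\<Sum>i\<in>F. int (e i) * \<kappa> i \<sigma>) = (\<Sum>i\<in>F. c i * \<kappa> i \<sigma>)] (mod int CHAR('b))"
          unfolding e_def by (intro cong_sum cong_mult cong_refl nat_mod_cong[OF p])
        then show "[(\<Sum>i\<in>F. int (e i) * \<kappa> i \<sigma>) = 0] (mod int CHAR('b))" using F(3) s cong_trans by blast
      qed
      finally show "\<sigma> y = y" by simp
    qed
    moreover have "y ^ CHAR('b) - y = (\<Sum>i\<in>F. of_nat (e i) * a i)"
    proof -
      have "y ^ CHAR('b) = (\<Sum>i\<in>F. (of_nat (e i) * x i) ^ CHAR('b))"
        unfolding y_def using F(1)
      proof (induction F rule: finite_induct)
        case empty
        then show ?case using p by (simp add: zero_power)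
      next
        case (insert i F)
        then show ?case by (simp add: freshmans_dream[OF pr refl])
      qed
      also have "\<dots> = (\<Sum>i\<in>F. of_nat (e i) * x i ^ CHAR('b))"
        using frobenius_of_int[OF p, of "int (e _)"] by (simp add: power_mult_distrib)
      finally show ?thesis by (simp add: y_def x[symmetric] sum_subtractf right_diff_distrib)
    qed
    ultimately have "CHAR('b) dvd e j" using indep[OF F(1,2)] j by blast
    then have "int CHAR('b) dvd int (e j)" by simp
    then show "int CHAR('b) dvd c j" unfolding e_def using p by (simp add: dvd_mod_iff)
  qed
  then show ?thesis using \<kappa>(2) by blast
qed

text \<open>For every prime the basis \<open>B\<close> satisfies \<open>J \<lesssim> B\<close> and
  \<open>B \<lesssim> K\<close>, while \<open>K \<lesssim> J\<close>; so all bases can be reindexed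
  by the one set \<open>I\<close>. Primes other than the characteristic use \<open>a j\<close>, the
  characteristic uses \<open>inverse (a j)\<close>.\<close>

theorem gal_iso_of_independent:
  fixes I :: "'i set"
  assumes card: "I \<approx> K" "K \<lesssim> J" and a: "\<And>j. j \<in> J \<Longrightarrow> a j \<in> K \<and> a j \<noteq> 0"
    and km: "\<And>l F e y j. prime l \<Longrightarrow> l \<noteq> CHAR('b) \<Longrightarrow> finite F \<Longrightarrow> F \<subseteq> J \<Longrightarrow> y \<in> K \<Longrightarrow> y ^ l = (\<Prod>j\<in>F. a j ^ e j) \<Longrightarrow> j \<in> F \<Longrightarrow> l dvd e j"
    and as: "\<And>F e y j. CHAR('b) > 0 \<Longrightarrow> finite F \<Longrightarrow> F \<subseteq> J \<Longrightarrow> y \<in> K \<Longrightarrow> y ^ CHAR('b) - y = (\<Sum>j\<in>F. of_nat (e j) / a j) \<Longrightarrow> j \<in> F \<Longrightarrow> CHAR('b) dvd e j"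
  shows "gal_iso_zhat_pow K E I"
proof (rule gal_iso)
  fix l :: nat assume l: "prime l"
  have "\<exists>\<kappa>. (\<forall>j\<in>J. chr l (\<kappa> j)) \<and> ind J l \<kappa>"
  proof (cases "l = CHAR('b)")
    case False
    show ?thesis by (rule kummer_family[OF l False, of J a]) (fact a, fact km[OF l False])
  next
    case True
    then have p: "CHAR('b) > 0" using prime_gt_0_nat[OF l] by simp
    have "\<exists>\<kappa>. (\<forall>j\<in>J. chr CHAR('b) (\<kappa> j)) \<and> ind J CHAR('b) \<kappa>"
      by (rule artin_schreier_family[OF p, of J "\<lambda>j. inverse (a j)"])
         (use a subfield_inverse[OF K] as[OF p] in \<open>auto simp: divide_inverse\<close>)
    then show ?thesis unfolding True .
  qed
  then obtain \<kappa> where \<kappa>: "\<forall>j\<in>J. chr l (\<kappa> j)" "ind J l \<kappa>" by (elim exE conjE)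
  have "\<exists>B. B \<subseteq> chars l \<and> J \<lesssim> B \<and> ind B l (\<lambda>f. f) \<and> spn B l (\<lambda>f. f)"
    by (rule ex_basis[OF l _ \<kappa>(2)]) (simp add: \<kappa>(1))
  then   obtain B where B: "B \<subseteq> chars l" "J \<lesssim> B" "ind B l (\<lambda>f. f)" "spn B l (\<lambda>f. f)" by (elim exE conjE)
  have "B \<lesssim> K" by (rule lepoll_trans[OF subset_imp_lepoll[OF B(1)] chars_lepoll[OF l]])
  then have "B \<lesssim> I" by (rule lepoll_trans2) (rule eqpoll_sym[OF card(1)])
  moreover have "I \<lesssim> B" using lepoll_trans1[OF card(1) lepoll_trans[OF card(2) B(2)]] .
  ultimately have "I \<approx> B" by (rule lepoll_antisym[rotated])
  then obtain h where h: "bij_betw h I B" unfolding eqpoll_def by blast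
  then have hi: "inj_on h I" and hB: "h ` I = B" by (auto simp: bij_betw_def)
  have "ind I l h"
    unfolding ind_def
  proof (intro allI impI)
    fix F c assume F: "finite F" "F \<subseteq> I" "\<forall>\<sigma>\<in>G. [(\<Sum>i\<in>F. c i * h i \<sigma>) = 0] (mod int l)"
    have fi: "inj_on h F" using inj_on_subset[OF hi F(2)] .
    define d where "d f = c (the_inv_into F h f)" for f
    have d: "d (h i) = c i" if "i \<in> F" for i using that fi by (simp add: d_def the_inv_into_f_f)
    have "(\<Sum>f\<in>h ` F. d f * f \<sigma>) = (\<Sum>i\<in>F. c i * h i \<sigma>)" for \<sigma>
      unfolding sum.reindex[OF fi] o_def by (rule sum.cong[OF refl]) (simp add: d)
    then have "\<forall>\<sigma>\<in>G. [(\<Sum>f\<in>h ` F. d f * f \<sigma>) = 0] (mod int l)" using F(3) by simp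
    then have "\<forall>f\<in>h ` F. int l dvd d f"
      using B(3)[unfolded ind_def, rule_format, of "h ` F" d] F(1,2) hB by blast
    then show "\<forall>i\<in>F. int l dvd c i" using d by (metis imageI)
  qed
  moreover have "spn I l h"
    unfolding spn_def
  proof (intro allI impI)
    fix \<psi> assume "chr l \<psi>"
    from B(4)[unfolded spn_def, rule_format, OF this]
    obtain F c where F: "finite F" "F \<subseteq> B" "\<forall>\<sigma>\<in>G. [\<psi> \<sigma> = (\<Sum>f\<in>F. c f * f \<sigma>)] (mod int l)"
      by (elim exE conjE)
    obtain F' where F': "F' \<subseteq> I" "finite F'" "F = h ` F'" using finite_subset_image[OF F(1)] F(2) hB by metis
    have "(\<Sum>f\<in>F. c f * f \<sigma>) = (\<Sum>i\<in>F'. c (h i) * h i \<sigma>)" for \<sigma>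
      unfolding F'(3) sum.reindex[OF inj_on_subset[OF hi F'(1)]] o_def ..
    then show "\<exists>F c. finite F \<and> F \<subseteq> I \<and> (\<forall>\<sigma>\<in>G. [\<psi> \<sigma> = (\<Sum>i\<in>F. c i * h i \<sigma>)] (mod int l))"
      using F(3) F'(1,2) by (intro exI[of _ F'] exI[of _ "\<lambda>i. c (h i)"]) simp
  qed
  moreover have "\<forall>i\<in>I. chr l (h i)" using hB B(1) chars_chr by blast
  ultimately show "\<exists>b. (\<forall>i\<in>I. chr l (b i)) \<and> ind I l b \<and> spn I l b" by blast
qed

end

section \<open>The compositum\<close>

text \<open>A polynomial over the image is pulled back coefficientwise along the injective
  \<open>f\<close>, solved in \<open>L\<close>, and the root is sent back. It serves to find all
  roots of unity of the target field in the image of \<open>L\<close>.\<close>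

lemma alg_closed_image:
  assumes L: "alg_closed_subfield L" and N: "subfield N" "L \<subseteq> N" and h: "pfield (graph N f)"
  shows "alg_closed_subfield (f ` L)" "subfield (f ` N)"
proof -
  have im: "subfield (f ` A)" if A: "subfield A" "A \<subseteq> N" for A
  proof -
    note P = pfield_pring[OF h] and S = subfield_sring[OF A(1)]
    have e: "f 0 = 0" "f 1 = 1" "\<And>x y. x \<in> A \<Longrightarrow> y \<in> A \<Longrightarrow> f (x + y) = f x + f y \<and> f (x - y) = f x - f y \<and> f (x * y) = f x * f y"
      "\<And>x. x \<in> A \<Longrightarrow> f (inverse x) = inverse (f x)"
      using pring_0[OF P] pring_1[OF P] pring_add[OF P] pring_diff[OF P] pring_mult[OF P] pfield_inverse[OF h] A(2)
      by (auto simp: subset_iff)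
    have c: "f x + f y \<in> f ` A" "f x - f y \<in> f ` A" "f x * f y \<in> f ` A" if "x \<in> A" "y \<in> A" for x y
      using imageI[OF sring_add[OF S that], of f] imageI[OF sring_diff[OF S that], of f] imageI[OF sring_mult[OF S that], of f] e(3)[OF that] by simp_all
    have "0 \<in> f ` A" "1 \<in> f ` A" using imageI[OF sring_0[OF S], of f] imageI[OF sring_1[OF S], of f] e(1,2) by simp_all
    moreover have "inverse (f x) \<in> f ` A" if "x \<in> A" for x
      using imageI[OF subfield_inverse[OF A(1) that], of f] e(4)[OF that] by simp
    ultimately show ?thesis unfolding subfield_def using c by blast
  qed
  show "subfield (f ` N)" by (rule im[OF N(1) order_refl])
  have inj: "inj_on f L"
  proof (rule inj_onI)
    fix x y assume x: "x \<in> L" "y \<in> L" "f x = f y"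
    then have "(x - y, f x - f y) \<in> graph N f" using N(2) by (intro pring_diff[OF pfield_pring[OF h]]) auto
    then show "x = y" using pfield_inj[OF h, of "x - y"] x(3) by simp
  qed
  note SL = subfield_sring[OF alg_closed_subfieldD[OF L]]
  have f0: "f 0 = 0" using pring_0[OF pfield_pring[OF h]] by simp
  have "\<exists>x\<in>f ` L. poly p x = 0" if p: "\<forall>i. coeff p i \<in> f ` L" "degree p > 0" for p
  proof -
    define g where "g = inv_into L f"
    have g0: "g 0 = 0" using inv_into_f_f[OF inj sring_0[OF SL]] f0 by (simp add: g_def)
    have g: "g c \<in> L" "f (g c) = c" if "c \<in> f ` L" for c
      using that unfolding g_def by (auto intro: inv_into_into f_inv_into_f)
    define q where "q = map_poly g p"
    have cq: "coeff q i = g (coeff p i)" for i unfolding q_def by (rule coeff_map_poly[of g, OF g0])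
    have qL: "q \<in> pol L" using p(1) g(1) by (simp add: pol_def cq)
    have "coeff q (degree p) \<noteq> 0"
    proof
      assume "coeff q (degree p) = 0"
      then have "f (g (lead_coeff p)) = f 0" by (simp add: cq)
      then have "lead_coeff p = 0" using g(2) p(1) f0 by simp
      then show False using p(2) by auto
    qed
    then have "degree q > 0" using le_degree p(2) by fastforce
    then obtain x where x: "x \<in> L" "poly q x = 0" using alg_closed_root[OF L qL] by blast
    have "(q, p) \<in> ppol (graph N f)" unfolding ppol_def using p(1) g N(2) by (auto simp: cq)
    moreover have "(x, f x) \<in> graph N f" using x(1) N(2) by auto
    ultimately have "(poly q x, poly p (f x)) \<in> graph N f" by (rule ppol_poly[OF pfield_pring[OF h]])
    then have "poly p (f x) = 0" using x(2) f0 by simp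
    then show ?thesis using x(1) by blast
  qed
  then show "alg_closed_subfield (f ` L)"
    unfolding alg_closed_subfield_def using im[OF alg_closed_subfieldD[OF L] N(2)] by blast
qed

lemma CHAR_eq_image:
  fixes f :: "'a::field \<Rightarrow> 'b::field"
  assumes h: "pfield (graph N f)"
  shows "CHAR('a) = CHAR('b)"
proof -
  have "of_nat n = (0::'a) \<longleftrightarrow> of_nat n = (0::'b)" for n
    using pring_of_nat[OF pfield_pring[OF h], of n] pfield_inj[OF h, of "of_nat n"] pfield_zero[OF h, of "of_nat n"] by metis
  then show ?thesis unfolding of_nat_eq_0_iff_char_dvd by (metis dvd_antisym dvd_refl)
qed

text \<open>The case in which the larger of the two cardinalities is that of \<open>L\<close>; then \<open>|L \<setminus> C| = |N|\<close>, so
  the elements \<open>t - x\<close> with \<open>x \<in> L \<setminus> C\<close> provide enough independent classes for a fixed \<open>t \<in> M \<setminus> L\<close>.\<close>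
lemma (in ld_pair) gal_iso_compositum:
  fixes \<iota> :: "'a \<Rightarrow> 'b::field"
  assumes t: "t \<in> M" "t \<notin> L" and LM: "\<not> L \<subseteq> M" and card: "M \<lesssim> L"
    and hom: "\<And>x y. x \<in> compositum L M \<Longrightarrow> y \<in> compositum L M \<Longrightarrow>
           \<iota> (x + y) = \<iota> x + \<iota> y \<and> \<iota> (x * y) = \<iota> x * \<iota> y" and one: "\<iota> 1 = 1"
    and closed: "\<forall>p::'b poly. degree p > 0 \<longrightarrow> (\<exists>z. poly p z = 0)"
    and alg: "\<forall>z::'b. \<exists>p. p \<noteq> 0 \<and> (\<forall>i. coeff p i \<in> \<iota> ` compositum L M) \<and> poly p z = 0"
  shows "gal_iso_zhat_pow (\<iota> ` compositum L M) (max_abelian_ext (\<iota> ` compositum L M)) (compositum L M)"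
proof -
  obtain F0 where F0: "sring F0" "C \<subseteq> F0" "F0 \<subseteq> M" "trans F0 t" "\<And>x. x \<in> M \<Longrightarrow> alg_over (frac (adj F0 t)) x"
    using exists_F[OF t] by metis
  have T: "ld_trans L M t F0"
    by (intro ld_trans.intro ld_trans_axioms.intro ld_pair_axioms t F0)
  define N where "N = compositum L M"
  have N: "subfield N" "L \<subseteq> N" "M \<subseteq> N"
    using compositum_subfield[of L M] compositum_subset[of L M] by (auto simp: N_def)
  note SN = subfield_sring[OF N(1)]
  have h: "pfield (graph N \<iota>)"
    by (rule pfield_graph[of N \<iota>, OF SN]) (use hom one subfield_inverse[OF N(1)] in \<open>auto simp: N_def\<close>)
  note P = pfield_pring[OF h]
  have inj: "inj_on \<iota> N"
  proof (rule inj_onI)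
    fix x y assume x: "x \<in> N" "y \<in> N" "\<iota> x = \<iota> y"
    then have "(x - y, \<iota> x - \<iota> y) \<in> graph N \<iota>" by (intro pring_diff[OF P]) auto
    then show "x = y" using pfield_inj[OF h, of "x - y"] x(3) by simp
  qed
  have ch: "CHAR('a) = CHAR('b)" by (rule CHAR_eq_image[OF h])
  have K: "subfield (\<iota> ` N)" and LI: "alg_closed_subfield (\<iota> ` L)" using alg_closed_image[OF L N(1,2) h] by blast+
  interpret kum "\<iota> ` N"
  proof unfold_locales
    show "subfield (\<iota> ` N)" by (rule K)
    show "alg_closed_subfield (UNIV :: 'b set)" unfolding alg_closed_subfield_def using closed subfield_UNIV by auto
    show "alg_over (\<iota> ` N) x" for x using alg unfolding alg_over_def pol_def N_def by blast
    fix n :: nat and w :: 'b assume n: "n > 0" "w ^ n = 1"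
    note S = subfield_sring[OF alg_closed_subfieldD[OF LI]]
    define f where "f = monom 1 n - [:1::'b:]"
    have "f \<in> pol (\<iota> ` L)" unfolding f_def
      by (intro sring_diff[OF sring_pol[OF S]] pol_monom[OF S] pol_const[OF S] sring_1[OF S])
    moreover have "poly f 0 \<noteq> 0" using n(1) by (simp add: f_def poly_monom zero_power)
    then have "f \<noteq> 0" by auto
    moreover have "poly f w = 0" using n(2) by (simp add: f_def poly_monom)
    ultimately show "w \<in> \<iota> ` N" using alg_closed_roots[OF LI] N(2) by blast
  qed simp
  have C: "C \<noteq> L" using LM by blast
  have L_inf: "infinite L" by (rule alg_closed_infinite[OF L])
  have "L \<lesssim> L - C" by (rule lepoll_Diff_subfield[OF Lf L_inf Cf _ C]) simp
  moreover have "N \<lesssim> L" unfolding N_def by (rule compositum_lepoll[OF Lf L_inf lepoll_refl card])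
  ultimately have NJ: "\<iota> ` N \<lesssim> L - C" using image_lepoll lepoll_trans by blast
  have tN: "t \<in> N" using t N(3) by blast
  have d: "(t - j, \<iota> (t - j)) \<in> graph N \<iota>" if "j \<in> L - C" for j
    using that sring_diff[OF SN tN, of j] N(2) by auto
  have "gal_iso_zhat_pow (\<iota> ` N) E N"
  proof (rule gal_iso_of_independent[where a = "\<lambda>j. \<iota> (t - j)" and J = "L - C"])
    show "N \<approx> \<iota> ` N" using inj_on_image_eqpoll_self[OF inj] eqpoll_sym by blast
    show "\<iota> ` N \<lesssim> L - C" by (rule NJ)
    show "\<iota> (t - j) \<in> \<iota> ` N \<and> \<iota> (t - j) \<noteq> 0" if j: "j \<in> L - C" for j
    proof -
      have "t - j \<noteq> 0" using t(2) j by auto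
      then show ?thesis using d[OF j] pfield_inj[OF h, of "t - j"] by auto
    qed
    fix F and e :: "'a \<Rightarrow> nat" and y :: 'b and j
    assume F: "finite F" "F \<subseteq> L - C" and yN: "y \<in> \<iota> ` N" and j: "j \<in> F"
    obtain y0 where y0: "y0 \<in> N" "y = \<iota> y0" using yN by blast
    have gy: "(y0, y) \<in> graph N \<iota>" using y0 by simp
    {
      fix l :: nat assume l: "prime l" "l \<noteq> CHAR('b)" and eq: "y ^ l = (\<Prod>j\<in>F. \<iota> (t - j) ^ e j)"
      have a: "(y0 ^ l, y ^ l) \<in> graph N \<iota>" by (rule pring_power[OF P gy])
      have b: "(\<Prod>j\<in>F. (t - j) ^ e j, \<Prod>j\<in>F. \<iota> (t - j) ^ e j) \<in> graph N \<iota>"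
        by (intro pring_prod[OF P] pring_power[OF P] d) (use F in blast)
      have "y0 ^ l = (\<Prod>j\<in>F. (t - j) ^ e j)"
        using pring_diff[OF P a b] pfield_inj[OF h, of "y0 ^ l - (\<Prod>j\<in>F. (t - j) ^ e j)"] unfolding eq by simp
      then show "l dvd e j"
        using ld_trans.kummer_independent[OF T F l(1) _ y0(1)[unfolded N_def] _ j] l(2) unfolding ch by blast
    }
    assume p: "CHAR('b) > 0" and eq: "y ^ CHAR('b) - y = (\<Sum>j\<in>F. of_nat (e j) / \<iota> (t - j))"
    have a: "(y0 ^ CHAR('b) - y0, y ^ CHAR('b) - y) \<in> graph N \<iota>" by (intro pring_diff[OF P] pring_power[OF P] gy)
    have b: "(\<Sum>j\<in>F. of_nat (e j) / (t - j), \<Sum>j\<in>F. of_nat (e j) / \<iota> (t - j)) \<in> graph N \<iota>"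
      unfolding divide_inverse
      by (intro pring_sum[OF P] pring_mult[OF P] pring_of_nat[OF P] pfield_inverse[OF h] d) (use F in blast)
    have "y0 ^ CHAR('a) - y0 = (\<Sum>j\<in>F. of_nat (e j) / (t - j))"
      using pring_diff[OF P a b] pfield_inj[OF h, of "y0 ^ CHAR('b) - y0 - (\<Sum>j\<in>F. of_nat (e j) / (t - j))"]
      unfolding eq ch by simp
    then show "CHAR('b) dvd e j"
      using ld_trans.artin_schreier_independent[OF T F _ y0(1)[unfolded N_def] _ j] p unfolding ch by blast
  qed
  then show ?thesis unfolding N_def[symmetric] max_abelian_ext_eq .
qed

theorem theorem4p1:
  fixes L M :: "'a::field set"
    and \<iota> :: "'a \<Rightarrow> 'b::field"
  assumes "alg_closed_subfield L" and "alg_closed_subfield M"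
    and "\<not> L \<subseteq> M" and "\<not> M \<subseteq> L"
    and "linearly_disjoint (L \<inter> M) L M"
    \<comment> \<open>\<iota> embeds N = LM into the field 'b, which is an algebraic closure of \<iota>(N)\<close>
    and "\<And>x y. x \<in> compositum L M \<Longrightarrow> y \<in> compositum L M \<Longrightarrow>
           \<iota> (x + y) = \<iota> x + \<iota> y \<and> \<iota> (x * y) = \<iota> x * \<iota> y"
    and "\<iota> 1 = 1"
    and "\<forall>p::'b poly. degree p > 0 \<longrightarrow> (\<exists>z. poly p z = 0)"
    and "\<forall>z::'b. \<exists>p. p \<noteq> 0 \<and> (\<forall>i. coeff p i \<in> \<iota> ` compositum L M) \<and> poly p z = 0"
  shows "gal_iso_zhat_pow (\<iota> ` compositum L M) (max_abelian_ext (\<iota> ` compositum L M))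
           (compositum L M)"
proof -
  note Lf = alg_closed_subfieldD[OF assms(1)] and Mf = alg_closed_subfieldD[OF assms(2)]
  have C: "subfield (L \<inter> M)" using Lf Mf by (auto simp: subfield_def)
  have d: "linearly_disjoint (L \<inter> M) M L"
    by (rule lin_disjoint_sym[OF Lf Mf C _ assms(5)]) simp
  interpret ld: ld_pair L M using assms(1,2) d by unfold_locales
  interpret ld': ld_pair M L using assms(1,2,5) by unfold_locales (simp_all add: Int_commute)
  \<comment> \<open>The larger field has to take the place of \<open>L\<close>, which supplies the
    points \<open>a\<close>; linear disjointness is available in both directions.\<close>
  have "M \<lesssim> L \<or> L \<lesssim> M"
    unfolding lepoll_iff_card_of using ordLeq_total card_of_Well_order by blast
  then show ?thesis
  proof
    assume c: "M \<lesssim> L"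
    obtain t where "t \<in> M" "t \<notin> L" using assms(4) by blast
    from ld.gal_iso_compositum[OF this assms(3) c assms(6-9)] show ?thesis .
  next
    assume c: "L \<lesssim> M"
    obtain t where "t \<in> L" "t \<notin> M" using assms(3) by blast
    from ld'.gal_iso_compositum[OF this assms(4) c assms(6-9)[unfolded compositum_commute[of L M]]]
    show ?thesis unfolding compositum_commute[of L M] .
  qed
qed

end
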